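(* Let $n\ge1$ and let $w_0^{(n)}$ be the longest element of $W_n$ (type $\mathrm{C}$) resp. of $W'_n$ (type $\mathrm{D}$). Let $\mathfrak{C}_w$ and $\mathfrak{D}_w$ denote the double Schubert polynomials $\mathfrak{S}_w(z,t;x)$ of types $\mathrm{C}$ and $\mathrm{D}$. Then (1) $\mathfrak{C}_{w_0^{(n)}}(z,t;x)=Q_{\rho_n+\rho_{n-1}}(x\,|\,t_1,-z_1,t_2,-z_2,\dots,t_{n-1},-z_{n-1})$; (2) $\mathfrak{D}_{w_0^{(n)}}(z,t;x)=P_{2\rho_{n-1}}(x\,|\,t_1,-z_1,t_2,-z_2,\dots,t_{n-1},-z_{n-1})$, where $\rho_k=(k,k-1,\dots,1)$, so $\rho_n+\rho_{n-1}=(2n-1,2n-3,\dots,3,1)$ and $2\rho_{n-1}=(2n-2,2n-4,\dots,2)$.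
   Context: Setting. Let $t,z,x$ be infinite sequences of indeterminates. $Q_k(x)$ is defined by $\prod_{i\ge1}\frac{1+x_iu}{1-x_iu}=\sum_k Q_k(x)u^k$, $P_k=\tfrac12Q_k$, $\Gamma=\mathbb{Z}[Q_1,Q_2,\dots]$, $\Gamma'=\mathbb{Z}[P_1,P_2,\dots]$; type C uses $R=\mathbb{Z}[t]\otimes\mathbb{Z}[z]\otimes\Gamma$, type D uses $R=\mathbb{Z}[t]\otimes\mathbb{Z}[z]\otimes\Gamma'$ (grading $\deg t_i=\deg z_i=1$, $\deg Q_k=\deg P_k=k$). $W_\infty$ is the group of finitely supported signed permutations of $\{1,2,\dots\}$ ($w(\bar i)=\overline{w(i)}$), a Coxeter group on $s_0=(1,\bar1)$, $s_i=(i,i+1)(\bar i,\overline{i+1})$ ($i\ge1$); $W'_\infty$ is its subgroup of elements with an even number of sign changes, Coxeter on $s_{\hat1}=s_0s_1s_0,s_1,s_2,\dots$. $W_n=\langle s_0,\dots,s_{n-1}\rangle$, $W'_n=\langle s_{\hat1},s_1,\dots,s_{n-1}\rangle$. Type C: $W=W_\infty$, $I=\{0,1,\dots\}$; type D: $W=W'_\infty$, $I=\{\hat1,1,2,\dots\}$. Actions on $R$: $s_i^z$ ($i\ge1$) swaps $z_i,z_{i+1}$; $s_0^z$: $z_1\mapsto-z_1$, $\varphi(x)\mapsto\varphi(z_1,x_1,x_2,\dots)$ for $\varphi\in\Gamma'$; $s_i^t$ swaps $t_i,t_{i+1}$; $s_0^t$: $t_1\mapsto -t_1$, $\varphi(x)\mapsto\varphi(-t_1,x_1,\dots)$;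 all other generators fixed; $s_{\hat1}^{z}=s_0^zs_1^zs_0^z$, $s_{\hat1}^t=s_0^ts_1^ts_0^t$. Roots: $\alpha_i=t_{i+1}-t_i$ ($i\ge1$), $\alpha_0=2t_1$ (C), $\alpha_{\hat1}=t_1+t_2$ (D). $\omega$: ring involution $z_i\mapsto -t_i$, $t_i\mapsto-z_i$, fixing $\Gamma'$. $\partial_if=(f-s_i^zf)/\omega(\alpha_i)$, $\delta_if=(f-s_i^tf)/\alpha_i$. The double Schubert polynomials $\{\mathfrak{S}_w\}_{w\in W}$ are the unique elements of $R$ with $\partial_i\mathfrak{S}_w=\mathfrak{S}_{ws_i}$ if $\ell(ws_i)<\ell(w)$ and $0$ otherwise, $\delta_i\mathfrak{S}_w=\mathfrak{S}_{s_iw}$ if $\ell(s_iw)<\ell(w)$ and $0$ otherwise ($i\in I$), $\mathfrak{S}_e=1$, and zero constant term for $w\ne e$. Factorial functions. For a sequence $a=(a_1,a_2,\dots)$ put $(y|a)^k=\prod_{i=1}^k(y-a_i)$. For a strict partition $\lambda=(\lambda_1>\dots>\lambda_r>0)$ and $n\ge r$, $P^{(n)}_\lambda(x_1,\dots,x_n|a)=\frac1{(n-r)!}\sum_{w\in S_n}w\big(\prod_{i=1}^r(x_i|a)^{\lambda_i}\prod_{i\le r,\,i<j\le n}\frac{x_i+x_j}{x_i-x_j}\big)$, $S_n$ permuting the $x_i$. If $a_1=0$, $P^{(n+1)}_\lambda(x_1,\dots,x_n,0|a)=P^{(n)}_\lambda(x_1,\dots,x_n|a)$ and $P_\lambda(x|a)$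 is the limit; if $a_1\ne0$, $P^{(n+2)}_\lambda(x_1,\dots,x_n,0,0|a)=P^{(n)}_\lambda(x_1,\dots,x_n|a)$ and $P_\lambda(x|a)$ denotes the limit along even $n$. $Q_\lambda(x|a)=2^{\ell(\lambda)}P_\lambda(x|0,a_1,a_2,\dots)$, $\ell(\lambda)$ the number of nonzero parts. $Q_\lambda(x|a)$ depends only on $a_1,\dots,a_{\lambda_1-1}$ and $P_\lambda(x|a)$ only on $a_1,\dots,a_{\lambda_1}$, so the finite parameter lists in the claim suffice.
   Formalization: For n = 1 in type D the group W'_1 is taken to be trivial rather than generated by s_{\hat1}; with the literal generator list, (2) would equate a polynomial with zero constant term to P_∅ = 1 and be false. *)

theory Defs
  imports
    "HOL-Library.Poly_Mapping"
    "HOL-Library.Function_Algebras"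
    "HOL-Library.More_List"
    "HOL-Computational_Algebra.Computational_Algebra"
    "HOL-Combinatorics.Combinatorics"
begin

text \<open>The indeterminates of the theory are those with index at least 1.\<close>

datatype var = T nat | Z nat | X nat

text \<open>The library proves that \<open>(var \<Rightarrow>\<^sub>0 nat) \<Rightarrow>\<^sub>0 int\<close> is an integral domain only for linearly
  ordered index types; the particular order on the indeterminates plays no role.\<close>

fun var_code :: "var \<Rightarrow> nat" where
  "var_code (T i) = 3 * i"
| "var_code (Z i) = 3 * i + 1"
| "var_code (X i) = 3 * i + 2"

lemma var_code_inj: "var_code u = var_code v \<Longrightarrow> u = v"
  by (cases u; cases v; simp; presburger)

instantiation var :: linorder
begin

definition less_eq_var :: "var \<Rightarrow> var \<Rightarrow> bool" where
  "u \<le> v \<longleftrightarrow> var_code u \<le> var_code v"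

definition less_var :: "var \<Rightarrow> var \<Rightarrow> bool" where
  "u < v \<longleftrightarrow> var_code u < var_code v"

instance
  by standard (auto simp: less_eq_var_def less_var_def intro: var_code_inj)

end

type_synonym mpoly = "(var \<Rightarrow>\<^sub>0 nat) \<Rightarrow>\<^sub>0 int"

definition Var :: "var \<Rightarrow> mpoly" where
  "Var v = Poly_Mapping.single (Poly_Mapping.single v 1) 1"

text \<open>Simultaneous substitution of polynomials for the indeterminates.\<close>

definition subst :: "(var \<Rightarrow> mpoly) \<Rightarrow> mpoly \<Rightarrow> mpoly" where
  "subst \<sigma> p = (\<Sum>m\<in>Poly_Mapping.keys p. of_int (Poly_Mapping.lookup p m) *
     (\<Prod>v\<in>Poly_Mapping.keys m. \<sigma> v ^ Poly_Mapping.lookup m v))"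

text \<open>\<open>restrict_x N\<close> sets \<open>x\<^sub>j = 0\<close> for \<open>j > N\<close>.\<close>

definition restrict_x :: "nat \<Rightarrow> mpoly \<Rightarrow> mpoly" where
  "restrict_x N = subst (\<lambda>v. case v of X j \<Rightarrow> if j \<le> N then Var v else 0 | _ \<Rightarrow> Var v)"

text \<open>A function of the infinite sequence x is represented, as usual for symmetric functions, as an
  element of an inverse limit: \<open>f N\<close> is its specialization \<open>x\<^sub>j = 0\<close> for all \<open>j > N\<close>, a polynomial
  in \<open>x\<^sub>1, \<dots>, x\<^sub>N\<close> and the t, z. The ring operations are the pointwise ones
  of \<^theory>\<open>HOL-Library.Function_Algebras\<close>.\<close>

type_synonym xfun = "nat \<Rightarrow> mpoly"

definition t_var :: "nat \<Rightarrow> xfun" where "t_var i = (\<lambda>N. Var (T i))"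

definition z_var :: "nat \<Rightarrow> xfun" where "z_var i = (\<lambda>N. Var (Z i))"

text \<open>The quotient of f by a, if it exists and is unique (which holds as soon as a divides f and
  no \<open>a N\<close> is zero).\<close>

definition exact_quotient :: "'a::comm_ring_1 \<Rightarrow> 'a \<Rightarrow> 'a" where
  "exact_quotient f a = (THE g. a * g = f)"

text \<open>The factor \<open>1 / (1 - x\<^sub>i u)\<close> is written as the geometric series \<open>\<Sum>k. x\<^sub>i\<^sup>k u\<^sup>k\<close>.\<close>

definition Qgen :: "nat \<Rightarrow> mpoly fps" where
  "Qgen N = (\<Prod>i = 1..N. (1 + fps_const (Var (X i)) * fps_X) * Abs_fps (\<lambda>k. Var (X i) ^ k))"

definition Qfun :: "nat \<Rightarrow> xfun" where
  "Qfun k = (\<lambda>N. fps_nth (Qgen N) k)"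

definition Pfun :: "nat \<Rightarrow> xfun" where
  "Pfun k = exact_quotient (Qfun k) 2"

inductive_set subring_generated :: "'a::ring_1 set \<Rightarrow> 'a set" for G where
  "1 \<in> subring_generated G"
| "a \<in> G \<Longrightarrow> a \<in> subring_generated G"
| "a \<in> subring_generated G \<Longrightarrow> b \<in> subring_generated G \<Longrightarrow> a - b \<in> subring_generated G"
| "a \<in> subring_generated G \<Longrightarrow> b \<in> subring_generated G \<Longrightarrow> a * b \<in> subring_generated G"

datatype lie_type = TypeC | TypeD

text \<open>The tensor product of \<open>\<int>[t]\<close>, \<open>\<int>[z]\<close> and \<open>\<Gamma>\<close> (resp. \<open>\<Gamma>'\<close>), as the subring of the inverse
  limit generated by the three factors.\<close>

fun Rring :: "lie_type \<Rightarrow> xfun set" where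
  "Rring TypeC = subring_generated (t_var ` {1..} \<union> z_var ` {1..} \<union> Qfun ` {1..})"
| "Rring TypeD = subring_generated (t_var ` {1..} \<union> z_var ` {1..} \<union> Pfun ` {1..})"

definition const_term :: "xfun \<Rightarrow> int" where
  "const_term f = Poly_Mapping.lookup (f 0) 0"

text \<open>\<open>Nd i\<close> is the node i and \<open>Hat1\<close> the node \<open>1\<close> with a hat. Signed permutations are maps on
  the integers, with \<open>-i\<close> for the barred i; they fix 0.\<close>

datatype node = Nd nat | Hat1

fun nodes :: "lie_type \<Rightarrow> node set" where
  "nodes TypeC = range Nd"
| "nodes TypeD = insert Hat1 (Nd ` {1..})"

definition W_infinity :: "(int \<Rightarrow> int) set" where
  "W_infinity = {w. bij w \<and> (\<forall>i. w (- i) = - w i) \<and> finite {i. w i \<noteq> i}}"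

fun weyl :: "lie_type \<Rightarrow> (int \<Rightarrow> int) set" where
  "weyl TypeC = W_infinity"
| "weyl TypeD = {w \<in> W_infinity. even (card {i. i > 0 \<and> w i < 0})}"

definition simple_refl_nat :: "nat \<Rightarrow> int \<Rightarrow> int" where
  "simple_refl_nat i k = (if i = 0 then (if \<bar>k\<bar> = 1 then - k else k)
     else sgn k * int (transpose i (Suc i) (nat \<bar>k\<bar>)))"

fun simple_refl :: "node \<Rightarrow> int \<Rightarrow> int" where
  "simple_refl (Nd i) = simple_refl_nat i"
| "simple_refl Hat1 = simple_refl_nat 0 \<circ> simple_refl_nat 1 \<circ> simple_refl_nat 0"

definition word_product :: "node list \<Rightarrow> int \<Rightarrow> int" where
  "word_product is = foldr (\<lambda>i w. simple_refl i \<circ> w) is id"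

definition coxeter_length :: "lie_type \<Rightarrow> (int \<Rightarrow> int) \<Rightarrow> nat" where
  "coxeter_length ty w = (LEAST l. \<exists>is. set is \<subseteq> nodes ty \<and> length is = l \<and> word_product is = w)"

text \<open>The generators of \<open>W\<^sub>n\<close> and \<open>W'\<^sub>n\<close>. The reflection at \<open>Hat1\<close> involves the entries 1 and 2,
  so that it is a generator of \<open>W'\<^sub>n\<close> only for \<open>n \<ge> 2\<close>; \<open>W'\<^sub>1\<close> is trivial.\<close>

fun finite_nodes :: "lie_type \<Rightarrow> nat \<Rightarrow> node set" where
  "finite_nodes TypeC n = Nd ` {0..<n}"
| "finite_nodes TypeD n = (if n \<ge> 2 then {Hat1} else {}) \<union> Nd ` {1..<n}"

text \<open>As the generators are involutions, the subgroup they generate consists of the products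
  of words in them.\<close>

definition finite_weyl :: "lie_type \<Rightarrow> nat \<Rightarrow> (int \<Rightarrow> int) set" where
  "finite_weyl ty n = {word_product is | is. set is \<subseteq> finite_nodes ty n}"

definition longest :: "lie_type \<Rightarrow> nat \<Rightarrow> int \<Rightarrow> int" where
  "longest ty n = (THE w. w \<in> finite_weyl ty n \<and> (\<forall>v \<in> finite_weyl ty n. coxeter_length ty v \<le> coxeter_length ty w))"

text \<open>\<open>insert_x y\<close> is the substitution \<open>\<phi>(x\<^sub>1, x\<^sub>2, \<dots>) \<mapsto> \<phi>(y, x\<^sub>1, x\<^sub>2, \<dots>)\<close>; consequently the
  N-variable part of the image is computed from the (N+1)-variable part of \<open>\<phi>\<close>.\<close>

definition insert_x :: "mpoly \<Rightarrow> nat \<Rightarrow> mpoly" where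
  "insert_x y k = (if k = 1 then y else Var (X (k - 1)))"

definition act_z_nat :: "nat \<Rightarrow> xfun \<Rightarrow> xfun" where
  "act_z_nat i f = (if i = 0
     then (\<lambda>N. subst (\<lambda>v. case v of
             T k \<Rightarrow> Var (T k)
           | Z k \<Rightarrow> if k = 1 then - Var (Z 1) else Var (Z k)
           | X k \<Rightarrow> insert_x (Var (Z 1)) k) (f (Suc N)))
     else (\<lambda>N. subst (\<lambda>v. case v of
             Z k \<Rightarrow> Var (Z (transpose i (Suc i) k))
           | _ \<Rightarrow> Var v) (f N)))"

definition act_t_nat :: "nat \<Rightarrow> xfun \<Rightarrow> xfun" where
  "act_t_nat i f = (if i = 0
     then (\<lambda>N. subst (\<lambda>v. case v of
             T k \<Rightarrow> if k = 1 then - Var (T 1) else Var (T k)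
           | Z k \<Rightarrow> Var (Z k)
           | X k \<Rightarrow> insert_x (- Var (T 1)) k) (f (Suc N)))
     else (\<lambda>N. subst (\<lambda>v. case v of
             T k \<Rightarrow> Var (T (transpose i (Suc i) k))
           | _ \<Rightarrow> Var v) (f N)))"

fun act_z :: "node \<Rightarrow> xfun \<Rightarrow> xfun" where
  "act_z (Nd i) = act_z_nat i"
| "act_z Hat1 = act_z_nat 0 \<circ> act_z_nat 1 \<circ> act_z_nat 0"

fun act_t :: "node \<Rightarrow> xfun \<Rightarrow> xfun" where
  "act_t (Nd i) = act_t_nat i"
| "act_t Hat1 = act_t_nat 0 \<circ> act_t_nat 1 \<circ> act_t_nat 0"

fun simple_root :: "node \<Rightarrow> xfun" where
  "simple_root (Nd i) = (if i = 0 then 2 * t_var 1 else t_var (Suc i) - t_var i)"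
| "simple_root Hat1 = t_var 1 + t_var 2"

definition omega :: "xfun \<Rightarrow> xfun" where
  "omega f = (\<lambda>N. subst (\<lambda>v. case v of
      T k \<Rightarrow> - Var (Z k) | Z k \<Rightarrow> - Var (T k) | X k \<Rightarrow> Var (X k)) (f N))"

definition diff_z :: "node \<Rightarrow> xfun \<Rightarrow> xfun" where
  "diff_z i f = exact_quotient (f - act_z i f) (omega (simple_root i))"

definition diff_t :: "node \<Rightarrow> xfun \<Rightarrow> xfun" where
  "diff_t i f = exact_quotient (f - act_t i f) (simple_root i)"

definition double_schubert :: "lie_type \<Rightarrow> ((int \<Rightarrow> int) \<Rightarrow> xfun) \<Rightarrow> bool" where
  "double_schubert ty S \<longleftrightarrow>
     (\<forall>w \<in> weyl ty. S w \<in> Rring ty) \<and>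
     (\<forall>w \<in> weyl ty. \<forall>i \<in> nodes ty.
        diff_z i (S w) = (if coxeter_length ty (w \<circ> simple_refl i) < coxeter_length ty w then S (w \<circ> simple_refl i) else 0)) \<and>
     (\<forall>w \<in> weyl ty. \<forall>i \<in> nodes ty.
        diff_t i (S w) = (if coxeter_length ty (simple_refl i \<circ> w) < coxeter_length ty w then S (simple_refl i \<circ> w) else 0)) \<and>
     S id = 1 \<and>
     (\<forall>w \<in> weyl ty. w \<noteq> id \<longrightarrow> const_term (S w) = 0)"

text \<open>Parameter sequences are indexed from 0: \<open>a k\<close> is the parameter \<open>a\<^sub>k\<^sub>+\<^sub>1\<close>. They are taken in
  the polynomials and must not involve x.\<close>

definition factorial_power :: "mpoly \<Rightarrow> (nat \<Rightarrow> mpoly) \<Rightarrow> nat \<Rightarrow> mpoly" where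
  "factorial_power y a k = (\<Prod>i<k. y - a i)"

definition factorial_P_fract :: "nat \<Rightarrow> nat list \<Rightarrow> (nat \<Rightarrow> mpoly) \<Rightarrow> mpoly fract" where
  "factorial_P_fract n lam a = (let r = length lam; x = (\<lambda>i. Var (X i)) in
     1 / of_nat (fact (n - r)) *
     (\<Sum>w | w permutes {1..n}.
        (\<Prod>i = 1..r. to_fract (factorial_power (x (w i)) a (lam ! (i - 1)))) *
        (\<Prod>i = 1..r. \<Prod>j = i+1..n. to_fract (x (w i) + x (w j)) / to_fract (x (w i) - x (w j)))))"

definition factorial_P_fin :: "nat \<Rightarrow> nat list \<Rightarrow> (nat \<Rightarrow> mpoly) \<Rightarrow> mpoly" where
  "factorial_P_fin n lam a = (THE p. to_fract p = factorial_P_fract n lam a)"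

text \<open>The limit in the inverse limit, along all n if the first parameter vanishes and along
  even n otherwise: for every N the restrictions to N variables are eventually constant.\<close>

definition factorial_P :: "nat list \<Rightarrow> (nat \<Rightarrow> mpoly) \<Rightarrow> xfun" where
  "factorial_P lam a = (\<lambda>N. THE p. \<forall>\<^sub>F n in sequentially.
     (a 0 = 0 \<or> even n) \<longrightarrow> restrict_x N (factorial_P_fin n lam a) = p)"

definition factorial_Q :: "nat list \<Rightarrow> (nat \<Rightarrow> mpoly) \<Rightarrow> xfun" where
  "factorial_Q lam a = 2 ^ length lam * factorial_P lam (case_nat 0 a)"

text \<open>The parameters \<open>t\<^sub>1, -z\<^sub>1, \<dots>, t\<^sub>n\<^sub>-\<^sub>1, -z\<^sub>n\<^sub>-\<^sub>1\<close>, continued by zeros.\<close>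

definition tz_params :: "nat \<Rightarrow> nat \<Rightarrow> mpoly" where
  "tz_params n = nth_default 0 (concat (map (\<lambda>i. [Var (T i), - Var (Z i)]) [1..<n]))"

definition rho :: "nat \<Rightarrow> nat list" where
  "rho k = rev [1..<Suc k]"

text \<open>The shorter partition is padded by a zero part before adding.\<close>

definition rho_C :: "nat \<Rightarrow> nat list" where
  "rho_C n = map2 (+) (rho n) (rho (n - 1) @ [0])"

definition rho_D :: "nat \<Rightarrow> nat list" where
  "rho_D n = map ((*) 2) (rho (n - 1))"

end

theory Submission
  imports Defs
begin

text \<open>The factorial function F and the Schubert polynomial S of the longest element are compared by
  means of their difference D. Both are symmetric in the x-variables and unchanged by inserting 0 or
  a pair of opposite values, and both satisfy the same relation between \<open>f - s\<^sub>i\<^sup>t f\<close> and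
  \<open>f - s\<^sub>j\<^sup>z f\<close>, where \<open>s\<^sub>i w\<^sub>0 = w\<^sub>0 s\<^sub>j\<close>. A function D with this property and
  of bounded degree vanishes as soon as all its localizations, i.e. the values of its \<open>W\<^sub>n\<close>-translates
  in t at \<open>z = t\<close> and \<open>x = 0\<close>, vanish: by induction on the degree, the divided differences
  of D vanish, so that D is invariant under all reflections in t; such a function involves neither t
  nor x and is determined by its value at \<open>z = t\<close>. The localizations of S are computed along
  reduced words from the recursion for divided differences, those of F by a triangularity argument; both are supported at \<open>w\<^sub>0\<close>, with the product of the positive roots of
  \<open>W\<^sub>n\<close> as the common value.\<close>

text \<open>The factorial function is not shown to lie in \<open>Rring\<close>, so the comparison
  takes place in a larger ring in which divided differences still exist. For S the relation between
  t and z only says that both differences lead to the Schubert polynomial of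
  \<open>s_i w_0 = w_0 s_j\<close>. For F it comes from a symmetry: \<open>t_j\<close> and
  \<open>- z_j\<close> enter every row of the staircase as a pair, and the two difference quotients
  agree because a symmetrized sum with two equal rows vanishes; only the lowest rows have to be
  summed in closed form. At \<open>z = t\<close> the values \<open>- t_k\<close> of the x-variables
  are also parameters, so the row of index \<open>k\<close> vanishes at
  \<open>- t_1, ..., - t_k\<close>; this is the triangularity. The zero constant terms of the
  \<open>S_w\<close> enter through their vanishing at \<open>z = t\<close>, \<open>x = 0\<close> for
  \<open>w \<noteq> id\<close>. The parity conditions of type D have one source: the symmetrized sum
  of the constant row 1 depends on the parity of the number of variables. Since the symmetrized sums
  are fractions whose denominators need distinct x-values, identities are proved generically and
  then specialized.\<close>

section \<open>Ring homomorphisms and evaluation of polynomials\<close>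

definition ring_hom_fun :: "('a::comm_ring_1 \<Rightarrow> 'b::comm_ring_1) \<Rightarrow> bool" where
  "ring_hom_fun h \<longleftrightarrow> h 1 = 1 \<and> (\<forall>x y. h (x + y) = h x + h y) \<and> (\<forall>x y. h (x * y) = h x * h y)"

lemma ring_hom_fun_1: "ring_hom_fun h \<Longrightarrow> h 1 = 1"
  and ring_hom_fun_add: "ring_hom_fun h \<Longrightarrow> h (x + y) = h x + h y"
  and ring_hom_fun_mult: "ring_hom_fun h \<Longrightarrow> h (x * y) = h x * h y"
  by (auto simp: ring_hom_fun_def)

lemma ring_hom_fun_0: "ring_hom_fun h \<Longrightarrow> h 0 = 0"
  using ring_hom_fun_add[of h 0 0] by simp

lemma ring_hom_fun_uminus: "ring_hom_fun h \<Longrightarrow> h (- x) = - h x"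
  using ring_hom_fun_add[of h x "- x"] ring_hom_fun_0[of h] by (simp add: eq_neg_iff_add_eq_0 add.commute)

lemma ring_hom_fun_diff: "ring_hom_fun h \<Longrightarrow> h (x - y) = h x - h y"
  using ring_hom_fun_add[of h x "- y"] by (simp add: ring_hom_fun_uminus)

lemma ring_hom_fun_sum: "ring_hom_fun h \<Longrightarrow> h (sum f A) = (\<Sum>x\<in>A. h (f x))"
  by (induction A rule: infinite_finite_induct) (auto simp: ring_hom_fun_0 ring_hom_fun_add)

lemma ring_hom_fun_prod: "ring_hom_fun h \<Longrightarrow> h (prod f A) = (\<Prod>x\<in>A. h (f x))"
  by (induction A rule: infinite_finite_induct) (auto simp: ring_hom_fun_1 ring_hom_fun_mult)

lemma ring_hom_fun_power: "ring_hom_fun h \<Longrightarrow> h (x ^ n) = h x ^ n"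
  by (induction n) (auto simp: ring_hom_fun_1 ring_hom_fun_mult)

lemma ring_hom_fun_of_nat: "ring_hom_fun h \<Longrightarrow> h (of_nat n) = of_nat n"
  by (induction n) (auto simp: ring_hom_fun_0 ring_hom_fun_1 ring_hom_fun_add)

lemma ring_hom_fun_of_int: "ring_hom_fun h \<Longrightarrow> h (of_int n) = of_int n"
  by (cases n) (auto simp: ring_hom_fun_uminus ring_hom_fun_of_nat ring_hom_fun_diff ring_hom_fun_1)

definition monom_eval :: "(var \<Rightarrow> 'a::comm_ring_1) \<Rightarrow> (var \<Rightarrow>\<^sub>0 nat) \<Rightarrow> 'a" where
  "monom_eval \<rho> m = (\<Prod>v\<in>Poly_Mapping.keys m. \<rho> v ^ Poly_Mapping.lookup m v)"

text \<open>This is \<open>subst\<close> with an arbitrary commutative ring as target, so that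
  substitution, the scaling that measures degrees and evaluation at integers are instances of one
  notion.\<close>

definition eval_mpoly :: "(var \<Rightarrow> 'a::comm_ring_1) \<Rightarrow> mpoly \<Rightarrow> 'a" where
  "eval_mpoly \<rho> p = (\<Sum>m\<in>Poly_Mapping.keys p. of_int (Poly_Mapping.lookup p m) * monom_eval \<rho> m)"

lemma subst_eq_eval: "subst = eval_mpoly"
  by (intro ext) (simp add: subst_def eval_mpoly_def monom_eval_def)

lemma monom_eval_superset:
  assumes "finite A" "Poly_Mapping.keys m \<subseteq> A"
  shows "monom_eval \<rho> m = (\<Prod>v\<in>A. \<rho> v ^ Poly_Mapping.lookup m v)"
  unfolding monom_eval_def
  by (rule prod.mono_neutral_left) (use assms in \<open>auto simp: in_keys_iff\<close>)

lemma monom_eval_add: "monom_eval \<rho> (m + n) = monom_eval \<rho> m * monom_eval \<rho> n"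
proof -
  let ?A = "Poly_Mapping.keys m \<union> Poly_Mapping.keys n"
  have "monom_eval \<rho> (m + n) = (\<Prod>v\<in>?A. \<rho> v ^ Poly_Mapping.lookup (m + n) v)"
    by (rule monom_eval_superset) (auto simp: keys_add)
  also have "\<dots> = (\<Prod>v\<in>?A. \<rho> v ^ Poly_Mapping.lookup m v) * (\<Prod>v\<in>?A. \<rho> v ^ Poly_Mapping.lookup n v)"
    by (simp add: lookup_add power_add prod.distrib)
  also have "\<dots> = monom_eval \<rho> m * monom_eval \<rho> n"
    by (simp add: monom_eval_superset[of ?A])
  finally show ?thesis .
qed

lemma monom_eval_0 [simp]: "monom_eval \<rho> 0 = 1"
  by (simp add: monom_eval_def)

lemma eval_superset:
  assumes "finite A" "Poly_Mapping.keys p \<subseteq> A"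
  shows "eval_mpoly \<rho> p = (\<Sum>m\<in>A. of_int (Poly_Mapping.lookup p m) * monom_eval \<rho> m)"
  unfolding eval_mpoly_def
  by (rule sum.mono_neutral_left) (use assms in \<open>auto simp: in_keys_iff\<close>)

lemma eval_add: "eval_mpoly \<rho> (p + q) = eval_mpoly \<rho> p + eval_mpoly \<rho> q"
proof -
  let ?A = "Poly_Mapping.keys p \<union> Poly_Mapping.keys q"
  have "eval_mpoly \<rho> (p + q) = (\<Sum>m\<in>?A. of_int (Poly_Mapping.lookup (p + q) m) * monom_eval \<rho> m)"
    by (rule eval_superset) (auto simp: keys_add)
  also have "\<dots> = eval_mpoly \<rho> p + eval_mpoly \<rho> q"
    by (simp add: lookup_add eval_superset[of ?A] sum.distrib algebra_simps)
  finally show ?thesis .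
qed

lemma eval_single: "eval_mpoly \<rho> (Poly_Mapping.single m c) = of_int c * monom_eval \<rho> m"
  by (cases "c = 0") (auto simp: eval_mpoly_def)

lemma mpoly_sum_singles: "p = (\<Sum>m\<in>Poly_Mapping.keys p. Poly_Mapping.single m (Poly_Mapping.lookup p m))"
  for p :: mpoly
  by (rule poly_mapping_eqI)
     (auto simp: lookup_sum lookup_single when_def in_keys_iff)

lemma eval_0 [simp]: "eval_mpoly \<rho> 0 = 0"
  by (simp add: eval_mpoly_def)

lemma eval_sum_aux: "eval_mpoly \<rho> (sum f A) = (\<Sum>x\<in>A. eval_mpoly \<rho> (f x))"
  by (induction A rule: infinite_finite_induct) (auto simp: eval_add)

lemma eval_mult: "eval_mpoly \<rho> (p * q) = eval_mpoly \<rho> p * eval_mpoly \<rho> q"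
proof -
  let ?l = Poly_Mapping.lookup and ?k = Poly_Mapping.keys
  have "p * q = (\<Sum>m\<in>?k p. Poly_Mapping.single m (?l p m)) * (\<Sum>n\<in>?k q. Poly_Mapping.single n (?l q n))"
    using mpoly_sum_singles[of p] mpoly_sum_singles[of q] by simp
  also have "\<dots> = (\<Sum>m\<in>?k p. \<Sum>n\<in>?k q. Poly_Mapping.single (m + n) (?l p m * ?l q n))"
    by (simp add: sum_product mult_single)
  finally have "eval_mpoly \<rho> (p * q)
      = (\<Sum>m\<in>?k p. \<Sum>n\<in>?k q. of_int (?l p m * ?l q n) * monom_eval \<rho> (m + n))"
    by (simp add: eval_sum_aux eval_single)
  also have "\<dots> = eval_mpoly \<rho> p * eval_mpoly \<rho> q"
    by (simp add: eval_mpoly_def sum_product monom_eval_add algebra_simps)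
  finally show ?thesis .
qed

lemma eval_1 [simp]: "eval_mpoly \<rho> 1 = 1"
  by (metis eval_single monom_eval_0 mult_1 of_int_1 single_one)

lemma ring_hom_eval: "ring_hom_fun (eval_mpoly \<rho>)"
  by (simp add: ring_hom_fun_def eval_add eval_mult)

lemmas eval_hom [simp] =
  ring_hom_fun_add[OF ring_hom_eval] ring_hom_fun_mult[OF ring_hom_eval]
  ring_hom_fun_uminus[OF ring_hom_eval] ring_hom_fun_diff[OF ring_hom_eval]
  ring_hom_fun_sum[OF ring_hom_eval] ring_hom_fun_prod[OF ring_hom_eval]
  ring_hom_fun_power[OF ring_hom_eval] ring_hom_fun_of_nat[OF ring_hom_eval]
  ring_hom_fun_of_int[OF ring_hom_eval]

lemma eval_numeral [simp]: "eval_mpoly \<rho> (numeral k) = numeral k"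
  using ring_hom_fun_of_nat[OF ring_hom_eval, of \<rho> "numeral k"] by simp

lemma eval_Var [simp]: "eval_mpoly \<rho> (Var v) = \<rho> v"
  by (simp add: Var_def eval_single monom_eval_def)

lemma hom_eval:
  assumes "ring_hom_fun h"
  shows "h (eval_mpoly \<rho> p) = eval_mpoly (\<lambda>v. h (\<rho> v)) p"
  unfolding eval_mpoly_def monom_eval_def
  by (simp add: ring_hom_fun_sum[OF assms] ring_hom_fun_mult[OF assms] ring_hom_fun_of_int[OF assms]
      ring_hom_fun_prod[OF assms] ring_hom_fun_power[OF assms])

lemma eval_eval: "eval_mpoly \<rho> (eval_mpoly \<sigma> p) = eval_mpoly (\<lambda>v. eval_mpoly \<rho> (\<sigma> v)) p"
  by (rule hom_eval[OF ring_hom_eval])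

lemma single_conv_monom_eval: "Poly_Mapping.single m c = of_int c * monom_eval Var m"
proof -
  have pow: "Var v ^ k = Poly_Mapping.single (Poly_Mapping.single v k) 1" for v k
    by (induction k) (auto simp: Var_def mult_single simp flip: single_add)
  have prod1: "(\<Prod>v\<in>A. Poly_Mapping.single (f v) (1::int)) = Poly_Mapping.single (\<Sum>v\<in>A. f v) 1"
    if "finite A" for A and f :: "var \<Rightarrow> var \<Rightarrow>\<^sub>0 nat"
    using that by induction (auto simp: mult_single)
  have m: "m = (\<Sum>v\<in>Poly_Mapping.keys m. Poly_Mapping.single v (Poly_Mapping.lookup m v))"
    by (rule poly_mapping_eqI) (auto simp: lookup_sum lookup_single when_def in_keys_iff)
  have "monom_eval Var m = Poly_Mapping.single m 1"
    unfolding monom_eval_def using m by (simp add: pow prod1)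
  moreover have "Poly_Mapping.single m c = of_int c * Poly_Mapping.single m 1"
    using mult_single[of 0 c m 1] by (simp flip: single_of_int)
  ultimately show ?thesis by simp
qed

lemma eval_id: "eval_mpoly Var p = p"
proof -
  have "eval_mpoly Var p = (\<Sum>m\<in>Poly_Mapping.keys p. Poly_Mapping.single m (Poly_Mapping.lookup p m))"
    unfolding eval_mpoly_def by (simp add: single_conv_monom_eval)
  thus ?thesis using mpoly_sum_singles[of p] by simp
qed

text \<open>Every \<open>p\<close> is its own evaluation at the \<open>Var v\<close>, and that is a
  finite sum of finite products of the given building blocks.\<close>

lemma mpoly_induct [case_names const Var add mult]:
  assumes const: "\<And>c. P (of_int c)" and var: "\<And>v. P (Var v)"
    and add: "\<And>p q. P p \<Longrightarrow> P q \<Longrightarrow> P (p + q)" and mult: "\<And>p q. P p \<Longrightarrow> P q \<Longrightarrow> P (p * q)"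
  shows "P (p :: mpoly)"
proof -
  have s: "P (sum f A)" if "\<And>x. x \<in> A \<Longrightarrow> P (f x)" for f :: "(var \<Rightarrow>\<^sub>0 nat) \<Rightarrow> mpoly" and A
    using that const[of 0] by (induction A rule: infinite_finite_induct) (auto intro: add)
  have pr: "P (prod f A)" if "\<And>x. x \<in> A \<Longrightarrow> P (f x)" for f :: "var \<Rightarrow> mpoly" and A
    using that const[of 1] by (induction A rule: infinite_finite_induct) (auto intro: mult)
  have pw: "P (x ^ k)" if "P x" for x k
    using that const[of 1] by (induction k) (auto intro: mult)
  have "P (eval_mpoly Var p)"
    unfolding eval_mpoly_def monom_eval_def by (intro s mult const pr pw var)
  thus ?thesis by (simp add: eval_id)
qed

text \<open>At the origin a nonempty monomial contains a positive power of 0. This links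
  \<open>const_term\<close> to evaluation.\<close>

lemma eval_at_0: "eval_mpoly (\<lambda>_. 0) p = of_int (Poly_Mapping.lookup p 0)"
proof -
  have "monom_eval (\<lambda>_. 0 :: 'a) m = (if m = 0 then 1 else 0)" for m
  proof (cases "m = 0")
    case False
    then obtain v where "v \<in> Poly_Mapping.keys m" by (metis all_not_in_conv keys_eq_empty)
    thus ?thesis using False unfolding monom_eval_def
      by (subst prod_zero) (auto simp: in_keys_iff power_0_left)
  qed simp
  hence "eval_mpoly (\<lambda>_. 0 :: 'a) p = (\<Sum>m\<in>Poly_Mapping.keys p. if m = 0 then of_int (Poly_Mapping.lookup p 0) else 0)"
    unfolding eval_mpoly_def by (intro sum.cong) auto
  thus ?thesis by (auto simp: in_keys_iff)
qed

text \<open>Factor theorem: modulo \<open>Var v - q\<close> the indeterminate \<open>v\<close> may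
  be replaced by \<open>q\<close>, and congruences are compatible with sums and products.\<close>

lemma Var_diff_dvd_subst: "(Var v - q) dvd p - eval_mpoly (Var(v := q)) p"
proof (induction p rule: mpoly_induct)
  case (Var w)
  then show ?case by simp
next
  case (add p r)
  then show ?case using dvd_add[OF add] by (simp add: algebra_simps)
next
  case (mult p r)
  let ?s = "eval_mpoly (Var(v := q))"
  have "p * r - ?s (p * r) = (p - ?s p) * r + ?s p * (r - ?s r)"
    by (simp add: algebra_simps)
  with mult show ?case by (metis dvd_add dvd_mult dvd_mult2)
qed simp

lemma Var_diff_dvd: "eval_mpoly (Var(v := q)) p = 0 \<Longrightarrow> (Var v - q) dvd p"
  using Var_diff_dvd_subst[of v q p] by simp

subsection \<open>Degree\<close>

text \<open>The substitution \<open>v \<mapsto> v s\<close> with a new indeterminate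
  \<open>s\<close>. The degree in \<open>s\<close> is the total degree, which makes the degree
  theory of univariate polynomials over a domain available.\<close>

definition scale_poly :: "mpoly \<Rightarrow> mpoly poly" where
  "scale_poly = eval_mpoly (\<lambda>v. [:0, Var v:])"

definition total_degree :: "mpoly \<Rightarrow> nat" where
  "total_degree p = degree (scale_poly p)"

lemma ring_hom_poly_eval: "ring_hom_fun (\<lambda>p. poly p x)"
  by (simp add: ring_hom_fun_def)

text \<open>Putting \<open>s = 1\<close> undoes the scaling; hence \<open>scale_poly\<close> is
  injective.\<close>

lemma poly_scale_1: "poly (scale_poly p) 1 = p"
  unfolding scale_poly_def hom_eval[OF ring_hom_poly_eval] by (simp add: eval_id)

lemma scale_poly_eq_0_iff [simp]: "scale_poly p = 0 \<longleftrightarrow> p = 0"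
  by (metis poly_0 poly_scale_1 scale_poly_def eval_0)

lemma total_degree_mult: "p \<noteq> 0 \<Longrightarrow> q \<noteq> 0 \<Longrightarrow> total_degree (p * q) = total_degree p + total_degree q"
proof -
  assume "p \<noteq> 0" "q \<noteq> 0"
  hence "degree (scale_poly p * scale_poly q) = degree (scale_poly p) + degree (scale_poly q)"
    by (simp add: degree_mult_eq)
  thus ?thesis by (simp add: total_degree_def scale_poly_def)
qed

lemma total_degree_mult_le: "total_degree (p * q) \<le> total_degree p + total_degree q"
  by (simp add: total_degree_def scale_poly_def degree_mult_le)

lemma total_degree_add_le: "total_degree (p + q) \<le> max (total_degree p) (total_degree q)"
  by (simp add: total_degree_def scale_poly_def degree_add_le_max)

lemma total_degree_diff_le: "total_degree (p - q) \<le> max (total_degree p) (total_degree q)"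
  by (simp add: total_degree_def scale_poly_def degree_diff_le_max)

lemma total_degree_uminus [simp]: "total_degree (- p) = total_degree p"
  by (simp add: total_degree_def scale_poly_def)

lemma total_degree_0 [simp]: "total_degree 0 = 0"
  and total_degree_1 [simp]: "total_degree 1 = 0"
  by (simp_all add: total_degree_def scale_poly_def)

lemma Var_neq_0 [simp]: "Var v \<noteq> 0"
  unfolding Var_def by (metis lookup_single_eq lookup_zero zero_neq_one)

lemma total_degree_Var [simp]: "total_degree (Var v) = 1"
  by (simp add: total_degree_def scale_poly_def)

lemma total_degree_sum_le: "(\<And>x. x \<in> A \<Longrightarrow> total_degree (f x) \<le> d) \<Longrightarrow> total_degree (sum f A) \<le> d"
proof (induction A rule: infinite_finite_induct)
  case (insert x F)
  thus ?case using total_degree_add_le[of "f x" "sum f F"] by force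
qed auto

lemma total_degree_prod_le: "total_degree (prod f A) \<le> (\<Sum>x\<in>A. total_degree (f x))"
proof (induction A rule: infinite_finite_induct)
  case (insert x F)
  thus ?case using total_degree_mult_le[of "f x" "prod f F"] by force
qed auto

lemma ring_hom_map_poly:
  assumes "ring_hom_fun h"
  shows "ring_hom_fun (map_poly h)"
proof -
  have 0: "h 0 = 0" using assms by (rule ring_hom_fun_0)
  have "map_poly h (p * q) = map_poly h p * map_poly h q" for p q
    by (rule poly_eqI) (simp add: coeff_map_poly[of h, OF 0] coeff_mult ring_hom_fun_sum[OF assms] ring_hom_fun_mult[OF assms])
  moreover have "map_poly h (p + q) = map_poly h p + map_poly h q" for p q
    by (rule poly_eqI) (simp add: coeff_map_poly[of h, OF 0] ring_hom_fun_add[OF assms])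
  ultimately show ?thesis
    using ring_hom_fun_1[OF assms] by (simp add: ring_hom_fun_def)
qed

text \<open>The hypothesis says that each \<open>\<sigma> v\<close> is a linear form or 0. Such a
  substitution commutes with the scaling, so it acts on the coefficients of
  \<open>scale_poly p\<close> and cannot raise the degree.\<close>

lemma total_degree_eval_le:
  assumes "\<And>v. scale_poly (\<sigma> v) = [:0, \<sigma> v:]"
  shows "total_degree (eval_mpoly \<sigma> p) \<le> total_degree p"
proof -
  have "scale_poly (eval_mpoly \<sigma> p) = eval_mpoly (\<lambda>v. [:0, \<sigma> v:]) p"
    using assms by (simp add: scale_poly_def eval_eval)
  also have "\<dots> = map_poly (eval_mpoly \<sigma>) (scale_poly p)"
    unfolding scale_poly_def hom_eval[OF ring_hom_map_poly[OF ring_hom_eval]]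
    by (simp add: map_poly_pCons)
  finally show ?thesis
    unfolding total_degree_def by (simp add: map_poly_degree_leq)
qed

lemma scale_poly_linear [simp]:
  "scale_poly 0 = 0" "scale_poly (Var v) = [:0, Var v:]"
  "scale_poly (- p) = - scale_poly p" "scale_poly (p + q) = scale_poly p + scale_poly q"
  "scale_poly (p - q) = scale_poly p - scale_poly q"
  by (simp_all add: scale_poly_def)

subsection \<open>Support\<close>

text \<open>Phrased as invariance under killing the variables outside \<open>A\<close>, so that
  closure under ring operations, intersections and exact division follows from the homomorphism
  laws.\<close>

definition involves_only :: "var set \<Rightarrow> mpoly \<Rightarrow> bool" where
  "involves_only A p \<longleftrightarrow> eval_mpoly (\<lambda>v. if v \<in> A then Var v else 0) p = p"

lemma eval_cong_involves:
  assumes "involves_only A p" "\<And>v. v \<in> A \<Longrightarrow> \<rho> v = \<rho>' v"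
  shows "eval_mpoly \<rho> p = eval_mpoly \<rho>' p"
proof -
  let ?k = "\<lambda>v. if v \<in> A then Var v else 0"
  have "eval_mpoly \<rho> p = eval_mpoly \<rho> (eval_mpoly ?k p)"
    using assms(1) by (simp add: involves_only_def)
  also have "\<dots> = eval_mpoly \<rho>' (eval_mpoly ?k p)"
    unfolding eval_eval by (rule arg_cong[where f = "\<lambda>r. eval_mpoly r p"]) (use assms(2) in auto)
  finally show ?thesis using assms(1) by (simp add: involves_only_def)
qed

lemma involves_only_0 [simp]: "involves_only A 0"
  and involves_only_1 [simp]: "involves_only A 1"
  and involves_only_Var [simp]: "involves_only A (Var v) \<longleftrightarrow> v \<in> A"
  by (auto simp: involves_only_def)

lemma involves_only_add: "involves_only A p \<Longrightarrow> involves_only A q \<Longrightarrow> involves_only A (p + q)"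
  and involves_only_diff: "involves_only A p \<Longrightarrow> involves_only A q \<Longrightarrow> involves_only A (p - q)"
  and involves_only_mult: "involves_only A p \<Longrightarrow> involves_only A q \<Longrightarrow> involves_only A (p * q)"
  and involves_only_uminus: "involves_only A p \<Longrightarrow> involves_only A (- p)"
  by (simp_all add: involves_only_def)

lemma involves_only_mono: "involves_only A p \<Longrightarrow> A \<subseteq> B \<Longrightarrow> involves_only B p"
  unfolding involves_only_def[of B]
  by (subst eval_cong_involves[of A p _ Var]) (auto simp: eval_id)

lemma involves_only_eval:
  assumes "involves_only A p" "\<And>v. v \<in> A \<Longrightarrow> involves_only B (\<sigma> v)"
  shows "involves_only B (eval_mpoly \<sigma> p)"
  unfolding involves_only_def eval_eval
  by (rule eval_cong_involves[OF assms(1)]) (use assms(2) in \<open>simp add: involves_only_def\<close>)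

lemma involves_only_Int:
  assumes "involves_only A p" "involves_only B p"
  shows "involves_only (A \<inter> B) p"
proof -
  let ?k = "\<lambda>A v. if v \<in> A then Var v else 0"
  have "eval_mpoly (?k (A \<inter> B)) p = eval_mpoly (?k A) (eval_mpoly (?k B) p)"
    unfolding eval_eval by (rule arg_cong[where f = "\<lambda>r. eval_mpoly r p"]) auto
  thus ?thesis using assms by (simp add: involves_only_def)
qed

lemma involves_only_divide:
  assumes "a * q = p" "a \<noteq> 0" "involves_only A a" "involves_only A p"
  shows "involves_only A q"
proof -
  let ?k = "eval_mpoly (\<lambda>v. if v \<in> A then Var v else 0)"
  have "a * ?k q = ?k (a * q)" using assms(3) by (simp add: involves_only_def)
  also have "\<dots> = a * q" using assms(1,4) by (simp add: involves_only_def)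
  finally show ?thesis using assms(2) by (simp add: involves_only_def)
qed

lemma Var_eq_iff [simp]: "Var v = Var w \<longleftrightarrow> v = w"
  by (metis involves_only_Var singletonD singletonI)

lemma mpoly_double_eq_0_iff: "(p :: mpoly) + p = 0 \<longleftrightarrow> p = 0"
proof -
  have "p + p = of_int 2 * p" by simp
  thus ?thesis by (metis mult_eq_0_iff add_0 of_int_eq_0_iff zero_neq_numeral)
qed

section \<open>Evaluation of x-functions\<close>

text \<open>The parameters are functions on the integers, so that signed permutations act on them by
  composition. The x-variables beyond the list \<open>\<xi>\<close> take the value 0.\<close>

definition point :: "(int \<Rightarrow> 'a::comm_ring_1) \<Rightarrow> (int \<Rightarrow> 'a) \<Rightarrow> 'a list \<Rightarrow> var \<Rightarrow> 'a" where
  "point \<tau> \<zeta> \<xi> v = (case v of T i \<Rightarrow> \<tau> (int i) | Z i \<Rightarrow> \<zeta> (int i)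
     | X k \<Rightarrow> if 1 \<le> k \<and> k \<le> length \<xi> then \<xi> ! (k - 1) else 0)"

text \<open>The component with as many x-variables as there are values is used; for a family
  compatible with restriction this is the value at \<open>\<xi>\<close> followed by zeros.\<close>

definition xeval :: "(int \<Rightarrow> 'a::comm_ring_1) \<Rightarrow> (int \<Rightarrow> 'a) \<Rightarrow> 'a list \<Rightarrow> xfun \<Rightarrow> 'a" where
  "xeval \<tau> \<zeta> \<xi> f = eval_mpoly (point \<tau> \<zeta> \<xi>) (f (length \<xi>))"

definition odd_fun :: "(int \<Rightarrow> 'a::ab_group_add) \<Rightarrow> bool" where
  "odd_fun \<tau> \<longleftrightarrow> (\<forall>k. \<tau> (- k) = - \<tau> k)"

text \<open>Together with \<open>gen_Z\<close> and \<open>gen_X\<close> this is the generic point,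
  extended to negative indices by oddness; \<open>gen_T 0\<close> is 0.\<close>

definition gen_T :: "int \<Rightarrow> mpoly" where "gen_T k = of_int (sgn k) * Var (T (nat \<bar>k\<bar>))"
definition gen_Z :: "int \<Rightarrow> mpoly" where "gen_Z k = of_int (sgn k) * Var (Z (nat \<bar>k\<bar>))"
definition gen_X :: "nat \<Rightarrow> mpoly list" where "gen_X N = map (\<lambda>k. Var (X (Suc k))) [0..<N]"

lemma odd_fun_uminus: "odd_fun \<tau> \<Longrightarrow> \<tau> (- k) = - \<tau> k"
  by (simp add: odd_fun_def)

lemma odd_fun_gen [simp]: "odd_fun gen_T" "odd_fun gen_Z"
  by (auto simp: odd_fun_def gen_T_def gen_Z_def sgn_minus)

lemma gen_pos [simp]:
  "i \<ge> 1 \<Longrightarrow> gen_T (int i) = Var (T i)" "i \<ge> 1 \<Longrightarrow> gen_Z (int i) = Var (Z i)"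
  "gen_T 1 = Var (T 1)" "gen_Z 1 = Var (Z 1)" "gen_T 2 = Var (T 2)" "gen_Z 2 = Var (Z 2)"
  by (auto simp: gen_T_def gen_Z_def)

lemma length_gen_X [simp]: "length (gen_X N) = N"
  by (simp add: gen_X_def)

lemma xeval_hom:
  assumes "ring_hom_fun h"
  shows "h (xeval \<tau> \<zeta> \<xi> f) = xeval (\<lambda>k. h (\<tau> k)) (\<lambda>k. h (\<zeta> k)) (map h \<xi>) f"
  unfolding xeval_def hom_eval[OF assms] length_map
  by (rule arg_cong[where f = "\<lambda>r. eval_mpoly r _"])
     (auto simp: fun_eq_iff point_def ring_hom_fun_0[OF assms] split: var.split)

lemma xeval_ring [simp]:
  "xeval \<tau> \<zeta> \<xi> (f + g) = xeval \<tau> \<zeta> \<xi> f + xeval \<tau> \<zeta> \<xi> g"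
  "xeval \<tau> \<zeta> \<xi> (f - g) = xeval \<tau> \<zeta> \<xi> f - xeval \<tau> \<zeta> \<xi> g"
  "xeval \<tau> \<zeta> \<xi> (f * g) = xeval \<tau> \<zeta> \<xi> f * xeval \<tau> \<zeta> \<xi> g"
  "xeval \<tau> \<zeta> \<xi> (- f) = - xeval \<tau> \<zeta> \<xi> f"
  "xeval \<tau> \<zeta> \<xi> 0 = 0" "xeval \<tau> \<zeta> \<xi> 1 = 1"
  by (simp_all add: xeval_def zero_fun_def one_fun_def)

lemma xeval_t_var [simp]: "xeval \<tau> \<zeta> \<xi> (t_var i) = \<tau> (int i)"
  and xeval_z_var [simp]: "xeval \<tau> \<zeta> \<xi> (z_var i) = \<zeta> (int i)"
  by (simp_all add: xeval_def t_var_def z_var_def point_def)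

section \<open>Reflections as changes of the evaluation point\<close>

text \<open>The values which a reflection prepends to the x-list: \<open>a\<close> is
  \<open>\<zeta>\<close> for the action on z and \<open>- \<tau>\<close> for the action on t. The
  node \<open>Hat1\<close> contains \<open>s_0\<close> twice, hence two values.\<close>

fun inserted :: "node \<Rightarrow> (int \<Rightarrow> 'a) \<Rightarrow> 'a list" where
  "inserted (Nd i) a = (if i = 0 then [a 1] else [])"
| "inserted Hat1 a = [a 2, a 1]"

lemma refl_nat_simps: "simple_refl_nat 0 1 = - 1" "simple_refl_nat 0 2 = 2" "simple_refl_nat 1 1 = 2"
  "simple_refl_nat 1 2 = 1" "simple_refl_nat (Suc 0) 1 = 2" "simple_refl_nat (Suc 0) 2 = 1"
  by (auto simp: simple_refl_nat_def transpose_def)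

lemma simple_refl_nat_uminus: "simple_refl_nat i (- k) = - simple_refl_nat i k"
  by (auto simp: simple_refl_nat_def sgn_minus)

lemma simple_refl_uminus: "simple_refl i (- k) = - simple_refl i k"
  by (cases i) (auto simp: simple_refl_nat_uminus)

lemma odd_fun_comp: "odd_fun \<tau> \<Longrightarrow> odd_fun (\<tau> \<circ> simple_refl i)"
  by (simp add: odd_fun_def simple_refl_uminus)

lemma simple_refl_nat_int: "i \<ge> 1 \<Longrightarrow> simple_refl_nat i (int k) = int (transpose i (Suc i) k)"
  by (cases "k = 0") (auto simp: simple_refl_nat_def transpose_def)

lemma xeval_act_t_nat_pos: "i \<ge> 1 \<Longrightarrow>
    xeval \<tau> \<zeta> \<xi> (act_t_nat i f) = xeval (\<tau> \<circ> simple_refl_nat i) \<zeta> \<xi> f"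
  unfolding xeval_def act_t_nat_def subst_eq_eval
  by (auto simp: eval_eval intro!: arg_cong[where f = "\<lambda>r. eval_mpoly r _"])
     (auto simp: fun_eq_iff point_def simple_refl_nat_int split: var.split)

lemma xeval_act_z_nat_pos: "i \<ge> 1 \<Longrightarrow>
    xeval \<tau> \<zeta> \<xi> (act_z_nat i f) = xeval \<tau> (\<zeta> \<circ> simple_refl_nat i) \<xi> f"
  unfolding xeval_def act_z_nat_def subst_eq_eval
  by (auto simp: eval_eval intro!: arg_cong[where f = "\<lambda>r. eval_mpoly r _"])
     (auto simp: fun_eq_iff point_def simple_refl_nat_int split: var.split)

lemma xeval_act_t_nat_0:
  assumes "odd_fun \<tau>"
  shows "xeval \<tau> \<zeta> \<xi> (act_t_nat 0 f) = xeval (\<tau> \<circ> simple_refl_nat 0) \<zeta> (- \<tau> 1 # \<xi>) f"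
  unfolding xeval_def act_t_nat_def subst_eq_eval
  using odd_fun_uminus[OF assms, of 1]
  by (auto simp: eval_eval intro!: arg_cong[where f = "\<lambda>r. eval_mpoly r _"])
     (auto simp: fun_eq_iff point_def simple_refl_nat_def insert_x_def nth_Cons split: var.split nat.split,
      (rule arg_cong[where f = "(!) \<xi>"], arith)+)

lemma xeval_act_z_nat_0:
  assumes "odd_fun \<zeta>"
  shows "xeval \<tau> \<zeta> \<xi> (act_z_nat 0 f) = xeval \<tau> (\<zeta> \<circ> simple_refl_nat 0) (\<zeta> 1 # \<xi>) f"
  unfolding xeval_def act_z_nat_def subst_eq_eval
  using odd_fun_uminus[OF assms, of 1]
  by (auto simp: eval_eval intro!: arg_cong[where f = "\<lambda>r. eval_mpoly r _"])
     (auto simp: fun_eq_iff point_def simple_refl_nat_def insert_x_def nth_Cons split: var.split nat.split,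
      (rule arg_cong[where f = "(!) \<xi>"], arith)+)

lemma odd_fun_comp_nat: "odd_fun \<tau> \<Longrightarrow> odd_fun (\<tau> \<circ> simple_refl_nat i)"
  by (simp add: odd_fun_def simple_refl_nat_uminus)

text \<open>Later computations with the actions go through this formula: a reflection composes the
  parameters with the signed permutation and lengthens the x-list. Oddness of \<open>\<tau>\<close>
  accounts for \<open>s_0\<close> changing the sign of \<open>t_1\<close>.\<close>

lemma xeval_act_t:
  assumes "odd_fun \<tau>"
  shows "xeval \<tau> \<zeta> \<xi> (act_t i f) = xeval (\<tau> \<circ> simple_refl i) \<zeta> (inserted i (\<lambda>k. - \<tau> k) @ \<xi>) f"
proof (cases i)
  case (Nd j)
  thus ?thesis using assms by (auto simp: xeval_act_t_nat_0 xeval_act_t_nat_pos)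
next
  case Hat1
  have "odd_fun (\<tau> \<circ> simple_refl_nat 0 \<circ> simple_refl_nat 1)" "odd_fun (\<tau> \<circ> simple_refl_nat 0)"
    using assms by (auto intro!: odd_fun_comp_nat)
  thus ?thesis using assms Hat1
    by (simp add: xeval_act_t_nat_0 xeval_act_t_nat_pos refl_nat_simps comp_assoc)
qed

lemma xeval_act_z:
  assumes "odd_fun \<zeta>"
  shows "xeval \<tau> \<zeta> \<xi> (act_z i f) = xeval \<tau> (\<zeta> \<circ> simple_refl i) (inserted i \<zeta> @ \<xi>) f"
proof (cases i)
  case (Nd j)
  thus ?thesis using assms by (auto simp: xeval_act_z_nat_0 xeval_act_z_nat_pos)
next
  case Hat1
  have "odd_fun (\<zeta> \<circ> simple_refl_nat 0 \<circ> simple_refl_nat 1)" "odd_fun (\<zeta> \<circ> simple_refl_nat 0)"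
    using assms by (auto intro!: odd_fun_comp_nat)
  thus ?thesis using assms Hat1
    by (simp add: xeval_act_z_nat_0 xeval_act_z_nat_pos refl_nat_simps comp_assoc)
qed

lemma act_t_nat_ring:
  "act_t_nat i (f + g) = act_t_nat i f + act_t_nat i g"
  "act_t_nat i (f - g) = act_t_nat i f - act_t_nat i g"
  "act_t_nat i (f * g) = act_t_nat i f * act_t_nat i g"
  "act_t_nat i 1 = 1" "act_t_nat i 0 = 0" "act_t_nat i (- f) = - act_t_nat i f"
  by (auto simp: act_t_nat_def subst_eq_eval fun_eq_iff)

lemma act_z_nat_ring:
  "act_z_nat i (f + g) = act_z_nat i f + act_z_nat i g"
  "act_z_nat i (f - g) = act_z_nat i f - act_z_nat i g"
  "act_z_nat i (f * g) = act_z_nat i f * act_z_nat i g"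
  "act_z_nat i 1 = 1" "act_z_nat i 0 = 0" "act_z_nat i (- f) = - act_z_nat i f"
  by (auto simp: act_z_nat_def subst_eq_eval fun_eq_iff)

lemma act_t_ring [simp]:
  "act_t i (f + g) = act_t i f + act_t i g" "act_t i (f - g) = act_t i f - act_t i g"
  "act_t i (f * g) = act_t i f * act_t i g" "act_t i 1 = 1" "act_t i 0 = 0" "act_t i (- f) = - act_t i f"
  by (cases i; simp add: act_t_nat_ring)+

lemma act_z_ring [simp]:
  "act_z i (f + g) = act_z i f + act_z i g" "act_z i (f - g) = act_z i f - act_z i g"
  "act_z i (f * g) = act_z i f * act_z i g" "act_z i 1 = 1" "act_z i 0 = 0" "act_z i (- f) = - act_z i f"
  by (cases i; simp add: act_z_nat_ring)+

lemma act_t_z_var [simp]: "act_t i (z_var k) = z_var k"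
  by (cases i) (auto simp: act_t_nat_def z_var_def subst_eq_eval fun_eq_iff)

lemma act_z_t_var [simp]: "act_z i (t_var k) = t_var k"
  by (cases i) (auto simp: act_z_nat_def t_var_def subst_eq_eval fun_eq_iff)

section \<open>The ambient ring of supersymmetric functions\<close>

definition allowed :: "nat \<Rightarrow> nat \<Rightarrow> var set" where
  "allowed K N = T ` {1..K} \<union> Z ` {1..K} \<union> X ` {1..N}"

text \<open>Besides giving one bound \<open>K\<close> for all \<open>N\<close>, this excludes
  indeterminates of index 0, so that \<open>f\<close> can be recovered from its values at the
  generic point, where \<open>gen_T 0\<close> and \<open>gen_Z 0\<close> vanish.\<close>

definition finite_vars :: "xfun \<Rightarrow> bool" where
  "finite_vars f \<longleftrightarrow> (\<exists>K. \<forall>N. involves_only (allowed K N) (f N))"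

definition bounded_degree :: "xfun \<Rightarrow> bool" where
  "bounded_degree f \<longleftrightarrow> (\<exists>d. \<forall>N. total_degree (f N) \<le> d)"

text \<open>The inverse limit lets \<open>x\<^sub>j\<close> vanish for large j, and in \<open>\<Gamma>'\<close> a pair of opposite
  values of the x-variables cancels.\<close>

definition supersymmetric :: "xfun \<Rightarrow> bool" where
  "supersymmetric f \<longleftrightarrow>
     (\<forall>\<xi> \<xi>'. mset \<xi> = mset \<xi>' \<longrightarrow> xeval gen_T gen_Z \<xi> f = xeval gen_T gen_Z \<xi>' f) \<and>
     (\<forall>\<xi>. xeval gen_T gen_Z (0 # \<xi>) f = xeval gen_T gen_Z \<xi> f) \<and>
     (\<forall>a \<xi>. xeval gen_T gen_Z (a # - a # \<xi>) f = xeval gen_T gen_Z \<xi> f)"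

lemma supersymmetricD:
  assumes "supersymmetric f"
  shows "mset \<xi> = mset \<xi>' \<Longrightarrow> xeval gen_T gen_Z \<xi> f = xeval gen_T gen_Z \<xi>' f"
    "xeval gen_T gen_Z (0 # \<xi>) f = xeval gen_T gen_Z \<xi> f"
    "xeval gen_T gen_Z (a # - a # \<xi>) f = xeval gen_T gen_Z \<xi> f"
  using assms unfolding supersymmetric_def by blast+

text \<open>A common ambient ring for both types. Unlike membership in \<open>Rring\<close>, these
  conditions can be checked directly for the factorial function, and they pass to exact quotients by
  roots.\<close>

definition good :: "xfun \<Rightarrow> bool" where
  "good f \<longleftrightarrow> finite_vars f \<and> bounded_degree f \<and> supersymmetric f"

lemma allowed_mono: "K \<le> K' \<Longrightarrow> N \<le> N' \<Longrightarrow> allowed K N \<subseteq> allowed K' N'"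
  by (auto simp: allowed_def)

lemma xeval_cong:
  assumes "finite_vars f" "\<And>k. k > 0 \<Longrightarrow> \<tau> k = \<tau>' k" "\<And>k. k > 0 \<Longrightarrow> \<zeta> k = \<zeta>' k"
  shows "xeval \<tau> \<zeta> \<xi> f = xeval \<tau>' \<zeta>' \<xi> f"
proof -
  obtain K where "involves_only (allowed K (length \<xi>)) (f (length \<xi>))"
    using assms(1) by (auto simp: finite_vars_def)
  thus ?thesis unfolding xeval_def
    by (rule eval_cong_involves) (use assms(2,3) in \<open>auto simp: allowed_def point_def\<close>)
qed

lemma xeval_generic:
  assumes "finite_vars f"
  shows "xeval gen_T gen_Z (gen_X N) f = f N"
proof -
  obtain K where K: "involves_only (allowed K N) (f N)"
    using assms by (auto simp: finite_vars_def)
  have "xeval gen_T gen_Z (gen_X N) f = eval_mpoly Var (f N)"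
    unfolding xeval_def length_gen_X
    by (rule eval_cong_involves[OF K]) (auto simp: allowed_def point_def gen_X_def)
  thus ?thesis by (simp add: eval_id)
qed

lemma xfun_ext:
  assumes "finite_vars f" "finite_vars g"
    "\<And>N. xeval gen_T gen_Z (gen_X N) f = xeval gen_T gen_Z (gen_X N) g"
  shows "f = g"
  using assms xeval_generic by (metis ext)

lemma xeval_specialize:
  assumes "finite_vars f" "\<And>i. i \<ge> 1 \<Longrightarrow> h (Var (T i)) = \<tau> (int i)" "\<And>i. i \<ge> 1 \<Longrightarrow> h (Var (Z i)) = \<zeta> (int i)"
    "ring_hom_fun h"
  shows "h (xeval gen_T gen_Z \<xi> f) = xeval \<tau> \<zeta> (map h \<xi>) f"
  unfolding xeval_hom[OF assms(4)]
proof (rule xeval_cong[OF assms(1)])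
  fix k :: int assume "k > 0"
  then obtain i where "k = int i" "i \<ge> 1" by (metis int_one_le_iff_zero_less nat_0_le nat_int of_nat_le_iff int_nat_eq less_imp_le of_nat_1 pos_int_cases zero_less_imp_eq_int of_nat_0_less_iff One_nat_def Suc_leI)
  thus "h (gen_T k) = \<tau> k" "h (gen_Z k) = \<zeta> k" using assms(2,3) by auto
qed

lemma map_point_gen_X:
  assumes "N \<le> length \<xi>"
  shows "map (eval_mpoly (point \<tau> \<zeta> \<xi>)) (gen_X N) = take N \<xi>"
  by (rule nth_equalityI) (use assms in \<open>auto simp: gen_X_def point_def\<close>)

lemma xeval_specialize_point:
  assumes "finite_vars f"
  shows "eval_mpoly (point \<tau> \<zeta> \<eta>) (xeval gen_T gen_Z \<xi> f) = xeval \<tau> \<zeta> (map (eval_mpoly (point \<tau> \<zeta> \<eta>)) \<xi>) f"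
  by (rule xeval_specialize[OF assms _ _ ring_hom_eval]) (auto simp: point_def)

text \<open>Supersymmetry is demanded only at the generic parameters over \<open>mpoly\<close>. The
  generic list of x-variables specializes to every list over every commutative ring, and the
  identity specializes with it.\<close>

lemma xeval_mset:
  assumes "good f" "mset \<xi> = mset \<xi>'"
  shows "xeval \<tau> \<zeta> \<xi> f = xeval \<tau> \<zeta> \<xi>' f"
proof -
  have fv: "finite_vars f" using assms by (simp add: good_def)
  obtain \<pi> where \<pi>: "\<pi> permutes {..<length \<xi>}" "permute_list \<pi> \<xi> = \<xi>'"
    using mset_eq_permutation[OF assms(2)[symmetric]] by blast
  let ?h = "eval_mpoly (point \<tau> \<zeta> \<xi>)" and ?\<eta> = "gen_X (length \<xi>)"
  have h: "map ?h ?\<eta> = \<xi>" by (simp add: map_point_gen_X)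
  have "xeval gen_T gen_Z ?\<eta> f = xeval gen_T gen_Z (permute_list \<pi> ?\<eta>) f"
    using assms(1) \<pi>(1) by (intro supersymmetricD(1)) (simp_all add: good_def mset_permute_list)
  hence "?h (xeval gen_T gen_Z ?\<eta> f) = ?h (xeval gen_T gen_Z (permute_list \<pi> ?\<eta>) f)" by simp
  hence "xeval \<tau> \<zeta> (map ?h ?\<eta>) f = xeval \<tau> \<zeta> (map ?h (permute_list \<pi> ?\<eta>)) f"
    by (simp only: xeval_specialize_point[OF fv])
  thus ?thesis using h \<pi> by (simp flip: permute_list_map)
qed

lemma xeval_zero:
  assumes "good f"
  shows "xeval \<tau> \<zeta> (0 # \<xi>) f = xeval \<tau> \<zeta> \<xi> f"
proof -
  have fv: "finite_vars f" using assms by (simp add: good_def)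
  let ?h = "eval_mpoly (point \<tau> \<zeta> \<xi>)" and ?\<eta> = "gen_X (length \<xi>)"
  have h: "map ?h ?\<eta> = \<xi>" by (simp add: map_point_gen_X)
  have "?h (xeval gen_T gen_Z (0 # ?\<eta>) f) = ?h (xeval gen_T gen_Z ?\<eta> f)"
    using assms(1) by (simp only: good_def supersymmetricD(2))
  hence "xeval \<tau> \<zeta> (map ?h (0 # ?\<eta>)) f = xeval \<tau> \<zeta> (map ?h ?\<eta>) f"
    by (simp only: xeval_specialize_point[OF fv])
  thus ?thesis using h by simp
qed

lemma xeval_cancel:
  assumes "good f"
  shows "xeval \<tau> \<zeta> (a # - a # \<xi>) f = xeval \<tau> \<zeta> \<xi> f"
proof -
  have fv: "finite_vars f" using assms by (simp add: good_def)
  \<comment> \<open>The appended entry makes the fresh variable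
    \<open>X (Suc (length \<xi>))\<close> specialize to \<open>a\<close>.\<close>
  let ?h = "eval_mpoly (point \<tau> \<zeta> (\<xi> @ [a]))" and ?\<eta> = "gen_X (length \<xi>)"
  let ?x = "Var (X (Suc (length \<xi>)))"
  have h: "map ?h ?\<eta> = \<xi>" "?h ?x = a" by (simp_all add: map_point_gen_X) (simp add: point_def)
  have "?h (xeval gen_T gen_Z (?x # - ?x # ?\<eta>) f) = ?h (xeval gen_T gen_Z ?\<eta> f)"
    using assms(1) by (simp only: good_def supersymmetricD(3))
  hence "xeval \<tau> \<zeta> (map ?h (?x # - ?x # ?\<eta>)) f = xeval \<tau> \<zeta> (map ?h ?\<eta>) f"
    by (simp only: xeval_specialize_point[OF fv])
  thus ?thesis using h by simp
qed

section \<open>Closure of the ambient ring under ring operations, exact division and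
  reflections\<close>

lemma finite_vars_binop:
  assumes "finite_vars f" "finite_vars g"
  obtains K where "\<And>N. involves_only (allowed K N) (f N)" "\<And>N. involves_only (allowed K N) (g N)"
proof -
  obtain K1 K2 where "\<And>N. involves_only (allowed K1 N) (f N)" "\<And>N. involves_only (allowed K2 N) (g N)"
    using assms by (auto simp: finite_vars_def)
  hence "involves_only (allowed (max K1 K2) N) (f N)" "involves_only (allowed (max K1 K2) N) (g N)" for N
    by (meson allowed_mono involves_only_mono max.cobounded1 max.cobounded2 order_refl)+
  thus thesis using that by blast
qed

lemma finite_vars_ring:
  assumes "finite_vars f" "finite_vars g"
  shows "finite_vars (f - g)" "finite_vars (f * g)"
proof -
  obtain K where K: "\<And>N. involves_only (allowed K N) (f N)" "\<And>N. involves_only (allowed K N) (g N)"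
    using finite_vars_binop[OF assms] by blast
  show "finite_vars (f - g)" "finite_vars (f * g)"
    unfolding finite_vars_def using K by (auto intro!: exI[of _ K] involves_only_diff involves_only_mult)
qed

lemma bounded_degree_ring:
  assumes "bounded_degree f" "bounded_degree g"
  shows "bounded_degree (f - g)" "bounded_degree (f * g)"
proof -
  obtain d e where d: "\<And>N. total_degree (f N) \<le> d" "\<And>N. total_degree (g N) \<le> e"
    using assms by (auto simp: bounded_degree_def)
  have "total_degree ((f - g) N) \<le> max d e" for N
    using total_degree_diff_le[of "f N" "g N"] d[of N] by (auto simp: max_def split: if_splits)
  moreover have "total_degree ((f * g) N) \<le> d + e" for N
    using total_degree_mult_le[of "f N" "g N"] d[of N] by simp
  ultimately show "bounded_degree (f - g)" "bounded_degree (f * g)"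
    unfolding bounded_degree_def by blast+
qed

lemma good_diff: "good f \<Longrightarrow> good g \<Longrightarrow> good (f - g)"
  and good_mult: "good f \<Longrightarrow> good g \<Longrightarrow> good (f * g)"
proof -
  assume fg: "good f" "good g"
  hence "supersymmetric f" "supersymmetric g" by (simp_all add: good_def)
  hence "supersymmetric (f - g)" "supersymmetric (f * g)"
    unfolding supersymmetric_def xeval_ring by (intro conjI allI impI arg_cong2[where f = "(-)"] arg_cong2[where f = "(*)"]; blast)+
  thus "good (f - g)" "good (f * g)"
    using fg by (simp_all add: good_def finite_vars_ring bounded_degree_ring)
qed

lemma good_const:
  assumes "involves_only (allowed K 0) p"
  shows "good (\<lambda>N. p)"
proof -
  have "involves_only (allowed K N) p" for N
    using assms by (rule involves_only_mono) (simp add: allowed_mono)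
  moreover have "xeval gen_T gen_Z \<xi> (\<lambda>N. p) = xeval gen_T gen_Z \<xi>' (\<lambda>N. p)" for \<xi> \<xi>'
    unfolding xeval_def by (rule eval_cong_involves[OF assms]) (auto simp: allowed_def point_def)
  ultimately show ?thesis
    unfolding good_def finite_vars_def bounded_degree_def supersymmetric_def by blast
qed

lemma good_1: "good 1"
  using good_const[of 0 1] by (simp add: one_fun_def)

lemma good_t_var: "i \<ge> 1 \<Longrightarrow> good (t_var i)"
  and good_z_var: "i \<ge> 1 \<Longrightarrow> good (z_var i)"
  unfolding t_var_def z_var_def by (rule good_const[of i]; simp add: allowed_def)+

text \<open>Every identity demanded of \<open>g\<close> holds after multiplication by
  \<open>a\<close>, and \<open>mpoly\<close> is a domain. This is how divided differences stay in
  the ambient ring.\<close>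

lemma good_divide:
  assumes "good h" "(\<lambda>N. a) * g = h" "a \<noteq> 0" "involves_only (allowed K 0) a"
  shows "good g"
proof -
  have h: "a * g N = h N" for N using assms(2) by (auto simp: fun_eq_iff)
  have a: "xeval gen_T gen_Z \<xi> (\<lambda>N. a) = a" for \<xi>
  proof -
    have "xeval gen_T gen_Z \<xi> (\<lambda>N. a) = eval_mpoly Var a"
      unfolding xeval_def by (rule eval_cong_involves[OF assms(4)]) (auto simp: allowed_def point_def)
    thus ?thesis by (simp add: eval_id)
  qed
  have xe: "a * xeval gen_T gen_Z \<xi> g = xeval gen_T gen_Z \<xi> h" for \<xi>
    using assms(2) a[of \<xi>] by (metis xeval_ring(3))
  have xe_eq: "xeval gen_T gen_Z \<xi> h = xeval gen_T gen_Z \<xi>' h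
      \<longleftrightarrow> xeval gen_T gen_Z \<xi> g = xeval gen_T gen_Z \<xi>' g" for \<xi> \<xi>'
    using assms(3) by (simp flip: xe)
  have "finite_vars h" using assms(1) by (simp add: good_def)
  moreover have "finite_vars (\<lambda>N. a)" using good_const[OF assms(4)] by (simp add: good_def)
  ultimately obtain K' where K': "\<And>N. involves_only (allowed K' N) (h N)" "\<And>N. involves_only (allowed K' N) a"
    using finite_vars_binop by (metis (no_types, lifting))
  have "finite_vars g"
    unfolding finite_vars_def using involves_only_divide[OF h assms(3) K'(2,1)] by blast
  moreover obtain d where d: "\<And>N. total_degree (h N) \<le> d"
    using assms(1) by (auto simp: good_def bounded_degree_def)
  have "total_degree (g N) \<le> d" for N
  proof (cases "g N = 0")
    case False
    thus ?thesis using total_degree_mult[OF assms(3) False] h[of N] d[of N] by simp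
  qed simp
  hence "bounded_degree g" unfolding bounded_degree_def by blast
  moreover have "supersymmetric g"
    using assms(1) unfolding good_def supersymmetric_def xe_eq
    by blast
  ultimately show ?thesis by (simp add: good_def)
qed

lemma involves_only_insert_x:
  "k \<in> {1..Suc N} \<Longrightarrow> involves_only A y \<Longrightarrow> X ` {1..N} \<subseteq> A \<Longrightarrow> involves_only A (insert_x y k)"
  by (force simp: insert_x_def)

lemma finite_vars_act_nat:
  assumes "finite_vars f"
  shows "finite_vars (act_t_nat i f)" "finite_vars (act_z_nat i f)"
proof -
  obtain K where K: "\<And>N. involves_only (allowed K N) (f N)"
    using assms by (auto simp: finite_vars_def)
  have tr: "k \<ge> 1 \<Longrightarrow> k \<le> K \<Longrightarrow> i \<ge> 1 \<Longrightarrow> 1 \<le> transpose i (Suc i) k \<and> transpose i (Suc i) k \<le> max K (Suc i)" for k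
    by (auto simp: transpose_def)
  have "involves_only (allowed (max K (Suc i)) N) (act_t_nat i f N)" for N
  proof (cases "i = 0")
    case True
    show ?thesis unfolding act_t_nat_def subst_eq_eval using True
      by (simp, intro involves_only_eval[OF K])
         (auto simp: allowed_def intro!: involves_only_insert_x[of _ N] involves_only_uminus)
  next
    case False
    show ?thesis unfolding act_t_nat_def subst_eq_eval using False
      by (simp, intro involves_only_eval[OF K]) (use tr in \<open>auto simp: allowed_def\<close>)
  qed
  moreover have "involves_only (allowed (max K (Suc i)) N) (act_z_nat i f N)" for N
  proof (cases "i = 0")
    case True
    show ?thesis unfolding act_z_nat_def subst_eq_eval using True
      by (simp, intro involves_only_eval[OF K])
         (auto simp: allowed_def intro!: involves_only_insert_x[of _ N] involves_only_uminus)
  next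
    case False
    show ?thesis unfolding act_z_nat_def subst_eq_eval using False
      by (simp, intro involves_only_eval[OF K]) (use tr in \<open>auto simp: allowed_def\<close>)
  qed
  ultimately show "finite_vars (act_t_nat i f)" "finite_vars (act_z_nat i f)"
    unfolding finite_vars_def by blast+
qed

lemma bounded_degree_act_nat:
  assumes "bounded_degree f"
  shows "bounded_degree (act_t_nat i f)" "bounded_degree (act_z_nat i f)"
proof -
  obtain d where d: "\<And>N. total_degree (f N) \<le> d" using assms by (auto simp: bounded_degree_def)
  have "total_degree (act_t_nat i f N) \<le> d" "total_degree (act_z_nat i f N) \<le> d" for N
    unfolding act_t_nat_def act_z_nat_def subst_eq_eval
    by (auto intro!: order_trans[OF total_degree_eval_le d] simp: insert_x_def split: var.split)
  thus "bounded_degree (act_t_nat i f)" "bounded_degree (act_z_nat i f)"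
    unfolding bounded_degree_def by blast+
qed

text \<open>For \<open>i = 0\<close> the action puts a value in front of the x-list; symmetry moves
  the 0 or the opposite pair to be cancelled past it.\<close>

lemma good_act_nat:
  assumes "good f"
  shows "good (act_t_nat i f)" "good (act_z_nat i f)"
proof -
  have swap: "xeval \<tau> \<zeta> (b # a # - a # \<xi>) f = xeval \<tau> \<zeta> (b # \<xi>) f"
    "xeval \<tau> \<zeta> (b # 0 # \<xi>) f = xeval \<tau> \<zeta> (b # \<xi>) f" for \<tau> \<zeta> :: "int \<Rightarrow> mpoly" and a b \<xi>
    using xeval_mset[OF assms, of "b # a # - a # \<xi>" "a # - a # b # \<xi>"] xeval_cancel[OF assms]
      xeval_mset[OF assms, of "b # 0 # \<xi>" "0 # b # \<xi>"] xeval_zero[OF assms]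
    by (auto simp: add_mset_commute)
  have "supersymmetric (act_t_nat i f)" "supersymmetric (act_z_nat i f)"
    unfolding supersymmetric_def
    by (cases "i = 0"; auto simp: xeval_act_t_nat_0 xeval_act_t_nat_pos xeval_act_z_nat_0 xeval_act_z_nat_pos
        swap xeval_zero[OF assms] xeval_cancel[OF assms] intro!: xeval_mset[OF assms])+
  thus "good (act_t_nat i f)" "good (act_z_nat i f)"
    using assms finite_vars_act_nat bounded_degree_act_nat by (auto simp: good_def)
qed

lemma good_act_t: "good f \<Longrightarrow> good (act_t i f)"
  and good_act_z: "good f \<Longrightarrow> good (act_z i f)"
  by (cases i; simp add: good_act_nat)+

lemma good_finite_vars: "good f \<Longrightarrow> finite_vars f"
  by (simp add: good_def)

text \<open>Both sides insert the same values into the x-list, but in different orders; symmetry in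
  x makes them agree.\<close>

lemma act_z_act_t:
  assumes "good f"
  shows "act_z i (act_t j f) = act_t j (act_z i f)"
proof (rule xfun_ext)
  show "finite_vars (act_z i (act_t j f))" "finite_vars (act_t j (act_z i f))"
    using assms by (simp_all add: good_finite_vars good_act_t good_act_z)
  fix N
  show "xeval gen_T gen_Z (gen_X N) (act_z i (act_t j f)) = xeval gen_T gen_Z (gen_X N) (act_t j (act_z i f))"
    by (simp add: xeval_act_t xeval_act_z odd_fun_comp) (rule xeval_mset[OF assms], simp)
qed

section \<open>The generators of the ring\<close>

definition fps_map_coeffs :: "('a::comm_ring_1 \<Rightarrow> 'b::comm_ring_1) \<Rightarrow> 'a fps \<Rightarrow> 'b fps" where
  "fps_map_coeffs h F = Abs_fps (\<lambda>n. h (fps_nth F n))"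

lemma ring_hom_fps_map_coeffs:
  assumes "ring_hom_fun h"
  shows "ring_hom_fun (fps_map_coeffs h)"
  unfolding ring_hom_fun_def fps_map_coeffs_def
  by (auto simp: fps_eq_iff fps_mult_nth ring_hom_fun_sum[OF assms] ring_hom_fun_mult[OF assms]
      ring_hom_fun_add[OF assms] ring_hom_fun_0[OF assms] ring_hom_fun_1[OF assms])

text \<open>The series \<open>(1 + a u) / (1 - a u)\<close>.\<close>

definition qfactor :: "'a::comm_ring_1 \<Rightarrow> 'a fps" where
  "qfactor a = (1 + fps_const a * fps_X) * Abs_fps (\<lambda>k. a ^ k)"

lemma geometric_fps: "(1 - fps_const a * fps_X) * Abs_fps (\<lambda>k. a ^ k) = (1 :: 'a::comm_ring_1 fps)"
proof (rule fps_ext)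
  fix n
  show "fps_nth ((1 - fps_const a * fps_X) * Abs_fps (\<lambda>k. a ^ k)) n = fps_nth 1 n"
    by (cases n) (auto simp: algebra_simps fps_X_mult_right_nth mult.assoc)
qed

lemma qfactor_0 [simp]: "qfactor 0 = 1"
proof -
  have "Abs_fps (\<lambda>k. 0 ^ k) = (1 :: 'a fps)"
    using geometric_fps[of "0 :: 'a"] by simp
  thus ?thesis by (simp add: qfactor_def)
qed

text \<open>A change of sign of \<open>a\<close> inverts \<open>(1 + a u) / (1 - a u)\<close>; the
  cancellation of opposite x-values in \<open>Qfun\<close> comes from this.\<close>

lemma qfactor_cancel: "qfactor a * qfactor (- a) = 1"
proof -
  have e: "1 + fps_const (- a) * fps_X = 1 - fps_const a * fps_X"
    "1 + fps_const a * fps_X = 1 - fps_const (- a) * fps_X"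
    by (simp_all flip: fps_const_neg)
  have "qfactor a * qfactor (- a) = ((1 - fps_const a * fps_X) * Abs_fps (\<lambda>k. a ^ k))
      * ((1 - fps_const (- a) * fps_X) * Abs_fps (\<lambda>k. (- a) ^ k))"
    unfolding qfactor_def e by (simp add: mult_ac)
  thus ?thesis by (simp only: geometric_fps mult_1)
qed

text \<open>\<open>(1 + a u) / (1 - a u) = 2 / (1 - a u) - 1\<close> is 1 modulo 2, which is why the
  \<open>Qfun k\<close> with \<open>k \<ge> 1\<close> can be halved.\<close>

lemma qfactor_conv: "qfactor a = 1 + 2 * (Abs_fps (\<lambda>k. a ^ k) - 1)"
proof -
  have "2 * (1 :: 'a fps) = 1 + 1" by simp
  have "qfactor a = (2 - (1 - fps_const a * fps_X)) * Abs_fps (\<lambda>k. a ^ k)"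
    by (simp add: qfactor_def algebra_simps)
  also have "\<dots> = 2 * Abs_fps (\<lambda>k. a ^ k) - 1"
    by (subst left_diff_distrib) (simp only: geometric_fps)
  finally show ?thesis by (simp add: algebra_simps)
qed

lemma eval_Qfun: "ring_hom_fun h \<Longrightarrow> h (Qfun k N) = fps_nth (\<Prod>i = 1..N. qfactor (h (Var (X i)))) k"
proof -
  assume h: "ring_hom_fun h"
  have q: "fps_map_coeffs h (qfactor a) = qfactor (h a)" for a
  proof -
    have "fps_map_coeffs h (1 + fps_const a * fps_X) = 1 + fps_const (h a) * fps_X"
      by (rule fps_ext) (auto simp: fps_map_coeffs_def ring_hom_fun_add[OF h] ring_hom_fun_0[OF h]
          ring_hom_fun_1[OF h] fps_X_mult_right_nth fps_X_def)
    moreover have "fps_map_coeffs h (Abs_fps (\<lambda>k. a ^ k)) = Abs_fps (\<lambda>k. h a ^ k)"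
      by (rule fps_ext) (simp add: fps_map_coeffs_def ring_hom_fun_power[OF h])
    ultimately show ?thesis
      unfolding qfactor_def by (simp add: ring_hom_fun_mult[OF ring_hom_fps_map_coeffs[OF h]])
  qed
  have "h (Qfun k N) = fps_nth (fps_map_coeffs h (\<Prod>i = 1..N. qfactor (Var (X i)))) k"
    by (simp add: fps_map_coeffs_def Qfun_def Qgen_def qfactor_def)
  also have "\<dots> = fps_nth (\<Prod>i = 1..N. qfactor (h (Var (X i)))) k"
    by (simp add: ring_hom_fun_prod[OF ring_hom_fps_map_coeffs[OF h]] q)
  finally show ?thesis .
qed

lemma xeval_Qfun: "xeval \<tau> \<zeta> \<xi> (Qfun k) = fps_nth (prod_list (map qfactor \<xi>)) k"
proof -
  have "(\<Prod>i = 1..length \<xi>. qfactor (point \<tau> \<zeta> \<xi> (X i))) = (\<Prod>i = 1..length \<xi>. qfactor (\<xi> ! (i - 1)))"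
    by (rule prod.cong) (auto simp: point_def)
  also have "\<dots> = (\<Prod>i<length \<xi>. qfactor (\<xi> ! i))"
    by (rule prod.reindex_bij_witness[of _ Suc "\<lambda>i. i - 1"]) auto
  also have "\<dots> = prod_list (map qfactor \<xi>)"
    by (simp add: prod.list_conv_set_nth atLeast0LessThan)
  finally show ?thesis
    using eval_Qfun[OF ring_hom_eval, of "point \<tau> \<zeta> \<xi>" k "length \<xi>"] by (simp add: xeval_def)
qed

lemma degree_fps_prod:
  fixes F :: "nat \<Rightarrow> 'a::comm_ring_1 poly fps"
  assumes "\<And>i n. i \<in> A \<Longrightarrow> degree (fps_nth (F i) n) \<le> n"
  shows "degree (fps_nth (\<Prod>i\<in>A. F i) n) \<le> n"
  using assms
proof (induction A arbitrary: n rule: infinite_finite_induct)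
  case (insert x A)
  have "degree (\<Sum>i = 0..n. fps_nth (F x) i * fps_nth (prod F A) (n - i)) \<le> n"
  proof (rule degree_sum_le)
    fix i assume i: "i \<in> {0..n}"
    have "degree (fps_nth (F x) i) \<le> i" "degree (fps_nth (prod F A) (n - i)) \<le> n - i"
      using insert by auto
    thus "degree (fps_nth (F x) i * fps_nth (prod F A) (n - i)) \<le> n"
      using degree_mult_le[of "fps_nth (F x) i" "fps_nth (prod F A) (n - i)"] i by simp
  qed simp
  thus ?case using insert by (simp add: fps_mult_nth)
qed auto

lemma good_Qfun: "good (Qfun k)"
proof -
  have fv: "involves_only (allowed 0 N) (Qfun k N)" for N
  proof -
    let ?h = "eval_mpoly (\<lambda>v. if v \<in> allowed 0 N then Var v else 0)"
    have "?h (Qfun k N) = fps_nth (\<Prod>i = 1..N. qfactor (?h (Var (X i)))) k"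
      by (rule eval_Qfun[OF ring_hom_eval])
    also have "(\<Prod>i = 1..N. qfactor (?h (Var (X i)))) = (\<Prod>i = 1..N. qfactor (Var (X i)))"
      by (rule prod.cong) (auto simp: allowed_def)
    finally show ?thesis by (simp add: involves_only_def Qfun_def Qgen_def qfactor_def)
  qed
  \<comment> \<open>After scaling, the coefficient of \<open>u^n\<close> in each factor has degree
    at most \<open>n\<close>, a property that is stable under products of series. The bound is
    independent of \<open>N\<close>.\<close>
  have deg: "total_degree (Qfun k N) \<le> k" for N
  proof -
    have "degree (fps_nth (qfactor [:0, Var (X i):]) n) \<le> n" for i n
    proof -
      have p: "degree ([:0, Var (X i):] ^ m) \<le> m" for m
        using degree_power_le[of "[:0, Var (X i):]" m] by simp
      have "fps_nth (qfactor [:0, Var (X i):]) n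
          = [:0, Var (X i):] ^ n + (if n = 0 then 0 else [:0, Var (X i):] * [:0, Var (X i):] ^ (n - 1))"
        unfolding qfactor_def distrib_right
        by (cases n) (auto simp: mult.assoc fps_X_mult_nth simp del: mult_pCons_left)
      also have "\<dots> = [:0, Var (X i):] ^ n + (if n = 0 then 0 else [:0, Var (X i):] ^ n)"
        by (cases n) (auto simp del: mult_pCons_left)
      also have "degree \<dots> \<le> n"
        by (rule degree_add_le) (use p in auto)
      finally show ?thesis .
    qed
    hence "degree (fps_nth (\<Prod>i = 1..N. qfactor [:0, Var (X i):]) k) \<le> k"
      by (rule degree_fps_prod)
    thus ?thesis
      using eval_Qfun[OF ring_hom_eval, of "\<lambda>v. [:0, Var v:]" k N]
      by (simp add: total_degree_def scale_poly_def)
  qed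
  have perm: "prod_list (map qfactor \<xi>) = prod_list (map qfactor \<xi>')" if "mset \<xi> = mset \<xi>'" for \<xi> \<xi>' :: "mpoly list"
    using that by (metis mset_map prod_mset_prod_list)
  have cancel: "qfactor a * (qfactor (- a) * F) = F" for a :: mpoly and F
    by (simp add: qfactor_cancel flip: mult.assoc)
  have "supersymmetric (Qfun k)"
    unfolding supersymmetric_def xeval_Qfun
    by (intro conjI allI impI, erule perm[THEN arg_cong], simp_all only: list.map prod_list.Cons qfactor_0 mult_1 cancel)
  with fv deg show ?thesis unfolding good_def finite_vars_def bounded_degree_def by blast
qed

lemma exact_quotient_eqI:
  fixes a f :: xfun
  assumes "a * g = f" "\<And>N. a N \<noteq> 0"
  shows "exact_quotient f a = g"
  unfolding exact_quotient_def
proof (rule the_equality)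
  show "a * g = f" by (rule assms(1))
  fix g' assume "a * g' = f"
  hence "a N * g' N = a N * g N" for N using assms(1) by (metis times_fun_apply)
  thus "g' = g" using assms(2) by auto
qed

lemma two_Pfun: "k \<ge> 1 \<Longrightarrow> 2 * Pfun k = Qfun k"
proof -
  assume k: "k \<ge> 1"
  \<comment> \<open>Series that are 1 modulo 2 are closed under multiplication.\<close>
  have "\<exists>R. (\<Prod>i\<in>A. qfactor (Var (X i))) = 1 + 2 * R" for A
  proof (induction A rule: infinite_finite_induct)
    case (insert x A)
    then obtain R where "(\<Prod>i\<in>A. qfactor (Var (X i))) = 1 + 2 * R" by blast
    moreover obtain R' where "qfactor (Var (X x)) = 1 + 2 * R'" using qfactor_conv by blast
    ultimately have "(\<Prod>i\<in>insert x A. qfactor (Var (X i))) = 1 + 2 * (R + R' + 2 * R * R')"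
      using insert by (simp add: algebra_simps)
    thus ?case by blast
  qed (auto intro: exI[of _ 0])
  hence "\<forall>N. \<exists>R. (\<Prod>i = 1..N. qfactor (Var (X i))) = 1 + 2 * R" by blast
  from choice[OF this] obtain R where R: "\<And>N. (\<Prod>i = 1..N. qfactor (Var (X i))) = 1 + 2 * R N"
    by blast
  have "2 * (\<lambda>N. fps_nth (R N) k) = Qfun k"
  proof
    fix N
    have "Qfun k N = fps_nth (1 + 2 * R N) k" unfolding Qfun_def Qgen_def qfactor_def[symmetric] R ..
    also have "\<dots> = 2 * fps_nth (R N) k"
    proof -
      have "fps_nth (2 * R N) k = 2 * fps_nth (R N) k" by (simp only: mult_2 fps_add_nth)
      thus ?thesis using k by simp
    qed
    finally show "(2 * (\<lambda>N. fps_nth (R N) k)) N = Qfun k N"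
      by (simp only: times_fun_apply numeral_fun_apply)
  qed
  moreover have "(2 :: xfun) N \<noteq> 0" for N by simp
  ultimately show ?thesis unfolding Pfun_def using exact_quotient_eqI[of 2 "\<lambda>N. fps_nth (R N) k" "Qfun k"] by metis
qed

lemma good_Pfun: "k \<ge> 1 \<Longrightarrow> good (Pfun k)"
proof (rule good_divide[OF good_Qfun, of 2 _ _ 0])
  assume "k \<ge> 1"
  have "(\<lambda>N. 2) = (2 :: xfun)" by (auto simp: fun_eq_iff)
  thus "(\<lambda>N. 2) * Pfun k = Qfun k" using two_Pfun[OF \<open>k \<ge> 1\<close>] by simp
  show "involves_only (allowed 0 0) 2" unfolding involves_only_def by (rule eval_numeral)
qed simp

lemma good_Rring: "f \<in> Rring ty \<Longrightarrow> good f"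
proof -
  have "good f" if "f \<in> subring_generated G" "\<And>g. g \<in> G \<Longrightarrow> good g" for G
    using that(1) by induction (fact good_1, fact that(2), (rule good_diff good_mult; assumption)+)
  note * = this
  assume f: "f \<in> Rring ty"
  show "good f"
  proof (cases ty)
    case TypeC
    show ?thesis by (rule *[OF f[unfolded TypeC Rring.simps]]) (auto simp: good_t_var good_z_var good_Qfun)
  next
    case TypeD
    show ?thesis by (rule *[OF f[unfolded TypeD Rring.simps]]) (auto simp: good_t_var good_z_var good_Pfun)
  qed
qed

section \<open>Divided differences\<close>

text \<open>In type C the root \<open>2 t\<^sub>1\<close> is replaced by \<open>t\<^sub>1\<close>, which divides \<open>f - s\<^sub>0 f\<close> also for f in \<open>\<Gamma>'\<close>.\<close>

fun root_t :: "node \<Rightarrow> mpoly" where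
  "root_t (Nd i) = (if i = 0 then Var (T 1) else Var (T (Suc i)) - Var (T i))"
| "root_t Hat1 = Var (T 1) + Var (T 2)"

text \<open>The image of \<open>root_t\<close> under \<open>omega\<close>.\<close>

fun root_z :: "node \<Rightarrow> mpoly" where
  "root_z (Nd i) = (if i = 0 then - Var (Z 1) else Var (Z i) - Var (Z (Suc i)))"
| "root_z Hat1 = - (Var (Z 1) + Var (Z 2))"

lemma Var_add_neq_0: "Var v + Var w \<noteq> 0"
proof
  assume "Var v + Var w = 0"
  hence "eval_mpoly (\<lambda>_. 1 :: int) (Var v + Var w) = eval_mpoly (\<lambda>_. 1) 0" by (rule arg_cong)
  thus False by simp
qed

lemma root_t_neq_0 [simp]: "root_t i \<noteq> 0"
  by (cases i) (simp_all add: Var_add_neq_0)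

lemma root_z_neq_0 [simp]: "root_z i \<noteq> 0"
proof (cases i)
  case Hat1
  show ?thesis unfolding Hat1 root_z.simps neg_equal_0_iff_equal by (rule Var_add_neq_0)
qed simp

lemma simple_refl_0_pos: "k > 0 \<Longrightarrow> simple_refl (Nd 0) k = (if k = 1 then - 1 else k)"
  by (auto simp: simple_refl_nat_def)

lemma simple_refl_Hat1_pos:
  "k > 0 \<Longrightarrow> simple_refl Hat1 k = (if k = 1 then - 2 else if k = 2 then - 1 else k)"
proof -
  assume "k > 0"
  hence "k = 1 \<or> k = 2 \<or> k > 2" by auto
  thus ?thesis
    by (elim disjE) (simp_all add: simple_refl_nat_def transpose_def nat_eq_iff)
qed

text \<open>By the factor theorem it suffices that \<open>f\<close> and \<open>act_t i f\<close>
  agree where the root vanishes. There the reflected parameters coincide with the original ones, and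
  the inserted values are 0 or an opposite pair, which supersymmetry removes.\<close>

lemma act_t_dvd:
  assumes "good f"
  shows "root_t i dvd (f - act_t i f) N"
proof -
  have fv: "finite_vars f" "finite_vars (act_t i f)"
    using assms good_act_t by (auto simp: good_def)
  have e: "(f - act_t i f) N = xeval gen_T gen_Z (gen_X N) f
      - xeval (gen_T \<circ> simple_refl i) gen_Z (inserted i (\<lambda>k. - gen_T k) @ gen_X N) f"
    using xeval_generic[OF fv(1), of N] xeval_generic[OF fv(2), of N] by (simp add: xeval_act_t)
  \<comment> \<open>The root is \<open>Var v - q\<close>: it vanishes for
    \<open>t_(j+1) = t_j\<close>, for \<open>t_1 = 0\<close> if the node is \<open>Nd 0\<close>, and
    for \<open>t_2 = - t_1\<close> if it is \<open>Hat1\<close>.\<close>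
  define v q where "v = (case i of Hat1 \<Rightarrow> T 2 | Nd j \<Rightarrow> T (Suc j))"
    and "q = (case i of Hat1 \<Rightarrow> - Var (T 1) | Nd j \<Rightarrow> if j = 0 then 0 else Var (T j))"
  let ?h = "eval_mpoly (Var(v := q))"
  have "?h ((f - act_t i f) N) = 0"
  proof -
    have X: "map ?h (gen_X N) = gen_X N"
      by (auto simp: gen_X_def v_def split: node.split)
    have Z: "?h (gen_Z k) = gen_Z k" for k
      by (auto simp: gen_Z_def v_def split: node.split)
    have T: "?h (gen_T (simple_refl i k)) = ?h (gen_T k)" if "k > 0" for k
    proof (cases i)
      case (Nd j)
      hence vq: "v = T (Suc j)" "q = (if j = 0 then 0 else Var (T j))" by (simp_all add: v_def q_def)
      show ?thesis
      proof (cases "j = 0") 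
        case True
        show ?thesis unfolding Nd vq True simple_refl_0_pos[OF that]
          using that by (cases "k = 1") (simp_all add: gen_T_def nat_eq_iff)
      next
        case False
        define n where "n = nat k"
        have n: "k = int n" using that by (simp add: n_def)
        have "n \<ge> 1" "transpose j (Suc j) n \<ge> 1" using n that False by (auto simp: transpose_def)
        thus ?thesis using False unfolding Nd vq n
          by (simp add: simple_refl_nat_int) (auto simp: transpose_def)
      qed
    next
      case Hat1
      hence vq: "v = T 2" "q = - Var (T 1)" by (simp_all add: v_def q_def)
      show ?thesis unfolding Hat1 vq simple_refl_Hat1_pos[OF that]
        using that by (cases "k = 1"; cases "k = 2"; simp add: gen_T_def nat_eq_iff)
    qed
    have ins: "xeval \<tau> \<zeta> (map ?h (inserted i (\<lambda>k. - gen_T k)) @ \<xi>) f = xeval \<tau> \<zeta> \<xi> f"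
      for \<tau> \<zeta> and \<xi> :: "mpoly list"
    proof (cases i)
      case (Nd j)
      hence "v = T (Suc j)" "q = (if j = 0 then 0 else Var (T j))" by (simp_all add: v_def q_def)
      hence "map ?h (inserted i (\<lambda>k. - gen_T k)) = (if j = 0 then [0] else [])" using Nd by simp
      thus ?thesis by (simp add: xeval_zero[OF assms])
    next
      case Hat1
      hence "v = T 2" "q = - Var (T 1)" by (simp_all add: v_def q_def)
      hence "map ?h (inserted i (\<lambda>k. - gen_T k)) = [Var (T 1), - Var (T 1)]" using Hat1 by simp
      thus ?thesis using xeval_cancel[OF assms, of \<tau> \<zeta> "Var (T 1)"] by simp
    qed
    show ?thesis unfolding e
      by (simp add: ring_hom_fun_diff[OF ring_hom_eval] xeval_hom[OF ring_hom_eval] X Z ins)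
         (rule xeval_cong[OF fv(1)], use T in auto)
  qed
  hence "(Var v - q) dvd (f - act_t i f) N" by (rule Var_diff_dvd)
  moreover have "Var v - q = root_t i" by (auto simp: v_def q_def split: node.split)
  ultimately show ?thesis by simp
qed

text \<open>The argument given for t, with \<open>root_z i\<close> equal to
  \<open>q - Var v\<close>, so that a sign enters at the end.\<close>

lemma act_z_dvd:
  assumes "good f"
  shows "root_z i dvd (f - act_z i f) N"
proof -
  have fv: "finite_vars f" "finite_vars (act_z i f)"
    using assms good_act_z by (auto simp: good_def)
  have e: "(f - act_z i f) N = xeval gen_T gen_Z (gen_X N) f
      - xeval gen_T (gen_Z \<circ> simple_refl i) (inserted i gen_Z @ gen_X N) f"
    using xeval_generic[OF fv(1), of N] xeval_generic[OF fv(2), of N] by (simp add: xeval_act_z)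
  define v q where "v = (case i of Hat1 \<Rightarrow> Z 2 | Nd j \<Rightarrow> Z (Suc j))"
    and "q = (case i of Hat1 \<Rightarrow> - Var (Z 1) | Nd j \<Rightarrow> if j = 0 then 0 else Var (Z j))"
  let ?h = "eval_mpoly (Var(v := q))"
  have "?h ((f - act_z i f) N) = 0"
  proof -
    have X: "map ?h (gen_X N) = gen_X N"
      by (auto simp: gen_X_def v_def split: node.split)
    have Z: "?h (gen_T k) = gen_T k" for k
      by (auto simp: gen_T_def v_def split: node.split)
    have T: "?h (gen_Z (simple_refl i k)) = ?h (gen_Z k)" if "k > 0" for k
    proof (cases i)
      case (Nd j)
      hence vq: "v = Z (Suc j)" "q = (if j = 0 then 0 else Var (Z j))" by (simp_all add: v_def q_def)
      show ?thesis
      proof (cases "j = 0") 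
        case True
        show ?thesis unfolding Nd vq True simple_refl_0_pos[OF that]
          using that by (cases "k = 1") (simp_all add: gen_Z_def nat_eq_iff)
      next
        case False
        define n where "n = nat k"
        have n: "k = int n" using that by (simp add: n_def)
        have "n \<ge> 1" "transpose j (Suc j) n \<ge> 1" using n that False by (auto simp: transpose_def)
        thus ?thesis using False unfolding Nd vq n
          by (simp add: simple_refl_nat_int) (auto simp: transpose_def)
      qed
    next
      case Hat1
      hence vq: "v = Z 2" "q = - Var (Z 1)" by (simp_all add: v_def q_def)
      show ?thesis unfolding Hat1 vq simple_refl_Hat1_pos[OF that]
        using that by (cases "k = 1"; cases "k = 2"; simp add: gen_Z_def nat_eq_iff)
    qed
    have ins: "xeval \<tau> \<zeta> (map ?h (inserted i gen_Z) @ \<xi>) f = xeval \<tau> \<zeta> \<xi> f"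
      for \<tau> \<zeta> and \<xi> :: "mpoly list"
    proof (cases i)
      case (Nd j)
      hence "v = Z (Suc j)" "q = (if j = 0 then 0 else Var (Z j))" by (simp_all add: v_def q_def)
      hence "map ?h (inserted i gen_Z) = (if j = 0 then [0] else [])" using Nd by simp
      thus ?thesis by (simp add: xeval_zero[OF assms])
    next
      case Hat1
      hence "v = Z 2" "q = - Var (Z 1)" by (simp_all add: v_def q_def)
      hence "map ?h (inserted i gen_Z) = [- Var (Z 1), - (- Var (Z 1))]" using Hat1 by simp
      thus ?thesis using xeval_cancel[OF assms, of \<tau> \<zeta> "- Var (Z 1)"] by simp
    qed
    show ?thesis unfolding e
      by (simp add: ring_hom_fun_diff[OF ring_hom_eval] xeval_hom[OF ring_hom_eval] X Z ins)
         (rule xeval_cong[OF fv(1)], use T in auto)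
  qed
  hence "(Var v - q) dvd (f - act_z i f) N" by (rule Var_diff_dvd)
  moreover have "root_z i = - (Var v - q)" by (auto simp: v_def q_def split: node.split)
  ultimately show ?thesis by (simp only: minus_dvd_iff)
qed

lemma involves_only_root:
  "\<exists>K. involves_only (allowed K 0) (root_t i)" "\<exists>K. involves_only (allowed K 0) (root_z i)"
proof -
  let ?K = "case i of Hat1 \<Rightarrow> 2 | Nd j \<Rightarrow> Suc j"
  have "involves_only (allowed ?K 0) (root_t i)" "involves_only (allowed ?K 0) (root_z i)"
    by (auto simp: allowed_def split: node.split
        intro!: involves_only_diff involves_only_add involves_only_uminus)
  thus "\<exists>K. involves_only (allowed K 0) (root_t i)" "\<exists>K. involves_only (allowed K 0) (root_z i)" by blast+
qed

text \<open>The divided difference with respect to \<open>root_z\<close>, available on the whole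
  ambient ring; \<open>diff_z\<close> divides by \<open>omega (simple_root i)\<close>, which has a
  further factor 2 for \<open>Nd 0\<close>.\<close>

definition div_diff_z :: "node \<Rightarrow> xfun \<Rightarrow> xfun" where
  "div_diff_z i f = (SOME g. (\<lambda>N. root_z i) * g = f - act_z i f)"

lemma div_diff_z:
  assumes "good f"
  shows "(\<lambda>N. root_z i) * div_diff_z i f = f - act_z i f" "good (div_diff_z i f)"
proof -
  have "\<forall>N. \<exists>q. root_z i * q = (f - act_z i f) N"
  proof
    fix N
    obtain q where "(f - act_z i f) N = root_z i * q" using act_z_dvd[OF assms] by (rule dvdE)
    thus "\<exists>q. root_z i * q = (f - act_z i f) N" by (intro exI[of _ q]) (rule sym)
  qed
  from choice[OF this] obtain g where g: "\<And>N. root_z i * g N = (f - act_z i f) N" by blast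
  have "\<exists>g. (\<lambda>N. root_z i) * g = f - act_z i f"
    by (rule exI[of _ g], rule ext) (simp only: times_fun_apply g)
  thus e: "(\<lambda>N. root_z i) * div_diff_z i f = f - act_z i f"
    unfolding div_diff_z_def by (rule someI_ex)
  obtain K where "involves_only (allowed K 0) (root_z i)" using involves_only_root by blast
  thus "good (div_diff_z i f)"
    using good_divide[OF good_diff[OF assms good_act_z[OF assms]] e root_z_neq_0] by blast
qed

lemma root_cancel:
  fixes g g' :: xfun
  shows "(\<lambda>N. root_t i) * g = (\<lambda>N. root_t i) * g' \<Longrightarrow> g = g'"
  "(\<lambda>N. root_z i) * g = (\<lambda>N. root_z i) * g' \<Longrightarrow> g = g'"
proof -
  have *: "g = g'" if "(\<lambda>N. a) * g = (\<lambda>N. a) * g'" "a \<noteq> 0" for a and g g' :: xfun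
  proof
    fix N
    have "a * g N = a * g' N" using that(1) by (metis times_fun_apply)
    thus "g N = g' N" using that(2) by simp
  qed
  show "g = g'" if "(\<lambda>N. root_t i) * g = (\<lambda>N. root_t i) * g'"
    using *[OF that] by simp
  show "g = g'" if "(\<lambda>N. root_z i) * g = (\<lambda>N. root_z i) * g'"
    using *[OF that] by simp
qed

section \<open>Divisibility in the ring of double Schubert polynomials\<close>

text \<open>The quotient of \<open>simple_root i\<close> by \<open>root_t i\<close>; the 2 is that
  of \<open>2 t_1\<close>.\<close>

definition root_factor :: "node \<Rightarrow> mpoly" where
  "root_factor i = (if i = Nd 0 then 2 else 1)"

lemma root_factor_neq_0 [simp]: "root_factor i \<noteq> 0"
  by (simp add: root_factor_def)

lemma simple_root_conv: "simple_root i = (\<lambda>N. root_factor i * root_t i)"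
  by (cases i) (auto simp: fun_eq_iff t_var_def root_factor_def)

lemma omega_simple_root_conv: "omega (simple_root i) = (\<lambda>N. root_factor i * root_z i)"
  by (cases i) (auto simp: fun_eq_iff t_var_def root_factor_def omega_def subst_eq_eval)

lemma act_t_2 [simp]: "act_t i 2 = 2" and act_z_2 [simp]: "act_z i 2 = 2"
  using act_t_ring(1)[of i 1 1] act_z_ring(1)[of i 1 1] by (simp_all only: one_add_one act_t_ring act_z_ring)

lemma act_t_dvd_xfun: "good f \<Longrightarrow> (\<lambda>N. root_t i) dvd f - act_t i f"
proof -
  assume f: "good f"
  have "\<forall>N. \<exists>q. (f - act_t i f) N = root_t i * q"
  proof
    fix N
    show "\<exists>q. (f - act_t i f) N = root_t i * q"
      using act_t_dvd[OF f, of i N] unfolding dvd_def .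
  qed
  from choice[OF this] obtain g where g: "\<And>N. (f - act_t i f) N = root_t i * g N" by blast
  show ?thesis by (rule dvdI[of _ _ g], rule ext) (simp only: times_fun_apply g)
qed

lemma act_z_dvd_xfun: "good f \<Longrightarrow> (\<lambda>N. root_z i) dvd f - act_z i f"
  using div_diff_z(1)[of f i] by (metis dvd_triv_left)

text \<open>The twisted Leibniz rule \<open>f g - s (f g) = (f - s f) g + s f (g - s g)\<close>
  reduces divisibility to the generators.\<close>

lemma dvd_subring_generated:
  fixes a :: xfun
  assumes "f \<in> subring_generated G" "\<And>g. g \<in> G \<Longrightarrow> a dvd g - s g"
    "s 1 = 1" "\<And>f g. s (f - g) = s f - s g" "\<And>f g. s (f * g) = s f * s g"
  shows "a dvd f - s f"
  using assms(1)
proof induction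
  case 1
  have "(1::xfun) - s 1 = 0" by (simp only: assms(3) diff_self)
  thus ?case by (simp only: dvd_0_right)
next
  case (2 g)
  thus ?case by (rule assms(2))
next
  case (3 f g)
  have "f - g - s (f - g) = (f - s f) - (g - s g)" unfolding assms(4) by (simp only: algebra_simps)
  thus ?case using 3 by (metis dvd_diff)
next
  case (4 f g)
  have "f * g - s (f * g) = (f - s f) * g + s f * (g - s g)" unfolding assms(5) by (simp only: algebra_simps)
  thus ?case using 4 by (metis dvd_add dvd_mult dvd_mult2)
qed

text \<open>Makes \<open>diff_t\<close> and \<open>diff_z\<close> genuine quotients. Beyond
  divisibility by \<open>root_t\<close> and \<open>root_z\<close> only the factor 2 of
  \<open>Nd 0\<close> is at stake. This node belongs to type C, where
  \<open>Qfun k = 2 * Pfun k\<close>, and where \<open>t_1\<close> and \<open>z_1\<close> change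
  sign.\<close>

lemma Rring_dvd:
  assumes "f \<in> Rring ty" "i \<in> nodes ty"
  shows "simple_root i dvd f - act_t i f" "omega (simple_root i) dvd f - act_z i f"
proof -
  have "simple_root i dvd f - act_t i f \<and> omega (simple_root i) dvd f - act_z i f"
  proof (cases "i = Nd 0")
    case False
    have "omega (simple_root i) = (\<lambda>N. root_z i)"
      unfolding omega_simple_root_conv using False by (simp add: root_factor_def)
    moreover have "simple_root i = (\<lambda>N. root_t i)"
      using False by (simp add: simple_root_conv root_factor_def)
    ultimately
    show ?thesis
      using act_t_dvd_xfun[OF good_Rring[OF assms(1)]] act_z_dvd_xfun[OF good_Rring[OF assms(1)]] by simp
  next
    case True
    with assms(2) have ty: "ty = TypeC" by (cases ty) auto
    let ?G = "t_var ` {1..} \<union> z_var ` {1..} \<union> Qfun ` {1..}"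
    have f: "f \<in> subring_generated ?G" using assms(1) ty by simp
    have tz: "t_var k - act_t (Nd 0) (t_var k) = (if k = 1 then 2 * t_var 1 else 0)"
      "z_var k - act_z (Nd 0) (z_var k) = (if k = 1 then 2 * z_var 1 else 0)" for k
      by (auto simp: fun_eq_iff t_var_def z_var_def act_t_nat_def act_z_nat_def subst_eq_eval)
    have Q: "simple_root i dvd Qfun k - act_t i (Qfun k)"
      "omega (simple_root i) dvd Qfun k - act_z i (Qfun k)" if "k \<ge> 1" for k
    proof -
      have two: "(\<lambda>N. root_factor i * a) = 2 * (\<lambda>N. a)" for a
        by (auto simp: fun_eq_iff root_factor_def True)
      have "2 * Pfun k - act_t i (2 * Pfun k) = 2 * (Pfun k - act_t i (Pfun k))"
        "2 * Pfun k - act_z i (2 * Pfun k) = 2 * (Pfun k - act_z i (Pfun k))"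
        by (simp_all only: act_t_ring act_z_ring act_t_2 act_z_2 right_diff_distrib)
      thus "simple_root i dvd Qfun k - act_t i (Qfun k)"
        "omega (simple_root i) dvd Qfun k - act_z i (Qfun k)"
        unfolding two_Pfun[OF that] omega_simple_root_conv unfolding simple_root_conv two
        using act_t_dvd_xfun[OF good_Pfun[OF that]] act_z_dvd_xfun[OF good_Pfun[OF that]]
        by (simp_all only: mult_dvd_mono dvd_refl)
    qed
    have "simple_root i dvd g - act_t i g" if "g \<in> ?G" for g
    proof -
      have r: "simple_root i = 2 * t_var 1" using True by simp
      from that consider k where "g = t_var k" | k where "g = z_var k" | k where "g = Qfun k" "k \<ge> 1" by auto
      thus ?thesis
      proof cases
        case (1 k)
        show ?thesis unfolding r 1 unfolding True tz by simp
      next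
        case (2 k)
        show ?thesis unfolding 2 act_t_z_var by simp
      qed (use Q in auto)
    qed
    moreover have "omega (simple_root i) dvd g - act_z i g" if "g \<in> ?G" for g
    proof -
      have r: "omega (simple_root i) = - (2 * z_var 1)"
        unfolding omega_simple_root_conv using True by (auto simp: fun_eq_iff root_factor_def z_var_def)
      from that consider k where "g = t_var k" | k where "g = z_var k" | k where "g = Qfun k" "k \<ge> 1" by auto
      thus ?thesis
      proof cases
        case (2 k)
        show ?thesis unfolding r 2 unfolding True tz
          by (simp only: minus_dvd_iff dvd_refl dvd_0_right split: if_split) simp
      next
        case (1 k)
        show ?thesis unfolding 1 act_z_t_var by simp
      qed (use Q in auto)
    qed
    ultimately show ?thesis
      using dvd_subring_generated[OF f, of "simple_root i" "act_t i"]
        dvd_subring_generated[OF f, of "omega (simple_root i)" "act_z i"] by simp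
  qed
  thus "simple_root i dvd f - act_t i f" "omega (simple_root i) dvd f - act_z i f" by blast+
qed

lemma exact_quotient_dvd:
  fixes a f :: xfun
  assumes "a dvd f" "\<And>N. a N \<noteq> 0"
  shows "a * exact_quotient f a = f"
proof -
  obtain g where "f = a * g" using assms(1) by (rule dvdE)
  thus ?thesis using exact_quotient_eqI[of a g f] assms(2) by simp
qed

lemma diff_t_mult:
  assumes "f \<in> Rring ty" "i \<in> nodes ty"
  shows "simple_root i * diff_t i f = f - act_t i f"
  unfolding diff_t_def by (rule exact_quotient_dvd) (use assms Rring_dvd in \<open>auto simp: simple_root_conv\<close>)

lemma diff_z_mult:
  assumes "f \<in> Rring ty" "i \<in> nodes ty"
  shows "omega (simple_root i) * diff_z i f = f - act_z i f"
  unfolding diff_z_def by (rule exact_quotient_dvd) (use assms Rring_dvd in \<open>auto simp: omega_simple_root_conv\<close>)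

section \<open>Invariants\<close>

definition rename_T :: "(nat \<Rightarrow> nat) \<Rightarrow> mpoly \<Rightarrow> mpoly" where
  "rename_T \<pi> = eval_mpoly (\<lambda>v. case v of T k \<Rightarrow> Var (T (\<pi> k)) | _ \<Rightarrow> Var v)"

lemma rename_T_comp: "rename_T \<pi> (rename_T \<sigma> p) = rename_T (\<pi> \<circ> \<sigma>) p"
  unfolding rename_T_def eval_eval
  by (rule arg_cong[where f = "\<lambda>r. eval_mpoly r p"]) (auto simp: fun_eq_iff split: var.split)

lemma rename_T_id: "rename_T (\<lambda>k. k) p = p"
proof -
  have "(\<lambda>v. case v of T k \<Rightarrow> Var (T k) | _ \<Rightarrow> Var v) = Var"
    by (auto simp: fun_eq_iff split: var.split)
  thus ?thesis by (simp add: rename_T_def eval_id)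
qed

text \<open>The transposition of \<open>k\<close> and \<open>k + m + 1\<close> is that of
  \<open>k\<close> and \<open>k + m\<close> conjugated by an adjacent one.\<close>

lemma rename_T_transpose:
  assumes "\<And>i. i \<ge> 1 \<Longrightarrow> rename_T (transpose i (Suc i)) p = p" "k \<ge> 1"
  shows "rename_T (transpose k (k + m)) p = p"
proof (induction m)
  case 0
  show ?case by (simp add: rename_T_id id_def)
next
  case (Suc m)
  show ?case
  proof (cases "m = 0")
    case True
    thus ?thesis using assms by simp
  next
    case False
    let ?s = "transpose (k + m) (Suc (k + m))"
    have "transpose k (k + Suc m) = ?s \<circ> (transpose k (k + m) \<circ> ?s)"
      using False by (auto simp: fun_eq_iff transpose_def)
    thus ?thesis using Suc assms by (simp only: rename_T_comp[symmetric])
  qed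
qed

text \<open>A symmetric polynomial in infinitely many variables is constant in them:
  \<open>T k\<close> can be exchanged with \<open>T (k + K)\<close>, which lies beyond all t that
  occur, without changing \<open>p\<close>; so \<open>T k\<close> does not occur.\<close>

lemma symmetric_imp_T_free:
  assumes sym: "\<And>i. i \<ge> 1 \<Longrightarrow> rename_T (transpose i (Suc i)) p = p"
    and A: "involves_only A p" "A \<inter> range T \<subseteq> T ` {1..K}"
  shows "involves_only (A - range T) p"
proof -
  have one: "involves_only (- {T k}) p" if k: "k \<in> {1..K}" for k
  proof -
    have "involves_only (- {T k}) (rename_T (transpose k (k + K)) p)"
      unfolding rename_T_def
    proof (rule involves_only_eval[OF A(1)])
      fix v assume v: "v \<in> A"
      show "involves_only (- {T k}) (case v of T j \<Rightarrow> Var (T (transpose k (k + K) j)) | _ \<Rightarrow> Var v)"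
      proof (cases v)
        case (T j)
        hence "j \<in> {1..K}" using v A(2) by auto
        thus ?thesis using k T by (auto simp: transpose_def)
      qed auto
    qed
    thus ?thesis using rename_T_transpose[OF sym] k by simp
  qed
  have "involves_only (A - T ` {1..L}) p" if "L \<le> K" for L
    using that
  proof (induction L)
    case (Suc L)
    have "involves_only ((A - T ` {1..L}) \<inter> (- {T (Suc L)})) p"
      using Suc one by (intro involves_only_Int) auto
    moreover have "(A - T ` {1..L}) \<inter> (- {T (Suc L)}) = A - T ` {1..Suc L}"
      by (auto simp: atLeastAtMostSuc_conv)
    ultimately show ?case by simp
  qed (use A in simp)
  from this[of K] have "involves_only (A - T ` {1..K}) p" by simp
  thus ?thesis by (rule involves_only_mono) (use A in auto)
qed

lemma good_invariant_eq_0: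
  assumes f: "good f" and inv: "\<And>i. i \<in> nodes ty \<Longrightarrow> act_t i f = f"
    and 0: "xeval gen_T gen_T [] f = 0"
  shows "f = 0"
proof -
  have fv: "finite_vars f" using f by (simp add: good_def)
  obtain K where K: "\<And>N. involves_only (allowed K N) (f N)" using fv by (auto simp: finite_vars_def)
  have "rename_T (transpose i (Suc i)) (f N) = f N" if "i \<ge> 1" for i N
  proof -
    have "Nd i \<in> nodes ty" using that by (cases ty) auto
    from inv[OF this] have "act_t_nat i f N = f N" by simp
    thus ?thesis using that by (simp add: act_t_nat_def rename_T_def subst_eq_eval)
  qed
  hence free: "involves_only (allowed K N - range T) (f N)" for N
    by (rule symmetric_imp_T_free[OF _ K, where K = K]) (auto simp: allowed_def)
  have eval_free: "xeval \<tau> gen_Z \<xi> f = xeval gen_T gen_Z \<xi> f" for \<tau> and \<xi> :: "mpoly list"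
    unfolding xeval_def by (rule eval_cong_involves[OF free]) (auto simp: point_def allowed_def)
  have all_eq: "xeval gen_T gen_Z \<xi> f = f 0" for \<xi>
  proof (cases ty)
    case TypeC
    have step: "xeval gen_T gen_Z (a # \<xi>) f = xeval gen_T gen_Z \<xi> f" for a and \<xi> :: "mpoly list"
    proof -
      \<comment> \<open>Chosen so that \<open>s_0\<close> inserts exactly
        \<open>- \<tau> 1 = a\<close>.\<close>
      define \<tau> where "\<tau> k = of_int (sgn k) * - a" for k :: int
      have "odd_fun \<tau>" by (simp add: odd_fun_def \<tau>_def sgn_minus)
      have "xeval \<tau> gen_Z \<xi> f = xeval \<tau> gen_Z \<xi> (act_t (Nd 0) f)" using inv[of "Nd 0"] TypeC by simp
      also have "\<dots> = xeval (\<tau> \<circ> simple_refl (Nd 0)) gen_Z (a # \<xi>) f"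
        using xeval_act_t[OF \<open>odd_fun \<tau>\<close>, of gen_Z \<xi> "Nd 0" f] by (simp add: \<tau>_def)
      finally show ?thesis using eval_free[of \<tau> \<xi>] eval_free[of "\<tau> \<circ> simple_refl (Nd 0)" "a # \<xi>"]
        by argo
    qed
    have "xeval gen_T gen_Z \<xi> f = xeval gen_T gen_Z [] f" by (induction \<xi>) (simp_all only: step)
    thus ?thesis using xeval_generic[OF fv, of 0] by (simp add: gen_X_def)
  next
    case TypeD
    have step: "xeval gen_T gen_Z (a # b # \<xi>) f = xeval gen_T gen_Z \<xi> f" for a b and \<xi> :: "mpoly list"
    proof -
      \<comment> \<open>Chosen so that \<open>Hat1\<close> inserts \<open>- \<tau> 2 = a\<close> and
        \<open>- \<tau> 1 = b\<close>.\<close>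
      define \<tau> where "\<tau> k = of_int (sgn k) * (if \<bar>k\<bar> = 1 then - b else - a)" for k :: int
      have "odd_fun \<tau>" by (simp add: odd_fun_def \<tau>_def sgn_minus)
      have "xeval \<tau> gen_Z \<xi> f = xeval \<tau> gen_Z \<xi> (act_t Hat1 f)" using inv[of Hat1] TypeD by simp
      also have "\<dots> = xeval (\<tau> \<circ> simple_refl Hat1) gen_Z (a # b # \<xi>) f"
        using xeval_act_t[OF \<open>odd_fun \<tau>\<close>, of gen_Z \<xi> Hat1 f] by (simp add: \<tau>_def)
      finally show ?thesis using eval_free[of \<tau> \<xi>] eval_free[of "\<tau> \<circ> simple_refl Hat1" "a # b # \<xi>"]
        by argo
    qed
    have "xeval gen_T gen_Z \<xi> f = xeval gen_T gen_Z [] f"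
    proof (induction \<xi> rule: induct_list012)
      case (2 x)
      \<comment> \<open>Values are dropped in pairs only, so a single one is first completed by a
        zero.\<close>
      have "xeval gen_T gen_Z [x] f = xeval gen_T gen_Z [0, x] f" by (rule xeval_zero[OF f, symmetric])
      thus ?case by (simp only: step)
    qed (simp_all only: step)
    thus ?thesis using xeval_generic[OF fv, of 0] by (simp add: gen_X_def)
  qed
  have const: "f N = f 0" for N
    using xeval_generic[OF fv, of N] all_eq by simp
  \<comment> \<open>Undoes the specialization \<open>z = t\<close> of a polynomial in z
    alone.\<close>
  define h where "h = eval_mpoly (\<lambda>v. case v of T k \<Rightarrow> Var (Z k) | _ \<Rightarrow> Var v)"
  have "h (xeval gen_T gen_T [] f) = eval_mpoly Var (f 0)"
    unfolding h_def xeval_def eval_eval list.size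
    by (rule eval_cong_involves[OF free]) (auto simp: point_def allowed_def)
  hence "f 0 = 0" using 0 by (simp add: eval_id h_def)
  hence "f N = 0 N" for N using const[of N] by simp
  thus ?thesis by (rule ext)
qed

text \<open>Every diagonal point is a specialization of the generic one.\<close>

lemma xeval_eq_0_transfer:
  assumes "finite_vars f" "xeval gen_T gen_T [] f = 0"
  shows "xeval \<tau> \<tau> [] f = 0"
proof -
  let ?h = "eval_mpoly (point \<tau> \<tau> [])"
  have "?h (xeval gen_T gen_T [] f) = xeval \<tau> \<tau> [] f"
    unfolding xeval_hom[OF ring_hom_eval] list.map
  proof (rule xeval_cong[OF assms(1)])
    fix k :: int assume "k > 0"
    hence "gen_T k = Var (T (nat k))" "int (nat k) = k" by (simp_all add: gen_T_def)
    thus "?h (gen_T k) = \<tau> k" "?h (gen_T k) = \<tau> k" by (simp_all add: point_def)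
  qed
  thus ?thesis using assms(2) by simp
qed


section \<open>A vanishing criterion\<close>

lemma root_xfun:
  "(\<lambda>N. root_t i) = (case i of Hat1 \<Rightarrow> t_var 1 + t_var 2 | Nd j \<Rightarrow> if j = 0 then t_var 1 else t_var (Suc j) - t_var j)"
  "(\<lambda>N. root_z i) = (case i of Hat1 \<Rightarrow> - (z_var 1 + z_var 2) | Nd j \<Rightarrow> if j = 0 then - z_var 1 else z_var j - z_var (Suc j))"
  by (cases i; auto simp: fun_eq_iff t_var_def z_var_def)+

lemma act_t_root_z: "act_t i (\<lambda>N. root_z j) = (\<lambda>N. root_z j)"
  unfolding root_xfun
  by (cases j; cases "j = Nd 0") (simp_all only: act_t_ring act_t_z_var node.case node.inject if_True if_False simp_thms)

lemma act_z_root_t: "act_z i (\<lambda>N. root_t j) = (\<lambda>N. root_t j)"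
  unfolding root_xfun
  by (cases j; cases "j = Nd 0") (simp_all only: act_z_ring act_z_t_var node.case node.inject if_True if_False simp_thms)

lemma good_foldr_act_t: "good f \<Longrightarrow> good (foldr act_t u f)"
  by (induction u) (auto simp: good_act_t)

lemma act_z_foldr_act_t: "good f \<Longrightarrow> act_z i (foldr act_t u f) = foldr act_t u (act_z i f)"
  by (induction u) (auto simp: act_z_act_t good_foldr_act_t)

lemma foldr_act_t_diff: "foldr act_t u (f - g) = foldr act_t u f - foldr act_t u g"
  by (induction u) (simp_all only: foldr.simps comp_apply id_apply act_t_ring)

lemma foldr_act_t_mult: "foldr act_t u (f * g) = foldr act_t u f * foldr act_t u g"
  by (induction u) (simp_all only: foldr.simps comp_apply id_apply act_t_ring)

lemma foldr_act_t_root_z: "foldr act_t u (\<lambda>N. root_z j) = (\<lambda>N. root_z j)"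
  by (induction u) (simp_all only: foldr.simps comp_apply id_apply act_t_root_z)

text \<open>\<open>g\<close> is at least \<open>l\<close> degrees below the bound \<open>d\<close>.
  The zero polynomial has degree 0 and needs its own disjunct; once \<open>l > d\<close> it is the
  only possibility left.\<close>

definition deg_room :: "nat \<Rightarrow> nat \<Rightarrow> xfun \<Rightarrow> bool" where
  "deg_room d l g \<longleftrightarrow> (\<forall>N. g N = 0 \<or> total_degree (g N) + l \<le> d)"

text \<open>\<open>s_0\<close> reads the component with one more x-variable, so it is a bound
  uniform in \<open>N\<close> that is preserved.\<close>

lemma deg_room_act_z_nat: "deg_room d l g \<Longrightarrow> deg_room d l (act_z_nat i g)"
  unfolding deg_room_def
proof
  fix N assume g: "\<forall>N. g N = 0 \<or> total_degree (g N) + l \<le> d"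
  let ?M = "if i = 0 then Suc N else N"
  have "total_degree (act_z_nat i g N) \<le> total_degree (g ?M)"
    unfolding act_z_nat_def subst_eq_eval
    by (auto intro!: total_degree_eval_le simp: insert_x_def split: var.split)
  moreover have "g ?M = 0 \<Longrightarrow> act_z_nat i g N = 0"
    by (auto simp: act_z_nat_def subst_eq_eval)
  moreover have "g ?M = 0 \<or> total_degree (g ?M) + l \<le> d" using g by blast
  ultimately show "act_z_nat i g N = 0 \<or> total_degree (act_z_nat i g N) + l \<le> d" by linarith
qed

lemma deg_room_act_z: "deg_room d l g \<Longrightarrow> deg_room d l (act_z i g)"
  by (cases i) (auto simp: deg_room_act_z_nat)

lemma total_degree_root_z: "total_degree (root_z i) = 1"
proof -
  have "scale_poly (root_z i) = [:0, root_z i:]" by (cases i) auto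
  thus ?thesis by (simp add: total_degree_def)
qed

lemma deg_room_div_diff_z:
  assumes "good g" "deg_room d l g"
  shows "deg_room d (Suc l) (div_diff_z i g)"
  unfolding deg_room_def
proof
  fix N
  let ?h = "div_diff_z i g N" and ?p = "g N - act_z i g N"
  have e: "root_z i * ?h = ?p"
    using fun_cong[OF div_diff_z(1)[OF assms(1), of i], of N] by simp
  show "?h = 0 \<or> total_degree ?h + Suc l \<le> d"
  proof (cases "?h = 0")
    case False
    have "total_degree ?p = Suc (total_degree ?h)"
      using total_degree_mult[OF root_z_neq_0 False, of i] e by (simp add: total_degree_root_z)
    moreover have "g N = 0 \<or> total_degree (g N) + l \<le> d"
      "act_z i g N = 0 \<or> total_degree (act_z i g N) + l \<le> d"
      using assms(2) deg_room_act_z[OF assms(2), of i] by (auto simp: deg_room_def)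
    moreover have "total_degree ?p \<le> max (total_degree (g N)) (total_degree (act_z i g N))"
      by (rule total_degree_diff_le)
    ultimately have "Suc (total_degree ?h) + l \<le> d" by (auto simp: max_def split: if_splits)
    thus ?thesis by simp
  qed simp
qed

lemma simple_refl_nat_involutory: "simple_refl_nat i (simple_refl_nat i k) = k"
proof (cases "i = 0")
  case False
  obtain n where "k = int n \<or> k = - int n" by (metis int_cases2)
  thus ?thesis using False by (auto simp: simple_refl_nat_int simple_refl_nat_uminus)
qed (auto simp: simple_refl_nat_def)

lemma simple_refl_involutory: "simple_refl i (simple_refl i k) = k"
  by (cases i) (auto simp: simple_refl_nat_involutory)

text \<open>Both sides take t at \<open>\<tau>\<close> and z at its reflection; the inserted values
  agree up to order because \<open>\<tau>\<close> is odd. On the diagonal this trades reflections in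
  z for reflections in t.\<close>

lemma xeval_diagonal_act:
  assumes "good f" "odd_fun \<tau>"
  shows "xeval \<tau> \<tau> [] (act_z i f) = xeval (\<tau> \<circ> simple_refl i) (\<tau> \<circ> simple_refl i) [] (act_t i f)"
proof -
  have inv: "\<tau> \<circ> simple_refl i \<circ> simple_refl i = \<tau>" by (auto simp: fun_eq_iff simple_refl_involutory)
  have ins: "mset (inserted i \<tau>) = mset (inserted i (\<lambda>k. - (\<tau> \<circ> simple_refl i) k))"
    using odd_fun_uminus[OF assms(2), of 1] odd_fun_uminus[OF assms(2), of 2]
    by (cases i) (auto simp: simple_refl_nat_def transpose_def)
  show ?thesis
    unfolding xeval_act_z[OF assms(2)] xeval_act_t[OF odd_fun_comp[OF assms(2)]] append_Nil2 inv
    by (rule xeval_mset[OF assms(1) ins])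
qed

lemma xeval_root_z_neq_0: "xeval gen_T gen_T [] (\<lambda>N. root_z k) \<noteq> 0"
proof (cases k)
  case (Nd j)
  show ?thesis
  proof (cases "j = 0")
    case True
    have "xeval gen_T gen_T [] (\<lambda>N. root_z k) = - Var (T 1)"
      unfolding root_xfun Nd True by (simp only: node.case if_True simp_thms xeval_ring xeval_z_var of_nat_1 gen_pos)
    thus ?thesis by (simp only: neg_equal_0_iff_equal Var_neq_0 not_False_eq_True)
  next
    case False
    hence "j \<ge> 1" by simp
    have "xeval gen_T gen_T [] (\<lambda>N. root_z k) = Var (T j) - Var (T (Suc j))"
      unfolding root_xfun Nd using False gen_pos(1)[OF \<open>j \<ge> 1\<close>] gen_pos(1)[of "Suc j"]
      by (simp only: node.case if_False xeval_ring xeval_z_var)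
    thus ?thesis by (simp only: right_minus_eq Var_eq_iff var.inject n_not_Suc_n not_False_eq_True)
  qed
next
  case Hat1
  have "xeval gen_T gen_T [] (\<lambda>N. root_z k) = - (Var (T 1) + Var (T 2))"
    unfolding root_xfun Hat1
    by (simp only: node.case xeval_ring xeval_z_var of_nat_1 of_nat_numeral gen_pos)
  thus ?thesis by (simp only: neg_equal_0_iff_equal Var_add_neq_0 not_False_eq_True)
qed

text \<open>The iterated differences \<open>?W u\<close> in z are treated for all words
  \<open>u\<close> together. They commute with the t-actions, so \<open>sym\<close> prolongs each
  word at the end next to \<open>D\<close>: \<open>?W u\<close> minus its t-reflection is a root
  times \<open>?W (u @ [j])\<close>. Hence vanishing of the longer words makes \<open>?W u\<close>
  invariant in t.\<close>

lemma vanishing_criterion: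
  assumes D: "good D" and fin: "fin \<subseteq> nodes ty"
    and rest: "\<And>i. i \<in> nodes ty - fin \<Longrightarrow> act_t i D = D"
    and sym: "\<And>i. i \<in> fin \<Longrightarrow> \<exists>j\<in>fin. (\<lambda>N. root_z j) * (D - act_t i D) = (\<lambda>N. root_t i) * (D - act_z j D)"
    and loc: "\<And>u. set u \<subseteq> fin \<Longrightarrow> xeval gen_T gen_T [] (foldr act_t u D) = 0"
  shows "D = 0"
proof -
  let ?W = "\<lambda>u. foldr div_diff_z u D"
  obtain d where d: "deg_room d 0 D"
    using D by (auto simp: good_def bounded_degree_def deg_room_def)
  have good: "good (?W u)" for u
    by (induction u) (auto simp: D div_diff_z(2))
  have room: "deg_room d (length u) (?W u)" for u
    by (induction u) (auto simp: d good deg_room_div_diff_z)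
  have dz_t: "div_diff_z k (act_t i g) = act_t i (div_diff_z k g)" if "good g" for k i g
  proof (rule root_cancel(2)[of k])
    show "(\<lambda>N. root_z k) * div_diff_z k (act_t i g) = (\<lambda>N. root_z k) * act_t i (div_diff_z k g)"
      using div_diff_z(1)[OF good_act_t[OF that], of k i]
        arg_cong[OF div_diff_z(1)[OF that, of k], of "act_t i"] act_z_act_t[OF that, of k i]
      by (simp only: act_t_ring act_t_root_z)
  qed
  have inv: "act_t i (?W u) = ?W u" if "i \<in> nodes ty - fin" for u i
  proof (induction u)
    case (Cons k u)
    have "act_t i (div_diff_z k (?W u)) = div_diff_z k (act_t i (?W u))"
      by (rule dz_t[OF good, symmetric])
    thus ?case by (simp only: Cons foldr.simps comp_apply)
  qed (use rest that in simp)
  have step: "\<exists>j\<in>fin. ?W u - act_t i (?W u) = (\<lambda>N. root_t i) * ?W (u @ [j])" if i: "i \<in> fin" for i u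
  proof -
    obtain j where j: "j \<in> fin"
      "(\<lambda>N. root_z j) * (D - act_t i D) = (\<lambda>N. root_t i) * (D - act_z j D)"
      using sym[OF i] by (elim bexE)
    have "?W u - act_t i (?W u) = (\<lambda>N. root_t i) * ?W (u @ [j])"
    proof (induction u)
      case Nil
      have "(\<lambda>N. root_z j) * (D - act_t i D) = (\<lambda>N. root_z j) * ((\<lambda>N. root_t i) * div_diff_z j D)"
        unfolding j(2) div_diff_z(1)[OF D, symmetric] by (simp only: mult.left_commute)
      from root_cancel(2)[OF this] show ?case by (simp only: foldr.simps comp_apply id_apply append_Nil)
    next
      case (Cons k u)
      let ?g = "?W u" and ?g' = "?W (u @ [j])"
      have "(\<lambda>N. root_z k) * (div_diff_z k ?g - act_t i (div_diff_z k ?g))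
          = (\<lambda>N. root_z k) * div_diff_z k ?g - act_t i ((\<lambda>N. root_z k) * div_diff_z k ?g)"
        by (simp only: act_t_ring act_t_root_z right_diff_distrib)
      also have "\<dots> = (?g - act_t i ?g) - act_z k (?g - act_t i ?g)"
        unfolding div_diff_z(1)[OF good] act_t_ring act_z_ring act_z_act_t[OF good]
        by (simp only: algebra_simps)
      also have "\<dots> = (\<lambda>N. root_t i) * (?g' - act_z k ?g')"
        unfolding Cons act_z_ring act_z_root_t by (simp only: right_diff_distrib)
      also have "\<dots> = (\<lambda>N. root_z k) * ((\<lambda>N. root_t i) * div_diff_z k ?g')"
        unfolding div_diff_z(1)[OF good, symmetric] by (simp only: mult.left_commute)
      finally have "div_diff_z k ?g - act_t i (div_diff_z k ?g) = (\<lambda>N. root_t i) * div_diff_z k ?g'"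
        by (rule root_cancel(2))
      thus ?case by (simp only: foldr.simps comp_apply append_Cons)
    qed
    thus ?thesis using j(1) by (rule bexI)
  qed
  \<comment> \<open>The root is nonzero on the diagonal, and the numerator of the localization of a
    difference consists of localizations of \<open>?W u\<close> at the words \<open>w\<close> and
    \<open>k # w\<close>.\<close>
  have zero: "xeval \<tau> \<tau> [] (foldr act_t w (?W u)) = 0" if "set u \<subseteq> fin" "set w \<subseteq> fin" for u w \<tau>
  proof -
    have "xeval gen_T gen_T [] (foldr act_t w (?W u)) = 0"
      using that
    proof (induction u arbitrary: w)
      case (Cons k u)
      let ?g = "?W u"
      have IH: "xeval \<tau> \<tau> [] (foldr act_t w ?g) = 0" if "set w \<subseteq> fin" for w and \<tau> :: "int \<Rightarrow> mpoly"
      proof (rule xeval_eq_0_transfer)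
        show "finite_vars (foldr act_t w ?g)"
          by (intro good_finite_vars good_foldr_act_t good)
        show "xeval gen_T gen_T [] (foldr act_t w ?g) = 0"
          using Cons.prems that by (intro Cons.IH) simp_all
      qed
      have "xeval gen_T gen_T [] (\<lambda>N. root_z k) * xeval gen_T gen_T [] (foldr act_t w (div_diff_z k ?g))
          = xeval gen_T gen_T [] (foldr act_t w ((\<lambda>N. root_z k) * div_diff_z k ?g))"
        by (simp only: foldr_act_t_mult foldr_act_t_root_z xeval_ring)
      also have "\<dots> = xeval gen_T gen_T [] (foldr act_t w ?g) - xeval gen_T gen_T [] (act_z k (foldr act_t w ?g))"
        unfolding div_diff_z(1)[OF good] foldr_act_t_diff act_z_foldr_act_t[OF good] by (simp only: xeval_ring)
      also have "xeval gen_T gen_T [] (foldr act_t w ?g) = 0"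
        using Cons.prems by (intro IH) simp
      also have "xeval gen_T gen_T [] (act_z k (foldr act_t w ?g))
          = xeval (gen_T \<circ> simple_refl k) (gen_T \<circ> simple_refl k) [] (foldr act_t (k # w) ?g)"
        by (simp only: foldr.simps comp_apply xeval_diagonal_act[OF good_foldr_act_t[OF good] odd_fun_gen(1)])
      also have "\<dots> = 0"
        using Cons.prems by (intro IH) simp
      finally have "xeval gen_T gen_T [] (\<lambda>N. root_z k) = 0
          \<or> xeval gen_T gen_T [] (foldr act_t w (div_diff_z k ?g)) = 0"
        by (simp only: mult_eq_0_iff diff_0_right)
      moreover have "xeval gen_T gen_T [] (\<lambda>N. root_z k) \<noteq> 0" by (rule xeval_root_z_neq_0)
      ultimately show ?case by (simp only: foldr.simps comp_apply simp_thms)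
    qed (use loc in simp)
    moreover have "finite_vars (foldr act_t w (?W u))"
      by (intro good_finite_vars good_foldr_act_t good)
    ultimately show ?thesis by (rule xeval_eq_0_transfer[rotated])
  qed
  \<comment> \<open>Induction on the missing length \<open>m\<close>: a word longer than
    \<open>d\<close> leaves no room in degree.\<close>
  have "?W u = 0" if "d < length u + m" "set u \<subseteq> fin" for m u
    using that
  proof (induction m arbitrary: u)
    case 0
    have "?W u N = 0" for N
    proof -
      have "?W u N = 0 \<or> total_degree (?W u N) + length u \<le> d"
        using room[of u] unfolding deg_room_def by (rule spec)
      thus ?thesis using 0(1) by linarith
    qed
    hence "?W u N = 0 N" for N by simp
    thus ?case by (rule ext)
  next
    case (Suc m)
    show ?case
    proof (rule good_invariant_eq_0[OF good])
      fix i assume i: "i \<in> nodes ty"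
      show "act_t i (?W u) = ?W u"
      proof (cases "i \<in> fin")
        case True
        obtain j where "j \<in> fin" "?W u - act_t i (?W u) = (\<lambda>N. root_t i) * ?W (u @ [j])"
          using step[OF True, of u] by (elim bexE)
        moreover have "?W (u @ [j]) = 0" using Suc.prems \<open>j \<in> fin\<close> by (intro Suc.IH) simp_all
        ultimately have "?W u - act_t i (?W u) = 0" by (simp only: mult_zero_right)
        thus ?thesis by (simp only: right_minus_eq)
      next
        case False
        with i show ?thesis by (intro inv) simp
      qed
    next
      show "xeval gen_T gen_T [] (?W u) = 0" using zero[of u "[]"] Suc.prems by simp
    qed
  qed
  from this[of "[]" "Suc d"] show ?thesis by simp
qed

section \<open>Signed permutations\<close>

definition negs :: "(int \<Rightarrow> int) \<Rightarrow> int set" where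
  "negs w = {i. i > 0 \<and> w i < 0}"

definition fixes_above :: "nat \<Rightarrow> (int \<Rightarrow> int) \<Rightarrow> bool" where
  "fixes_above n w \<longleftrightarrow> (\<forall>k. \<bar>k\<bar> > int n \<longrightarrow> w k = k)"

lemma W_odd: "w \<in> W_infinity \<Longrightarrow> w (- k) = - w k"
  and W_bij: "w \<in> W_infinity \<Longrightarrow> bij w"
  and W_finite: "w \<in> W_infinity \<Longrightarrow> finite {k. w k \<noteq> k}"
  by (auto simp: W_infinity_def)

lemma W_inj: "w \<in> W_infinity \<Longrightarrow> w a = w b \<longleftrightarrow> a = b"
  using W_bij[of w] by (meson bij_is_inj injD)

lemma W_0: "w \<in> W_infinity \<Longrightarrow> w 0 = 0"
  using W_odd[of w 0] by simp

lemma W_eq_0_iff: "w \<in> W_infinity \<Longrightarrow> w k = 0 \<longleftrightarrow> k = 0"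
  using W_inj[of w k 0] W_0[of w] by simp

lemma simple_refl_nat_pos: "j \<ge> 1 \<Longrightarrow> simple_refl_nat j k =
    (if k = int j then int j + 1 else if k = int j + 1 then int j
     else if k = - int j then - int j - 1 else if k = - int j - 1 then - int j else k)"
proof -
  assume j: "j \<ge> 1"
  have p: "simple_refl_nat j (int n) = (if n = j then int (Suc j) else if n = Suc j then int j else int n)" for n
    using j by (simp add: simple_refl_nat_int transpose_def)
  obtain n where "k = int n \<or> k = - int n" by (metis int_cases2)
  thus ?thesis
  proof
    assume k: "k = int n"
    show ?thesis unfolding k p using j by auto
  next
    assume k: "k = - int n"
    show ?thesis unfolding k simple_refl_nat_uminus p using j by auto
  qed
qed

lemma simple_refl_nat_zero: "simple_refl_nat 0 k = (if k = 1 then - 1 else if k = - 1 then 1 else k)"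
  by (auto simp: simple_refl_nat_def)

lemma simple_refl_Hat1: "simple_refl Hat1 k =
    (if k = 1 then - 2 else if k = 2 then - 1 else if k = - 1 then 2 else if k = - 2 then 1 else k)"
  by (simp add: simple_refl_nat_zero simple_refl_nat_pos)

lemma W_id: "id \<in> W_infinity"
  by (simp add: W_infinity_def)

lemma W_comp:
  assumes "v \<in> W_infinity" "w \<in> W_infinity"
  shows "v \<circ> w \<in> W_infinity"
proof -
  have "{k. (v \<circ> w) k \<noteq> k} \<subseteq> {k. v k \<noteq> k} \<union> {k. w k \<noteq> k}" by auto
  hence "finite {k. (v \<circ> w) k \<noteq> k}" using W_finite assms by (meson finite_UnI finite_subset)
  moreover have "bij (v \<circ> w)" using assms by (intro bij_comp W_bij)
  moreover have "\<forall>k. (v \<circ> w) (- k) = - (v \<circ> w) k"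
    by (simp add: W_odd[OF assms(1)] W_odd[OF assms(2)])
  ultimately show ?thesis unfolding W_infinity_def by blast
qed

lemma W_refl_nat: "simple_refl_nat j \<in> W_infinity"
proof -
  have "bij (simple_refl_nat j)" by (rule involuntory_imp_bij) (rule simple_refl_nat_involutory)
  moreover have "{k. simple_refl_nat j k \<noteq> k} \<subseteq> {- int j - 1..int j + 1}"
    by (cases "j = 0") (auto simp: simple_refl_nat_zero simple_refl_nat_pos split: if_splits)
  hence "finite {k. simple_refl_nat j k \<noteq> k}" by (rule finite_subset) simp
  ultimately show ?thesis by (auto simp: W_infinity_def simple_refl_nat_uminus)
qed

lemma W_refl: "simple_refl i \<in> W_infinity"
proof (cases i)
  case (Nd j)
  show ?thesis unfolding Nd simple_refl.simps by (rule W_refl_nat)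
next
  case Hat1
  show ?thesis unfolding Hat1 simple_refl.simps by (rule W_comp[OF W_comp[OF W_refl_nat W_refl_nat] W_refl_nat])
qed

lemma W_inv:
  assumes w: "w \<in> W_infinity"
  shows "inv w \<in> W_infinity"
proof -
  have b: "bij w" using w by (rule W_bij)
  have odd: "\<forall>k. inv w (- k) = - inv w k"
  proof
    fix k
    have "w (- inv w k) = - k"
      unfolding W_odd[OF w] surj_f_inv_f[OF bij_is_surj[OF b]] ..
    hence "- inv w k = inv w (- k)" unfolding bij_inv_eq_iff[OF b] .
    thus "inv w (- k) = - inv w k" by (rule sym)
  qed
  have sub: "{k. inv w k \<noteq> k} \<subseteq> {k. w k \<noteq> k}"
  proof
    fix k assume k: "k \<in> {k. inv w k \<noteq> k}"
    have "w k \<noteq> k"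
    proof
      assume "w k = k"
      hence "inv w k = k" using inv_f_f[OF bij_is_inj[OF b], of k] by simp
      with k show False by simp
    qed
    thus "k \<in> {k. w k \<noteq> k}" by simp
  qed
  have "finite {k. inv w k \<noteq> k}" using sub W_finite[OF w] by (rule finite_subset)
  moreover have "bij (inv w)" using b by (rule bij_imp_bij_inv)
  ultimately show ?thesis using odd unfolding W_infinity_def by blast
qed

lemma finite_negs: "w \<in> W_infinity \<Longrightarrow> finite (negs w)"
  by (rule finite_subset[OF _ W_finite]) (auto simp: negs_def)

lemma odd_card_toggle:
  assumes "finite A"
  shows "even (card (if x \<in> A then A - {x} else insert x A)) \<longleftrightarrow> odd (card A)"
proof (cases "x \<in> A")
  case True
  have "card A = Suc (card (A - {x}))" by (rule card.remove[OF assms True])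
  thus ?thesis using True by simp
qed (use assms in simp)

lemma negs_refl_0: "w \<in> W_infinity \<Longrightarrow>
    negs (w \<circ> simple_refl_nat 0) = (if 1 \<in> negs w then negs w - {1} else insert 1 (negs w))"
proof -
  assume w: "w \<in> W_infinity"
  have "k \<in> negs (w \<circ> simple_refl_nat 0) \<longleftrightarrow> (if k = 1 then \<not> w 1 < 0 else k \<in> negs w)" for k
    using W_odd[OF w, of 1] W_eq_0_iff[OF w, of 1] by (auto simp: negs_def simple_refl_nat_zero)
  moreover have "1 \<in> negs w \<longleftrightarrow> w 1 < 0" by (simp add: negs_def)
  ultimately show ?thesis by (auto simp: set_eq_iff)
qed

lemma negs_refl_pos:
  assumes "j \<ge> 1"
  shows "negs (w \<circ> simple_refl_nat j) = simple_refl_nat j ` negs w"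
proof (intro equalityI subsetI)
  fix k assume "k \<in> negs (w \<circ> simple_refl_nat j)"
  hence "simple_refl_nat j k \<in> negs w"
    using assms by (auto simp: negs_def simple_refl_nat_pos split: if_splits)
  thus "k \<in> simple_refl_nat j ` negs w"
    by (intro image_eqI[of _ _ "simple_refl_nat j k"]) (simp add: simple_refl_nat_involutory)
next
  fix k assume "k \<in> simple_refl_nat j ` negs w"
  then obtain m where m: "k = simple_refl_nat j m" "m \<in> negs w" by blast
  have "k > 0" using m assms by (auto simp: negs_def simple_refl_nat_pos split: if_splits)
  thus "k \<in> negs (w \<circ> simple_refl_nat j)" using m by (simp add: negs_def simple_refl_nat_involutory)
qed

lemma even_negs_refl_nat:
  assumes "w \<in> W_infinity"
  shows "even (card (negs (w \<circ> simple_refl_nat j))) \<longleftrightarrow> (even (card (negs w)) \<longleftrightarrow> j \<noteq> 0)"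
proof (cases "j = 0")
  case True
  thus ?thesis using odd_card_toggle[OF finite_negs[OF assms], of 1] negs_refl_0[OF assms] by auto
next
  case False
  have "inj_on (simple_refl_nat j) (negs w)"
    by (rule inj_on_inverseI[of _ "simple_refl_nat j"]) (rule simple_refl_nat_involutory)
  thus ?thesis using False by (simp add: negs_refl_pos card_image)
qed

lemma weyl_def': "weyl ty = {w \<in> W_infinity. ty = TypeD \<longrightarrow> even (card (negs w))}"
  by (cases ty) (auto simp: negs_def)

lemma weyl_W: "w \<in> weyl ty \<Longrightarrow> w \<in> W_infinity"
  by (simp add: weyl_def')

lemma weyl_refl_right:
  assumes "w \<in> weyl ty" "i \<in> nodes ty"
  shows "w \<circ> simple_refl i \<in> weyl ty"
proof -
  have w: "w \<in> W_infinity" using assms(1) by (rule weyl_W)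
  have "even (card (negs (w \<circ> simple_refl i)))" if ty: "ty = TypeD"
  proof -
    have ev: "even (card (negs w))" using assms(1) ty by (simp add: weyl_def')
    show ?thesis
    proof (cases i)
      case (Nd j)
      hence "j \<noteq> 0" using assms(2) ty by auto
      thus ?thesis using ev unfolding Nd simple_refl.simps even_negs_refl_nat[OF w] by simp
    next
      case Hat1
      have 1: "w \<circ> simple_refl_nat 0 \<in> W_infinity" by (rule W_comp[OF w W_refl_nat])
      have 2: "w \<circ> simple_refl_nat 0 \<circ> simple_refl_nat 1 \<in> W_infinity" by (rule W_comp[OF 1 W_refl_nat])
      have "w \<circ> simple_refl i = w \<circ> simple_refl_nat 0 \<circ> simple_refl_nat 1 \<circ> simple_refl_nat 0"
        by (simp only: Hat1 simple_refl.simps comp_assoc)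
      thus ?thesis using ev even_negs_refl_nat[OF 2, of 0] even_negs_refl_nat[OF 1, of 1] even_negs_refl_nat[OF w, of 0]
        by (simp only: simp_thms one_neq_zero)
    qed
  qed
  moreover have "w \<circ> simple_refl i \<in> W_infinity" by (rule W_comp[OF w W_refl])
  ultimately show ?thesis unfolding weyl_def' by blast
qed

lemma weyl_inv:
  assumes "w \<in> weyl ty"
  shows "inv w \<in> weyl ty"
proof -
  have w: "w \<in> W_infinity" using assms by (rule weyl_W)
  have b: "bij w" using w by (rule W_bij)
  \<comment> \<open>A position \<open>i\<close> with \<open>w i < 0\<close> corresponds to the
    position \<open>- w i\<close> of a sign change of the inverse, so the numbers of sign changes
    agree.\<close>
  have "(\<lambda>i. - w i) ` negs w = negs (inv w)"
  proof (intro equalityI subsetI)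
    fix j assume "j \<in> (\<lambda>i. - w i) ` negs w"
    then obtain i where i: "j = - w i" "i > 0" "w i < 0" by (auto simp: negs_def)
    have "inv w j = - i" 
    proof (rule sym)
      show "- i = inv w j" unfolding bij_inv_eq_iff[OF b] using W_odd[OF w, of i] i(1) by simp
    qed
    thus "j \<in> negs (inv w)" using i by (simp add: negs_def)
  next
    fix j assume "j \<in> negs (inv w)"
    hence j: "j > 0" "inv w j < 0" by (auto simp: negs_def)
    have "w (- inv w j) = - j"
      unfolding W_odd[OF w] surj_f_inv_f[OF bij_is_surj[OF b]] ..
    hence "j = - w (- inv w j)" "- inv w j \<in> negs w" using j by (simp_all add: negs_def)
    thus "j \<in> (\<lambda>i. - w i) ` negs w" by (rule image_eqI)
  qed
  moreover have "inj_on (\<lambda>i. - w i) (negs w)" by (rule inj_onI) (simp add: W_inj[OF w])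
  ultimately have "card (negs (inv w)) = card (negs w)" using card_image by fastforce
  thus ?thesis using assms W_inv[OF w] unfolding weyl_def' by simp
qed

lemma inv_simple_refl: "inv (simple_refl i) = simple_refl i"
  by (rule inv_unique_comp) (auto simp: fun_eq_iff simple_refl_involutory)

lemma inv_comp_refl: "w \<in> W_infinity \<Longrightarrow> inv (w \<circ> simple_refl i) = simple_refl i \<circ> inv w"
  "w \<in> W_infinity \<Longrightarrow> inv (simple_refl i \<circ> w) = inv w \<circ> simple_refl i"
  by (simp_all add: o_inv_distrib W_bij W_refl inv_simple_refl)

lemma weyl_refl_left:
  assumes "w \<in> weyl ty" "i \<in> nodes ty"
  shows "simple_refl i \<circ> w \<in> weyl ty"
proof -
  have w: "w \<in> W_infinity" using assms(1) by (rule weyl_W)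
  have "inv (inv w \<circ> simple_refl i) \<in> weyl ty"
    by (rule weyl_inv[OF weyl_refl_right[OF weyl_inv[OF assms(1)] assms(2)]])
  thus ?thesis
    unfolding inv_comp_refl(1)[OF W_inv[OF w]] inv_inv_eq[OF W_bij[OF w]] .
qed

lemma weyl_id: "id \<in> weyl ty"
proof -
  have "negs id = {}" by (auto simp: negs_def)
  thus ?thesis by (simp add: weyl_def' W_id)
qed

section \<open>Words in the simple reflections\<close>

lemma word_product_simps [simp]:
  "word_product [] = id" "word_product (i # u) = simple_refl i \<circ> word_product u"
  by (simp_all add: word_product_def)

lemma word_product_append: "word_product (u @ v) = word_product u \<circ> word_product v"
  by (induction u) (simp_all add: comp_assoc)

lemma word_product_snoc: "word_product (u @ [i]) = word_product u \<circ> simple_refl i"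
  by (simp only: word_product_append word_product_simps comp_id)

lemma word_product_weyl: "set u \<subseteq> nodes ty \<Longrightarrow> word_product u \<in> weyl ty"
proof (induction u)
  case (Cons i u)
  thus ?case unfolding word_product_simps by (intro weyl_refl_left) simp_all
next
  case Nil
  show ?case unfolding word_product_simps by (rule weyl_id)
qed

lemma word_product_W: "word_product u \<in> W_infinity"
proof (induction u)
  case (Cons i u)
  show ?case unfolding word_product_simps by (rule W_comp[OF W_refl Cons])
next
  case Nil
  show ?case unfolding word_product_simps by (rule W_id)
qed

lemma word_product_rev: "word_product (rev u) = inv (word_product u)"
proof (induction u)
  case (Cons i u)
  show ?case
    by (simp only: rev.simps word_product_append Cons word_product_simps comp_id
        inv_comp_refl(2)[OF word_product_W])
qed simp

section \<open>Inversions and length\<close>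

text \<open>The pair (a, b) stands for the root \<open>t\<^sub>b - t\<^sub>a\<close>, where \<open>t\<^sub>-\<^sub>a = - t\<^sub>a\<close>; each positive root has
  exactly one such representative with \<open>\<bar>a\<bar> \<le> b\<close>.\<close>

definition pos_roots :: "lie_type \<Rightarrow> (int \<times> int) set" where
  "pos_roots ty = {(a, b). a \<noteq> 0 \<and> \<bar>a\<bar> < b \<or> ty = TypeC \<and> b > 0 \<and> a = - b}"

text \<open>The positive roots made negative by \<open>w\<close>, which sends
  \<open>t_b - t_a\<close> to \<open>t_(w b) - t_(w a)\<close>.\<close>

definition inversions :: "lie_type \<Rightarrow> (int \<Rightarrow> int) \<Rightarrow> (int \<times> int) set" where
  "inversions ty w = {(a, b) \<in> pos_roots ty. w a > w b}"

fun root_pair :: "node \<Rightarrow> int \<times> int" where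
  "root_pair (Nd i) = (if i = 0 then (- 1, 1) else (int i, int i + 1))"
| "root_pair Hat1 = (- 1, 2)"

text \<open>The action of a simple reflection on roots, brought back to the chosen representative:
  \<open>(a, b)\<close> and \<open>(- b, - a)\<close> stand for the same root.\<close>

definition refl_pair :: "lie_type \<Rightarrow> node \<Rightarrow> int \<times> int \<Rightarrow> int \<times> int" where
  "refl_pair ty i = (\<lambda>(a, b). if (simple_refl i a, simple_refl i b) \<in> pos_roots ty
     then (simple_refl i a, simple_refl i b) else (- simple_refl i b, - simple_refl i a))"

lemma root_pair_pos: "i \<in> nodes ty \<Longrightarrow> root_pair i \<in> pos_roots ty"
  by (cases i; cases ty) (auto simp: pos_roots_def)

lemma root_pair_swap: "simple_refl i (fst (root_pair i)) = snd (root_pair i)"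
  "simple_refl i (snd (root_pair i)) = fst (root_pair i)"
proof -
  have "simple_refl i (fst (root_pair i)) = snd (root_pair i) \<and>
    simple_refl i (snd (root_pair i)) = fst (root_pair i)"
  proof (cases i)
    case (Nd j)
    thus ?thesis by (cases "j = 0") (simp_all add: simple_refl_nat_zero simple_refl_nat_pos)
  next
    case Hat1
    show ?thesis unfolding Hat1 simple_refl_Hat1 by simp
  qed
  thus "simple_refl i (fst (root_pair i)) = snd (root_pair i)"
    "simple_refl i (snd (root_pair i)) = fst (root_pair i)" by blast+
qed

text \<open>Together with involutivity this is the classical fact behind the length formula: a
  simple reflection permutes the positive roots other than its own.\<close>

lemma refl_pair_mem:
  assumes "i \<in> nodes ty" "p \<in> pos_roots ty" "p \<noteq> root_pair i"
  shows "refl_pair ty i p \<in> pos_roots ty"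
proof -
  obtain a b where p: "p = (a, b)" by (cases p)
  let ?pos = "\<lambda>a b :: int. a \<noteq> 0 \<and> \<bar>a\<bar> < b \<or> ty = TypeC \<and> b > 0 \<and> a = - b"
  have ab: "?pos a b" using assms(2) by (simp add: p pos_roots_def)
  have "?pos (simple_refl i a) (simple_refl i b) \<or> ?pos (- simple_refl i b) (- simple_refl i a)"
  proof (cases i)
    case (Nd j)
    show ?thesis
    proof (cases "j = 0")
      case True
      have ne: "\<not> (a = - 1 \<and> b = 1)" using assms(3) by (simp add: p Nd True)
      have s: "simple_refl i k = (if k = 1 then - 1 else if k = - 1 then 1 else k)" for k
        unfolding Nd True simple_refl.simps by (rule simple_refl_nat_zero)
      show ?thesis
      proof (cases "b = 1")
        case True
        thus ?thesis using ab ne by auto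
      next
        case False
        hence "simple_refl i b = b" "\<bar>simple_refl i a\<bar> = \<bar>a\<bar>" "simple_refl i a \<noteq> 0"
          "a = - b \<Longrightarrow> simple_refl i a = - b"
          using ab by (auto simp: s)
        thus ?thesis using ab by auto
      qed
    next
      case False
      define c where "c = int j"
      have "c > 0" using False by (simp add: c_def)
      have ne: "\<not> (a = c \<and> b = c + 1)" using assms(3) False by (simp add: p Nd c_def)
      have s: "simple_refl i k = (if k = c then c + 1 else if k = c + 1 then c
          else if k = - c then - c - 1 else if k = - c - 1 then - c else k)" for k
        using False by (simp add: Nd simple_refl_nat_pos c_def)
      have b: "b > 0" "\<bar>a\<bar> \<le> b" "a \<noteq> 0" using ab by auto
      have neg: "simple_refl i (- k) = - simple_refl i k" for k by (rule simple_refl_uminus)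
      \<comment> \<open>In terms of absolute values the reflection is increasing except on the pair
        \<open>c\<close>, \<open>c + 1\<close>; there \<open>a = c\<close> is the excluded root, and
        \<open>a = - c\<close> stays positive.\<close>
      define e where "e = \<bar>a\<bar>"
      have e: "0 < e" "e \<le> b" "a = e \<or> a = - e" using b by (auto simp: e_def)
      have s': "simple_refl i k = (if k = c then c + 1 else if k = c + 1 then c else k)" if "k > 0" for k
        using that \<open>c > 0\<close> unfolding s by simp
      have sb: "simple_refl i b > 0" and se: "simple_refl i e > 0"
        using b e \<open>c > 0\<close> by (simp_all add: s')
      show ?thesis
      proof (cases "e = b")
        case True
        thus ?thesis using ab e sb by (auto simp: neg)
      next
        case ne_b: False
        show ?thesis
        proof (cases "e = c \<and> b = c + 1")
          case True
          hence "a = - c" using ne e by auto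
          thus ?thesis using True \<open>c > 0\<close> by (simp add: neg s')
        next
          case False
          hence "simple_refl i e < simple_refl i b" using e ne_b b by (auto simp: s')
          thus ?thesis using e sb se by (auto simp: neg)
        qed
      qed
    qed
  next
    case Hat1
    have ty: "ty \<noteq> TypeC" using assms(1) Hat1 by (cases ty) auto
    have ne: "\<not> (a = - 1 \<and> b = 2)" using assms(3) by (simp add: p Hat1)
    have ab': "a \<noteq> 0" "\<bar>a\<bar> < b" using ab ty by auto
    show ?thesis
    proof (cases "b \<le> 2")
      case True
      hence "b = 2" "a = 1" using ab' ne by auto
      thus ?thesis unfolding Hat1 simple_refl_Hat1 by simp
    next
      case False
      hence "simple_refl i b = b" "simple_refl i a \<noteq> 0" "\<bar>simple_refl i a\<bar> < b"
        using ab' unfolding Hat1 simple_refl_Hat1 by auto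
      thus ?thesis by simp
    qed
  qed
  thus ?thesis by (auto simp: p refl_pair_def pos_roots_def)
qed

lemma refl_pair_cases:
  "refl_pair ty i (a, b) = (simple_refl i a, simple_refl i b)
   \<or> refl_pair ty i (a, b) = (- simple_refl i b, - simple_refl i a)"
  by (cases "(simple_refl i a, simple_refl i b) \<in> pos_roots ty")
     (simp_all only: refl_pair_def prod.case if_True if_False simp_thms)

lemma pos_roots_antisym: "(a, b) \<in> pos_roots ty \<Longrightarrow> (- b, - a) \<in> pos_roots ty \<Longrightarrow> (a, b) = (- b, - a)"
  by (auto simp: pos_roots_def)

lemma refl_pair_involutory:
  assumes "i \<in> nodes ty" "p \<in> pos_roots ty" "p \<noteq> root_pair i"
  shows "refl_pair ty i (refl_pair ty i p) = p"
proof -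
  obtain a b where p: "p = (a, b)" by (cases p)
  have ab: "(a, b) \<in> pos_roots ty" using assms(2) by (simp only: p)
  show ?thesis
  proof (cases "(simple_refl i a, simple_refl i b) \<in> pos_roots ty")
    case True
    thus ?thesis unfolding p refl_pair_def
      by (simp only: prod.case if_True simple_refl_involutory ab)
  next
    case False
    hence "refl_pair ty i (refl_pair ty i p)
        = (if (- b, - a) \<in> pos_roots ty then (- b, - a) else (- (- a), - (- b)))"
      unfolding p refl_pair_def
      by (simp only: prod.case if_False simple_refl_uminus simple_refl_involutory)
    \<comment> \<open>A long root \<open>(- b, b)\<close> is its own opposite representative;
      otherwise at most one of the two pairs is in \<open>pos_roots ty\<close>.\<close>
    moreover have "(if (- b, - a) \<in> pos_roots ty then (- b, - a) else (- (- a), - (- b))) = (a, b)"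
    proof (cases "(- b, - a) \<in> pos_roots ty")
      case True
      from pos_roots_antisym[OF ab this, symmetric] True show ?thesis by (simp only: if_True)
    qed (simp only: if_False minus_minus)
    ultimately show ?thesis by (simp only: p)
  qed
qed

lemma refl_pair_ne_root:
  assumes "i \<in> nodes ty" "p \<in> pos_roots ty" "p \<noteq> root_pair i"
  shows "refl_pair ty i p \<noteq> root_pair i"
proof
  obtain c d where r: "root_pair i = (c, d)" by (cases "root_pair i")
  have s: "simple_refl i c = d" "simple_refl i d = c" using root_pair_swap[of i] r by simp_all
  assume "refl_pair ty i p = root_pair i"
  hence "p = refl_pair ty i (c, d)" using refl_pair_involutory[OF assms] by (simp only: r)
  moreover have "refl_pair ty i (c, d) = (d, c) \<or> refl_pair ty i (c, d) = (- c, - d)"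
    using refl_pair_cases[of ty i c d] by (simp only: s)
  ultimately have "p = (- c, - d) \<or> p = (d, c)" by blast
  moreover have "(c, d) \<in> pos_roots ty" using root_pair_pos[OF assms(1)] r by simp
  hence "c < d" by (auto simp: pos_roots_def)
  moreover have "fst p < snd p" using assms(2) by (auto simp: pos_roots_def)
  ultimately show False by auto
qed

lemma inversions_refl:
  assumes w: "w \<in> W_infinity" and i: "i \<in> nodes ty"
  shows "inversions ty (w \<circ> simple_refl i) - {root_pair i} = refl_pair ty i ` (inversions ty w - {root_pair i})"
    "root_pair i \<in> inversions ty (w \<circ> simple_refl i) \<longleftrightarrow> root_pair i \<notin> inversions ty w"
proof -
  have iff: "p \<in> inversions ty (w \<circ> simple_refl i) \<longleftrightarrow> refl_pair ty i p \<in> inversions ty w"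
    if p: "p \<in> pos_roots ty" "p \<noteq> root_pair i" for p
  proof -
    obtain a b where ab: "p = (a, b)" by (cases p)
    have m: "refl_pair ty i (a, b) \<in> pos_roots ty" "(a, b) \<in> pos_roots ty"
      using refl_pair_mem[OF i p] p(1) by (simp_all only: ab)
    have mem: "(c, d) \<in> inversions ty v \<longleftrightarrow> (c, d) \<in> pos_roots ty \<and> v c > v d" for c d v
      by (simp add: inversions_def)
    from refl_pair_cases[of ty i a b] show ?thesis
    proof
      assume e: "refl_pair ty i (a, b) = (simple_refl i a, simple_refl i b)"
      show ?thesis using m unfolding ab e mem comp_apply by simp
    next
      assume e: "refl_pair ty i (a, b) = (- simple_refl i b, - simple_refl i a)"
      show ?thesis using m unfolding ab e mem comp_apply W_odd[OF w] by simp
    qed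
  qed
  show "inversions ty (w \<circ> simple_refl i) - {root_pair i} = refl_pair ty i ` (inversions ty w - {root_pair i})"
  proof (intro equalityI subsetI)
    fix p assume "p \<in> inversions ty (w \<circ> simple_refl i) - {root_pair i}"
    hence p: "p \<in> pos_roots ty" "p \<noteq> root_pair i" "p \<in> inversions ty (w \<circ> simple_refl i)"
      by (auto simp: inversions_def)
    show "p \<in> refl_pair ty i ` (inversions ty w - {root_pair i})"
    proof (rule image_eqI)
      show "p = refl_pair ty i (refl_pair ty i p)" using refl_pair_involutory[OF i p(1,2)] by simp
      show "refl_pair ty i p \<in> inversions ty w - {root_pair i}"
        using iff[OF p(1,2)] refl_pair_ne_root[OF i p(1,2)] p(3) by simp
    qed
  next
    fix p assume "p \<in> refl_pair ty i ` (inversions ty w - {root_pair i})"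
    then obtain q where q: "p = refl_pair ty i q" "q \<in> inversions ty w" "q \<noteq> root_pair i" by auto
    have q': "q \<in> pos_roots ty" using q(2) by (auto simp: inversions_def)
    have p: "p \<in> pos_roots ty" "p \<noteq> root_pair i"
      using q refl_pair_mem[OF i q' q(3)] refl_pair_ne_root[OF i q' q(3)] by simp_all
    have "refl_pair ty i p = q" using q(1) refl_pair_involutory[OF i q' q(3)] by simp
    thus "p \<in> inversions ty (w \<circ> simple_refl i) - {root_pair i}"
      using iff[OF p] q(2) p(2) by simp
  qed
  obtain c d where r: "root_pair i = (c, d)" by (cases "root_pair i")
  have s: "simple_refl i c = d" "simple_refl i d = c" using root_pair_swap[of i] r by simp_all
  have "(c, d) \<in> pos_roots ty" using root_pair_pos[OF i] r by simp
  moreover from this have "c \<noteq> d" by (auto simp: pos_roots_def)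
  ultimately show "root_pair i \<in> inversions ty (w \<circ> simple_refl i) \<longleftrightarrow> root_pair i \<notin> inversions ty w"
    using W_inj[OF w, of c d] unfolding r by (auto simp: inversions_def s)
qed

section \<open>Finiteness of inversion sets\<close>

lemma W_preserves_interval:
  assumes "w \<in> W_infinity" "fixes_above n w" "\<bar>k\<bar> \<le> int n"
  shows "\<bar>w k\<bar> \<le> int n"
proof (rule ccontr)
  assume "\<not> \<bar>w k\<bar> \<le> int n"
  hence "w (w k) = w k" using assms(2) by (simp add: fixes_above_def)
  hence "w k = k" using W_inj[OF assms(1)] by simp
  thus False using \<open>\<not> \<bar>w k\<bar> \<le> int n\<close> assms(3) by simp
qed

lemma inversions_bounded:
  assumes w: "w \<in> W_infinity" and n: "fixes_above n w" and p: "p \<in> inversions ty w"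
  shows "snd p \<le> int n"
proof (rule ccontr)
  obtain a b where ab: "p = (a, b)" by (cases p)
  assume "\<not> snd p \<le> int n"
  hence b: "b > int n" by (simp add: ab)
  hence wb: "w b = b" using n by (simp add: fixes_above_def)
  have a: "\<bar>a\<bar> \<le> b" "w a > b" "b > 0"
    using p wb by (auto simp: ab inversions_def pos_roots_def)
  show False
  proof (cases "\<bar>a\<bar> > int n")
    case True
    hence "w a = a" using n by (simp add: fixes_above_def)
    thus ?thesis using a by simp
  next
    case False
    hence "\<bar>w a\<bar> \<le> int n" using W_preserves_interval[OF w n] by simp
    thus ?thesis using a b by simp
  qed
qed

lemma finite_pos_roots_le: "finite {p \<in> pos_roots ty. snd p \<le> int n}"
  by (rule finite_subset[of _ "{- int n..int n} \<times> {0..int n}"]) (auto simp: pos_roots_def)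

lemma W_fixes_above:
  assumes "w \<in> W_infinity"
  obtains n where "n \<ge> 1" "fixes_above n w"
proof -
  define A where "A = (\<lambda>k. nat \<bar>k\<bar>) ` {k. w k \<noteq> k}"
  have "finite A" unfolding A_def using W_finite[OF assms] by (rule finite_imageI)
  then obtain n where n: "\<And>m. m \<in> A \<Longrightarrow> m \<le> n" by (meson finite_nat_set_iff_bounded_le)
  have "fixes_above (Suc n) w"
    unfolding fixes_above_def
  proof (intro allI impI)
    fix k :: int assume k: "int (Suc n) < \<bar>k\<bar>"
    show "w k = k"
    proof (rule ccontr)
      assume "w k \<noteq> k"
      hence "nat \<bar>k\<bar> \<in> A" unfolding A_def by (intro imageI) simp
      from n[OF this] k show False by simp
    qed
  qed
  thus thesis by (intro that[of "Suc n"]) simp_all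
qed

lemma inversions_subset:
  "w \<in> W_infinity \<Longrightarrow> fixes_above n w \<Longrightarrow> inversions ty w \<subseteq> {p \<in> pos_roots ty. snd p \<le> int n}"
  using inversions_bounded[of w n _ ty] by (auto simp: inversions_def)

lemma finite_inversions: "w \<in> W_infinity \<Longrightarrow> finite (inversions ty w)"
proof -
  assume w: "w \<in> W_infinity"
  obtain n where "fixes_above n w" using W_fixes_above[OF w] by blast
  thus ?thesis by (rule finite_subset[OF inversions_subset[OF w] finite_pos_roots_le])
qed

lemma inj_on_refl_pair:
  assumes "i \<in> nodes ty"
  shows "inj_on (refl_pair ty i) (inversions ty w - {root_pair i})"
  using refl_pair_involutory[OF assms] by (intro inj_on_inverseI[of _ "refl_pair ty i"]) (auto simp: inversions_def)

lemma card_inversions_refl: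
  assumes w: "w \<in> W_infinity" and i: "i \<in> nodes ty"
  shows "root_pair i \<notin> inversions ty w \<Longrightarrow> card (inversions ty (w \<circ> simple_refl i)) = Suc (card (inversions ty w))"
    "root_pair i \<in> inversions ty w \<Longrightarrow> card (inversions ty w) = Suc (card (inversions ty (w \<circ> simple_refl i)))"
proof -
  have ws: "w \<circ> simple_refl i \<in> W_infinity" by (rule W_comp[OF w W_refl])
  have c: "card (inversions ty (w \<circ> simple_refl i) - {root_pair i}) = card (inversions ty w - {root_pair i})"
    unfolding inversions_refl(1)[OF w i] by (rule card_image[OF inj_on_refl_pair[OF i]])
  show "card (inversions ty (w \<circ> simple_refl i)) = Suc (card (inversions ty w))" if n: "root_pair i \<notin> inversions ty w"
  proof -
    have "root_pair i \<in> inversions ty (w \<circ> simple_refl i)" using inversions_refl(2)[OF w i] n by blast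
    from card.remove[OF finite_inversions[OF ws] this] show ?thesis
      unfolding c Diff_insert0[OF n] Diff_empty .
  qed
  show "card (inversions ty w) = Suc (card (inversions ty (w \<circ> simple_refl i)))" if y: "root_pair i \<in> inversions ty w"
  proof -
    have n: "root_pair i \<notin> inversions ty (w \<circ> simple_refl i)" using inversions_refl(2)[OF w i] y by blast
    from card.remove[OF finite_inversions[OF w] y] show ?thesis
      unfolding c[symmetric] Diff_insert0[OF n] Diff_empty .
  qed
qed

section \<open>Reduced words and the length function\<close>

text \<open>Without descents \<open>w\<close> increases on the positive integers, and the node
  \<open>Nd 0\<close>, or \<open>Hat1\<close> together with the parity of sign changes, makes
  \<open>w 1\<close> positive. An increasing positive map that is the identity beyond
  \<open>n\<close> is the identity.\<close>

lemma no_descents_imp_id: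
  assumes w: "w \<in> weyl ty" and n: "fixes_above n w"
    and nd: "\<And>i. i \<in> finite_nodes ty n \<Longrightarrow> root_pair i \<notin> inversions ty w"
  shows "w = id"
proof -
  have W: "w \<in> W_infinity" using w by (rule weyl_W)
  have incr: "w (int i) < w (int i + 1)" if "i \<ge> 1" for i
  proof (cases "i < n")
    case True
    hence "Nd i \<in> finite_nodes ty n" using that by (cases ty) auto
    from nd[OF this] have "\<not> w (int i) > w (int i + 1)"
      using that by (cases ty) (auto simp: inversions_def pos_roots_def)
    moreover have "w (int i) \<noteq> w (int i + 1)" using W_inj[OF W] by simp
    ultimately show ?thesis by simp
  next
    case False
    hence "w (int i + 1) = int i + 1" using n by (simp add: fixes_above_def)
    moreover have "\<bar>w (int i)\<bar> \<le> int i"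
    proof (cases "i = n")
      case True
      thus ?thesis using W_preserves_interval[OF W n, of "int i"] by simp
    qed (use False n in \<open>auto simp: fixes_above_def\<close>)
    ultimately show ?thesis by simp
  qed
  have mono: "w (int i) + int m \<le> w (int i + int m)" if "i \<ge> 1" for i m
  proof (induction m)
    case (Suc m)
    have "w (int (i + m)) < w (int (i + m) + 1)" using that by (intro incr) simp
    thus ?case using Suc by (simp add: algebra_simps)
  qed simp
  have pos: "w 1 > 0"
  proof (cases ty)
    case TypeC
    have "w 1 \<noteq> 0" using W_eq_0_iff[OF W] by simp
    moreover have "w 1 \<ge> 0"
    proof (cases "n = 0")
      case True
      thus ?thesis using n by (simp add: fixes_above_def)
    next
      case False
      hence "Nd 0 \<in> finite_nodes ty n" using TypeC by simp
      from nd[OF this] show ?thesis using TypeC W_odd[OF W, of 1]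
        by (auto simp: inversions_def pos_roots_def)
    qed
    ultimately show ?thesis by simp
  next
    case TypeD
    have 12: "w 1 < w 2" using incr[of 1] by simp
    have "w 2 > 0"
    proof (cases "n \<ge> 2")
      case True
      hence "Hat1 \<in> finite_nodes ty n" using TypeD by simp
      from nd[OF this] have "w 1 + w 2 \<ge> 0" using TypeD W_odd[OF W, of 1]
        by (auto simp: inversions_def pos_roots_def)
      thus ?thesis using 12 by simp
    next
      case False
      thus ?thesis using n by (simp add: fixes_above_def)
    qed
    show ?thesis
    proof (rule ccontr)
      assume "\<not> w 1 > 0"
      moreover have "w 1 \<noteq> 0" using W_eq_0_iff[OF W] by simp
      ultimately have "w 1 < 0" by simp
      \<comment> \<open>As \<open>w 2 > 0\<close> and \<open>w\<close> is increasing, this would be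
        the only sign change, against parity.\<close>
      have "negs w = {1}"
      proof (intro equalityI subsetI)
        fix k assume k: "k \<in> negs w"
        have "w k > 0" if "k \<ge> 2"
          using mono[of 2 "nat (k - 2)"] that \<open>w 2 > 0\<close> by simp
        moreover have "k > 0" "w k < 0" using k by (auto simp: negs_def)
        ultimately have "\<not> k \<ge> 2" by linarith
        thus "k \<in> {1}" using \<open>k > 0\<close> by simp
      qed (use \<open>w 1 < 0\<close> in \<open>simp add: negs_def\<close>)
      thus False using w TypeD by (simp add: weyl_def')
    qed
  qed
  have p: "w k = k" if k: "k > 0" for k
  proof -
    have "w k \<ge> k" using mono[of 1 "nat (k - 1)"] pos k by simp
    \<comment> \<open>Climbing \<open>n + 1\<close> steps from \<open>k\<close> leads beyond
      \<open>n\<close>, where \<open>w\<close> is the identity.\<close>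
    moreover have "w k \<le> k"
      using mono[of "nat k" "Suc n"] k n by (simp add: fixes_above_def)
    ultimately show ?thesis by simp
  qed
  show ?thesis
  proof
    fix k show "w k = id k"
      using p[of k] p[of "- k"] W_odd[OF W, of k] W_0[OF W] by (cases k "0 :: int" rule: linorder_cases) auto
  qed
qed

lemma refl_fixes_above: "i \<in> finite_nodes ty n \<Longrightarrow> fixes_above n (simple_refl i)"
proof (cases i)
  case (Nd j)
  assume i: "i \<in> finite_nodes ty n"
  show ?thesis
  proof (cases "j = 0")
    case True
    hence "n \<ge> 1" using i Nd by (cases ty) (auto split: if_splits)
    thus ?thesis using True Nd by (auto simp: fixes_above_def simple_refl_nat_zero)
  next
    case False
    hence "j < n" using i Nd by (cases ty) (auto split: if_splits)
    thus ?thesis using False Nd by (auto simp: fixes_above_def simple_refl_nat_pos)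
  qed
next
  case Hat1
  assume "i \<in> finite_nodes ty n"
  hence "n \<ge> 2" using Hat1 by (cases ty) (auto split: if_splits)
  thus ?thesis unfolding Hat1 fixes_above_def simple_refl_Hat1 by auto
qed

lemma fixes_above_comp: "fixes_above n v \<Longrightarrow> fixes_above n w \<Longrightarrow> fixes_above n (v \<circ> w)"
  by (simp add: fixes_above_def)

lemma finite_nodes_subset: "finite_nodes ty n \<subseteq> nodes ty"
  by (cases ty) auto

text \<open>Descents are removed one at a time on the right. They are found among
  \<open>finite_nodes ty n\<close>, so this also identifies the subgroup on these nodes as the
  elements that fix everything beyond \<open>n\<close>.\<close>

lemma reduced_word_exists:
  assumes "w \<in> weyl ty" "fixes_above n w"
  shows "\<exists>u. set u \<subseteq> finite_nodes ty n \<and> length u = card (inversions ty w) \<and> word_product u = w"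
  using assms
proof (induction "card (inversions ty w)" arbitrary: w)
  case 0
  hence "inversions ty w = {}" using finite_inversions weyl_W by (metis card_0_eq)
  hence "w = id" using no_descents_imp_id[OF 0(2,3)] by simp
  thus ?case using 0(1) by (intro exI[of _ "[]"]) simp
next
  case (Suc m)
  have W: "w \<in> W_infinity" using Suc.prems(1) by (rule weyl_W)
  obtain i where i: "i \<in> finite_nodes ty n" "root_pair i \<in> inversions ty w"
  proof (rule ccontr)
    assume "\<not> thesis"
    hence "w = id" using that by (intro no_descents_imp_id[OF Suc.prems]) blast
    hence "inversions ty w = {}" by (auto simp: inversions_def pos_roots_def)
    thus False using Suc.hyps(2) by simp
  qed
  have i': "i \<in> nodes ty" using i(1) finite_nodes_subset by blast
  have c: "card (inversions ty w) = Suc (card (inversions ty (w \<circ> simple_refl i)))"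
    by (rule card_inversions_refl(2)[OF W i' i(2)])
  have "\<exists>u. set u \<subseteq> finite_nodes ty n \<and> length u = card (inversions ty (w \<circ> simple_refl i))
      \<and> word_product u = w \<circ> simple_refl i"
  proof (rule Suc.hyps(1))
    show "m = card (inversions ty (w \<circ> simple_refl i))" using Suc.hyps(2) c by simp
    show "w \<circ> simple_refl i \<in> weyl ty" by (rule weyl_refl_right[OF Suc.prems(1) i'])
    show "fixes_above n (w \<circ> simple_refl i)"
      by (rule fixes_above_comp[OF Suc.prems(2) refl_fixes_above[OF i(1)]])
  qed
  then obtain u where u: "set u \<subseteq> finite_nodes ty n" "length u = card (inversions ty (w \<circ> simple_refl i))"
    "word_product u = w \<circ> simple_refl i" by blast
  have "word_product (u @ [i]) = w"
    unfolding word_product_snoc u(3) by (simp add: fun_eq_iff simple_refl_involutory)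
  thus ?case using u c i(1) by (intro exI[of _ "u @ [i]"]) simp
qed

lemma card_inversions_le_length:
  "set u \<subseteq> nodes ty \<Longrightarrow> card (inversions ty (word_product u)) \<le> length u"
proof (induction u rule: rev_induct)
  case Nil
  have "inversions ty id = {}" by (auto simp: inversions_def pos_roots_def)
  thus ?case by (simp only: word_product_simps list.size card.empty)
next
  case (snoc i u)
  have "card (inversions ty (word_product u \<circ> simple_refl i)) \<le> Suc (card (inversions ty (word_product u)))"
    using card_inversions_refl[OF word_product_W, of i ty u] snoc.prems
    by (cases "root_pair i \<in> inversions ty (word_product u)") auto
  moreover have "card (inversions ty (word_product u)) \<le> length u" using snoc by simp
  moreover have "length (u @ [i]) = Suc (length u)" by simp
  ultimately show ?case unfolding word_product_snoc by linarith
qed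

lemma coxeter_length_eq:
  assumes "w \<in> weyl ty"
  shows "coxeter_length ty w = card (inversions ty w)"
  unfolding coxeter_length_def
proof (rule Least_equality)
  obtain n where "fixes_above n w" using W_fixes_above[OF weyl_W[OF assms]] by blast
  from reduced_word_exists[OF assms this] obtain u where
    "set u \<subseteq> finite_nodes ty n" "length u = card (inversions ty w)" "word_product u = w" by (elim exE conjE)
  thus "\<exists>u. set u \<subseteq> nodes ty \<and> length u = card (inversions ty w) \<and> word_product u = w"
    using finite_nodes_subset by (intro exI[of _ u] conjI) auto
next
  fix l assume "\<exists>u. set u \<subseteq> nodes ty \<and> length u = l \<and> word_product u = w"
  then obtain u where "set u \<subseteq> nodes ty" "length u = l" "word_product u = w" by (elim exE conjE)
  thus "card (inversions ty w) \<le> l" using card_inversions_le_length[of u ty] by simp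
qed

lemma reduced_word:
  assumes "w \<in> weyl ty"
  obtains u where "set u \<subseteq> nodes ty" "length u = coxeter_length ty w" "word_product u = w"
proof -
  obtain n where "fixes_above n w" using W_fixes_above[OF weyl_W[OF assms]] by blast
  from reduced_word_exists[OF assms this] obtain u where
    u: "set u \<subseteq> finite_nodes ty n" "length u = card (inversions ty w)" "word_product u = w" by (elim exE conjE)
  show thesis
  proof (rule that)
    show "set u \<subseteq> nodes ty" using u(1) finite_nodes_subset by blast
    show "length u = coxeter_length ty w" unfolding coxeter_length_eq[OF assms] by (rule u(2))
  qed (rule u(3))
qed

lemma coxeter_length_le: "set u \<subseteq> nodes ty \<Longrightarrow> coxeter_length ty (word_product u) \<le> length u"
  by (simp add: coxeter_length_eq word_product_weyl card_inversions_le_length)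

lemma coxeter_length_inv:
  assumes "w \<in> weyl ty"
  shows "coxeter_length ty (inv w) = coxeter_length ty w"
proof -
  have le: "coxeter_length ty (inv v) \<le> coxeter_length ty v" if v: "v \<in> weyl ty" for v
  proof -
    obtain u where u: "set u \<subseteq> nodes ty" "length u = coxeter_length ty v" "word_product u = v"
      using reduced_word[OF v] by blast
    have "coxeter_length ty (word_product (rev u)) \<le> length (rev u)"
      using u(1) by (intro coxeter_length_le) simp
    thus ?thesis using u by (simp add: word_product_rev)
  qed
  from le[OF assms] le[OF weyl_inv[OF assms]] show ?thesis
    by (simp add: inv_inv_eq W_bij[OF weyl_W[OF assms]])
qed

lemma coxeter_length_refl:
  assumes "w \<in> weyl ty" "i \<in> nodes ty"
  shows "coxeter_length ty (w \<circ> simple_refl i) < coxeter_length ty w \<longleftrightarrow> root_pair i \<in> inversions ty w"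
    "coxeter_length ty w \<le> Suc (coxeter_length ty (w \<circ> simple_refl i))"
    "coxeter_length ty (w \<circ> simple_refl i) \<noteq> coxeter_length ty w"
  unfolding coxeter_length_eq[OF assms(1)] coxeter_length_eq[OF weyl_refl_right[OF assms]]
  by (cases "root_pair i \<in> inversions ty w";
      use card_inversions_refl[OF weyl_W[OF assms(1)] assms(2)] in linarith)+

section \<open>The longest elements\<close>

text \<open>Changing all \<open>n\<close> signs is not allowed in type D for odd \<open>n\<close>;
  leaving the entry 1 alone repairs the parity.\<close>

definition w_max :: "lie_type \<Rightarrow> nat \<Rightarrow> int \<Rightarrow> int" where
  "w_max ty n k = (if \<bar>k\<bar> \<le> int n \<and> \<not> (ty = TypeD \<and> odd n \<and> \<bar>k\<bar> = 1) then - k else k)"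

lemma w_max_involutory: "w_max ty n (w_max ty n k) = k"
  by (cases "\<bar>k\<bar> \<le> int n \<and> \<not> (ty = TypeD \<and> odd n \<and> \<bar>k\<bar> = 1)")
     (simp_all only: w_max_def abs_minus_cancel simp_thms if_True if_False minus_minus)

lemma fixes_above_w_max: "fixes_above n (w_max ty n)"
  by (auto simp: fixes_above_def w_max_def)

lemma w_max_weyl: "w_max ty n \<in> weyl ty"
proof -
  have "bij (w_max ty n)" by (rule involuntory_imp_bij) (rule w_max_involutory)
  moreover have "{k. w_max ty n k \<noteq> k} \<subseteq> {- int n..int n}" by (auto simp: w_max_def split: if_splits)
  hence "finite {k. w_max ty n k \<noteq> k}" by (rule finite_subset) simp
  moreover have "even (card (negs (w_max ty n)))" if "ty = TypeD"
  proof (cases "odd n")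
    case True
    hence "negs (w_max ty n) = {2..int n}" using that by (auto simp: negs_def w_max_def split: if_splits)
    moreover have "nat (int n - 1) = n - 1" by linarith
    ultimately show ?thesis using True by simp
  next
    case False
    hence "negs (w_max ty n) = {1..int n}" by (auto simp: negs_def w_max_def split: if_splits)
    thus ?thesis using False by simp
  qed
  ultimately show ?thesis by (auto simp: weyl_def' W_infinity_def w_max_def)
qed

lemma inversions_w_max: "inversions ty (w_max ty n) = {p \<in> pos_roots ty. snd p \<le> int n}"
proof
  show "inversions ty (w_max ty n) \<subseteq> {p \<in> pos_roots ty. snd p \<le> int n}"
    by (rule inversions_subset[OF weyl_W[OF w_max_weyl] fixes_above_w_max])
  show "{p \<in> pos_roots ty. snd p \<le> int n} \<subseteq> inversions ty (w_max ty n)"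
    by (auto simp: inversions_def pos_roots_def w_max_def)
qed

lemma finite_weyl_eq: "finite_weyl ty n = {w \<in> weyl ty. fixes_above n w}"
proof
  have "fixes_above n (word_product u)" if "set u \<subseteq> finite_nodes ty n" for u
    using that
  proof (induction u)
    case (Cons i u)
    show ?case unfolding word_product_simps
      by (rule fixes_above_comp[OF refl_fixes_above]) (use Cons in auto)
  qed (simp add: fixes_above_def)
  thus "finite_weyl ty n \<subseteq> {w \<in> weyl ty. fixes_above n w}"
    using word_product_weyl finite_nodes_subset by (fastforce simp: finite_weyl_def)
  show "{w \<in> weyl ty. fixes_above n w} \<subseteq> finite_weyl ty n"
    using reduced_word_exists by (fastforce simp: finite_weyl_def)
qed

lemma root_pair_finite_nodes: "i \<in> finite_nodes ty n \<Longrightarrow> root_pair i \<in> inversions ty (w_max ty n)"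
proof -
  assume i: "i \<in> finite_nodes ty n"
  hence "root_pair i \<in> pos_roots ty" using finite_nodes_subset root_pair_pos by blast
  moreover have "snd (root_pair i) \<le> int n"
    using i by (cases i; cases ty) (auto split: if_splits)
  ultimately show ?thesis by (simp add: inversions_w_max)
qed

lemma root_pair_not_finite_nodes:
  "i \<in> nodes ty - finite_nodes ty n \<Longrightarrow> n \<ge> 1 \<Longrightarrow> root_pair i \<notin> inversions ty (w_max ty n)"
  by (cases i; cases ty) (auto simp: inversions_w_max split: if_splits)

text \<open>\<open>w_max\<close> inverts all positive roots up to \<open>n\<close>, so it has at
  least the inversions of \<open>v\<close>. If \<open>v\<close> had all of them too, then
  \<open>v \<circ> w_max ty n\<close> would have no descents and would be the identity.\<close>

lemma coxeter_length_less_w_max: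
  assumes v: "v \<in> weyl ty" "fixes_above n v" "v \<noteq> w_max ty n"
  shows "coxeter_length ty v < coxeter_length ty (w_max ty n)"
proof -
  have W: "v \<in> W_infinity" "w_max ty n \<in> W_infinity" using v w_max_weyl weyl_W by blast+
  have sub: "inversions ty v \<subseteq> inversions ty (w_max ty n)"
    using inversions_subset[OF W(1) v(2)] by (simp add: inversions_w_max)
  have "inversions ty v \<noteq> inversions ty (w_max ty n)"
  proof
    assume eq: "inversions ty v = inversions ty (w_max ty n)"
    have "v \<circ> w_max ty n = id"
    proof (rule no_descents_imp_id[of _ ty n])
      show "fixes_above n (v \<circ> w_max ty n)" by (rule fixes_above_comp[OF v(2) fixes_above_w_max])
      have "even (card (negs (v \<circ> w_max ty n)))" if ty: "ty = TypeD"
      proof -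
        obtain u where "set u \<subseteq> nodes ty" "word_product u = v" using reduced_word[OF v(1)] by metis
        moreover obtain u' where "set u' \<subseteq> nodes ty" "word_product u' = w_max ty n"
          using reduced_word[OF w_max_weyl] by metis
        ultimately have "v \<circ> w_max ty n = word_product (u @ u')" "set (u @ u') \<subseteq> nodes ty"
          by (simp_all add: word_product_append)
        thus ?thesis using word_product_weyl[of "u @ u'" ty] ty by (simp add: weyl_def')
      qed
      thus "v \<circ> w_max ty n \<in> weyl ty" using W_comp[OF W] unfolding weyl_def' by blast
    next
      fix i assume i: "i \<in> finite_nodes ty n"
      show "root_pair i \<notin> inversions ty (v \<circ> w_max ty n)"
      \<comment> \<open>In this case \<open>w_max\<close> fixes 1 and negates 2, which exchanges the
        roots of \<open>Nd 1\<close> and \<open>Hat1\<close> up to sign; the inversion of one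
        settles the other.\<close>
      proof (cases "ty = TypeD \<and> odd n \<and> (i = Hat1 \<or> i = Nd 1)")
        case True
        hence n: "n \<ge> 2" using i by (auto split: if_splits)
        hence "(1, 2) \<in> inversions ty v" "(- 1, 2) \<in> inversions ty v"
          by (auto simp: eq inversions_w_max pos_roots_def)
        hence "v 1 > v 2" "- v 1 > v 2" using W_odd[OF W(1), of 1] by (auto simp: inversions_def)
        thus ?thesis using True n W_odd[OF W(1), of 1] W_odd[OF W(1), of 2]
          by (auto simp: inversions_def w_max_def)
      next
        case False
        obtain a b where ab: "root_pair i = (a, b)" by (cases "root_pair i")
        have inv: "(a, b) \<in> inversions ty v" using root_pair_finite_nodes[OF i] eq ab by simp
        have "\<bar>a\<bar> \<le> b" "b \<le> int n" using root_pair_finite_nodes[OF i] ab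
          by (auto simp: inversions_w_max pos_roots_def)
        moreover have "\<not> (ty = TypeD \<and> odd n \<and> (\<bar>a\<bar> = 1 \<or> \<bar>b\<bar> = 1))"
          using False i ab by (cases i) (auto split: if_splits)
        ultimately have "w_max ty n a = - a" "w_max ty n b = - b" by (auto simp: w_max_def)
        thus ?thesis using inv W_odd[OF W(1)] by (auto simp: ab inversions_def)
      qed
    qed
    hence "v = w_max ty n" using w_max_involutory by (metis comp_apply ext id_apply)
    thus False using v(3) by simp
  qed
  hence "inversions ty v \<subset> inversions ty (w_max ty n)" using sub by blast
  hence "card (inversions ty v) < card (inversions ty (w_max ty n))"
    by (rule psubset_card_mono[OF finite_inversions[OF W(2)]])
  thus ?thesis using v(1) w_max_weyl by (simp add: coxeter_length_eq)
qed

lemma longest_eq: "longest ty n = w_max ty n"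
  unfolding longest_def finite_weyl_eq
proof (rule the_equality)
  show "w_max ty n \<in> {w \<in> weyl ty. fixes_above n w} \<and>
    (\<forall>v\<in>{w \<in> weyl ty. fixes_above n w}. coxeter_length ty v \<le> coxeter_length ty (w_max ty n))"
    using w_max_weyl fixes_above_w_max coxeter_length_less_w_max by (fastforce intro: less_imp_le)
next
  fix w assume "w \<in> {w \<in> weyl ty. fixes_above n w} \<and>
    (\<forall>v\<in>{w \<in> weyl ty. fixes_above n w}. coxeter_length ty v \<le> coxeter_length ty w)"
  thus "w = w_max ty n"
    using w_max_weyl[of ty n] fixes_above_w_max[of n ty] coxeter_length_less_w_max[of w ty n]
    by (metis (mono_tags, lifting) mem_Collect_eq not_less)
qed

section \<open>Conjugation by the longest element\<close>

text \<open>The automorphism of the Coxeter diagram induced by conjugation with the longest element;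
  it is nontrivial in type D for odd \<open>n\<close> only.\<close>

definition conj_node :: "lie_type \<Rightarrow> nat \<Rightarrow> node \<Rightarrow> node" where
  "conj_node ty n i = (if ty = TypeD \<and> odd n then
     (if i = Hat1 then Nd 1 else if i = Nd 1 then Hat1 else i) else i)"

lemma conj_node_finite: "i \<in> finite_nodes ty n \<Longrightarrow> conj_node ty n i \<in> finite_nodes ty n"
  by (cases ty) (auto simp: conj_node_def split: if_splits)

lemma refl_w_max:
  assumes "i \<in> finite_nodes ty n"
  shows "simple_refl i \<circ> w_max ty n = w_max ty n \<circ> simple_refl (conj_node ty n i)"
proof (cases "ty = TypeD \<and> odd n \<and> (i = Hat1 \<or> i = Nd 1)")
  case True
  hence "n \<ge> 2" using assms by (auto split: if_splits)
  moreover have "simple_refl (Nd 1) k = (if k = 1 then 2 else if k = 2 then 1 else if k = - 1 then - 2 else if k = - 2 then - 1 else k)" for k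
    by (simp add: simple_refl_nat_pos)
  ultimately show ?thesis using True
    by (auto simp: fun_eq_iff conj_node_def w_max_def simple_refl_Hat1 simp del: simple_refl.simps)
next
  case False
  hence "conj_node ty n i = i" by (auto simp: conj_node_def)
  moreover have "simple_refl i (w_max ty n k) = w_max ty n (simple_refl i k)" for k
  proof (cases i)
    case (Nd j)
    show ?thesis
    proof (cases "j = 0")
      case True
      have "n \<ge> 1" "ty \<noteq> TypeD" using assms Nd True by (cases ty; auto split: if_splits)+
      thus ?thesis using True Nd by (auto simp: w_max_def simple_refl_nat_zero)
    next
      case j: False
      have "j < n" using assms Nd by (cases ty) (auto split: if_splits)
      thus ?thesis using j Nd False by (auto simp: w_max_def simple_refl_nat_pos)
    qed
  next
    case Hat1
    have "n \<ge> 2" "ty = TypeD" using assms Hat1 by (cases ty; auto split: if_splits)+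
    thus ?thesis using False Hat1 unfolding Hat1 by (auto simp: w_max_def simple_refl_Hat1 simp del: simple_refl.simps)
  qed
  ultimately show ?thesis by (auto simp: fun_eq_iff)
qed

section \<open>Symmetrized sums\<close>

text \<open>Working with sets of field elements builds in the symmetry in the x-variables and keeps
  all denominators nonzero.\<close>

definition pair_ratio :: "'a::field \<Rightarrow> 'a set \<Rightarrow> 'a" where
  "pair_ratio x Y = (\<Prod>y\<in>Y - {x}. (x + y) / (x - y))"

text \<open>\<open>sym_sum gs G\<close> sums over all choices of distinct elements of Y, one for each row in gs;
  G is applied to the set of the elements which are left over.\<close>

fun sym_sum :: "('a::field \<Rightarrow> 'a) list \<Rightarrow> ('a set \<Rightarrow> 'a) \<Rightarrow> 'a set \<Rightarrow> 'a" where
  "sym_sum [] G Y = G Y"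
| "sym_sum (g # gs) G Y = (\<Sum>x\<in>Y. g x * pair_ratio x Y * sym_sum gs G (Y - {x}))"

lemma sym_sum_append: "sym_sum (gs @ hs) G Y = sym_sum gs (sym_sum hs G) Y"
  by (induction gs arbitrary: Y) (auto intro!: sum.cong)

text \<open>The size of the remaining sets \<open>B\<close> is recorded because closed formulas for
  the last row depend on its parity.\<close>

lemma sym_sum_cong:
  assumes "finite Y" "\<And>B. B \<subseteq> Y \<Longrightarrow> card B + length gs = card Y \<Longrightarrow> G B = G' B"
  shows "sym_sum gs G Y = sym_sum gs G' Y"
  using assms
proof (induction gs arbitrary: Y)
  case (Cons g gs)
  have "sym_sum gs G (Y - {x}) = sym_sum gs G' (Y - {x})" if x: "x \<in> Y" for x
  proof (rule Cons.IH)
    show "finite (Y - {x})" using Cons.prems(1) by simp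
    fix B assume B: "B \<subseteq> Y - {x}" "card B + length gs = card (Y - {x})"
    have "card Y = Suc (card (Y - {x}))" by (rule card.remove[OF Cons.prems(1) x])
    thus "G B = G' B" using B by (intro Cons.prems(2)) auto
  qed
  thus ?case by simp
qed simp

lemma sym_sum_linear:
  "sym_sum gs (\<lambda>B. c * G B + d * G' B) Y = c * sym_sum gs G Y + d * sym_sum gs G' Y"
proof (induction gs arbitrary: Y)
  case (Cons g gs)
  have "sym_sum (g # gs) (\<lambda>B. c * G B + d * G' B) Y
      = (\<Sum>x\<in>Y. c * (g x * pair_ratio x Y * sym_sum gs G (Y - {x}))
          + d * (g x * pair_ratio x Y * sym_sum gs G' (Y - {x})))"
    unfolding sym_sum.simps Cons by (rule sum.cong) (simp_all add: algebra_simps)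
  also have "\<dots> = c * sym_sum (g # gs) G Y + d * sym_sum (g # gs) G' Y"
    by (simp add: sum.distrib sum_distrib_left)
  finally show ?case .
qed simp

lemma sym_sum_scale: "sym_sum gs (\<lambda>B. c * G B) Y = c * sym_sum gs G Y"
  using sym_sum_linear[of gs c G 0 G Y] by simp

lemma sym_sum_diff: "sym_sum gs (\<lambda>B. G B - G' B) Y = sym_sum gs G Y - sym_sum gs G' Y"
  using sym_sum_linear[of gs 1 G "- 1" G' Y] by simp

lemma sym_sum_row_diff:
  assumes "\<And>x. g x - g' x = c * h x"
  shows "sym_sum (gs @ g # hs) G Y - sym_sum (gs @ g' # hs) G Y = c * sym_sum (gs @ h # hs) G Y"
proof -
  have "sym_sum (g # hs) G B - sym_sum (g' # hs) G B = c * sym_sum (h # hs) G B" for B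
  proof -
    have "sym_sum (g # hs) G B - sym_sum (g' # hs) G B
        = (\<Sum>x\<in>B. (g x - g' x) * pair_ratio x B * sym_sum hs G (B - {x}))"
      by (simp add: sum_subtractf[symmetric] left_diff_distrib)
    also have "\<dots> = c * sym_sum (h # hs) G B"
      unfolding assms by (simp add: sum_distrib_left mult.assoc)
    finally show ?thesis .
  qed
  hence "(\<lambda>B. sym_sum (g # hs) G B - sym_sum (g' # hs) G B) = (\<lambda>B. c * sym_sum (h # hs) G B)"
    by (rule ext)
  thus ?thesis
    unfolding sym_sum_append sym_sum_diff[symmetric] sym_sum_scale[symmetric] by simp
qed

lemma pair_ratio_remove:
  assumes "finite Y" "z \<in> Y" "z \<noteq> x"
  shows "pair_ratio x Y = (x + z) / (x - z) * pair_ratio x (Y - {z})"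
proof -
  have "pair_ratio x Y = (x + z) / (x - z) * (\<Prod>y\<in>Y - {x} - {z}. (x + y) / (x - y))"
    unfolding pair_ratio_def by (rule prod.remove) (use assms in auto)
  also have "Y - {x} - {z} = Y - {z} - {x}" by blast
  finally show ?thesis by (simp only: pair_ratio_def)
qed

lemma pair_ratio_insert:
  assumes "finite Y" "z \<notin> Y" "z \<noteq> x"
  shows "pair_ratio x (insert z Y) = (x + z) / (x - z) * pair_ratio x Y"
proof -
  have "insert z Y - {z} = Y" using assms(2) by blast
  with pair_ratio_remove[of "insert z Y" z x] assms show ?thesis by simp
qed

lemma pair_ratio_insert_self: "x \<notin> Y \<Longrightarrow> pair_ratio x (insert x Y) = (\<Prod>y\<in>Y. (x + y) / (x - y))"
  unfolding pair_ratio_def by (rule prod.cong) auto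

text \<open>Exchanging the two chosen elements only changes the sign of
  \<open>(x + z) / (x - z)\<close>, so the sum equals its own negative.\<close>

lemma sym_sum_equal_rows:
  assumes "finite Y" "(2 :: 'a::field) \<noteq> 0"
  shows "sym_sum (g # g # hs) G Y = (0 :: 'a)"
proof -
  define f where "f x z = g x * pair_ratio x Y * (g z * pair_ratio z (Y - {x}) * sym_sum hs G (Y - {x} - {z}))" for x z
  define S where "S = sym_sum (g # g # hs) G Y"
  have anti: "f x z = - f z x" if xz: "x \<in> Y" "z \<in> Y" "x \<noteq> z" for x z
  proof -
    have r: "pair_ratio x Y = (x + z) / (x - z) * pair_ratio x (Y - {z})"
      "pair_ratio z Y = (z + x) / (z - x) * pair_ratio z (Y - {x})"
      by (rule pair_ratio_remove[OF assms(1) xz(2) xz(3)[symmetric]]) (rule pair_ratio_remove[OF assms(1) xz(1,3)])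
    have s: "Y - {x} - {z} = Y - {z} - {x}" by blast
    have m: "(z + x) / (z - x) = - ((x + z) / (x - z))"
    proof -
      have "z - x = - (x - z)" by simp
      thus ?thesis by (simp only: minus_divide_right add.commute[of z x])
    qed
    have alg: "u * (a * P) * (v * Q * H) = - (v * (- a * Q) * (u * P * H))" for u v a P Q H :: 'a
      by (simp add: algebra_simps)
    show ?thesis unfolding f_def r s m by (rule alg)
  qed
  have S1: "S = (\<Sum>x\<in>Y. \<Sum>z\<in>Y. if x \<noteq> z then f x z else 0)"
  proof -
    have "S = (\<Sum>x\<in>Y. \<Sum>z\<in>Y - {x}. f x z)"
      unfolding S_def sym_sum.simps f_def sum_distrib_left ..
    also have "\<dots> = (\<Sum>x\<in>Y. \<Sum>z\<in>Y. if x \<noteq> z then f x z else 0)"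
    proof (rule sum.cong[OF refl])
      fix x assume "x \<in> Y"
      show "(\<Sum>z\<in>Y - {x}. f x z) = (\<Sum>z\<in>Y. if x \<noteq> z then f x z else 0)"
        by (rule sum.mono_neutral_cong_left) (use assms(1) in auto)
    qed
    finally show ?thesis .
  qed
  also have "\<dots> = (\<Sum>z\<in>Y. \<Sum>x\<in>Y. if x \<noteq> z then f x z else 0)"
    by (rule sum.swap)
  also have "\<dots> = (\<Sum>z\<in>Y. \<Sum>x\<in>Y. - (if z \<noteq> x then f z x else 0))"
  proof (intro sum.cong refl)
    fix z x assume zx: "z \<in> Y" "x \<in> Y"
    show "(if x \<noteq> z then f x z else 0) = - (if z \<noteq> x then f z x else 0)"
    proof (cases "x = z")
      case False
      from anti[OF zx(2,1) False] False show ?thesis by simp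
    qed simp
  qed
  also have "\<dots> = - S" unfolding S1 by (simp only: sum_negf)
  finally have e: "S = - S" .
  have "2 * S = S + S" by (rule mult_2)
  also have "\<dots> = S + - S" by (rule arg_cong[OF e])
  also have "\<dots> = 0" by (rule right_minus)
  finally have "2 * S = 0" .
  thus ?thesis using assms(2) by (simp add: S_def)
qed

lemma sym_sum_equal_rows_append:
  assumes "finite Y" "(2 :: 'a::field) \<noteq> 0"
  shows "sym_sum (gs @ g # g # hs) G Y = (0 :: 'a)"
proof -
  have "sym_sum (gs @ g # g # hs) G Y = sym_sum gs (\<lambda>_. 0) Y"
    unfolding sym_sum_append
    by (rule sym_sum_cong[OF assms(1)])
       (rule sym_sum_equal_rows[OF finite_subset[OF _ assms(1)] assms(2)])
  also have "\<dots> = 0" using sym_sum_scale[of gs 0 "\<lambda>_. 0" Y] by simp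
  finally show ?thesis .
qed

text \<open>The rows vanish at \<open>c\<close>, so \<open>c\<close> is never chosen and stays in
  the remaining set. Its presence multiplies each chosen row by \<open>(x + c) / (x - c)\<close>,
  which turns the factor \<open>x - c\<close> into \<open>x + c\<close>.\<close>

lemma sym_sum_insert_root:
  assumes "finite Y" "c \<notin> Y"
  shows "sym_sum (map (\<lambda>b x. (x - c) * b x) bs) G (insert c Y)
    = sym_sum (map (\<lambda>b x. (x + c) * b x) bs) (\<lambda>B. G (insert c B)) Y"
  using assms
proof (induction bs arbitrary: Y)
  case (Cons b bs)
  let ?L = "sym_sum (map (\<lambda>b x. (x - c) * b x) bs) G"
  let ?R = "sym_sum (map (\<lambda>b x. (x + c) * b x) bs) (\<lambda>B. G (insert c B))"
  have "sym_sum (map (\<lambda>b x. (x - c) * b x) (b # bs)) G (insert c Y)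
      = (\<Sum>x\<in>Y. (x - c) * b x * pair_ratio x (insert c Y) * ?L (insert c Y - {x}))"
    using Cons.prems by simp
  also have "\<dots> = (\<Sum>x\<in>Y. (x + c) * b x * pair_ratio x Y * ?R (Y - {x}))"
  proof (rule sum.cong[OF refl])
    fix x assume x: "x \<in> Y"
    hence ne: "c \<noteq> x" using Cons.prems(2) by auto
    have "insert c Y - {x} = insert c (Y - {x})" using ne by blast
    moreover have "?L (insert c (Y - {x})) = ?R (Y - {x})"
      using Cons.prems by (intro Cons.IH) auto
    moreover have "(x - c) * pair_ratio x (insert c Y) = (x + c) * pair_ratio x Y"
      unfolding pair_ratio_insert[OF Cons.prems ne] using ne by simp
    hence "(x - c) * b x * pair_ratio x (insert c Y) = (x + c) * b x * pair_ratio x Y"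
      by (metis (no_types, lifting) mult.assoc mult.commute)
    ultimately show "(x - c) * b x * pair_ratio x (insert c Y) * ?L (insert c Y - {x})
      = (x + c) * b x * pair_ratio x Y * ?R (Y - {x})" by simp
  qed
  finally show ?case by simp
qed simp

text \<open>The rows vanish at 0, so 0 is never chosen, and its presence contributes
  \<open>(x + 0) / (x - 0) = 1\<close>.\<close>

lemma sym_sum_insert_0:
  assumes "finite Y" "0 \<notin> Y" "\<And>g. g \<in> set gs \<Longrightarrow> g 0 = 0"
  shows "sym_sum gs (\<lambda>_. c) (insert 0 Y) = sym_sum gs (\<lambda>_. c) Y"
  using assms
proof (induction gs arbitrary: Y)
  case (Cons g gs)
  have "sym_sum (g # gs) (\<lambda>_. c) (insert 0 Y)
      = (\<Sum>x\<in>Y. g x * pair_ratio x (insert 0 Y) * sym_sum gs (\<lambda>_. c) (insert 0 Y - {x}))"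
    using Cons.prems by simp
  also have "\<dots> = (\<Sum>x\<in>Y. g x * pair_ratio x Y * sym_sum gs (\<lambda>_. c) (Y - {x}))"
  proof (rule sum.cong[OF refl])
    fix x assume x: "x \<in> Y"
    hence ne: "0 \<noteq> x" using Cons.prems(2) by auto
    have "insert 0 Y - {x} = insert 0 (Y - {x})" using ne by blast
    moreover have "sym_sum gs (\<lambda>_. c) (insert 0 (Y - {x})) = sym_sum gs (\<lambda>_. c) (Y - {x})"
      using Cons.prems by (intro Cons.IH) auto
    moreover have "pair_ratio x (insert 0 Y) = pair_ratio x Y"
      unfolding pair_ratio_insert[OF Cons.prems(1,2) ne] using ne by simp
    ultimately show "g x * pair_ratio x (insert 0 Y) * sym_sum gs (\<lambda>_. c) (insert 0 Y - {x})
      = g x * pair_ratio x Y * sym_sum gs (\<lambda>_. c) (Y - {x})" by simp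
  qed
  finally show ?case by simp
qed simp

text \<open>Choosing \<open>p\<close> or \<open>- p\<close> in the presence of the other gives the
  factor \<open>p + (- p)\<close>; for any other \<open>x\<close> the contributions of the two are
  inverse to each other.\<close>

lemma sym_sum_insert_opposite:
  assumes "finite Y" "p \<notin> Y" "- p \<notin> Y" "p \<noteq> - p"
  shows "sym_sum gs (\<lambda>_. c) (insert p (insert (- p) Y)) = sym_sum gs (\<lambda>_. c) Y"
  using assms(1-3)
proof (induction gs arbitrary: Y)
  case (Cons g gs)
  let ?Y = "insert p (insert (- p) Y)"
  have fin: "finite ?Y" using Cons.prems(1) by simp
  have z: "pair_ratio p ?Y = 0" "pair_ratio (- p) ?Y = 0"
    using pair_ratio_remove[OF fin, of "- p" p] pair_ratio_remove[OF fin, of p "- p"] assms(4) by auto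
  have "sym_sum (g # gs) (\<lambda>_. c) ?Y
      = (\<Sum>x\<in>Y. g x * pair_ratio x ?Y * sym_sum gs (\<lambda>_. c) (?Y - {x}))"
    using Cons.prems assms(4) z by simp
  also have "\<dots> = (\<Sum>x\<in>Y. g x * pair_ratio x Y * sym_sum gs (\<lambda>_. c) (Y - {x}))"
  proof (rule sum.cong[OF refl])
    fix x assume x: "x \<in> Y"
    hence ne: "p \<noteq> x" "- p \<noteq> x" using Cons.prems by auto
    have "?Y - {x} = insert p (insert (- p) (Y - {x}))" using ne by blast
    moreover have "sym_sum gs (\<lambda>_. c) (insert p (insert (- p) (Y - {x}))) = sym_sum gs (\<lambda>_. c) (Y - {x})"
      using Cons.prems by (intro Cons.IH) auto
    moreover have "pair_ratio x ?Y = pair_ratio x Y"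
    proof -
      have "p \<notin> insert (- p) Y" "finite (insert (- p) Y)" using Cons.prems assms(4) by auto
      hence "pair_ratio x ?Y = (x + p) / (x - p) * ((x + - p) / (x - - p) * pair_ratio x Y)"
        using pair_ratio_insert ne Cons.prems by metis
      moreover have "x - p \<noteq> 0" "x + p \<noteq> 0" using ne by (auto simp: add_eq_0_iff2)
      ultimately show ?thesis by simp
    qed
    ultimately show "g x * pair_ratio x ?Y * sym_sum gs (\<lambda>_. c) (?Y - {x})
      = g x * pair_ratio x Y * sym_sum gs (\<lambda>_. c) (Y - {x})" by simp
  qed
  finally show ?case by simp
qed simp

section \<open>Symmetrized sums with one row\<close>

text \<open>The partial fraction expansion in \<open>c\<close>: the product tends to 1 at infinity,
  and its residue at the simple pole \<open>y\<close> is
  \<open>2 * y * pair_ratio y B\<close>.\<close>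

lemma pair_ratio_partial_fractions:
  assumes "finite B" "c \<notin> B"
  shows "(\<Prod>y\<in>B. (c + y) / (c - y)) = (1 :: 'a::field) + (\<Sum>y\<in>B. 2 * y / (c - y) * pair_ratio y B)"
  using assms
proof (induction B arbitrary: c rule: finite_induct)
  case (insert m B)
  have cm: "c - m \<noteq> 0" using insert.prems by auto
  have mB: "m \<notin> B" using insert.hyps by simp
  have IHc: "(\<Prod>y\<in>B. (c + y) / (c - y)) = 1 + (\<Sum>y\<in>B. 2 * y / (c - y) * pair_ratio y B)"
    using insert.prems by (intro insert.IH) auto
  have IHm: "(\<Prod>y\<in>B. (m + y) / (m - y)) = 1 + (\<Sum>y\<in>B. 2 * y / (m - y) * pair_ratio y B)"
    by (rule insert.IH[OF mB])
  have tm: "(c + m) / (c - m) * (2 * y / (c - y) * pair_ratio y B)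
      = 2 * y / (c - y) * pair_ratio y (insert m B) + 2 * m / (c - m) * (2 * y / (m - y) * pair_ratio y B)"
    if y: "y \<in> B" for y
  proof -
    have ne: "c - y \<noteq> 0" "y - m \<noteq> 0" "m - y \<noteq> 0" "m \<noteq> y" using y mB insert.prems by auto
    have "(c + m) / (c - m) * (1 / (c - y)) = 1 / (c - y) * ((y + m) / (y - m)) + 2 * m / (c - m) * (1 / (m - y))"
      using ne cm by (simp add: divide_simps) (simp add: algebra_simps)
    note id = this
    have alg: "r * (w * a * P) = w * a * (k * P) + e * (w * b * P)"
      if "r * a = a * k + e * b" for r w a P k e b :: 'a
    proof -
      have "r * (w * a * P) = r * a * (w * P)" by (simp only: mult_ac)
      thus ?thesis unfolding that by (simp only: distrib_left distrib_right mult_ac)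
    qed
    have d: "2 * y / (c - y) = 2 * y * (1 / (c - y))" "2 * y / (m - y) = 2 * y * (1 / (m - y))" by simp_all
    show ?thesis unfolding pair_ratio_insert[OF insert.hyps(1) mB ne(4)] d by (rule alg[OF id])
  qed
  define e S S' Sm where "e = 2 * m / (c - m)" and "S = (\<Sum>y\<in>B. 2 * y / (c - y) * pair_ratio y B)"
    and "S' = (\<Sum>y\<in>B. 2 * y / (c - y) * pair_ratio y (insert m B))"
    and "Sm = (\<Sum>y\<in>B. 2 * y / (m - y) * pair_ratio y B)"
  have "(c + m) / (c - m) * S = S' + e * Sm"
    unfolding e_def S_def S'_def Sm_def sum_distrib_left sum.distrib[symmetric] by (rule sum.cong[OF refl tm])
  moreover have "pair_ratio m (insert m B) = 1 + Sm"
    unfolding pair_ratio_insert_self[OF mB] IHm Sm_def ..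
  moreover have "(c + m) / (c - m) = 1 + e"
    unfolding e_def using cm by (simp add: divide_simps)
  moreover have "(\<Prod>y\<in>insert m B. (c + y) / (c - y)) = (c + m) / (c - m) * (1 + S)"
    unfolding S_def IHc[symmetric] by (rule prod.insert[OF insert.hyps(1,2)])
  moreover have "(\<Sum>y\<in>insert m B. 2 * y / (c - y) * pair_ratio y (insert m B)) = e * pair_ratio m (insert m B) + S'"
    unfolding e_def S'_def by (rule sum.insert[OF insert.hyps(1,2)])
  ultimately show ?case by (simp only: distrib_left mult_1_right add.assoc add.commute add.left_commute)
qed simp

text \<open>The product belonging to the new point \<open>c\<close> is replaced by its partial
  fractions. What remains is a one-row sum over \<open>B\<close> again, which yields a recursion for
  the power sums below.\<close>

lemma sum_insert_pair_ratio:
  fixes h :: "'a::field \<Rightarrow> 'a"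
  assumes "finite B" "c \<notin> B"
  shows "(\<Sum>y\<in>insert c B. h y * pair_ratio y (insert c B))
    = h c + (\<Sum>y\<in>B. (h y * (y + c) - 2 * y * h c) / (y - c) * pair_ratio y B)"
proof -
  have tm: "h y * pair_ratio y (insert c B) + h c * (2 * y / (c - y) * pair_ratio y B)
      = (h y * (y + c) - 2 * y * h c) / (y - c) * pair_ratio y B" if "y \<in> B" for y
  proof -
    have ne: "c \<noteq> y" "y - c \<noteq> 0" "c - y \<noteq> 0" using that assms(2) by auto
    have "h y * ((y + c) / (y - c)) + h c * (2 * y / (c - y)) = (h y * (y + c) - 2 * y * h c) / (y - c)"
      using ne by (simp add: divide_simps) (simp add: algebra_simps)
    hence "pair_ratio y B * (h y * ((y + c) / (y - c)) + h c * (2 * y / (c - y)))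
        = pair_ratio y B * ((h y * (y + c) - 2 * y * h c) / (y - c))"
      by (rule arg_cong)
    thus ?thesis unfolding pair_ratio_insert[OF assms ne(1)] by (simp add: algebra_simps)
  qed
  have "(\<Sum>y\<in>insert c B. h y * pair_ratio y (insert c B))
      = h c * (1 + (\<Sum>y\<in>B. 2 * y / (c - y) * pair_ratio y B)) + (\<Sum>y\<in>B. h y * pair_ratio y (insert c B))"
    unfolding sum.insert[OF assms] pair_ratio_insert_self[OF assms(2)] pair_ratio_partial_fractions[OF assms] ..
  also have "\<dots> = h c + (\<Sum>y\<in>B. h y * pair_ratio y (insert c B) + h c * (2 * y / (c - y) * pair_ratio y B))"
    by (simp add: distrib_left sum_distrib_left sum.distrib)
  also have "(\<Sum>y\<in>B. h y * pair_ratio y (insert c B) + h c * (2 * y / (c - y) * pair_ratio y B))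
      = (\<Sum>y\<in>B. (h y * (y + c) - 2 * y * h c) / (y - c) * pair_ratio y B)"
    by (rule sum.cong[OF refl tm])
  finally show ?thesis .
qed

text \<open>Adding a point replaces the sum by 1 minus itself. In type D this is the obstruction to
  adding a single variable with value 0.\<close>

lemma sum_pair_ratio_0:
  assumes "finite B"
  shows "(\<Sum>y\<in>B. pair_ratio y B) = (if odd (card B) then 1 else 0 :: 'a::field)"
  using assms
proof (induction B rule: finite_induct)
  case (insert c B)
  have "(\<Sum>y\<in>B. (1 * (y + c) - 2 * y * 1) / (y - c) * pair_ratio y B) = (\<Sum>y\<in>B. - pair_ratio y B)"
  proof (rule sum.cong[OF refl])
    fix y assume "y \<in> B"
    hence "y - c \<noteq> 0" using insert.hyps by auto
    thus "(1 * (y + c) - 2 * y * 1) / (y - c) * pair_ratio y B = - pair_ratio y B"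
      by (simp add: divide_simps) (simp add: algebra_simps)
  qed
  with sum_insert_pair_ratio[OF insert.hyps(1,2), of "\<lambda>_. 1"] insert
  show ?case by (simp add: sum_negf)
qed simp

lemma sum_pair_ratio_1:
  assumes "finite B"
  shows "(\<Sum>y\<in>B. y * pair_ratio y B) = (\<Sum>B :: 'a::field)"
  using assms
proof (induction B rule: finite_induct)
  case (insert c B)
  have "(\<Sum>y\<in>B. (y * (y + c) - 2 * y * c) / (y - c) * pair_ratio y B) = (\<Sum>y\<in>B. y * pair_ratio y B)"
  proof (rule sum.cong[OF refl])
    fix y assume "y \<in> B"
    hence "y - c \<noteq> 0" using insert.hyps by auto
    hence "(y * (y + c) - 2 * y * c) / (y - c) = y"
      by (simp add: divide_simps) (simp add: algebra_simps)
    thus "(y * (y + c) - 2 * y * c) / (y - c) * pair_ratio y B = y * pair_ratio y B" by simp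
  qed
  with sum_insert_pair_ratio[OF insert.hyps(1,2), of "\<lambda>y. y"] insert show ?case by simp
qed simp

text \<open>The fraction in the recursion reduces to \<open>y^2 + 2 c y\<close>, so the recursion is
  that of the square of \<open>\<Sum>B + c\<close>.\<close>

lemma sum_pair_ratio_2:
  assumes "finite B"
  shows "(\<Sum>y\<in>B. y * y * pair_ratio y B) = (\<Sum>B :: 'a::field) * \<Sum>B"
  using assms
proof (induction B rule: finite_induct)
  case (insert c B)
  have "(\<Sum>y\<in>B. (y * y * (y + c) - 2 * y * (c * c)) / (y - c) * pair_ratio y B)
      = (\<Sum>y\<in>B. y * y * pair_ratio y B + 2 * c * (y * pair_ratio y B))"
  proof (rule sum.cong[OF refl])
    fix y assume "y \<in> B"
    hence "y - c \<noteq> 0" using insert.hyps by auto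
    hence "(y * y * (y + c) - 2 * y * (c * c)) / (y - c) = y * y + 2 * c * y"
      by (simp add: divide_simps) (simp add: algebra_simps)
    thus "(y * y * (y + c) - 2 * y * (c * c)) / (y - c) * pair_ratio y B
        = y * y * pair_ratio y B + 2 * c * (y * pair_ratio y B)" by (simp add: algebra_simps)
  qed
  also have "\<dots> = \<Sum>B * \<Sum>B + 2 * c * \<Sum>B"
    unfolding sum.distrib sum_distrib_left[symmetric] sum_pair_ratio_1[OF insert.hyps(1)] insert.IH ..
  finally show ?case
    using sum_insert_pair_ratio[OF insert.hyps(1,2), of "\<lambda>y. y * y"] insert.hyps by (simp add: algebra_simps)
qed simp

lemma sym_sum_quadratic:
  fixes B :: "'a::field set"
  assumes "finite B"
  shows "sym_sum [\<lambda>x. (x - p) * (x - q)] (\<lambda>_. 1) B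
    = \<Sum>B * \<Sum>B - (p + q) * \<Sum>B + p * q * (if odd (card B) then 1 else 0)"
proof -
  have "sym_sum [\<lambda>x. (x - p) * (x - q)] (\<lambda>_. 1) B
      = (\<Sum>y\<in>B. y * y * pair_ratio y B - (p + q) * (y * pair_ratio y B) + p * q * pair_ratio y B)"
    by (simp add: algebra_simps)
  also have "\<dots> = \<Sum>B * \<Sum>B - (p + q) * \<Sum>B + p * q * (if odd (card B) then 1 else 0)"
    unfolding sum.distrib sum_subtractf sum_distrib_left[symmetric]
      sum_pair_ratio_0[OF assms] sum_pair_ratio_1[OF assms] sum_pair_ratio_2[OF assms] ..
  finally show ?thesis .
qed

lemma sym_sum_affine:
  fixes B :: "'a::field set"
  assumes "finite B"
  shows "sym_sum [\<lambda>x. x - q] (\<lambda>_. 1) B = \<Sum>B - q * (if odd (card B) then 1 else 0)"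
proof -
  have "sym_sum [\<lambda>x. x - q] (\<lambda>_. 1) B = (\<Sum>y\<in>B. y * pair_ratio y B - q * pair_ratio y B)"
    by (simp add: algebra_simps)
  thus ?thesis
    unfolding sum_subtractf sum_distrib_left[symmetric] sum_pair_ratio_0[OF assms] sum_pair_ratio_1[OF assms] .
qed

section \<open>The factorial functions of staircase shape\<close>

text \<open>The parameters \<open>t\<^sub>j\<close> and \<open>-z\<^sub>j\<close> are abstracted to p and q, between which the function is symmetric.\<close>

definition stair_row :: "lie_type \<Rightarrow> (nat \<Rightarrow> 'a::field) \<Rightarrow> (nat \<Rightarrow> 'a) \<Rightarrow> nat \<Rightarrow> 'a \<Rightarrow> 'a" where
  "stair_row ty p q k x = (if ty = TypeC then x else 1) * (\<Prod>j\<in>{1..k}. (x - p j) * (x - q j))"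

text \<open>Row \<open>k\<close> belongs to the part \<open>2 k + 1\<close> in type C and
  \<open>2 k\<close> in type D; the smallest part is 1 resp. 2.\<close>

definition low_row :: "lie_type \<Rightarrow> nat" where
  "low_row ty = (if ty = TypeC then 0 else 1)"

definition stair :: "lie_type \<Rightarrow> (nat \<Rightarrow> 'a::field) \<Rightarrow> (nat \<Rightarrow> 'a) \<Rightarrow> nat \<Rightarrow> 'a set \<Rightarrow> 'a" where
  "stair ty p q n Y = sym_sum (map (stair_row ty p q) (rev [low_row ty..<n])) (\<lambda>_. 1) Y"

lemma low_row_simps [simp]: "low_row TypeC = 0" "low_row TypeD = 1"
  by (simp_all add: low_row_def)

lemma stair_row_commute: "stair_row ty p q = stair_row ty q p"
  by (intro ext) (simp add: stair_row_def mult.commute)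

lemma stair_commute: "stair ty p q n Y = stair ty q p n Y"
  unfolding stair_def stair_row_commute[of ty p q] ..

lemma stair_row_Suc: "stair_row ty p q (Suc k) x = stair_row ty p q k x * ((x - p (Suc k)) * (x - q (Suc k)))"
  by (simp add: stair_row_def mult.assoc)

lemma stair_row_cong: "(\<And>j. 1 \<le> j \<Longrightarrow> j \<le> k \<Longrightarrow> p j = p' j) \<Longrightarrow> stair_row ty p q k = stair_row ty p' q k"
  by (intro ext) (simp add: stair_row_def)

lemma stair_row_permute:
  assumes "\<pi> permutes {1..k}"
  shows "stair_row ty (p \<circ> \<pi>) q k = stair_row ty p q k"
proof
  fix x
  have "(\<Prod>j\<in>{1..k}. x - p (\<pi> j)) = (\<Prod>j\<in>{1..k}. x - p j)"
    by (rule prod.permute[OF assms, of "\<lambda>j. x - p j", unfolded comp_def, symmetric])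
  thus "stair_row ty (p \<circ> \<pi>) q k x = stair_row ty p q k x"
    by (simp add: stair_row_def prod.distrib)
qed

lemma upt_split: "l \<le> i \<Longrightarrow> i < n \<Longrightarrow> rev [l..<n] = rev [Suc i..<n] @ i # rev [l..<i]"
proof -
  assume "l \<le> i" "i < n"
  hence "[l..<n] = [l..<i] @ [i..<n]" "[i..<n] = i # [Suc i..<n]"
    using upt_add_eq_append[of l i "n - i"] upt_conv_Cons[of i n] by auto
  thus ?thesis by simp
qed

text \<open>Rows below \<open>i\<close> contain neither \<open>p i\<close> nor
  \<open>p (Suc i)\<close> and rows above \<open>i\<close> contain both. Only row \<open>i\<close>
  changes, where \<open>x - p i\<close> becomes \<open>x - p (Suc i)\<close>.\<close>

lemma stair_swap:
  assumes "1 \<le> i" "i < n"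
  shows "stair ty p q n Y - stair ty (p \<circ> transpose i (Suc i)) q n Y
    = (p (Suc i) - p i) * sym_sum (map (stair_row ty p q) (rev [Suc i..<n]) @
        (\<lambda>x. stair_row ty p q (i - 1) x * (x - q i)) # map (stair_row ty p q) (rev [low_row ty..<i])) (\<lambda>_. 1) Y"
proof -
  let ?p = "p \<circ> transpose i (Suc i)"
  have li: "low_row ty \<le> i" using assms(1) by (simp add: low_row_def)
  have hi: "map (stair_row ty ?p q) (rev [Suc i..<n]) = map (stair_row ty p q) (rev [Suc i..<n])"
  proof (rule map_cong[OF refl])
    fix k assume "k \<in> set (rev [Suc i..<n])"
    hence "transpose i (Suc i) permutes {1..k}" using assms(1) by (intro permutes_swap_id) auto
    thus "stair_row ty ?p q k = stair_row ty p q k" by (rule stair_row_permute)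
  qed
  have lo': "stair_row ty ?p q k = stair_row ty p q k" if "k < i" for k
    by (rule stair_row_cong) (use that in \<open>auto simp: transpose_def\<close>)
  hence lo: "map (stair_row ty ?p q) (rev [low_row ty..<i]) = map (stair_row ty p q) (rev [low_row ty..<i])"
    by (intro map_cong[OF refl]) simp
  have row: "stair_row ty p q i x - stair_row ty ?p q i x
      = (p (Suc i) - p i) * (stair_row ty p q (i - 1) x * (x - q i))" for x
  proof -
    obtain m where m: "i = Suc m" using assms(1) by (cases i) auto
    have "stair_row ty ?p q m x = stair_row ty p q m x" using lo'[of m] m by simp
    thus ?thesis unfolding m by (simp add: stair_row_Suc algebra_simps)
  qed
  show ?thesis
    unfolding stair_def upt_split[OF li assms(2)] map_append list.map hi lo
    by (rule sym_sum_row_diff[OF row])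
qed

text \<open>The quotients for \<open>p\<close> and \<open>q\<close> differ in one row, which is row
  \<open>i - 1\<close> times \<open>x - q i\<close> resp. \<open>x - p i\<close>. The difference of
  these is a multiple of row \<open>i - 1\<close>, which already stands next to it, so the sum with
  two equal rows vanishes.\<close>

lemma stair_swap_symmetric:
  fixes p q :: "nat \<Rightarrow> 'a::field"
  assumes "low_row ty < i" "i < n" "finite Y" "(2 :: 'a::field) \<noteq> 0"
  obtains G :: 'a where
    "stair ty p q n Y - stair ty (p \<circ> transpose i (Suc i)) q n Y = (p (Suc i) - p i) * G"
    "stair ty p q n Y - stair ty p (q \<circ> transpose i (Suc i)) n Y = (q (Suc i) - q i) * G"
proof -
  have i: "1 \<le> i" using assms(1) by simp
  let ?pre = "map (stair_row ty p q) (rev [Suc i..<n])" and ?post = "map (stair_row ty p q) (rev [low_row ty..<i])"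
  define G where "G c = sym_sum (?pre @ (\<lambda>x. stair_row ty p q (i - 1) x * (x - c)) # ?post) (\<lambda>_. 1) Y" for c
  have "?post = stair_row ty p q (i - 1) # map (stair_row ty p q) (rev [low_row ty..<i - 1])"
    using assms(1) upt_split[of "low_row ty" "i - 1" i] i by simp
  hence "G (q i) - G (p i) = (p i - q i) * 0"
    unfolding G_def
    by (subst sym_sum_row_diff[where c = "p i - q i" and h = "stair_row ty p q (i - 1)"])
       (auto simp: sym_sum_equal_rows_append[OF assms(3,4)] algebra_simps)
  hence eq: "G (q i) = G (p i)" by simp
  have 1: "stair ty p q n Y - stair ty (p \<circ> transpose i (Suc i)) q n Y = (p (Suc i) - p i) * G (q i)"
    unfolding G_def by (rule stair_swap[OF i assms(2)])
  have "stair ty q p n Y - stair ty (q \<circ> transpose i (Suc i)) p n Y = (q (Suc i) - q i) * G (p i)"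
    unfolding G_def stair_row_commute[of ty p q] by (rule stair_swap[OF i assms(2)])
  hence 2: "stair ty p q n Y - stair ty p (q \<circ> transpose i (Suc i)) n Y = (q (Suc i) - q i) * G (q i)"
    unfolding eq stair_commute[of ty q p] stair_commute[of ty "q \<circ> transpose i (Suc i)" p] .
  show thesis by (rule that[OF 1 2])
qed

lemma stair_row_factor:
  assumes "1 \<le> k"
  shows "stair_row ty p q k x = (x - p 1) * ((if ty = TypeC then x else 1) * (x - q 1) * (\<Prod>j\<in>{2..k}. (x - p j) * (x - q j)))"
proof -
  have "{1..k} = insert 1 {2..k}" using assms by auto
  thus ?thesis by (simp add: stair_row_def)
qed

text \<open>All rows but the last contain \<open>x - p 1\<close>. Inserting \<open>- p 1\<close>
  exactly reverts the change of sign of \<open>p 1\<close> in them, and only the last row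
  \<open>x\<close>, whose sum is \<open>\<Sum>B\<close>, notices the inserted element. The resulting
  quotient is symmetric in \<open>p\<close> and \<open>q\<close>.\<close>

lemma stair_C_insert:
  fixes p q :: "nat \<Rightarrow> 'a::field"
  assumes "1 \<le> n" "finite Y" "- p 1 \<notin> Y"
  shows "stair TypeC p q n Y - stair TypeC (p(1 := - p 1)) q n (insert (- p 1) Y)
    = p 1 * sym_sum (map (stair_row TypeC p q) (rev [1..<n])) (\<lambda>_. 1) Y"
proof -
  let ?c = "- p 1"
  define b where "b k x = x * (x - q 1) * (\<Prod>j\<in>{2..k}. (x - p j) * (x - q j))" for k x
  have up: "rev [0..<n] = rev [1..<n] @ [0]"
    using upt_conv_Cons[of 0 n] assms(1) by simp
  have rows: "map (stair_row TypeC p q) (rev [1..<n]) = map (\<lambda>b x. (x + ?c) * b x) (map b (rev [1..<n]))"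
    "map (stair_row TypeC (p(1 := ?c)) q) (rev [1..<n]) = map (\<lambda>b x. (x - ?c) * b x) (map b (rev [1..<n]))"
    unfolding map_map by (auto simp: fun_eq_iff stair_row_factor b_def)
  have last: "stair_row TypeC p' q 0 = (\<lambda>x. x - 0)" for p' :: "nat \<Rightarrow> 'a"
    by (auto simp: stair_row_def)
  have base: "sym_sum [\<lambda>x. x - 0] (\<lambda>_. 1) B = \<Sum>B" if "finite B" for B :: "'a set"
    using sym_sum_affine[OF that, of 0] by simp
  have "stair TypeC (p(1 := ?c)) q n (insert ?c Y)
      = sym_sum (map (\<lambda>b x. (x - ?c) * b x) (map b (rev [1..<n]))) (sym_sum [\<lambda>x. x - 0] (\<lambda>_. 1)) (insert ?c Y)"
    unfolding stair_def low_row_simps up map_append sym_sum_append rows(2) list.map last ..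
  also have "\<dots> = sym_sum (map (stair_row TypeC p q) (rev [1..<n])) (\<lambda>B. sym_sum [\<lambda>x. x - 0] (\<lambda>_. 1) (insert ?c B)) Y"
    unfolding rows(1) by (rule sym_sum_insert_root[OF assms(2,3)])
  also have "\<dots> = sym_sum (map (stair_row TypeC p q) (rev [1..<n])) (\<lambda>B. 1 * sym_sum [\<lambda>x. x - 0] (\<lambda>_. 1) B + ?c * 1) Y"
  proof (rule sym_sum_cong[OF assms(2)])
    fix B assume B: "B \<subseteq> Y"
    hence "finite B" "?c \<notin> B" using assms(2,3) finite_subset by auto
    thus "sym_sum [\<lambda>x. x - 0] (\<lambda>_. 1) (insert ?c B) = 1 * sym_sum [\<lambda>x. x - 0] (\<lambda>_. 1) B + ?c * 1"
      using base[of B] base[of "insert ?c B"] by (simp del: sym_sum.simps)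
  qed
  also have "\<dots> = 1 * sym_sum (map (stair_row TypeC p q) (rev [1..<n])) (sym_sum [\<lambda>x. x - 0] (\<lambda>_. 1)) Y
      + ?c * sym_sum (map (stair_row TypeC p q) (rev [1..<n])) (\<lambda>_. 1) Y"
    by (rule sym_sum_linear)
  also have "sym_sum (map (stair_row TypeC p q) (rev [1..<n])) (sym_sum [\<lambda>x. x - 0] (\<lambda>_. 1)) Y = stair TypeC p q n Y"
    unfolding stair_def low_row_simps up map_append sym_sum_append list.map last ..
  finally have e: "stair TypeC (p(1 := ?c)) q n (insert ?c Y)
      = 1 * stair TypeC p q n Y + ?c * sym_sum (map (stair_row TypeC p q) (rev [1..<n])) (\<lambda>_. 1) Y" .
  show ?thesis unfolding e by simp
qed

text \<open>No row lies below row 1 here, so the changed row \<open>x - q 1\<close> comes last and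
  is summed in closed form. As \<open>card Y\<close> is even and \<open>n - 2\<close> elements have
  been chosen before, the parity involved is that of \<open>n\<close>.\<close>

lemma stair_D_swap_1:
  assumes "2 \<le> n" "finite Y" "even (card Y)"
  shows "stair TypeD p q n Y - stair TypeD (p \<circ> transpose 1 2) q n Y
    = (p 2 - p 1) * sym_sum (map (stair_row TypeD p q) (rev [2..<n])) (\<lambda>B. \<Sum>B - q 1 * (if odd n then 1 else 0)) Y"
proof -
  have "sym_sum (map (stair_row TypeD p q) (rev [2..<n]) @ [\<lambda>x. x - q 1]) (\<lambda>_. 1) Y
      = sym_sum (map (stair_row TypeD p q) (rev [2..<n])) (\<lambda>B. \<Sum>B - q 1 * (if odd n then 1 else 0)) Y"
    unfolding sym_sum_append
  proof (rule sym_sum_cong[OF assms(2)])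
    fix B assume B: "B \<subseteq> Y" "card B + length (map (stair_row TypeD p q) (rev [2..<n])) = card Y"
    have "card B + (n - 2) = card Y" using B(2) by simp
    hence "odd (card B) \<longleftrightarrow> odd n" using assms(1,3) by presburger
    thus "sym_sum [\<lambda>x. x - q 1] (\<lambda>_. 1) B = \<Sum>B - q 1 * (if odd n then 1 else 0)"
      using sym_sum_affine[OF finite_subset[OF B(1) assms(2)], of "q 1"] by simp
  qed
  moreover have "(\<lambda>x. stair_row TypeD p q (1 - 1) x * (x - q 1)) = (\<lambda>x. x - q 1)"
    by (simp add: stair_row_def)
  ultimately show ?thesis
    using stair_swap[of 1 n TypeD p q Y] assms(1) by (simp add: low_row_def numeral_2_eq_2)
qed

text \<open>Two insertions revert the changes in all rows but row 1, which is summed in closed form.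
  For even \<open>n\<close> the quotient is symmetric in \<open>p\<close> and \<open>q\<close>; for
  odd \<open>n\<close> it is that of \<open>stair_D_swap_1\<close> with \<open>p\<close> and
  \<open>q\<close> exchanged, in accordance with \<open>conj_node\<close>.\<close>

lemma stair_D_insert:
  fixes p q :: "nat \<Rightarrow> 'a::field"
  assumes "2 \<le> n" "finite Y" "even (card Y)" "- p 1 \<notin> Y" "- p 2 \<notin> Y" "p 1 \<noteq> p 2"
  shows "stair TypeD p q n Y - stair TypeD (p(1 := - p 2, 2 := - p 1)) q n (insert (- p 1) (insert (- p 2) Y))
    = (p 1 + p 2) * sym_sum (map (stair_row TypeD p q) (rev [2..<n]))
        (\<lambda>B. \<Sum>B - p 1 - q 1 * (if odd n then 0 else 1)) Y"
proof -
  let ?c = "- p 1" and ?d = "- p 2" and ?p = "p(1 := - p 2, 2 := - p 1)"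
  define b where "b k x = (x - q 1) * (x - q 2) * (\<Prod>j\<in>{3..k}. (x - p j) * (x - q j))" for k x
  have up: "rev [1..<n] = rev [2..<n] @ [1]"
    using upt_conv_Cons[of 1 n] assms(1) by (simp add: numeral_2_eq_2)
  have prod2: "stair_row TypeD p' q k x = (x - p' 1) * (x - p' 2) * ((x - q 1) * (x - q 2) * (\<Prod>j\<in>{3..k}. (x - p' j) * (x - q j)))"
    if "2 \<le> k" for p' :: "nat \<Rightarrow> 'a" and k x
  proof -
    have "{1..k} = insert 1 (insert 2 {3..k})" using that by auto
    thus ?thesis by (simp add: stair_row_def mult_ac)
  qed
  let ?bs = "map b (rev [2..<n])"
  let ?bc = "map (\<lambda>b x. (x - ?d) * b x) ?bs" and ?bd = "map (\<lambda>b x. (x + ?c) * b x) ?bs"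
  \<comment> \<open>Each rewriting puts the factor affected by the next insertion in front, for
    \<open>- p 1\<close> and then for \<open>- p 2\<close>. In rows of index at least 2 both
    parameters occur, so their order is irrelevant.\<close>
  have r1: "map (stair_row TypeD ?p q) (rev [2..<n]) = map (\<lambda>b x. (x - ?c) * b x) ?bc"
    unfolding map_map by (auto simp: fun_eq_iff prod2 b_def mult_ac)
  have r2: "map (\<lambda>b x. (x + ?c) * b x) ?bc = map (\<lambda>b x. (x - ?d) * b x) ?bd"
    unfolding map_map by (auto simp: fun_eq_iff mult_ac)
  have r3: "map (\<lambda>b x. (x + ?d) * b x) ?bd = map (stair_row TypeD p q) (rev [2..<n])"
    unfolding map_map by (auto simp: fun_eq_iff prod2 b_def mult_ac)
  let ?rows = "map (stair_row TypeD p q) (rev [2..<n])"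
  let ?G = "sym_sum [\<lambda>x. (x - ?d) * (x - q 1)] (\<lambda>_. 1)" and ?H = "sym_sum [\<lambda>x. (x - p 1) * (x - q 1)] (\<lambda>_. 1)"
  have last: "stair_row TypeD p' q 1 = (\<lambda>x. (x - p' 1) * (x - q 1))" for p' :: "nat \<Rightarrow> 'a"
    by (auto simp: stair_row_def)
  have "stair TypeD ?p q n (insert ?c (insert ?d Y)) = sym_sum (map (\<lambda>b x. (x - ?c) * b x) ?bc) ?G (insert ?c (insert ?d Y))"
  proof -
    have "?p 1 = ?d" by simp
    thus ?thesis
      unfolding stair_def low_row_simps up map_append sym_sum_append r1 list.map last by (simp only:)
  qed
  also have "\<dots> = sym_sum (map (\<lambda>b x. (x + ?c) * b x) ?bc) (\<lambda>B. ?G (insert ?c B)) (insert ?d Y)"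
    by (rule sym_sum_insert_root) (use assms in auto)
  also have "\<dots> = sym_sum (map (\<lambda>b x. (x - ?d) * b x) ?bd) (\<lambda>B. ?G (insert ?c B)) (insert ?d Y)"
    unfolding r2 ..
  also have "\<dots> = sym_sum (map (\<lambda>b x. (x + ?d) * b x) ?bd) (\<lambda>B. ?G (insert ?c (insert ?d B))) Y"
    by (rule sym_sum_insert_root) (use assms in auto)
  also have "\<dots> = sym_sum ?rows (\<lambda>B. ?G (insert ?c (insert ?d B))) Y"
    unfolding r3 ..
  finally have e1: "stair TypeD ?p q n (insert ?c (insert ?d Y)) = sym_sum ?rows (\<lambda>B. ?G (insert ?c (insert ?d B))) Y" .
  have e2: "stair TypeD p q n Y = sym_sum ?rows ?H Y"
    unfolding stair_def low_row_simps up map_append sym_sum_append list.map last ..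
  have "stair TypeD p q n Y - stair TypeD ?p q n (insert ?c (insert ?d Y))
      = sym_sum ?rows (\<lambda>B. ?H B - ?G (insert ?c (insert ?d B))) Y"
    unfolding e1 e2 by (rule sym_sum_diff[symmetric])
  also have "\<dots> = sym_sum ?rows (\<lambda>B. (p 1 + p 2) * (\<Sum>B - p 1 - q 1 * (if odd n then 0 else 1))) Y"
  proof (rule sym_sum_cong[OF assms(2)])
    fix B assume B: "B \<subseteq> Y" "card B + length ?rows = card Y"
    have fin: "finite B" by (rule finite_subset[OF B(1) assms(2)])
    have nin: "?d \<notin> B" "?c \<notin> insert ?d B" using B(1) assms by auto
    have "card B + (n - 2) = card Y" using B(2) by simp
    hence par: "odd (card B) \<longleftrightarrow> odd n" using assms(1,3) by presburger
    have card: "card (insert ?c (insert ?d B)) = Suc (Suc (card B))" using fin nin by simp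
    have sum: "\<Sum>(insert ?c (insert ?d B)) = ?c + (?d + \<Sum>B)" using fin nin by simp
    show "?H B - ?G (insert ?c (insert ?d B)) = (p 1 + p 2) * (\<Sum>B - p 1 - q 1 * (if odd n then 0 else 1))"
      unfolding sym_sum_quadratic[OF fin] sym_sum_quadratic[OF finite.insertI[OF finite.insertI[OF fin]]] sum card
      using par by (cases "odd n") (simp_all add: algebra_simps)
  qed
  also have "\<dots> = (p 1 + p 2) * sym_sum ?rows (\<lambda>B. \<Sum>B - p 1 - q 1 * (if odd n then 0 else 1)) Y"
    by (rule sym_sum_scale)
  finally show ?thesis .
qed

section \<open>Localization of the staircase functions\<close>

text \<open>The parameters \<open>q\<close> are the x-values themselves, so the top row vanishes at
  \<open>y 1, ..., y n\<close> and can only choose \<open>y (Suc n)\<close>.\<close>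

lemma stair_localize_step:
  fixes y p :: "nat \<Rightarrow> 'a::field"
  assumes inj: "inj_on y {1..Suc n}" and J: "J \<subseteq> {1..Suc n}" and low: "low_row ty \<le> n"
  shows "stair ty p y (Suc n) (y ` J) = (if Suc n \<in> J then
      stair_row ty p y n (y (Suc n)) * (\<Prod>j\<in>J - {Suc n}. (y (Suc n) + y j) / (y (Suc n) - y j))
        * stair ty p y n (y ` (J - {Suc n})) else 0)"
proof -
  let ?R = "\<lambda>Y. sym_sum (map (stair_row ty p y) (rev [low_row ty..<n])) (\<lambda>_. 1) Y"
  have injJ: "inj_on y J" using inj J by (rule inj_on_subset)
  have finJ: "finite J" using J finite_subset by blast
  have 0: "stair_row ty p y n (y j) = 0" if "j \<in> J" "j \<noteq> Suc n" for j
  proof -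
    have "j \<in> {1..n}" using that J by force
    hence "(\<Prod>i\<in>{1..n}. (y j - p i) * (y j - y i)) = 0" by (intro prod_zero) auto
    thus ?thesis by (simp add: stair_row_def)
  qed
  have "stair ty p y (Suc n) (y ` J)
      = (\<Sum>j\<in>J. stair_row ty p y n (y j) * pair_ratio (y j) (y ` J) * ?R (y ` J - {y j}))"
    unfolding stair_def using low sum.reindex[OF injJ] by (simp add: comp_def)
  also have "\<dots> = (\<Sum>j\<in>J \<inter> {Suc n}. stair_row ty p y n (y j) * pair_ratio (y j) (y ` J) * ?R (y ` J - {y j}))"
    by (rule sum.mono_neutral_right) (use finJ 0 in auto)
  also have "\<dots> = (if Suc n \<in> J then
      stair_row ty p y n (y (Suc n)) * pair_ratio (y (Suc n)) (y ` J) * ?R (y ` J - {y (Suc n)}) else 0)"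
    by simp
  finally have main: "stair ty p y (Suc n) (y ` J) = (if Suc n \<in> J then
      stair_row ty p y n (y (Suc n)) * pair_ratio (y (Suc n)) (y ` J) * ?R (y ` J - {y (Suc n)}) else 0)" .
  show ?thesis
  proof (cases "Suc n \<in> J")
    case True
    have img: "y ` J - {y (Suc n)} = y ` (J - {Suc n})" using inj_on_image_set_diff[OF injJ, of J "{Suc n}"] True by auto
    have injJ': "inj_on y (J - {Suc n})" using injJ by (rule inj_on_subset) blast
    have "pair_ratio (y (Suc n)) (y ` J) = (\<Prod>j\<in>J - {Suc n}. (y (Suc n) + y j) / (y (Suc n) - y j))"
      unfolding pair_ratio_def img prod.reindex[OF injJ'] comp_def ..
    thus ?thesis using main True unfolding img stair_def by simp
  qed (use main in simp)
qed

lemma prod_cancel_ratio: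
  fixes y p :: "nat \<Rightarrow> 'a::field"
  assumes "inj_on y {1..Suc n}"
  shows "(\<Prod>j\<in>{1..n}. (y (Suc n) - p j) * (y (Suc n) - y j)) * (\<Prod>j\<in>{1..n}. (y (Suc n) + y j) / (y (Suc n) - y j))
    = (\<Prod>j\<in>{1..n}. (y (Suc n) - p j) * (y (Suc n) + y j))"
  unfolding prod.distrib[symmetric]
proof (rule prod.cong[OF refl])
  fix j assume "j \<in> {1..n}"
  hence "y (Suc n) \<noteq> y j" using inj_onD[OF assms, of "Suc n" j] by auto
  thus "(y (Suc n) - p j) * (y (Suc n) - y j) * ((y (Suc n) + y j) / (y (Suc n) - y j))
    = (y (Suc n) - p j) * (y (Suc n) + y j)" by simp
qed

text \<open>Iterating the step, the \<open>n\<close> rows must choose \<open>y n, ..., y 1\<close>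
  in this order, so a missing index gives 0. The denominators cancel against the factors
  \<open>y k - y j\<close> of the rows.\<close>

lemma stair_C_localize:
  fixes y p :: "nat \<Rightarrow> 'a::field"
  assumes "inj_on y {1..n}" "J \<subseteq> {1..n}"
  shows "stair TypeC p y n (y ` J) = (if J = {1..n} then
      \<Prod>k\<in>{1..n}. y k * (\<Prod>j\<in>{1..<k}. (y k - p j) * (y k + y j)) else 0)"
  using assms
proof (induction n arbitrary: J)
  case 0
  thus ?case by (simp add: stair_def)
next
  case (Suc n)
  have step: "stair TypeC p y (Suc n) (y ` J) = (if Suc n \<in> J then
      stair_row TypeC p y n (y (Suc n)) * (\<Prod>j\<in>J - {Suc n}. (y (Suc n) + y j) / (y (Suc n) - y j))
        * stair TypeC p y n (y ` (J - {Suc n})) else 0)"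
    by (rule stair_localize_step[OF Suc.prems]) (simp add: low_row_def)
  have IH: "stair TypeC p y n (y ` (J - {Suc n})) = (if J - {Suc n} = {1..n} then
      \<Prod>k\<in>{1..n}. y k * (\<Prod>j\<in>{1..<k}. (y k - p j) * (y k + y j)) else 0)"
  proof (rule Suc.IH)
    show "inj_on y {1..n}" by (rule inj_on_subset[OF Suc.prems(1)]) auto
    show "J - {Suc n} \<subseteq> {1..n}"
    proof
      fix x assume "x \<in> J - {Suc n}"
      hence "x \<in> {1..Suc n}" "x \<noteq> Suc n" using Suc.prems(2) by auto
      thus "x \<in> {1..n}" by auto
    qed
  qed
  have J: "J = {1..Suc n} \<longleftrightarrow> Suc n \<in> J \<and> J - {Suc n} = {1..n}"
  proof -
    have ins: "{1..Suc n} = insert (Suc n) {1..n}" and nin: "Suc n \<notin> {1..n}" by auto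
    show ?thesis unfolding ins
    proof (rule iffI)
      assume e: "J = insert (Suc n) {1..n}"
      show "Suc n \<in> J \<and> J - {Suc n} = {1..n}"
      proof (rule conjI)
        show "Suc n \<in> J" unfolding e by (rule insertI1)
        show "J - {Suc n} = {1..n}" unfolding e by (rule Diff_insert_absorb[OF nin])
      qed
    next
      assume a: "Suc n \<in> J \<and> J - {Suc n} = {1..n}"
      have "J = insert (Suc n) (J - {Suc n})" by (rule insert_Diff[OF conjunct1[OF a], symmetric])
      also have "\<dots> = insert (Suc n) {1..n}" by (rule arg_cong[OF conjunct2[OF a]])
      finally show "J = insert (Suc n) {1..n}" .
    qed
  qed
  show ?case
  proof (cases "J = {1..Suc n}")
    case True
    hence J0: "Suc n \<in> J \<and> J - {Suc n} = {1..n}" unfolding J .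
    note J' = J0[THEN conjunct1] J0[THEN conjunct2]
    have r: "stair_row TypeC p y n (y (Suc n)) * (\<Prod>j\<in>{1..n}. (y (Suc n) + y j) / (y (Suc n) - y j))
        = y (Suc n) * (\<Prod>j\<in>{1..<Suc n}. (y (Suc n) - p j) * (y (Suc n) + y j))"
    proof -
      have e: "stair_row TypeC p y n (y (Suc n)) = y (Suc n) * (\<Prod>j\<in>{1..n}. (y (Suc n) - p j) * (y (Suc n) - y j))"
        unfolding stair_row_def by (simp only: if_True simp_thms)
      show ?thesis
        unfolding e mult.assoc prod_cancel_ratio[OF Suc.prems(1), of p] atLeastLessThanSuc_atLeastAtMost ..
    qed
    have "stair TypeC p y (Suc n) (y ` J) = (\<Prod>k\<in>{1..Suc n}. y k * (\<Prod>j\<in>{1..<k}. (y k - p j) * (y k + y j)))"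
    proof -
      have ins: "{1..Suc n} = insert (Suc n) {1..n}" by auto
      have "stair TypeC p y (Suc n) (y ` J)
          = stair_row TypeC p y n (y (Suc n)) * (\<Prod>j\<in>{1..n}. (y (Suc n) + y j) / (y (Suc n) - y j))
            * (\<Prod>k\<in>{1..n}. y k * (\<Prod>j\<in>{1..<k}. (y k - p j) * (y k + y j)))"
        using trans[OF step if_P[OF J'(1)]] unfolding trans[OF IH if_P[OF J'(2)]] unfolding J'(2) .
      moreover have "Suc n \<notin> {1..n}" "finite {1..n}" by auto
      ultimately show ?thesis unfolding r ins by (simp only: prod.insert simp_thms)
    qed
    also have "\<dots> = (if J = {1..Suc n} then
        \<Prod>k\<in>{1..Suc n}. y k * (\<Prod>j\<in>{1..<k}. (y k - p j) * (y k + y j)) else 0)"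
      by (rule if_P[OF True, symmetric])
    finally show ?thesis .
  next
    case False
    from False have nJ: "\<not> (Suc n \<in> J \<and> J - {Suc n} = {1..n})" unfolding J .
    have "stair TypeC p y (Suc n) (y ` J) = 0"
    proof (cases "Suc n \<in> J")
      case out: False
      show ?thesis by (rule trans[OF step if_not_P[OF out]])
    next
      case True
      hence ne: "J - {Suc n} \<noteq> {1..n}" using nJ by (rule_tac notI) (rule notE, assumption, rule conjI)
      show ?thesis
        using trans[OF step if_P[OF True]] unfolding trans[OF IH if_not_P[OF ne]] mult_zero_right .
    qed
    also have "0 = (if J = {1..Suc n} then
        \<Prod>k\<in>{1..Suc n}. y k * (\<Prod>j\<in>{1..<k}. (y k - p j) * (y k + y j)) else 0)"
      by (rule if_not_P[OF False, symmetric])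
    finally show ?thesis .
  qed
qed

text \<open>There are only \<open>n - 1\<close> rows, and \<open>y 1\<close> is never chosen. If it
  is present, its ratio turns the factor \<open>y k - y 1\<close> into \<open>y k + y 1\<close>; if
  not, the factor stays.\<close>

lemma stair_D_localize:
  fixes y p :: "nat \<Rightarrow> 'a::field"
  assumes "inj_on y {1..n}" "J \<subseteq> {1..n}" "1 \<le> n"
  shows "stair TypeD p y n (y ` J) = (if {2..n} \<subseteq> J then
      \<Prod>k\<in>{2..n}. \<Prod>j\<in>{1..<k}. (y k - p j) * (if j \<in> J then y k + y j else y k - y j) else 0)"
  using assms(3,1,2)
proof (induction n arbitrary: J rule: dec_induct)
  case base
  thus ?case by (simp add: stair_def low_row_def)
next
  case (step n)
  let ?J = "J - {Suc n}"
  have st: "stair TypeD p y (Suc n) (y ` J) = (if Suc n \<in> J then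
      stair_row TypeD p y n (y (Suc n)) * (\<Prod>j\<in>?J. (y (Suc n) + y j) / (y (Suc n) - y j))
        * stair TypeD p y n (y ` ?J) else 0)"
    by (rule stair_localize_step[OF step.prems]) (use step.hyps in \<open>simp add: low_row_def\<close>)
  have J': "?J \<subseteq> {1..n}" using step.prems(2) by force
  have IH: "stair TypeD p y n (y ` ?J) = (if {2..n} \<subseteq> ?J then
      \<Prod>k\<in>{2..n}. \<Prod>j\<in>{1..<k}. (y k - p j) * (if j \<in> ?J then y k + y j else y k - y j) else 0)"
    using step.prems J' by (intro step.IH) (auto intro: inj_on_subset)
  have J: "{2..Suc n} \<subseteq> J \<longleftrightarrow> Suc n \<in> J \<and> {2..n} \<subseteq> ?J"
    using step.hyps(1) by (auto simp: atLeastAtMostSuc_conv)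
  show ?case
  proof (cases "{2..Suc n} \<subseteq> J")
    case True
    hence JS: "Suc n \<in> J" "{2..n} \<subseteq> ?J" using J by blast+
    have r: "stair_row TypeD p y n (y (Suc n)) * (\<Prod>j\<in>?J. (y (Suc n) + y j) / (y (Suc n) - y j))
        = (\<Prod>j\<in>{1..<Suc n}. (y (Suc n) - p j) * (if j \<in> J then y (Suc n) + y j else y (Suc n) - y j))"
    proof -
      have "(\<Prod>j\<in>?J. (y (Suc n) + y j) / (y (Suc n) - y j))
          = (\<Prod>j\<in>{1..n}. if j \<in> J then (y (Suc n) + y j) / (y (Suc n) - y j) else 1)"
        by (rule prod.mono_neutral_cong_left) (use J' in auto)
      hence "stair_row TypeD p y n (y (Suc n)) * (\<Prod>j\<in>?J. (y (Suc n) + y j) / (y (Suc n) - y j))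
          = (\<Prod>j\<in>{1..n}. (y (Suc n) - p j) * (y (Suc n) - y j) * (if j \<in> J then (y (Suc n) + y j) / (y (Suc n) - y j) else 1))"
        by (simp add: stair_row_def prod.distrib)
      also have "\<dots> = (\<Prod>j\<in>{1..n}. (y (Suc n) - p j) * (if j \<in> J then y (Suc n) + y j else y (Suc n) - y j))"
      proof (rule prod.cong[OF refl])
        fix j assume "j \<in> {1..n}"
        hence "y (Suc n) \<noteq> y j" using inj_onD[OF step.prems(1), of "Suc n" j] by auto
        thus "(y (Suc n) - p j) * (y (Suc n) - y j) * (if j \<in> J then (y (Suc n) + y j) / (y (Suc n) - y j) else 1)
          = (y (Suc n) - p j) * (if j \<in> J then y (Suc n) + y j else y (Suc n) - y j)" by simp
      qed
      finally show ?thesis by (simp only: atLeastLessThanSuc_atLeastAtMost)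
    qed
    have IH': "(\<Prod>k\<in>{2..n}. \<Prod>j\<in>{1..<k}. (y k - p j) * (if j \<in> ?J then y k + y j else y k - y j))
        = (\<Prod>k\<in>{2..n}. \<Prod>j\<in>{1..<k}. (y k - p j) * (if j \<in> J then y k + y j else y k - y j))"
      by (intro prod.cong refl) auto
    have "{2..Suc n} = insert (Suc n) {2..n}" using step.hyps(1) by auto
    note ins = this
    have "stair TypeD p y (Suc n) (y ` J)
        = (\<Prod>k\<in>{2..Suc n}. \<Prod>j\<in>{1..<k}. (y k - p j) * (if j \<in> J then y k + y j else y k - y j))"
    proof -
      have "stair TypeD p y (Suc n) (y ` J)
          = stair_row TypeD p y n (y (Suc n)) * (\<Prod>j\<in>?J. (y (Suc n) + y j) / (y (Suc n) - y j))
            * (\<Prod>k\<in>{2..n}. \<Prod>j\<in>{1..<k}. (y k - p j) * (if j \<in> ?J then y k + y j else y k - y j))"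
        unfolding st IH using JS by (simp only: if_True simp_thms)
      thus ?thesis unfolding r IH' ins by (subst prod.insert) simp_all
    qed
    thus ?thesis using True by simp
  next
    case False
    from J False consider "Suc n \<notin> J" | "\<not> {2..n} \<subseteq> ?J" by blast
    thus ?thesis
    proof cases
      case 1
      thus ?thesis unfolding st using False by (simp only: if_False)
    next
      case 2
      hence "stair TypeD p y n (y ` ?J) = 0" unfolding IH by (simp only: if_False)
      thus ?thesis unfolding st using False by (simp only: if_False mult_zero_right if_cancel)
    qed
  qed
qed

section \<open>Specialization of fractions\<close>

text \<open>A relation, because a fraction can be evaluated only through a representation whose
  denominator survives. It allows a sum of fractions that happens to be a polynomial to be evaluated
  term by term.\<close>

definition specializes :: "(var \<Rightarrow> mpoly) \<Rightarrow> mpoly fract \<Rightarrow> mpoly fract \<Rightarrow> bool" where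
  "specializes \<rho> q q' \<longleftrightarrow> (\<exists>a b. q = to_fract a / to_fract b \<and> eval_mpoly \<rho> b \<noteq> 0 \<and>
     q' = to_fract (eval_mpoly \<rho> a) / to_fract (eval_mpoly \<rho> b))"

lemma specializesE:
  assumes "specializes \<rho> q q'"
  obtains a b where "q = to_fract a / to_fract b" "eval_mpoly \<rho> b \<noteq> 0" "b \<noteq> 0"
    "q' = to_fract (eval_mpoly \<rho> a) / to_fract (eval_mpoly \<rho> b)"
proof -
  obtain a b where ab: "q = to_fract a / to_fract b" "eval_mpoly \<rho> b \<noteq> 0"
    "q' = to_fract (eval_mpoly \<rho> a) / to_fract (eval_mpoly \<rho> b)"
    using assms unfolding specializes_def by (elim exE conjE)
  have "b \<noteq> 0" using ab(2) by (metis eval_0)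
  with ab show thesis by (intro that)
qed

lemma specializes_to_fract: "specializes \<rho> (to_fract a) (to_fract (eval_mpoly \<rho> a))"
  unfolding specializes_def by (rule exI[of _ a], rule exI[of _ 1]) simp

text \<open>For a polynomial, every admissible representation gives the ordinary evaluation.\<close>

lemma specializes_to_fractD:
  assumes "specializes \<rho> (to_fract p) q'"
  shows "q' = to_fract (eval_mpoly \<rho> p)"
proof -
  obtain a b where ab: "to_fract p = to_fract a / to_fract b" "eval_mpoly \<rho> b \<noteq> 0" "b \<noteq> 0"
    "q' = to_fract (eval_mpoly \<rho> a) / to_fract (eval_mpoly \<rho> b)"
    using specializesE[OF assms] .
  have "to_fract (p * b) = to_fract a" using ab(1,3) by (simp add: field_simps)
  hence "p * b = a" by (simp only: to_fract_eq_iff)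
  hence "a = p * b" by (rule sym)
  hence "eval_mpoly \<rho> a = eval_mpoly \<rho> p * eval_mpoly \<rho> b" by simp
  thus ?thesis unfolding ab(4) using ab(2) by simp
qed

lemma specializes_mult:
  assumes "specializes \<rho> q q'" "specializes \<rho> r r'"
  shows "specializes \<rho> (q * r) (q' * r')"
proof -
  obtain a b where ab: "q = to_fract a / to_fract b" "eval_mpoly \<rho> b \<noteq> 0" "b \<noteq> 0"
    "q' = to_fract (eval_mpoly \<rho> a) / to_fract (eval_mpoly \<rho> b)" using specializesE[OF assms(1)] .
  obtain c d where cd: "r = to_fract c / to_fract d" "eval_mpoly \<rho> d \<noteq> 0" "d \<noteq> 0"
    "r' = to_fract (eval_mpoly \<rho> c) / to_fract (eval_mpoly \<rho> d)" using specializesE[OF assms(2)] .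
  show ?thesis
    unfolding specializes_def
    by (rule exI[of _ "a * c"], rule exI[of _ "b * d"]) (use ab cd in simp)
qed

lemma specializes_add:
  assumes "specializes \<rho> q q'" "specializes \<rho> r r'"
  shows "specializes \<rho> (q + r) (q' + r')"
proof -
  obtain a b where ab: "q = to_fract a / to_fract b" "eval_mpoly \<rho> b \<noteq> 0" "b \<noteq> 0"
    "q' = to_fract (eval_mpoly \<rho> a) / to_fract (eval_mpoly \<rho> b)" using specializesE[OF assms(1)] .
  obtain c d where cd: "r = to_fract c / to_fract d" "eval_mpoly \<rho> d \<noteq> 0" "d \<noteq> 0"
    "r' = to_fract (eval_mpoly \<rho> c) / to_fract (eval_mpoly \<rho> d)" using specializesE[OF assms(2)] .
  show ?thesis
    unfolding specializes_def
  proof (rule exI[of _ "a * d + c * b"], rule exI[of _ "b * d"], intro conjI)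
    show "q + r = to_fract (a * d + c * b) / to_fract (b * d)"
      using ab(3) cd(3) unfolding ab(1) cd(1) by (simp add: add_frac_eq)
    show "eval_mpoly \<rho> (b * d) \<noteq> 0" using ab(2) cd(2) by simp
    show "q' + r' = to_fract (eval_mpoly \<rho> (a * d + c * b)) / to_fract (eval_mpoly \<rho> (b * d))"
      using ab(2) cd(2) unfolding ab(4) cd(4) by (simp add: add_frac_eq)
  qed
qed

lemma specializes_divide:
  assumes "specializes \<rho> q q'" "eval_mpoly \<rho> a \<noteq> 0"
  shows "specializes \<rho> (q / to_fract a) (q' / to_fract (eval_mpoly \<rho> a))"
proof -
  have "specializes \<rho> (1 / to_fract a) (1 / to_fract (eval_mpoly \<rho> a))"
    unfolding specializes_def by (rule exI[of _ 1], rule exI[of _ a]) (use assms(2) in simp)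
  from specializes_mult[OF assms(1) this] show ?thesis by simp
qed

lemma specializes_sum:
  "(\<And>x. x \<in> A \<Longrightarrow> specializes \<rho> (f x) (f' x)) \<Longrightarrow> specializes \<rho> (sum f A) (sum f' A)"
proof (induction A rule: infinite_finite_induct)
  case (insert x A)
  thus ?case by (simp add: specializes_add)
qed (use specializes_to_fract[of \<rho> 0] in simp_all)

lemma specializes_prod:
  "(\<And>x. x \<in> A \<Longrightarrow> specializes \<rho> (f x) (f' x)) \<Longrightarrow> specializes \<rho> (prod f A) (prod f' A)"
proof (induction A rule: infinite_finite_induct)
  case (insert x A)
  thus ?case by (simp add: specializes_mult)
qed (use specializes_to_fract[of \<rho> 1] in simp_all)

lemma pair_ratio_image:
  assumes "inj_on f B" "x \<in> B"
  shows "pair_ratio (f x) (f ` B) = (\<Prod>y\<in>B - {x}. (f x + f y) / (f x - f y))"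
proof -
  have "f ` B - {f x} = f ` (B - {x})" using assms by (auto dest: inj_onD)
  moreover have "inj_on f (B - {x})" using assms(1) by (rule inj_on_subset) blast
  ultimately show ?thesis unfolding pair_ratio_def by (simp add: prod.reindex)
qed

lemma sym_sum_image:
  assumes "inj_on f B"
  shows "sym_sum (g # gs) G (f ` B)
    = (\<Sum>x\<in>B. g (f x) * (\<Prod>y\<in>B - {x}. (f x + f y) / (f x - f y)) * sym_sum gs G (f ` (B - {x})))"
proof -
  have "sym_sum (g # gs) G (f ` B)
      = (\<Sum>x\<in>B. g (f x) * pair_ratio (f x) (f ` B) * sym_sum gs G (f ` B - {f x}))"
    by (simp add: sum.reindex[OF assms])
  also have "\<dots> = (\<Sum>x\<in>B. g (f x) * (\<Prod>y\<in>B - {x}. (f x + f y) / (f x - f y)) * sym_sum gs G (f ` (B - {x})))"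
  proof (rule sum.cong[OF refl])
    fix x assume x: "x \<in> B"
    have "f ` B - {f x} = f ` (B - {x})" using assms x by (auto dest: inj_onD)
    thus "g (f x) * pair_ratio (f x) (f ` B) * sym_sum gs G (f ` B - {f x})
      = g (f x) * (\<Prod>y\<in>B - {x}. (f x + f y) / (f x - f y)) * sym_sum gs G (f ` (B - {x}))"
      using pair_ratio_image[OF assms x] by simp
  qed
  finally show ?thesis .
qed

section \<open>The staircase functions as polynomials\<close>

text \<open>The parameters are read off from \<open>\<rho>\<close> and the x-values from
  \<open>Y\<close>; the list of rows is arbitrary, as inductions over the rows require.\<close>

definition stair_fract :: "(var \<Rightarrow> mpoly) \<Rightarrow> lie_type \<Rightarrow> nat list \<Rightarrow> mpoly fract set \<Rightarrow> mpoly fract" where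
  "stair_fract \<rho> ty ks Y = sym_sum (map (stair_row ty (\<lambda>j. to_fract (\<rho> (T j))) (\<lambda>j. - to_fract (\<rho> (Z j)))) ks) (\<lambda>_. 1) Y"

definition row_poly :: "lie_type \<Rightarrow> nat \<Rightarrow> mpoly \<Rightarrow> mpoly" where
  "row_poly ty k x = (if ty = TypeC then x else 1) * (\<Prod>j\<in>{1..k}. (x - Var (T j)) * (x + Var (Z j)))"

lemma to_fract_prod: "to_fract (prod f A) = (\<Prod>x\<in>A. to_fract (f x))"
  by (induction A rule: infinite_finite_induct) auto

lemma stair_row_poly:
  "stair_row ty (\<lambda>j. to_fract (\<rho> (T j))) (\<lambda>j. - to_fract (\<rho> (Z j))) k (to_fract (eval_mpoly \<rho> x))
    = to_fract (eval_mpoly \<rho> (row_poly ty k x))"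
  by (simp add: stair_row_def row_poly_def to_fract_prod)

text \<open>Injectivity of the evaluation on \<open>B\<close> keeps the denominators
  \<open>x - y\<close> nonzero.\<close>

lemma specializes_stair:
  assumes "finite B" "inj_on (eval_mpoly \<rho>) B"
  shows "specializes \<rho> (stair_fract Var ty ks (to_fract ` B)) (stair_fract \<rho> ty ks (to_fract ` eval_mpoly \<rho> ` B))"
  using assms
proof (induction ks arbitrary: B)
  case Nil
  show ?case using specializes_to_fract[of \<rho> 1] by (simp add: stair_fract_def)
next
  case (Cons k ks)
  let ?e = "eval_mpoly \<rho>" and ?f = "\<lambda>x. to_fract (eval_mpoly \<rho> x)"
  have inj1: "inj_on to_fract B" by (rule inj_onI) simp
  have inj2: "inj_on ?f B" by (rule inj_onI) (use Cons.prems(2) in \<open>auto dest: inj_onD\<close>)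
  have img: "to_fract ` ?e ` B' = ?f ` B'" for B' by (rule image_image)
  have l: "stair_fract Var ty (k # ks) (to_fract ` B)
      = (\<Sum>x\<in>B. to_fract (row_poly ty k x) * (\<Prod>y\<in>B - {x}. (to_fract x + to_fract y) / (to_fract x - to_fract y))
          * stair_fract Var ty ks (to_fract ` (B - {x})))"
    unfolding stair_fract_def list.map sym_sum_image[OF inj1]
    using stair_row_poly[of ty Var k] by (simp add: eval_id)
  have r: "stair_fract \<rho> ty (k # ks) (to_fract ` ?e ` B)
      = (\<Sum>x\<in>B. to_fract (?e (row_poly ty k x)) * (\<Prod>y\<in>B - {x}. (?f x + ?f y) / (?f x - ?f y))
          * stair_fract \<rho> ty ks (to_fract ` ?e ` (B - {x})))"
    unfolding stair_fract_def list.map img sym_sum_image[OF inj2] stair_row_poly ..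
  show ?case
    unfolding l r
  proof (intro specializes_sum specializes_mult specializes_prod specializes_to_fract)
    fix x y assume xy: "x \<in> B" "y \<in> B - {x}"
    have "?e (x - y) \<noteq> 0" using Cons.prems(2) xy by (auto dest: inj_onD)
    from specializes_divide[OF specializes_to_fract[of \<rho> "x + y"] this]
    show "specializes \<rho> ((to_fract x + to_fract y) / (to_fract x - to_fract y)) ((?f x + ?f y) / (?f x - ?f y))"
      by simp
  next
    fix x assume "x \<in> B"
    show "specializes \<rho> (stair_fract Var ty ks (to_fract ` (B - {x}))) (stair_fract \<rho> ty ks (to_fract ` ?e ` (B - {x})))"
      by (rule Cons.IH) (use Cons.prems in \<open>auto intro: inj_on_subset\<close>)
  qed
qed

section \<open>Removing the Vandermonde denominator\<close>

definition x_vars :: "nat set \<Rightarrow> mpoly set" where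
  "x_vars A = (\<lambda>i. Var (X i)) ` A"

lemma finite_x_vars: "finite A \<Longrightarrow> finite (x_vars A)"
  by (simp add: x_vars_def)

definition vandermonde :: "nat set \<Rightarrow> mpoly" where
  "vandermonde A = (\<Prod>i\<in>A. \<Prod>j\<in>{j\<in>A. i < j}. Var (X i) - Var (X j))"

lemma vandermonde_neq_0: "finite A \<Longrightarrow> vandermonde A \<noteq> 0"
  by (simp add: vandermonde_def)

lemma prod_sign: "finite A \<Longrightarrow> (\<Prod>j\<in>A. if P j then 1 else - 1 :: mpoly) \<in> {1, - 1}"
  by (induction A rule: finite_induct) auto

lemma vandermonde_remove:
  assumes A: "finite A" "i \<in> A"
  obtains e where "e \<in> {1, - 1}"
    "vandermonde A = e * (\<Prod>j\<in>A - {i}. Var (X i) - Var (X j)) * vandermonde (A - {i})"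
proof -
  let ?d = "\<lambda>i j. Var (X i) - Var (X j)" and ?e = "\<Prod>j\<in>A - {i}. if i < j then 1 else - 1 :: mpoly"
  have row: "(\<Prod>j\<in>{j\<in>A. k < j}. ?d k j) = (if k < i then ?d k i else 1) * (\<Prod>j\<in>{j\<in>A - {i}. k < j}. ?d k j)"
    if k: "k \<in> A - {i}" for k
  proof (cases "k < i")
    case True
    have s: "{j\<in>A. k < j} = insert i {j\<in>A - {i}. k < j}" using True A(2) by auto
    have "finite {j\<in>A - {i}. k < j}" "i \<notin> {j\<in>A - {i}. k < j}" using A(1) by auto
    thus ?thesis unfolding s using True by (simp only: prod.insert if_True simp_thms)
  next
    case False
    hence "{j\<in>A. k < j} = {j\<in>A - {i}. k < j}" using k by auto
    thus ?thesis using False by simp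
  qed
  have "vandermonde A = (\<Prod>j\<in>{j\<in>A. i < j}. ?d i j) * (\<Prod>k\<in>A - {i}. \<Prod>j\<in>{j\<in>A. k < j}. ?d k j)"
    unfolding vandermonde_def by (rule prod.remove[OF A])
  also have "(\<Prod>k\<in>A - {i}. \<Prod>j\<in>{j\<in>A. k < j}. ?d k j)
      = (\<Prod>k\<in>A - {i}. if k < i then ?d k i else 1) * vandermonde (A - {i})"
    unfolding vandermonde_def prod.distrib[symmetric] by (rule prod.cong[OF refl row])
  also have "(\<Prod>j\<in>{j\<in>A. i < j}. ?d i j) = (\<Prod>j\<in>A - {i}. if i < j then ?d i j else 1)"
    by (rule prod.mono_neutral_cong_left) (use A(1) in auto)
  also have "(\<Prod>j\<in>A - {i}. if i < j then ?d i j else 1)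
        * ((\<Prod>k\<in>A - {i}. if k < i then ?d k i else 1) * vandermonde (A - {i}))
      = ?e * (\<Prod>j\<in>A - {i}. ?d i j) * vandermonde (A - {i})"
    unfolding mult.assoc[symmetric] prod.distrib[symmetric]
    by (rule arg_cong[where f = "\<lambda>p. p * _"], rule prod.cong[OF refl]) auto
  finally show thesis using prod_sign[of "A - {i}" "\<lambda>j. i < j"] A(1) by (intro that) auto
qed

text \<open>Choosing \<open>x_i\<close> for a row costs the denominators \<open>x_i - x_j\<close>,
  which split off from the Vandermonde product and leave that of the other variables for the
  remaining rows. The factors \<open>x_i + x_j\<close> restore the lost degree, so each row adds at
  most its own degree, bounded by \<open>2 k + 1\<close>, whatever the number of variables.\<close>

lemma stair_numerator:
  assumes "finite A"
  shows "\<exists>N. to_fract N = to_fract (vandermonde A) * stair_fract Var ty ks (to_fract ` x_vars A)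
    \<and> total_degree N \<le> sum_list (map (\<lambda>k. 2 * k + 1) ks) + total_degree (vandermonde A)"
  using assms
proof (induction ks arbitrary: A)
  case Nil
  show ?case by (rule exI[of _ "vandermonde A"]) (simp add: stair_fract_def)
next
  case (Cons k ks)
  let ?x = "\<lambda>i. Var (X i)" and ?D = "sum_list (map (\<lambda>k. 2 * k + 1) ks)"
  have inj: "inj_on (\<lambda>i. to_fract (?x i)) A" by (rule inj_onI) simp
  have "\<forall>i\<in>A. \<exists>M. to_fract M = to_fract (vandermonde A) * (to_fract (row_poly ty k (?x i)) *
        (\<Prod>j\<in>A - {i}. (to_fract (?x i) + to_fract (?x j)) / (to_fract (?x i) - to_fract (?x j)))
        * stair_fract Var ty ks (to_fract ` x_vars (A - {i})))
      \<and> total_degree M \<le> 2 * k + 1 + ?D + total_degree (vandermonde A)"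
  proof
    fix i assume i: "i \<in> A"
    obtain e where e: "e \<in> {1, - 1}"
      "vandermonde A = e * (\<Prod>j\<in>A - {i}. ?x i - ?x j) * vandermonde (A - {i})"
      using vandermonde_remove[OF Cons.prems i] .
    obtain N where N: "to_fract N = to_fract (vandermonde (A - {i})) * stair_fract Var ty ks (to_fract ` x_vars (A - {i}))"
      "total_degree N \<le> ?D + total_degree (vandermonde (A - {i}))"
      using Cons.IH[of "A - {i}"] Cons.prems by auto
    define M where "M = row_poly ty k (?x i) * (e * (\<Prod>j\<in>A - {i}. ?x i + ?x j) * N)"
    have ratio: "to_fract (\<Prod>j\<in>A - {i}. ?x i - ?x j)
        * (\<Prod>j\<in>A - {i}. (to_fract (?x i) + to_fract (?x j)) / (to_fract (?x i) - to_fract (?x j)))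
        = to_fract (\<Prod>j\<in>A - {i}. ?x i + ?x j)"
      unfolding to_fract_prod prod.distrib[symmetric]
    proof (rule prod.cong[OF refl])
      fix j assume "j \<in> A - {i}"
      hence "to_fract (?x i) - to_fract (?x j) \<noteq> 0" by simp
      thus "to_fract (?x i - ?x j) * ((to_fract (?x i) + to_fract (?x j)) / (to_fract (?x i) - to_fract (?x j)))
        = to_fract (?x i + ?x j)" by simp
    qed
    have alg: "(e * d * v) * (r * q * s) = r * (e * (d * q) * (v * s))" for e d v r q s :: "mpoly fract"
      by (simp only: mult_ac)
    have "to_fract M = to_fract (vandermonde A) * (to_fract (row_poly ty k (?x i)) *
        (\<Prod>j\<in>A - {i}. (to_fract (?x i) + to_fract (?x j)) / (to_fract (?x i) - to_fract (?x j)))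
        * stair_fract Var ty ks (to_fract ` x_vars (A - {i})))"
      unfolding M_def e(2) to_fract_mult N(1) alg ratio ..
    moreover have "total_degree M \<le> 2 * k + 1 + ?D + total_degree (vandermonde A)"
    proof -
      have row: "total_degree (row_poly ty k (?x i)) \<le> 2 * k + 1"
      proof -
        have lin: "total_degree ((?x i - Var (T j)) * (?x i + Var (Z j))) \<le> 2" for j
          using total_degree_mult_le[of "?x i - Var (T j)" "?x i + Var (Z j)"]
            total_degree_diff_le[of "?x i" "Var (T j)"] total_degree_add_le[of "?x i" "Var (Z j)"] by simp
        have "total_degree (\<Prod>j\<in>{1..k}. (?x i - Var (T j)) * (?x i + Var (Z j))) \<le> (\<Sum>j\<in>{1..k}. 2)"
          by (rule order_trans[OF total_degree_prod_le sum_mono[OF lin]])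
        hence "total_degree (\<Prod>j\<in>{1..k}. (?x i - Var (T j)) * (?x i + Var (Z j))) \<le> 2 * k" by simp
        moreover have "total_degree (if ty = TypeC then ?x i else 1) \<le> 1" by simp
        ultimately show ?thesis
          unfolding row_poly_def
          using total_degree_mult_le[of "if ty = TypeC then ?x i else 1"
              "\<Prod>j\<in>{1..k}. (?x i - Var (T j)) * (?x i + Var (Z j))"] by linarith
      qed
      have deg_e: "total_degree (e * p) = total_degree p" for p using e(1) by auto
      have "total_degree (\<Prod>j\<in>A - {i}. ?x i + ?x j) \<le> (\<Sum>j\<in>A - {i}. 1)"
      proof (rule order_trans[OF total_degree_prod_le sum_mono])
        fix j show "total_degree (?x i + ?x j) \<le> 1" using total_degree_add_le[of "?x i" "?x j"] by simp
      qed
      hence num: "total_degree (e * (\<Prod>j\<in>A - {i}. ?x i + ?x j)) \<le> card (A - {i})" unfolding deg_e by simp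
      have "total_degree (\<Prod>j\<in>A - {i}. ?x i - ?x j) = card (A - {i})"
      proof -
        have "finite (A - {i})" using Cons.prems by simp
        moreover have "total_degree (\<Prod>j\<in>B. ?x i - ?x j) = card B" if "finite B" "i \<notin> B" for B
          using that
        proof (induction B rule: finite_induct)
          case (insert j B)
          have s: "scale_poly (?x i - ?x j) = [:0, ?x i - ?x j:]" by simp
          have "?x i - ?x j \<noteq> 0" using insert.prems by simp
          hence d: "total_degree (?x i - ?x j) = 1" unfolding total_degree_def s by simp
          have "(\<Prod>j\<in>B. ?x i - ?x j) \<noteq> 0" using insert.prems insert.hyps(1) by auto
          hence "total_degree ((?x i - ?x j) * (\<Prod>j\<in>B. ?x i - ?x j)) = 1 + card B"
            using total_degree_mult[of "?x i - ?x j" "\<Prod>j\<in>B. ?x i - ?x j"] insert d \<open>?x i - ?x j \<noteq> 0\<close> by simp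
          thus ?case using insert.hyps by simp
        qed simp
        ultimately show ?thesis by simp
      qed
      moreover have "(\<Prod>j\<in>A - {i}. ?x i - ?x j) \<noteq> 0" using Cons.prems by auto
      moreover have "vandermonde (A - {i}) \<noteq> 0" using Cons.prems by (simp add: vandermonde_neq_0)
      ultimately have van: "total_degree (vandermonde A) = card (A - {i}) + total_degree (vandermonde (A - {i}))"
        unfolding e(2) mult.assoc deg_e using total_degree_mult by metis
      show ?thesis
        unfolding M_def van
        using total_degree_mult_le[of "row_poly ty k (?x i)" "e * (\<Prod>j\<in>A - {i}. ?x i + ?x j) * N"]
          total_degree_mult_le[of "e * (\<Prod>j\<in>A - {i}. ?x i + ?x j)" N] row num N(2) by linarith
    qed
    ultimately show "\<exists>M. to_fract M = to_fract (vandermonde A) * (to_fract (row_poly ty k (?x i)) *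
        (\<Prod>j\<in>A - {i}. (to_fract (?x i) + to_fract (?x j)) / (to_fract (?x i) - to_fract (?x j)))
        * stair_fract Var ty ks (to_fract ` x_vars (A - {i})))
      \<and> total_degree M \<le> 2 * k + 1 + ?D + total_degree (vandermonde A)" by (intro exI[of _ M] conjI)
  qed
  from bchoice[OF this] obtain M where M: "\<And>i. i \<in> A \<Longrightarrow> to_fract (M i) = to_fract (vandermonde A) * (to_fract (row_poly ty k (?x i)) *
        (\<Prod>j\<in>A - {i}. (to_fract (?x i) + to_fract (?x j)) / (to_fract (?x i) - to_fract (?x j)))
        * stair_fract Var ty ks (to_fract ` x_vars (A - {i})))"
    "\<And>i. i \<in> A \<Longrightarrow> total_degree (M i) \<le> 2 * k + 1 + ?D + total_degree (vandermonde A)" by blast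
  have img: "to_fract ` x_vars B = (\<lambda>i. to_fract (?x i)) ` B" for B unfolding x_vars_def by (rule image_image)
  have "to_fract (sum M A) = to_fract (vandermonde A) * stair_fract Var ty (k # ks) (to_fract ` x_vars A)"
  proof -
    have "stair_fract Var ty (k # ks) (to_fract ` x_vars A) = (\<Sum>i\<in>A. to_fract (row_poly ty k (?x i)) *
        (\<Prod>j\<in>A - {i}. (to_fract (?x i) + to_fract (?x j)) / (to_fract (?x i) - to_fract (?x j)))
        * stair_fract Var ty ks (to_fract ` x_vars (A - {i})))"
      unfolding img stair_fract_def list.map sym_sum_image[OF inj]
      using stair_row_poly[of ty Var k] by (simp add: eval_id)
    thus ?thesis by (simp only: to_fract_sum sum_distrib_left) (rule sum.cong[OF refl M(1)])
  qed
  moreover have "total_degree (sum M A) \<le> 2 * k + 1 + ?D + total_degree (vandermonde A)"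
    by (rule total_degree_sum_le[OF M(2)])
  ultimately show ?case by (intro exI[of _ "sum M A"]) simp
qed

text \<open>Coprimality of distinct differences in elementary form: putting \<open>x_p = x_q\<close>
  kills \<open>N\<close> but none of the other differences, so it kills the cofactor. The condition
  \<open>i < j\<close> excludes repetitions up to sign.\<close>

lemma prod_differences_dvd:
  assumes "finite PS" "\<And>i j. (i, j) \<in> PS \<Longrightarrow> i < j \<and> (Var (X i) - Var (X j)) dvd N"
  shows "(\<Prod>(i, j)\<in>PS. Var (X i) - Var (X j)) dvd (N :: mpoly)"
  using assms
proof (induction PS rule: finite_induct)
  case (insert pq PS)
  obtain p q where pq: "pq = (p, q)" by (cases pq)
  let ?C = "\<Prod>(i, j)\<in>PS. Var (X i) - Var (X j)" and ?e = "eval_mpoly (Var(X p := Var (X q)))"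
  have "?C dvd N" using insert.prems by (intro insert.IH) blast
  then obtain M where M: "N = ?C * M" by (rule dvdE)
  have p: "p < q" "(Var (X p) - Var (X q)) dvd N" using insert.prems[of p q] pq by auto
  obtain N' where "N = (Var (X p) - Var (X q)) * N'" using p(2) by (rule dvdE)
  hence "?e N = 0" using p(1) by simp
  moreover have "?e ?C \<noteq> 0"
  proof -
    have "?e ?C = (\<Prod>(i, j)\<in>PS. ?e (Var (X i) - Var (X j)))"
      by (simp add: case_prod_unfold)
    moreover have "?e (Var (X i) - Var (X j)) \<noteq> 0" if ij: "(i, j) \<in> PS" for i j
    proof -
      have "i < j" using insert.prems[of i j] ij by blast
      moreover have "(i, j) \<noteq> (p, q)" using ij insert.hyps(2) pq by auto
      ultimately show ?thesis using p(1) by auto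
    qed
    ultimately show ?thesis using insert.hyps(1) by (auto simp: case_prod_unfold)
  qed
  moreover have "?e N = ?e ?C * ?e M" unfolding M by (rule eval_mult)
  ultimately have "?e M = 0" by (metis mult_eq_0_iff)
  hence "(Var (X p) - Var (X q)) dvd M" by (rule Var_diff_dvd)
  hence "(Var (X p) - Var (X q)) * ?C dvd M * ?C" by (rule mult_dvd_mono) (rule dvd_refl)
  thus ?case unfolding M using insert.hyps pq by (simp add: mult.commute)
qed simp

definition swap_X :: "nat \<Rightarrow> nat \<Rightarrow> var \<Rightarrow> mpoly" where
  "swap_X p q = (\<lambda>v. case v of X i \<Rightarrow> Var (X (transpose p q i)) | _ \<Rightarrow> Var v)"

text \<open>After splitting off the factors with \<open>x_p\<close> and \<open>x_q\<close>, the swap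
  exchanges two partial products and changes the sign of \<open>x_p - x_q\<close>.\<close>

lemma vandermonde_swap:
  assumes A: "finite A" "p \<in> A" "q \<in> A" "p \<noteq> q"
  shows "eval_mpoly (swap_X p q) (vandermonde A) = - vandermonde A"
proof -
  let ?x = "\<lambda>i. Var (X i)" and ?s = "eval_mpoly (swap_X p q)" and ?R = "A - {p} - {q}"
  obtain e where e: "e \<in> {1, - 1}" "vandermonde A = e * (\<Prod>j\<in>A - {p}. ?x p - ?x j) * vandermonde (A - {p})"
    using vandermonde_remove[OF A(1,2)] .
  have "finite (A - {p})" "q \<in> A - {p}" using A by auto
  from vandermonde_remove[OF this] obtain e' where e': "e' \<in> {1, - 1}"
    "vandermonde (A - {p}) = e' * (\<Prod>j\<in>?R. ?x q - ?x j) * vandermonde ?R" .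
  have rem: "(\<Prod>j\<in>A - {p}. ?x p - ?x j) = (?x p - ?x q) * (\<Prod>j\<in>?R. ?x p - ?x j)"
    by (rule prod.remove) (use A in auto)
  have v: "vandermonde A = e * ((?x p - ?x q) * (\<Prod>j\<in>?R. ?x p - ?x j)) * (e' * (\<Prod>j\<in>?R. ?x q - ?x j) * vandermonde ?R)"
    unfolding e(2) e'(2) rem ..
  have se: "?s e = e" "?s e' = e'" using e(1) e'(1) by auto
  have sx: "?s (?x p) = ?x q" "?s (?x q) = ?x p" by (simp_all add: swap_X_def)
  have sj: "?s (?x j) = ?x j" if "j \<in> ?R" for j using that by (auto simp: swap_X_def transpose_def)
  have sp: "?s (\<Prod>j\<in>?R. ?x p - ?x j) = (\<Prod>j\<in>?R. ?x q - ?x j)" "?s (\<Prod>j\<in>?R. ?x q - ?x j) = (\<Prod>j\<in>?R. ?x p - ?x j)"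
    using sx sj by simp_all
  have sv: "?s (vandermonde ?R) = vandermonde ?R"
  proof -
    have "?s (vandermonde ?R) = (\<Prod>i\<in>?R. \<Prod>j\<in>{j\<in>?R. i < j}. ?s (?x i) - ?s (?x j))"
      by (simp only: vandermonde_def eval_hom)
    also have "\<dots> = vandermonde ?R"
      unfolding vandermonde_def
    proof (intro prod.cong refl)
      fix i j assume "i \<in> ?R" "j \<in> {j \<in> ?R. i < j}"
      hence "i \<in> ?R" "j \<in> ?R" by simp_all
      thus "?s (?x i) - ?s (?x j) = ?x i - ?x j" by (simp only: sj)
    qed
    finally show ?thesis .
  qed
  have "?s (vandermonde A) = e * ((?x q - ?x p) * (\<Prod>j\<in>?R. ?x q - ?x j)) * (e' * (\<Prod>j\<in>?R. ?x p - ?x j) * vandermonde ?R)"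
    unfolding v eval_mult se sp sv by (simp only: eval_hom sx)
  also have "\<dots> = - vandermonde A"
  proof -
    have "e * ((b - a) * Q) * (e' * P * V) = - (e * ((a - b) * P) * (e' * Q * V))" for a b P Q V :: mpoly
      by (simp add: algebra_simps)
    thus ?thesis unfolding v .
  qed
  finally show ?thesis .
qed

lemma eval_swap_x_vars: "p \<in> A \<Longrightarrow> q \<in> A \<Longrightarrow> eval_mpoly (swap_X p q) ` x_vars A = x_vars A"
  unfolding x_vars_def image_image
proof -
  assume pq: "p \<in> A" "q \<in> A"
  have "(\<lambda>i. eval_mpoly (swap_X p q) (Var (X i))) ` A = (\<lambda>i. Var (X i)) ` (transpose p q ` A)"
    by (simp add: swap_X_def image_image)
  also have "transpose p q ` A = A" using pq by simp
  finally show "(\<lambda>i. eval_mpoly (swap_X p q) (Var (X i))) ` A = (\<lambda>i. Var (X i)) ` A" .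
qed

lemma stair_fract_cong:
  "(\<And>j. \<rho> (T j) = \<rho>' (T j)) \<Longrightarrow> (\<And>j. \<rho> (Z j) = \<rho>' (Z j)) \<Longrightarrow> stair_fract \<rho> ty ks Y = stair_fract \<rho>' ty ks Y"
  by (simp add: stair_fract_def)

text \<open>The symmetrized sum is symmetric, so its numerator over the Vandermonde product is
  alternating. It therefore vanishes at \<open>x_p = x_q\<close> and is divisible by every
  difference, hence by their product.\<close>

lemma stair_polynomial:
  assumes A: "finite A"
  shows "\<exists>P. to_fract P = stair_fract Var ty ks (to_fract ` x_vars A)
    \<and> total_degree P \<le> sum_list (map (\<lambda>k. 2 * k + 1) ks)"
proof -
  let ?S = "stair_fract Var ty ks (to_fract ` x_vars A)" and ?PS = "SIGMA i:A. {j\<in>A. i < j}"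
  obtain N where N: "to_fract N = to_fract (vandermonde A) * ?S"
    "total_degree N \<le> sum_list (map (\<lambda>k. 2 * k + 1) ks) + total_degree (vandermonde A)"
    using stair_numerator[OF A, of ty ks] by blast
  have dvd: "(Var (X p) - Var (X q)) dvd N" if pq: "p \<in> A" "q \<in> A" "p \<noteq> q" for p q
  proof -
    let ?s = "eval_mpoly (swap_X p q)" and ?e = "eval_mpoly (Var(X p := Var (X q)))"
    have inj: "inj_on ?s (x_vars A)"
      by (rule inj_onI) (auto simp: x_vars_def swap_X_def dest: transpose_eq_imp_eq)
    have "stair_fract (swap_X p q) ty ks (to_fract ` x_vars A) = ?S"
      by (rule stair_fract_cong) (simp_all add: swap_X_def)
    hence "specializes (swap_X p q) ?S ?S"
      using specializes_stair[OF finite_x_vars[OF A] inj, of ty ks] unfolding eval_swap_x_vars[OF pq(1,2)] by simp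
    from specializes_mult[OF specializes_to_fract this, of "vandermonde A"]
    have "to_fract (?s (vandermonde A)) * ?S = to_fract (?s N)"
      unfolding N(1)[symmetric] by (rule specializes_to_fractD)
    hence "to_fract (?s N) = to_fract (- N)"
      unfolding vandermonde_swap[OF A pq] by (simp add: N(1))
    hence sN: "?s N = - N" by (simp only: to_fract_eq_iff)
    \<comment> \<open>On the locus \<open>x_p = x_q\<close> the swap is invisible.\<close>
    have "?e N = ?e (?s N)"
      unfolding eval_eval
      by (rule arg_cong[where f = "\<lambda>r. eval_mpoly r N"]) (auto simp: fun_eq_iff swap_X_def transpose_def split: var.split)
    also have "\<dots> = - ?e N" unfolding sN by simp
    finally have "?e N + ?e N = 0" by (metis add.right_inverse)
    hence "?e N = 0" by (simp only: mpoly_double_eq_0_iff)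
    thus ?thesis by (rule Var_diff_dvd)
  qed
  have "vandermonde A = (\<Prod>(i, j)\<in>?PS. Var (X i) - Var (X j))"
    unfolding vandermonde_def using A by (intro prod.Sigma) auto
  moreover have "(\<Prod>(i, j)\<in>?PS. Var (X i) - Var (X j)) dvd N"
    by (rule prod_differences_dvd) (use A dvd in auto)
  ultimately obtain P where P: "N = vandermonde A * P" by (auto elim: dvdE)
  have v: "vandermonde A \<noteq> 0" by (rule vandermonde_neq_0[OF A])
  have "to_fract (vandermonde A) * to_fract P = to_fract (vandermonde A) * ?S"
    using N(1) unfolding P to_fract_mult .
  hence "to_fract P = ?S" using v by simp
  moreover have "total_degree P \<le> sum_list (map (\<lambda>k. 2 * k + 1) ks)"
  proof (cases "P = 0")
    case False
    have "total_degree N = total_degree (vandermonde A) + total_degree P"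
      unfolding P by (rule total_degree_mult[OF v False])
    thus ?thesis using N(2) by linarith
  qed simp
  ultimately show ?thesis by blast
qed

section \<open>The staircase polynomials and their compatibility\<close>

definition stair_poly :: "lie_type \<Rightarrow> nat \<Rightarrow> nat \<Rightarrow> mpoly" where
  "stair_poly ty n N = (THE P. to_fract P = stair_fract Var ty (rev [low_row ty..<n]) (to_fract ` x_vars {1..N}))"

lemma stair_poly_props:
  "to_fract (stair_poly ty n N) = stair_fract Var ty (rev [low_row ty..<n]) (to_fract ` x_vars {1..N})"
  "total_degree (stair_poly ty n N) \<le> sum_list (map (\<lambda>k. 2 * k + 1) (rev [low_row ty..<n]))"
proof -
  obtain P where P: "to_fract P = stair_fract Var ty (rev [low_row ty..<n]) (to_fract ` x_vars {1..N})"
    "total_degree P \<le> sum_list (map (\<lambda>k. 2 * k + 1) (rev [low_row ty..<n]))"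
    using stair_polynomial[of "{1..N}" ty "rev [low_row ty..<n]"] by auto
  have "stair_poly ty n N = P"
    unfolding stair_poly_def
  proof (rule the_equality)
    show "to_fract P = stair_fract Var ty (rev [low_row ty..<n]) (to_fract ` x_vars {1..N})" by (rule P(1))
  next
    fix Q assume "to_fract Q = stair_fract Var ty (rev [low_row ty..<n]) (to_fract ` x_vars {1..N})"
    hence "to_fract Q = to_fract P" unfolding P(1) .
    thus "Q = P" by simp
  qed
  with P show "to_fract (stair_poly ty n N) = stair_fract Var ty (rev [low_row ty..<n]) (to_fract ` x_vars {1..N})"
    "total_degree (stair_poly ty n N) \<le> sum_list (map (\<lambda>k. 2 * k + 1) (rev [low_row ty..<n]))" by simp_all
qed

text \<open>The fraction formula is evaluated at distinct x-values only. The compatibilities below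
  are first proved at a generic such point and then specialized to arbitrary values.\<close>

lemma eval_stair_poly:
  fixes \<rho> :: "var \<Rightarrow> mpoly"
  assumes "inj_on (\<lambda>i. \<rho> (X i)) {1..N}"
  shows "to_fract (eval_mpoly \<rho> (stair_poly ty n N))
    = stair ty (\<lambda>j. to_fract (\<rho> (T j))) (\<lambda>j. - to_fract (\<rho> (Z j))) n (to_fract ` (\<lambda>i. \<rho> (X i)) ` {1..N})"
proof -
  have img: "eval_mpoly \<rho> ` x_vars {1..N} = (\<lambda>i. \<rho> (X i)) ` {1..N}"
    by (simp only: x_vars_def image_image eval_Var)
  have inj: "inj_on (eval_mpoly \<rho>) (x_vars {1..N})"
  proof (rule inj_onI)
    fix x y assume "x \<in> x_vars {1..N}" "y \<in> x_vars {1..N}" and eq: "eval_mpoly \<rho> x = eval_mpoly \<rho> y"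
    then obtain i j where ij: "i \<in> {1..N}" "j \<in> {1..N}" "x = Var (X i)" "y = Var (X j)"
      unfolding x_vars_def by (elim imageE)
    from eq have "\<rho> (X i) = \<rho> (X j)" unfolding ij(3,4) eval_Var .
    hence "i = j" using inj_onD[OF assms _ ij(1,2)] by simp
    thus "x = y" unfolding ij(3,4) by (rule arg_cong)
  qed
  have "specializes \<rho> (to_fract (stair_poly ty n N))
      (stair_fract \<rho> ty (rev [low_row ty..<n]) (to_fract ` eval_mpoly \<rho> ` x_vars {1..N}))"
    unfolding stair_poly_props(1) by (rule specializes_stair[OF finite_x_vars inj]) simp
  from specializes_to_fractD[OF this] show ?thesis
    unfolding img stair_fract_def stair_def by (rule sym)
qed

lemma stair_fract_eq_stair:
  "to_fract (stair_poly ty n N) = stair ty (\<lambda>j. to_fract (Var (T j))) (\<lambda>j. - to_fract (Var (Z j))) n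
    (to_fract ` (\<lambda>i. Var (X i)) ` {1..N})"
  unfolding stair_poly_props(1) stair_fract_def stair_def x_vars_def ..

lemma stair_cong:
  assumes "\<And>j. 1 \<le> j \<Longrightarrow> j < n \<Longrightarrow> p j = p' j" "\<And>j. 1 \<le> j \<Longrightarrow> j < n \<Longrightarrow> q j = q' j"
  shows "stair ty p q n Y = stair ty p' q' n Y"
proof -
  have "map (stair_row ty p q) (rev [low_row ty..<n]) = map (stair_row ty p' q') (rev [low_row ty..<n])"
  proof (rule map_cong[OF refl])
    fix k assume "k \<in> set (rev [low_row ty..<n])"
    hence "k < n" by simp
    thus "stair_row ty p q k = stair_row ty p' q' k" using assms by (simp add: stair_row_def fun_eq_iff)
  qed
  thus ?thesis unfolding stair_def by (rule arg_cong)
qed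

lemma involves_only_stair_poly: "involves_only (allowed (n - 1) N) (stair_poly ty n N)"
proof -
  let ?k = "\<lambda>v. if v \<in> allowed (n - 1) N then Var v else 0"
  have X: "?k (X i) = Var (X i)" if "i \<in> {1..N}" for i using that by (simp add: allowed_def)
  have inj: "inj_on (\<lambda>i. ?k (X i)) {1..N}"
    by (rule inj_onI) (simp only: X Var_eq_iff var.inject)
  have img: "(\<lambda>i. ?k (X i)) ` {1..N} = (\<lambda>i. Var (X i)) ` {1..N}"
    by (rule image_cong[OF refl X])
  have "to_fract (eval_mpoly ?k (stair_poly ty n N)) = to_fract (stair_poly ty n N)"
    unfolding eval_stair_poly[OF inj] img stair_fract_eq_stair
    by (rule stair_cong) (simp_all add: allowed_def)
  thus ?thesis unfolding involves_only_def to_fract_eq_iff .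
qed

lemma eval_stair_poly_permute:
  assumes "\<pi> ` {1..N} = {1..N}" "inj_on \<pi> {1..N}"
    "\<And>j. \<rho>' (T j) = \<rho> (T j)" "\<And>j. \<rho>' (Z j) = \<rho> (Z j)" "\<And>k. k \<in> {1..N} \<Longrightarrow> \<rho>' (X k) = \<rho> (X (\<pi> k))"
  shows "eval_mpoly \<rho>' (stair_poly ty n N) = eval_mpoly \<rho> (stair_poly ty n N)"
proof -
  let ?\<sigma> = "\<lambda>v. case v of X k \<Rightarrow> Var (X (\<pi> k)) | _ \<Rightarrow> Var v"
  have inj: "inj_on (\<lambda>i. ?\<sigma> (X i)) {1..N}"
  proof (rule inj_onI)
    fix i j assume ij: "i \<in> {1..N}" "j \<in> {1..N}" "?\<sigma> (X i) = ?\<sigma> (X j)"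
    from ij(3) have "\<pi> i = \<pi> j" by (simp only: var.case Var_eq_iff var.inject)
    from inj_onD[OF assms(2) this ij(1,2)] show "i = j" .
  qed
  have "(\<lambda>i. ?\<sigma> (X i)) ` {1..N} = (\<lambda>i. Var (X i)) ` \<pi> ` {1..N}"
    by (simp only: image_image var.case)
  hence img: "(\<lambda>i. ?\<sigma> (X i)) ` {1..N} = (\<lambda>i. Var (X i)) ` {1..N}" unfolding assms(1) .
  have "to_fract (eval_mpoly ?\<sigma> (stair_poly ty n N)) = to_fract (stair_poly ty n N)"
    unfolding eval_stair_poly[OF inj] img stair_fract_eq_stair by simp
  hence s: "eval_mpoly ?\<sigma> (stair_poly ty n N) = stair_poly ty n N" by (simp only: to_fract_eq_iff)
  have "eval_mpoly \<rho> (stair_poly ty n N) = eval_mpoly \<rho> (eval_mpoly ?\<sigma> (stair_poly ty n N))"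
    unfolding s ..
  also have "\<dots> = eval_mpoly \<rho>' (stair_poly ty n N)"
    unfolding eval_eval
  proof (rule eval_cong_involves[OF involves_only_stair_poly])
    fix v assume "v \<in> allowed (n - 1) N"
    thus "eval_mpoly \<rho> (?\<sigma> v) = \<rho>' v" using assms(3-5) by (auto simp: allowed_def)
  qed
  finally show ?thesis by (rule sym)
qed

lemma eval_stair_poly_cancel:
  assumes "\<rho> (X (Suc (Suc N))) = - \<rho> (X (Suc N))"
  shows "eval_mpoly \<rho> (stair_poly ty n (Suc (Suc N))) = eval_mpoly \<rho> (stair_poly ty n N)"
proof -
  let ?x = "Var (X (Suc N))"
  \<comment> \<open>The opposite pair is taken generic, which keeps all x-values distinct.\<close>
  let ?\<sigma> = "Var(X (Suc (Suc N)) := - ?x)"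
  have V: "Var v \<noteq> - ?x" for v
  proof
    assume "Var v = - ?x"
    hence "Var v + ?x = 0" by simp
    thus False using Var_add_neq_0 by blast
  qed
  have S: "{1..Suc (Suc N)} = insert (Suc N) (insert (Suc (Suc N)) {1..N})" by auto
  have X: "?\<sigma> (X i) = Var (X i)" if "i \<in> {1..N}" for i using that by simp
  have inj: "inj_on (\<lambda>i. ?\<sigma> (X i)) {1..Suc (Suc N)}"
    by (rule inj_onI) (auto simp: V V[symmetric] split: if_splits)
  have "(\<lambda>i. ?\<sigma> (X i)) ` {1..N} = (\<lambda>i. Var (X i)) ` {1..N}"
    by (rule image_cong[OF refl X])
  hence img: "to_fract ` (\<lambda>i. ?\<sigma> (X i)) ` {1..Suc (Suc N)}
      = insert (to_fract ?x) (insert (- to_fract ?x) (to_fract ` (\<lambda>i. Var (X i)) ` {1..N}))"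
    unfolding S image_insert by simp
  have "to_fract (eval_mpoly ?\<sigma> (stair_poly ty n (Suc (Suc N)))) = to_fract (stair_poly ty n N)"
    unfolding eval_stair_poly[OF inj] img stair_fract_eq_stair
    unfolding stair_def
  proof (subst sym_sum_insert_opposite)
    show "to_fract ?x \<notin> to_fract ` (\<lambda>i. Var (X i)) ` {1..N}" by auto
    show "- to_fract ?x \<notin> to_fract ` (\<lambda>i. Var (X i)) ` {1..N}"
    proof
      assume "- to_fract ?x \<in> to_fract ` (\<lambda>i. Var (X i)) ` {1..N}"
      then obtain i where "- to_fract ?x = to_fract (Var (X i))" by blast
      hence "to_fract (- ?x) = to_fract (Var (X i))" by simp
      thus False using V[of "X i"] by (simp only: to_fract_eq_iff)
    qed
    have "to_fract ?x \<noteq> to_fract (- ?x)" using V[of "X (Suc N)"] by (simp only: to_fract_eq_iff not_False_eq_True)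
    thus "to_fract ?x \<noteq> - to_fract ?x" by simp
  qed simp_all
  hence s: "eval_mpoly ?\<sigma> (stair_poly ty n (Suc (Suc N))) = stair_poly ty n N" by (simp only: to_fract_eq_iff)
  have "eval_mpoly \<rho> (stair_poly ty n N) = eval_mpoly \<rho> (eval_mpoly ?\<sigma> (stair_poly ty n (Suc (Suc N))))"
    unfolding s ..
  also have "\<dots> = eval_mpoly \<rho> (stair_poly ty n (Suc (Suc N)))"
    unfolding eval_eval
    by (rule arg_cong[where f = "\<lambda>r. eval_mpoly r _"]) (use assms in \<open>simp add: fun_eq_iff\<close>)
  finally show ?thesis by (rule sym)
qed

text \<open>In type C every row contains the factor \<open>x\<close>; for \<open>n \<le> 1\<close>
  type D has no rows at all.\<close>

lemma stair_insert_0: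
  assumes "ty = TypeC \<or> n \<le> 1" "finite Y" "0 \<notin> Y"
  shows "stair ty p q n (insert 0 Y) = stair ty p q n Y"
  unfolding stair_def
proof (rule sym_sum_insert_0[OF assms(2,3)])
  fix g assume "g \<in> set (map (stair_row ty p q) (rev [low_row ty..<n]))"
  then obtain k where "g = stair_row ty p q k" "low_row ty \<le> k" "k < n" by auto
  thus "g 0 = 0" using assms(1) by (cases ty) (auto simp: stair_row_def)
qed

lemma eval_stair_poly_zero:
  assumes "ty = TypeC \<or> n \<le> 1" "\<rho> (X (Suc N)) = 0"
  shows "eval_mpoly \<rho> (stair_poly ty n (Suc N)) = eval_mpoly \<rho> (stair_poly ty n N)"
proof -
  let ?\<sigma> = "Var(X (Suc N) := 0)"
  have S: "{1..Suc N} = insert (Suc N) {1..N}" by auto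
  have X: "?\<sigma> (X i) = Var (X i)" if "i \<in> {1..N}" for i using that by simp
  have inj: "inj_on (\<lambda>i. ?\<sigma> (X i)) {1..Suc N}"
    by (rule inj_onI) (auto split: if_splits)
  have "(\<lambda>i. ?\<sigma> (X i)) ` {1..N} = (\<lambda>i. Var (X i)) ` {1..N}"
    by (rule image_cong[OF refl X])
  hence img: "to_fract ` (\<lambda>i. ?\<sigma> (X i)) ` {1..Suc N} = insert 0 (to_fract ` (\<lambda>i. Var (X i)) ` {1..N})"
    unfolding S image_insert by simp
  have "to_fract (eval_mpoly ?\<sigma> (stair_poly ty n (Suc N))) = to_fract (stair_poly ty n N)"
    unfolding eval_stair_poly[OF inj] img stair_fract_eq_stair
    by (subst stair_insert_0[OF assms(1)]) auto
  hence s: "eval_mpoly ?\<sigma> (stair_poly ty n (Suc N)) = stair_poly ty n N" by (simp only: to_fract_eq_iff)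
  have "eval_mpoly \<rho> (stair_poly ty n N) = eval_mpoly \<rho> (eval_mpoly ?\<sigma> (stair_poly ty n (Suc N)))"
    unfolding s ..
  also have "\<dots> = eval_mpoly \<rho> (stair_poly ty n (Suc N))"
    unfolding eval_eval
    by (rule arg_cong[where f = "\<lambda>r. eval_mpoly r _"]) (use assms(2) in \<open>simp add: fun_eq_iff\<close>)
  finally show ?thesis by (rule sym)
qed

text \<open>\<open>2 * N\<close> is an even number of variables that is at least \<open>N\<close>;
  the surplus variables are set to 0. Even numbers are compatible in both types.\<close>

definition stair_xfun :: "lie_type \<Rightarrow> nat \<Rightarrow> xfun" where
  "stair_xfun ty n N = restrict_x N (stair_poly ty n (2 * N))"

lemma eval_stair_poly_even:
  assumes "\<And>k. k > 2 * N \<Longrightarrow> \<rho> (X k) = 0"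
  shows "eval_mpoly \<rho> (stair_poly ty n (2 * (N + d))) = eval_mpoly \<rho> (stair_poly ty n (2 * N))"
proof (induction d)
  case (Suc d)
  have S: "2 * (N + Suc d) = Suc (Suc (2 * (N + d)))" by simp
  show ?case unfolding S Suc[symmetric] by (rule eval_stair_poly_cancel) (simp add: assms)
qed simp

lemma eval_stair_poly_stable:
  assumes "even M" "even M'" "\<And>k. k > M \<or> k > M' \<Longrightarrow> \<rho> (X k) = 0"
  shows "eval_mpoly \<rho> (stair_poly ty n M) = eval_mpoly \<rho> (stair_poly ty n M')"
proof -
  obtain m m' where m: "M = 2 * m" "M' = 2 * m'" using assms(1,2) by (elim evenE)
  have 1: "eval_mpoly \<rho> (stair_poly ty n (2 * (m + m'))) = eval_mpoly \<rho> (stair_poly ty n (2 * m))"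
    by (rule eval_stair_poly_even) (use assms(3) m in auto)
  have "eval_mpoly \<rho> (stair_poly ty n (2 * (m' + m))) = eval_mpoly \<rho> (stair_poly ty n (2 * m'))"
    by (rule eval_stair_poly_even) (use assms(3) m in auto)
  with 1 show ?thesis unfolding m by (simp add: add.commute)
qed

lemma restrict_stair_poly:
  assumes "even M" "M \<ge> N"
  shows "restrict_x N (stair_poly ty n M) = stair_xfun ty n N"
  unfolding restrict_x_def subst_eq_eval stair_xfun_def
  by (rule eval_stair_poly_stable) (use assms in auto)

lemma restrict_stair_poly_zero:
  assumes "ty = TypeC \<or> n \<le> 1" "M \<ge> N"
  shows "restrict_x N (stair_poly ty n M) = stair_xfun ty n N"
proof (cases "even M")
  case False
  have "restrict_x N (stair_poly ty n M) = restrict_x N (stair_poly ty n (Suc M))"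
    unfolding restrict_x_def subst_eq_eval
    by (rule eval_stair_poly_zero[OF assms(1), symmetric]) (use assms(2) in simp)
  also have "\<dots> = stair_xfun ty n N" by (rule restrict_stair_poly) (use False assms(2) in auto)
  finally show ?thesis .
qed (use assms(2) restrict_stair_poly in blast)

lemma xeval_stair_xfun:
  assumes "even M" "M \<ge> length \<xi>"
  shows "xeval \<tau> \<zeta> \<xi> (stair_xfun ty n) = eval_mpoly (point \<tau> \<zeta> \<xi>) (stair_poly ty n M)"
proof -
  have "xeval \<tau> \<zeta> \<xi> (stair_xfun ty n) = eval_mpoly (point \<tau> \<zeta> \<xi>) (stair_poly ty n (2 * length \<xi>))"
    unfolding xeval_def stair_xfun_def restrict_x_def subst_eq_eval eval_eval
    by (rule arg_cong[where f = "\<lambda>r. eval_mpoly r _"]) (auto simp: fun_eq_iff point_def split: var.split)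
  also have "\<dots> = eval_mpoly (point \<tau> \<zeta> \<xi>) (stair_poly ty n M)"
    by (rule eval_stair_poly_stable) (use assms in \<open>auto simp: point_def\<close>)
  finally show ?thesis .
qed

lemma stair_xfun_mset:
  assumes "mset \<xi> = mset \<xi>'"
  shows "xeval \<tau> \<zeta> \<xi> (stair_xfun ty n) = xeval \<tau> \<zeta> \<xi>' (stair_xfun ty n)"
proof -
  let ?L = "length \<xi>"
  obtain \<pi> where \<pi>: "\<pi> permutes {..<?L}" "permute_list \<pi> \<xi> = \<xi>'"
    using mset_eq_permutation[OF assms[symmetric]] by blast
  have len: "length \<xi>' = ?L" using mset_eq_length[OF assms] by (rule sym)
  \<comment> \<open>The value is computed with \<open>2 * ?L\<close> variables, the last half of
    them 0, so the permutation is extended by the identity and then shifted to indices from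
    1.\<close>
  have perm: "\<pi> permutes {..<2 * ?L}" using \<pi>(1) by (rule permutes_subset) simp
  define \<pi>' where "\<pi>' = (\<lambda>k. Suc (\<pi> (k - 1)))"
  have S: "{1..2 * ?L} = Suc ` {..<2 * ?L}" by (simp add: lessThan_atLeast0 image_Suc_atLeastLessThan atLeastLessThanSuc_atLeastAtMost)
  have comp: "(\<lambda>k. \<pi>' (Suc k)) = (\<lambda>k. Suc (\<pi> k))" by (simp add: \<pi>'_def)
  have "\<pi>' ` {1..2 * ?L} = Suc ` \<pi> ` {..<2 * ?L}" unfolding S image_image comp ..
  hence img: "\<pi>' ` {1..2 * ?L} = {1..2 * ?L}" unfolding permutes_image[OF perm] S .
  have inj: "inj_on \<pi>' {1..2 * ?L}"
  proof (rule inj_onI)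
    fix k l assume "k \<in> {1..2 * ?L}" "l \<in> {1..2 * ?L}" "\<pi>' k = \<pi>' l"
    moreover from this have "k - 1 = l - 1" using permutes_inj[OF perm] by (simp add: \<pi>'_def inj_eq)
    moreover have "k \<ge> 1" "l \<ge> 1" using calculation by auto
    ultimately show "k = l" by arith
  qed
  have pt: "point \<tau> \<zeta> \<xi>' (X k) = point \<tau> \<zeta> \<xi> (X (\<pi>' k))" if k: "k \<in> {1..2 * ?L}" for k
  proof (cases "k \<le> ?L")
    case True
    hence k1: "k - 1 < ?L" using k by auto
    have "\<pi> (k - 1) < ?L" using permutes_in_image[OF \<pi>(1), of "k - 1"] k1 by simp
    moreover have "\<xi>' ! (k - 1) = \<xi> ! \<pi> (k - 1)"
      unfolding \<pi>(2)[symmetric] by (rule permute_list_nth[OF \<pi>(1) k1])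
    ultimately show ?thesis using True k len by (simp add: point_def \<pi>'_def)
  next
    case False
    hence "\<pi> (k - 1) = k - 1" using k by (intro permutes_not_in[OF \<pi>(1)]) auto
    thus ?thesis using False k len by (simp add: point_def \<pi>'_def)
  qed
  have "eval_mpoly (point \<tau> \<zeta> \<xi>') (stair_poly ty n (2 * ?L)) = eval_mpoly (point \<tau> \<zeta> \<xi>) (stair_poly ty n (2 * ?L))"
    by (rule eval_stair_poly_permute[where \<pi> = \<pi>']) (rule img inj pt | simp add: point_def)+
  thus ?thesis
    using xeval_stair_xfun[of "2 * ?L" \<xi> \<tau> \<zeta> ty n] xeval_stair_xfun[of "2 * ?L" \<xi>' \<tau> \<zeta> ty n] len by simp
qed

lemma stair_xfun_zero: "xeval \<tau> \<zeta> (0 # \<xi>) (stair_xfun ty n) = xeval \<tau> \<zeta> \<xi> (stair_xfun ty n)"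
proof -
  let ?M = "2 * Suc (length \<xi>)"
  have pt: "point \<tau> \<zeta> (\<xi> @ [0]) = point \<tau> \<zeta> \<xi>"
    by (auto simp: fun_eq_iff point_def nth_append split: var.split)
  have "xeval \<tau> \<zeta> (0 # \<xi>) (stair_xfun ty n) = xeval \<tau> \<zeta> (\<xi> @ [0]) (stair_xfun ty n)"
    by (rule stair_xfun_mset) simp
  also have "\<dots> = eval_mpoly (point \<tau> \<zeta> \<xi>) (stair_poly ty n ?M)"
    unfolding pt[symmetric] by (rule xeval_stair_xfun) simp_all
  also have "\<dots> = xeval \<tau> \<zeta> \<xi> (stair_xfun ty n)"
    by (rule xeval_stair_xfun[symmetric]) simp_all
  finally show ?thesis .
qed

lemma stair_xfun_cancel: "xeval \<tau> \<zeta> (a # - a # \<xi>) (stair_xfun ty n) = xeval \<tau> \<zeta> \<xi> (stair_xfun ty n)"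
proof -
  have ev: "xeval \<tau> \<zeta> (a # - a # \<xi>) (stair_xfun ty n) = xeval \<tau> \<zeta> \<xi> (stair_xfun ty n)"
    if len: "even (length \<xi>)" for \<xi>
  proof -
    let ?L = "length \<xi>" and ?\<xi>' = "\<xi> @ [a, - a]"
    have "xeval \<tau> \<zeta> (a # - a # \<xi>) (stair_xfun ty n) = xeval \<tau> \<zeta> ?\<xi>' (stair_xfun ty n)"
      by (rule stair_xfun_mset) simp
    also have "\<dots> = eval_mpoly (point \<tau> \<zeta> ?\<xi>') (stair_poly ty n (Suc (Suc ?L)))"
      by (rule xeval_stair_xfun) (use len in simp_all)
    also have "\<dots> = eval_mpoly (point \<tau> \<zeta> ?\<xi>') (stair_poly ty n ?L)"
      by (rule eval_stair_poly_cancel) (simp add: point_def nth_append)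
    also have "\<dots> = eval_mpoly (point \<tau> \<zeta> \<xi>) (stair_poly ty n ?L)"
      by (rule eval_cong_involves[OF involves_only_stair_poly]) (auto simp: allowed_def point_def nth_append)
    also have "\<dots> = xeval \<tau> \<zeta> \<xi> (stair_xfun ty n)"
      by (rule xeval_stair_xfun[symmetric]) (use len in simp_all)
    finally show ?thesis .
  qed
  show ?thesis
  proof (cases "even (length \<xi>)")
    \<comment> \<open>A list of odd length is completed by a zero.\<close>
    case False
    have "xeval \<tau> \<zeta> (a # - a # \<xi>) (stair_xfun ty n) = xeval \<tau> \<zeta> (0 # a # - a # \<xi>) (stair_xfun ty n)"
      by (rule stair_xfun_zero[symmetric])
    also have "\<dots> = xeval \<tau> \<zeta> (a # - a # 0 # \<xi>) (stair_xfun ty n)"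
      by (rule stair_xfun_mset) simp
    also have "\<dots> = xeval \<tau> \<zeta> (0 # \<xi>) (stair_xfun ty n)" by (rule ev) (use False in simp)
    also have "\<dots> = xeval \<tau> \<zeta> \<xi> (stair_xfun ty n)" by (rule stair_xfun_zero)
    finally show ?thesis .
  qed (rule ev)
qed

lemma good_stair_xfun: "good (stair_xfun ty n)"
proof -
  have "involves_only (allowed (n - 1) N) (stair_xfun ty n N)" for N
    unfolding stair_xfun_def restrict_x_def subst_eq_eval
    by (rule involves_only_eval[OF involves_only_stair_poly]) (auto simp: allowed_def)
  hence fv: "finite_vars (stair_xfun ty n)" unfolding finite_vars_def by blast
  have "total_degree (stair_xfun ty n N) \<le> sum_list (map (\<lambda>k. 2 * k + 1) (rev [low_row ty..<n]))" for N
    unfolding stair_xfun_def restrict_x_def subst_eq_eval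
    by (rule order_trans[OF total_degree_eval_le stair_poly_props(2)]) (auto split: var.split)
  hence bd: "bounded_degree (stair_xfun ty n)" unfolding bounded_degree_def by blast
  have "supersymmetric (stair_xfun ty n)"
    unfolding supersymmetric_def
    by (intro conjI allI impI stair_xfun_mset stair_xfun_zero stair_xfun_cancel)
  with fv bd show ?thesis by (simp add: good_def)
qed

text \<open>The way back from polynomials to symmetrized sums. An odd list is completed by 0, which
  the sum tolerates in type C provided that 0 is not yet among the values.\<close>

lemma xeval_stair_xfun_eq:
  fixes \<tau> \<zeta> :: "int \<Rightarrow> mpoly"
  assumes "distinct \<xi>" "even (length \<xi>) \<or> ty = TypeC \<and> 0 \<notin> set \<xi>"
  shows "to_fract (xeval \<tau> \<zeta> \<xi> (stair_xfun ty n))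
    = stair ty (\<lambda>j. to_fract (\<tau> (int j))) (\<lambda>j. - to_fract (\<zeta> (int j))) n (to_fract ` set \<xi>)"
proof -
  have ev: "to_fract (xeval \<tau> \<zeta> \<xi> (stair_xfun ty n))
      = stair ty (\<lambda>j. to_fract (\<tau> (int j))) (\<lambda>j. - to_fract (\<zeta> (int j))) n (to_fract ` set \<xi>)"
    if d: "distinct \<xi>" "even (length \<xi>)" for \<xi>
  proof -
    let ?\<rho> = "point \<tau> \<zeta> \<xi>"
    have X: "?\<rho> (X k) = \<xi> ! (k - 1)" if "k \<in> {1..length \<xi>}" for k using that by (simp add: point_def)
    have inj: "inj_on (\<lambda>k. ?\<rho> (X k)) {1..length \<xi>}"
    proof (rule inj_onI)
      fix k l assume kl: "k \<in> {1..length \<xi>}" "l \<in> {1..length \<xi>}" "?\<rho> (X k) = ?\<rho> (X l)"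
      hence "\<xi> ! (k - 1) = \<xi> ! (l - 1)" by (simp only: X)
      moreover have "k - 1 < length \<xi>" "l - 1 < length \<xi>" using kl by auto
      ultimately have "k - 1 = l - 1" using nth_eq_iff_index_eq[OF d(1)] by blast
      thus "k = l" using kl(1,2) by auto
    qed
    have "(\<lambda>k. ?\<rho> (X k)) ` {1..length \<xi>} = (\<lambda>k. \<xi> ! (k - 1)) ` {1..length \<xi>}"
      by (rule image_cong[OF refl X])
    also have "(\<lambda>k. \<xi> ! (k - 1)) ` {1..length \<xi>} = (\<lambda>k. \<xi> ! (k - 1)) ` Suc ` {0..<length \<xi>}"
      by (simp add: atLeastLessThanSuc_atLeastAtMost)
    also have "\<dots> = set \<xi>"
      unfolding image_image set_conv_nth by auto
    finally have img: "(\<lambda>k. ?\<rho> (X k)) ` {1..length \<xi>} = set \<xi>" .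
    have "xeval \<tau> \<zeta> \<xi> (stair_xfun ty n) = eval_mpoly ?\<rho> (stair_poly ty n (length \<xi>))"
      by (rule xeval_stair_xfun) (use d in simp_all)
    hence "to_fract (xeval \<tau> \<zeta> \<xi> (stair_xfun ty n)) = stair ty (\<lambda>j. to_fract (?\<rho> (T j)))
        (\<lambda>j. - to_fract (?\<rho> (Z j))) n (to_fract ` set \<xi>)"
      using eval_stair_poly[OF inj, of ty n] unfolding img by (simp only:)
    moreover have "?\<rho> (T j) = \<tau> (int j)" "?\<rho> (Z j) = \<zeta> (int j)" for j by (simp_all add: point_def)
    ultimately show ?thesis by (simp only:)
  qed
  show ?thesis
  proof (cases "even (length \<xi>)")
    case False
    hence C: "ty = TypeC" "0 \<notin> set \<xi>" using assms(2) by auto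
    have "to_fract (xeval \<tau> \<zeta> (0 # \<xi>) (stair_xfun ty n))
      = stair ty (\<lambda>j. to_fract (\<tau> (int j))) (\<lambda>j. - to_fract (\<zeta> (int j))) n (to_fract ` set (0 # \<xi>))"
      by (rule ev) (use assms(1) C(2) False in simp_all)
    also have "to_fract ` set (0 # \<xi>) = insert 0 (to_fract ` set \<xi>)" by simp
    also have "stair ty (\<lambda>j. to_fract (\<tau> (int j))) (\<lambda>j. - to_fract (\<zeta> (int j))) n (insert 0 (to_fract ` set \<xi>))
      = stair ty (\<lambda>j. to_fract (\<tau> (int j))) (\<lambda>j. - to_fract (\<zeta> (int j))) n (to_fract ` set \<xi>)"
      by (rule stair_insert_0) (use C in auto)
    finally show ?thesis unfolding stair_xfun_zero .
  qed (use ev assms(1) in blast)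
qed

section \<open>Factorial functions as staircase functions\<close>

text \<open>The summand of the factorial function that belongs to the ordering \<open>l\<close> of
  the variables.\<close>

definition perm_term :: "('a::field \<Rightarrow> 'a) list \<Rightarrow> 'a list \<Rightarrow> 'a" where
  "perm_term gs l = (\<Prod>i<length gs. (gs ! i) (l ! i) * (\<Prod>j\<in>{Suc i..<length l}. (l ! i + l ! j) / (l ! i - l ! j)))"

lemma perm_term_Cons:
  assumes "distinct l"
  shows "perm_term (g # gs) (x # l) = g x * (\<Prod>y\<in>set l. (x + y) / (x - y)) * perm_term gs l"
proof -
  have row: "(\<Prod>j\<in>{0..<length l}. (x + l ! j) / (x - l ! j)) = (\<Prod>y\<in>set l. (x + y) / (x - y))"
    using prod.distinct_set_conv_list[OF assms, of "\<lambda>y. (x + y) / (x - y)"]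
      prod.list_conv_set_nth[of "map (\<lambda>y. (x + y) / (x - y)) l"] by simp
  show ?thesis
    unfolding perm_term_def length_Cons prod.lessThan_Suc_shift prod.shift_bounds_Suc_ivl nth_Cons_0 nth_Cons_Suc row ..
qed

text \<open>The summand depends only on the entries that receive a row and on the set of the others.
  The orderings of the latter account for the factorial that the definition divides by.\<close>

lemma sum_perm_term:
  assumes "finite Y" "length gs \<le> card Y"
  shows "(\<Sum>l\<in>permutations_of_set Y. perm_term gs l) = of_nat (fact (card Y - length gs)) * sym_sum gs (\<lambda>_. 1) Y"
  using assms
proof (induction gs arbitrary: Y)
  case Nil
  thus ?case by (simp add: perm_term_def card_permutations_of_set)
next
  case (Cons g gs)
  have ne: "Y \<noteq> {}" using Cons.prems by auto
  have "(\<Sum>l\<in>permutations_of_set Y. perm_term (g # gs) l)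
      = (\<Sum>x\<in>Y. \<Sum>l\<in>(#) x ` permutations_of_set (Y - {x}). perm_term (g # gs) l)"
    unfolding permutations_of_set_nonempty[OF ne]
    by (rule sum.UNION_disjoint) (use Cons.prems(1) in auto)
  also have "\<dots> = (\<Sum>x\<in>Y. of_nat (fact (card Y - length (g # gs))) * (g x * pair_ratio x Y * sym_sum gs (\<lambda>_. 1) (Y - {x})))"
  proof (rule sum.cong[OF refl])
    fix x assume x: "x \<in> Y"
    have c: "card (Y - {x}) = card Y - 1" using x by (simp add: Cons.prems(1))
    have "(\<Sum>l\<in>(#) x ` permutations_of_set (Y - {x}). perm_term (g # gs) l)
        = (\<Sum>l\<in>permutations_of_set (Y - {x}). perm_term (g # gs) (x # l))"
      by (subst sum.reindex) (auto simp: inj_on_def)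
    also have "\<dots> = (\<Sum>l\<in>permutations_of_set (Y - {x}). g x * pair_ratio x Y * perm_term gs l)"
    proof (rule sum.cong[OF refl])
      fix l assume "l \<in> permutations_of_set (Y - {x})"
      hence "distinct l" "set l = Y - {x}" by (auto dest: permutations_of_setD)
      thus "perm_term (g # gs) (x # l) = g x * pair_ratio x Y * perm_term gs l"
        by (simp only: perm_term_Cons pair_ratio_def)
    qed
    also have "\<dots> = g x * pair_ratio x Y * (of_nat (fact (card (Y - {x}) - length gs)) * sym_sum gs (\<lambda>_. 1) (Y - {x}))"
      unfolding sum_distrib_left[symmetric]
      by (subst Cons.IH) (use Cons.prems c in auto)
    also have "\<dots> = of_nat (fact (card Y - length (g # gs))) * (g x * pair_ratio x Y * sym_sum gs (\<lambda>_. 1) (Y - {x}))"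
      unfolding c by (simp add: mult_ac)
    finally show "(\<Sum>l\<in>(#) x ` permutations_of_set (Y - {x}). perm_term (g # gs) l)
      = of_nat (fact (card Y - length (g # gs))) * (g x * pair_ratio x Y * sym_sum gs (\<lambda>_. 1) (Y - {x}))" .
  qed
  also have "\<dots> = of_nat (fact (card Y - length (g # gs))) * sym_sum (g # gs) (\<lambda>_. 1) Y"
    by (simp only: sum_distrib_left sym_sum.simps)
  finally show ?case .
qed

lemma bij_betw_permutes_permutations_of_set:
  fixes f :: "nat \<Rightarrow> 'a"
  assumes "inj f"
  shows "bij_betw (\<lambda>w. map (\<lambda>i. f (w i)) [1..<Suc N]) {w. w permutes {1..N}} (permutations_of_set (f ` {1..N}))"
proof -
  let ?m = "\<lambda>w. map (\<lambda>i. f (w i)) [1..<Suc N]" and ?P = "{w. w permutes {1..N}}"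
  have set: "set [1..<Suc N] = {1..N}" by auto
  have inj: "inj_on ?m ?P"
  proof (rule inj_onI)
    fix w w' assume w: "w \<in> ?P" "w' \<in> ?P" "?m w = ?m w'"
    show "w = w'"
    proof
      fix i
      show "w i = w' i"
      proof (cases "i \<in> {1..N}")
        case True
        hence "f (w i) = f (w' i)" using w(3) unfolding map_eq_conv set by blast
        thus ?thesis using assms by (simp only: inj_eq)
      next
        case False
        have "w i = i" by (rule permutes_not_in[of w "{1..N}"]) (use w(1) False in simp_all)
        moreover have "w' i = i" by (rule permutes_not_in[of w' "{1..N}"]) (use w(2) False in simp_all)
        ultimately show ?thesis by simp
      qed
    qed
  qed
  have sub: "?m ` ?P \<subseteq> permutations_of_set (f ` {1..N})"
  proof
    fix l assume "l \<in> ?m ` ?P"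
    then obtain w where w: "w permutes {1..N}" "l = ?m w" by auto
    have "set l = (\<lambda>i. f (w i)) ` {1..N}" unfolding w(2) set_map set ..
    also have "\<dots> = f ` w ` {1..N}" by (simp only: image_image)
    also have "\<dots> = f ` {1..N}" unfolding permutes_image[OF w(1)] ..
    finally have "set l = f ` {1..N}" .
    moreover have "distinct l"
      unfolding w(2) distinct_map set
      by (intro conjI distinct_upt inj_onI) (use assms permutes_inj[OF w(1)] in \<open>simp add: inj_eq\<close>)
    ultimately show "l \<in> permutations_of_set (f ` {1..N})" by (rule permutations_of_setI)
  qed
  have "card (?m ` ?P) = card (permutations_of_set (f ` {1..N}))"
    unfolding card_image[OF inj]
    using card_permutations[of "{1..N}" N] card_image[of f "{1..N}"] assms
    by (simp add: card_permutations_of_set inj_on_subset)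
  hence "?m ` ?P = permutations_of_set (f ` {1..N})"
    by (intro card_subset_eq sub) simp
  with inj show ?thesis by (simp only: bij_betw_def)
qed

lemma factorial_P_fract_eq:
  assumes "length lam \<le> N"
  shows "factorial_P_fract N lam a
    = sym_sum (map (\<lambda>k x. \<Prod>i<k. x - to_fract (a i)) lam) (\<lambda>_. 1) (to_fract ` (\<lambda>i. Var (X i)) ` {1..N})"
proof -
  let ?r = "length lam" and ?f = "\<lambda>i. to_fract (Var (X i))" and ?P = "{w. w permutes {1..N}}"
  let ?gs = "map (\<lambda>k x. \<Prod>i<k. x - to_fract (a i)) lam" and ?Y = "?f ` {1..N}"
  let ?m = "\<lambda>w. map (\<lambda>i. ?f (w i)) [1..<Suc N]"
  have inj: "inj ?f" by (rule injI) (simp only: to_fract_eq_iff Var_eq_iff var.inject)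
  have card: "card ?Y = N" using card_image[of ?f "{1..N}"] inj by (simp add: inj_on_subset)
  have term_eq: "(\<Prod>i = 1..?r. to_fract (factorial_power (Var (X (w i))) a (lam ! (i - 1)))) *
      (\<Prod>i = 1..?r. \<Prod>j = i+1..N. to_fract (Var (X (w i)) + Var (X (w j))) / to_fract (Var (X (w i)) - Var (X (w j))))
      = perm_term ?gs (?m w)" for w
  proof -
    have nth: "?m w ! i = ?f (w (Suc i))" if "i < N" for i using that by (simp del: upt_Suc)
    have S: "(\<Prod>i = 1..?r. h i) = (\<Prod>i<?r. h (Suc i))" for h :: "nat \<Rightarrow> mpoly fract"
      by (simp only: One_nat_def prod.atLeast1_atMost_eq)
    have S2: "(\<Prod>j = Suc i + 1..N. h j) = (\<Prod>j\<in>{Suc i..<N}. h (Suc j))" for h :: "nat \<Rightarrow> mpoly fract" and i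
      by (simp only: add_Suc_right add_0_right One_nat_def prod.shift_bounds_Suc_ivl[symmetric] atLeastLessThanSuc_atLeastAtMost)
    show ?thesis
      unfolding S S2 prod.distrib[symmetric] perm_term_def length_map length_upt diff_Suc_1
    proof (rule prod.cong[OF refl])
      fix i assume i: "i \<in> {..<?r}"
      hence iN: "i < N" using assms by simp
      have "to_fract (factorial_power (Var (X (w (Suc i)))) a (lam ! i)) = (?gs ! i) (?m w ! i)"
        unfolding nth[OF iN] using i by (simp add: factorial_power_def to_fract_prod)
      moreover have "(\<Prod>j\<in>{Suc i..<N}. to_fract (Var (X (w (Suc i))) + Var (X (w (Suc j)))) / to_fract (Var (X (w (Suc i))) - Var (X (w (Suc j)))))
          = (\<Prod>j\<in>{Suc i..<N}. (?m w ! i + ?m w ! j) / (?m w ! i - ?m w ! j))"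
      proof (rule prod.cong[OF refl])
        fix j assume "j \<in> {Suc i..<N}"
        hence "j < N" by simp
        thus "to_fract (Var (X (w (Suc i))) + Var (X (w (Suc j)))) / to_fract (Var (X (w (Suc i))) - Var (X (w (Suc j))))
          = (?m w ! i + ?m w ! j) / (?m w ! i - ?m w ! j)"
          unfolding nth[OF iN] by (simp only: nth to_fract_add to_fract_diff)
      qed
      ultimately show "to_fract (factorial_power (Var (X (w (Suc i)))) a (lam ! i)) *
          (\<Prod>j\<in>{Suc i..<N}. to_fract (Var (X (w (Suc i))) + Var (X (w (Suc j)))) / to_fract (Var (X (w (Suc i))) - Var (X (w (Suc j)))))
        = (?gs ! i) (?m w ! i) * (\<Prod>j\<in>{Suc i..<N}. (?m w ! i + ?m w ! j) / (?m w ! i - ?m w ! j))"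
        by (simp only:)
    qed
  qed
  have "factorial_P_fract N lam a = 1 / of_nat (fact (N - ?r)) * (\<Sum>w\<in>?P. perm_term ?gs (?m w))"
    unfolding factorial_P_fract_def Let_def term_eq ..
  also have "(\<Sum>w\<in>?P. perm_term ?gs (?m w)) = (\<Sum>l\<in>permutations_of_set ?Y. perm_term ?gs l)"
    by (rule sum.reindex_bij_betw[OF bij_betw_permutes_permutations_of_set[OF inj]])
  also have "\<dots> = of_nat (fact (N - ?r)) * sym_sum ?gs (\<lambda>_. 1) ?Y"
  proof -
    have "finite ?Y" "length ?gs \<le> card ?Y" unfolding card length_map by (simp, rule assms)
    from sum_perm_term[OF this] show ?thesis unfolding card length_map .
  qed
  also have "1 / of_nat (fact (N - ?r)) * (of_nat (fact (N - ?r)) * sym_sum ?gs (\<lambda>_. 1) ?Y) = sym_sum ?gs (\<lambda>_. 1) ?Y"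
  proof -
    have "(of_nat k :: mpoly fract) = to_fract (of_nat k)" for k by (induction k) simp_all
    moreover have "(of_nat k :: mpoly) \<noteq> 0" if "k > 0" for k
    proof
      assume "(of_nat k :: mpoly) = 0"
      hence "eval_mpoly (\<lambda>_. 0 :: int) (of_nat k) = eval_mpoly (\<lambda>_. 0) 0" by (rule arg_cong)
      thus False using that by simp
    qed
    ultimately have "(of_nat k :: mpoly fract) \<noteq> 0" if "k > 0" for k using that by simp
    from this[of "fact (N - ?r)"] have "(of_nat (fact (N - ?r)) :: mpoly fract) \<noteq> 0" by (simp only: fact_gt_zero simp_thms)
    thus ?thesis by simp
  qed
  finally show ?thesis unfolding image_image .
qed

section \<open>Staircase partitions and their parameters\<close>

lemma prod_pairs: "(\<Prod>i<2 * k. h i) = (\<Prod>j\<in>{1..k}. h (2 * (j - 1)) * h (2 * (j - 1) + 1))"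
  for h :: "nat \<Rightarrow> 'a::comm_monoid_mult"
  by (induction k) (simp_all add: mult_ac)

lemma nth_default_pairs:
  assumes "m + j < n"
  shows "nth_default d (concat (map (\<lambda>i. [f i, g i]) [m..<n])) (2 * j) = f (m + j)"
    "nth_default d (concat (map (\<lambda>i. [f i, g i]) [m..<n])) (Suc (2 * j)) = g (m + j)"
  using assms
proof (induction j arbitrary: m)
  case 0
  { case 1 thus ?case by (simp add: upt_conv_Cons nth_default_Cons) }
  { case 2 thus ?case by (simp add: upt_conv_Cons nth_default_Cons) }
next
  case (Suc j)
  { case 1 thus ?case using Suc(1)[of "Suc m"] by (simp add: upt_conv_Cons nth_default_Cons) }
  { case 2 thus ?case using Suc(2)[of "Suc m"] by (simp add: upt_conv_Cons nth_default_Cons) }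
qed

lemma tz_params_nth:
  assumes "1 \<le> j" "j < n"
  shows "tz_params n (2 * (j - 1)) = Var (T j)" "tz_params n (2 * (j - 1) + 1) = - Var (Z j)"
  using nth_default_pairs[of 1 "j - 1" n "0 :: mpoly" "\<lambda>i. Var (T i)" "\<lambda>i. - Var (Z i)"] assms
  by (simp_all add: tz_params_def)

lemma prod_tz_params:
  assumes "k < n"
  shows "(\<Prod>i<2 * k. x - to_fract (tz_params n i))
    = (\<Prod>j\<in>{1..k}. (x - to_fract (Var (T j))) * (x - (- to_fract (Var (Z j)))))"
  unfolding prod_pairs
proof (rule prod.cong[OF refl])
  fix j assume "j \<in> {1..k}"
  hence "1 \<le> j" "j < n" using assms by auto
  thus "(x - to_fract (tz_params n (2 * (j - 1)))) * (x - to_fract (tz_params n (2 * (j - 1) + 1)))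
    = (x - to_fract (Var (T j))) * (x - (- to_fract (Var (Z j))))"
    by (simp only: tz_params_nth to_fract_uminus)
qed

definition lie_rho :: "lie_type \<Rightarrow> nat \<Rightarrow> nat list" where
  "lie_rho ty n = (if ty = TypeC then rho_C n else rho_D n)"

text \<open>The leading 0 in type C stems from the definition of Q by P; it is the source of the
  factor \<open>x\<close> in the rows.\<close>

definition lie_params :: "lie_type \<Rightarrow> nat \<Rightarrow> nat \<Rightarrow> mpoly" where
  "lie_params ty n = (if ty = TypeC then case_nat 0 (tz_params n) else tz_params n)"

lemma rho_nth: "i < k \<Longrightarrow> rho k ! i = k - i"
  and length_rho: "length (rho k) = k"
  by (simp_all add: rho_def rev_nth del: upt_Suc)

lemma lie_rho_eq:
  assumes "n \<ge> 1"
  shows "lie_rho ty n = map (\<lambda>k. if ty = TypeC then Suc (2 * k) else 2 * k) (rev [low_row ty..<n])"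
proof (cases ty)
  case TypeC
  have "rho_C n = map (\<lambda>k. Suc (2 * k)) (rev [0..<n])"
  proof (rule nth_equalityI)
    show "length (rho_C n) = length (map (\<lambda>k. Suc (2 * k)) (rev [0..<n]))"
      using assms by (simp add: rho_C_def length_rho)
    fix i assume "i < length (rho_C n)"
    hence i: "i < n" using assms by (simp add: rho_C_def length_rho)
    have "(rho (n - 1) @ [0]) ! i = n - 1 - i"
      using i assms by (cases "i = n - 1") (simp_all add: rho_nth length_rho nth_append)
    moreover have "rho n ! i = n - i" using i by (rule rho_nth)
    moreover have "i < length (rho n)" "i < length (rho (n - 1) @ [0])" using i by (simp_all add: length_rho)
    ultimately have "rho_C n ! i = n - i + (n - 1 - i)" unfolding rho_C_def by simp
    thus "rho_C n ! i = map (\<lambda>k. Suc (2 * k)) (rev [0..<n]) ! i" using i by (simp add: rev_nth)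
  qed
  thus ?thesis using TypeC by (simp add: lie_rho_def)
next
  case TypeD
  have "Suc (n - 1) = n" using assms by simp
  thus ?thesis using TypeD by (simp add: lie_rho_def rho_D_def rho_def)
qed

lemma lie_rho_rows:
  assumes "n \<ge> 1"
  shows "map (\<lambda>k x. \<Prod>i<k. x - to_fract (lie_params ty n i)) (lie_rho ty n)
    = map (stair_row ty (\<lambda>j. to_fract (Var (T j))) (\<lambda>j. - to_fract (Var (Z j)))) (rev [low_row ty..<n])"
  unfolding lie_rho_eq[OF assms] map_map
proof (rule map_cong[OF refl])
  fix k assume "k \<in> set (rev [low_row ty..<n])"
  hence k: "k < n" by simp
  show "((\<lambda>k x. \<Prod>i<k. x - to_fract (lie_params ty n i)) \<circ> (\<lambda>k. if ty = TypeC then Suc (2 * k) else 2 * k)) k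
    = stair_row ty (\<lambda>j. to_fract (Var (T j))) (\<lambda>j. - to_fract (Var (Z j))) k"
  proof
    fix x :: "mpoly fract"
    show "((\<lambda>k x. \<Prod>i<k. x - to_fract (lie_params ty n i)) \<circ> (\<lambda>k. if ty = TypeC then Suc (2 * k) else 2 * k)) k x
      = stair_row ty (\<lambda>j. to_fract (Var (T j))) (\<lambda>j. - to_fract (Var (Z j))) k x"
    proof (cases ty)
      case TypeC
      have "(\<Prod>i<Suc (2 * k). x - to_fract (case_nat 0 (tz_params n) i)) = x * (\<Prod>i<2 * k. x - to_fract (tz_params n i))"
        unfolding prod.lessThan_Suc_shift by simp
      thus ?thesis using TypeC unfolding prod_tz_params[OF k] by (simp add: lie_params_def stair_row_def)
    next
      case TypeD
      thus ?thesis using prod_tz_params[OF k] by (simp add: lie_params_def stair_row_def)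
    qed
  qed
qed

lemma factorial_P_fin_eq:
  assumes "n \<ge> 1" "length (lie_rho ty n) \<le> N"
  shows "factorial_P_fin N (lie_rho ty n) (lie_params ty n) = stair_poly ty n N"
proof -
  have "factorial_P_fract N (lie_rho ty n) (lie_params ty n) = to_fract (stair_poly ty n N)"
    unfolding factorial_P_fract_eq[OF assms(2)] lie_rho_rows[OF assms(1)] stair_fract_eq_stair stair_def ..
  thus ?thesis unfolding factorial_P_fin_def by simp
qed

text \<open>In type D with \<open>n \<ge> 2\<close> the first parameter is
  \<open>t_1 \<noteq> 0\<close>, so the limit runs over even numbers of variables. In the other
  cases the leading parameter is 0, and odd numbers are compatible as well.\<close>

lemma factorial_P_eq:
  assumes "n \<ge> 1"
  shows "factorial_P (lie_rho ty n) (lie_params ty n) = stair_xfun ty n"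
proof
  fix N
  let ?c = "\<lambda>m::nat. lie_params ty n 0 = 0 \<or> even m"
  let ?E = "\<lambda>p. \<forall>\<^sub>F m in sequentially. ?c m \<longrightarrow> restrict_x N (factorial_P_fin m (lie_rho ty n) (lie_params ty n)) = p"
  have rest: "restrict_x N (stair_poly ty n m) = stair_xfun ty n N" if "?c m" "m \<ge> N" for m
  proof (cases "ty = TypeC \<or> n \<le> 1")
    case True
    thus ?thesis using that(2) by (rule restrict_stair_poly_zero)
  next
    case False
    hence D: "ty = TypeD" "n > 1" by (cases ty; simp)+
    have "lie_params ty n 0 = Var (T 1)" using tz_params_nth(1)[of 1 n] D by (simp add: lie_params_def)
    hence "even m" using that(1) by simp
    thus ?thesis using that(2) by (rule restrict_stair_poly)
  qed
  have ex: "?E (stair_xfun ty n N)"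
    unfolding eventually_sequentially
  proof (rule exI[of _ "max N (length (lie_rho ty n))"], intro allI impI)
    fix m assume "max N (length (lie_rho ty n)) \<le> m" "?c m"
    thus "restrict_x N (factorial_P_fin m (lie_rho ty n) (lie_params ty n)) = stair_xfun ty n N"
      using factorial_P_fin_eq[OF assms, of ty m] rest[of m] by simp
  qed
  have "p = stair_xfun ty n N" if p: "?E p" for p
  proof -
    have "\<forall>\<^sub>F m in sequentially. ?c m \<longrightarrow> p = stair_xfun ty n N"
    proof (rule eventually_mono[OF eventually_conj[OF p ex]], rule impI)
      fix m assume "?c m" and E: "(?c m \<longrightarrow> restrict_x N (factorial_P_fin m (lie_rho ty n) (lie_params ty n)) = p) \<and>
        (?c m \<longrightarrow> restrict_x N (factorial_P_fin m (lie_rho ty n) (lie_params ty n)) = stair_xfun ty n N)"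
      show "p = stair_xfun ty n N"
        using mp[OF conjunct1[OF E] \<open>?c m\<close>] mp[OF conjunct2[OF E] \<open>?c m\<close>] by (rule trans[OF sym])
    qed
    then obtain M where M: "\<And>m. m \<ge> M \<Longrightarrow> ?c m \<Longrightarrow> p = stair_xfun ty n N"
      unfolding eventually_sequentially by blast
    \<comment> \<open>\<open>M + M\<close> is an even index that is at least \<open>M\<close>, hence
      admissible for both kinds of limit.\<close>
    show ?thesis by (rule M[of "M + M"]) (simp_all only: le_add1 even_add simp_thms)
  qed
  thus "factorial_P (lie_rho ty n) (lie_params ty n) N = stair_xfun ty n N"
    unfolding factorial_P_def by (rule the_equality[where P = ?E, OF ex])
qed

section \<open>Localization at a signed permutation\<close>

text \<open>The x-values of the localization at \<open>w\<close>: the elements \<open>- t_j\<close>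
  for those \<open>j\<close> that occur barred in \<open>w\<close>.\<close>

definition neg_values :: "(int \<Rightarrow> 'a) \<Rightarrow> (int \<Rightarrow> int) \<Rightarrow> 'a list" where
  "neg_values \<tau> w = map (\<lambda>i. \<tau> (w i)) (sorted_list_of_set (negs w))"

lemma mset_neg_values: "mset (neg_values \<tau> w) = image_mset (\<lambda>i. \<tau> (w i)) (mset_set (negs w))"
  unfolding neg_values_def mset_map sorted_list_of_mset_set[symmetric] mset_sorted_list_of_multiset ..

definition sign_insert :: "nat \<Rightarrow> (int \<Rightarrow> 'a::uminus) \<Rightarrow> 'a list" where
  "sign_insert j \<tau> = (if j = 0 then [- \<tau> 1] else [])"

text \<open>Composing with \<open>s_0\<close> changes the sign of the entry of absolute value 1.
  Either this entry becomes barred and the inserted \<open>- \<tau> 1\<close> is its value, or it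
  was barred and its value \<open>\<tau> 1\<close> cancels against the inserted one.\<close>

lemma neg_values_step:
  assumes f: "good f" and \<tau>: "odd_fun \<tau>" and w: "w \<in> W_infinity"
  shows "xeval \<rho> \<zeta> (neg_values (\<tau> \<circ> simple_refl_nat j) w @ sign_insert j \<tau> @ \<xi>) f
    = xeval \<rho> \<zeta> (neg_values \<tau> (simple_refl_nat j \<circ> w) @ \<xi>) f"
proof (cases "j = 0")
  case False
  hence j: "j \<ge> 1" by simp
  have "simple_refl_nat j k < 0 \<longleftrightarrow> k < 0" for k
    unfolding simple_refl_nat_pos[OF j] using j by auto
  hence "negs (simple_refl_nat j \<circ> w) = negs w" by (simp add: negs_def)
  hence "neg_values (\<tau> \<circ> simple_refl_nat j) w = neg_values \<tau> (simple_refl_nat j \<circ> w)"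
    by (simp add: neg_values_def)
  thus ?thesis using False by (simp add: sign_insert_def)
next
  case True
  let ?s = "simple_refl_nat 0"
  let ?g = "\<lambda>i. \<tau> (?s (w i))"
  have s1: "?s 1 = - 1" "?s (- 1) = 1" by (simp_all add: simple_refl_nat_zero)
  obtain k where k: "k > 0" "w k = 1 \<or> w k = - 1"
  proof -
    have 1: "w (inv w 1) = 1" using W_bij[OF w] by (simp add: bij_is_surj surj_f_inv_f)
    hence "inv w 1 \<noteq> 0" using W_0[OF w] by auto
    hence "inv w 1 > 0 \<or> - inv w 1 > 0" by arith
    thus thesis using that[of "inv w 1"] that[of "- inv w 1"] 1 W_odd[OF w, of "inv w 1"] by auto
  qed
  have other: "?s (w i) = w i" if i: "i > 0" "i \<noteq> k" for i
  proof -
    have "w i \<noteq> w k" using i(2) W_inj[OF w] by blast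
    moreover have "w i \<noteq> w (- k)" using i(1) k(1) W_inj[OF w, of i "- k"] by auto
    ultimately have "w i \<noteq> 1 \<and> w i \<noteq> - 1" using k(2) W_odd[OF w, of k] by auto
    thus ?thesis by (simp add: simple_refl_nat_zero)
  qed
  have fin: "finite (negs w)" using w by (rule finite_negs)
  have fin': "finite (negs (?s \<circ> w))" by (rule finite_negs[OF W_comp[OF W_refl_nat w]])
  have odd1: "\<tau> (- 1) = - \<tau> 1" by (rule odd_fun_uminus[OF \<tau>])
  from k(2) show ?thesis
  proof
    assume wk: "w k = 1"
    have "i \<in> negs (?s \<circ> w) \<longleftrightarrow> i \<in> insert k (negs w)" for i
      using other[of i] wk k(1) s1 by (cases "i = k") (auto simp: negs_def)
    hence n: "negs (?s \<circ> w) = insert k (negs w)" by blast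
    have kn: "k \<notin> negs w" using wk by (simp add: negs_def)
    have "mset (neg_values \<tau> (?s \<circ> w)) = add_mset (- \<tau> 1) (mset (neg_values (\<tau> \<circ> ?s) w))"
      unfolding mset_neg_values n mset_set.insert[OF fin kn] using odd1 by (simp add: wk s1)
    hence "mset (neg_values (\<tau> \<circ> ?s) w @ sign_insert 0 \<tau> @ \<xi>) = mset (neg_values \<tau> (?s \<circ> w) @ \<xi>)"
      by (simp add: sign_insert_def)
    thus ?thesis unfolding True by (rule xeval_mset[OF f])
  next
    assume wk: "w k = - 1"
    have "i \<in> negs w \<longleftrightarrow> i \<in> insert k (negs (?s \<circ> w))" for i
      using other[of i] wk k(1) s1 by (cases "i = k") (auto simp: negs_def)
    hence n: "negs w = insert k (negs (?s \<circ> w))" by blast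
    have kn: "k \<notin> negs (?s \<circ> w)" using wk s1 by (simp add: negs_def)
    have "mset (neg_values (\<tau> \<circ> ?s) w) = add_mset (\<tau> 1) (mset (neg_values \<tau> (?s \<circ> w)))"
      unfolding mset_neg_values n mset_set.insert[OF fin' kn] by (simp add: wk s1)
    hence "mset (neg_values (\<tau> \<circ> ?s) w @ sign_insert 0 \<tau> @ \<xi>)
        = mset (\<tau> 1 # - \<tau> 1 # (neg_values \<tau> (?s \<circ> w) @ \<xi>))"
      by (simp add: sign_insert_def)
    from xeval_mset[OF f this] show ?thesis unfolding True xeval_cancel[OF f] .
  qed
qed

text \<open>\<open>Hat1\<close> is expanded into \<open>s_0 s_1 s_0\<close>, so that only single
  letters have to be treated.\<close>

fun nat_letters :: "node \<Rightarrow> nat list" where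
  "nat_letters (Nd j) = [j]"
| "nat_letters Hat1 = [0, 1, 0]"

lemma act_t_nat_letters: "act_t i f = foldr act_t_nat (nat_letters i) f"
  by (cases i) auto

lemma simple_refl_nat_letters: "simple_refl i \<circ> w = foldr (\<lambda>j w. simple_refl_nat j \<circ> w) (nat_letters i) w"
  by (cases i) (auto simp: comp_assoc)

lemma foldr_act_t_nat_letters: "foldr act_t u f = foldr act_t_nat (concat (map nat_letters u)) f"
  by (induction u) (simp_all only: foldr.simps comp_apply id_apply list.map concat.simps foldr_append act_t_nat_letters)

lemma word_product_nat_letters:
  "word_product u = foldr (\<lambda>j w. simple_refl_nat j \<circ> w) (concat (map nat_letters u)) id"
proof (induction u)
  case (Cons i u)
  show ?case
    unfolding word_product_simps list.map concat.simps foldr_append Cons simple_refl_nat_letters ..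
qed simp

lemma nat_word_W: "foldr (\<lambda>j w. simple_refl_nat j \<circ> w) u id \<in> W_infinity"
proof (induction u)
  case Nil
  show ?case using W_id by (simp add: id_def)
next
  case (Cons j u)
  show ?case unfolding foldr.simps comp_apply[of "\<lambda>w. simple_refl_nat j \<circ> w"] by (rule W_comp[OF W_refl_nat Cons])
qed

lemma xeval_act_t_nat:
  "odd_fun \<tau> \<Longrightarrow> xeval \<tau> \<zeta> \<xi> (act_t_nat j g) = xeval (\<tau> \<circ> simple_refl_nat j) \<zeta> (sign_insert j \<tau> @ \<xi>) g"
  by (cases "j = 0") (auto simp: xeval_act_t_nat_0 xeval_act_t_nat_pos sign_insert_def)

lemma xeval_nat_word:
  assumes f: "good f"
  shows "odd_fun \<tau> \<Longrightarrow> xeval \<tau> \<zeta> \<xi> (foldr act_t_nat u f)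
    = xeval (\<tau> \<circ> foldr (\<lambda>j w. simple_refl_nat j \<circ> w) u id) \<zeta> (neg_values \<tau> (foldr (\<lambda>j w. simple_refl_nat j \<circ> w) u id) @ \<xi>) f"
proof (induction u arbitrary: \<tau> \<xi>)
  case Nil
  have "negs id = {}" by (simp add: negs_def)
  hence nil: "neg_values \<tau> id = []" by (simp add: neg_values_def)
  have e: "foldr (\<lambda>j w. simple_refl_nat j \<circ> w) [] id = id" "foldr act_t_nat [] f = f" by simp_all
  show ?case unfolding e comp_id nil append_Nil ..
next
  case (Cons j u)
  let ?w = "foldr (\<lambda>j w. simple_refl_nat j \<circ> w) u id" and ?s = "simple_refl_nat j"
  have w: "foldr (\<lambda>j w. simple_refl_nat j \<circ> w) (j # u) id = ?s \<circ> ?w" by simp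
  have "xeval \<tau> \<zeta> \<xi> (foldr act_t_nat (j # u) f) = xeval (\<tau> \<circ> ?s) \<zeta> (sign_insert j \<tau> @ \<xi>) (foldr act_t_nat u f)"
    unfolding foldr.simps comp_apply[of "act_t_nat j"] by (rule xeval_act_t_nat[OF Cons.prems])
  also have "\<dots> = xeval (\<tau> \<circ> ?s \<circ> ?w) \<zeta> (neg_values (\<tau> \<circ> ?s) ?w @ sign_insert j \<tau> @ \<xi>) f"
    by (rule Cons.IH[OF odd_fun_comp_nat[OF Cons.prems]])
  also have "\<dots> = xeval (\<tau> \<circ> ?s \<circ> ?w) \<zeta> (neg_values \<tau> (?s \<circ> ?w) @ \<xi>) f"
    by (rule neg_values_step[OF f Cons.prems nat_word_W])
  finally show ?case unfolding w comp_assoc .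
qed

text \<open>In particular the value depends on the group element only, so a word may be replaced by
  a reduced one.\<close>

lemma xeval_word:
  assumes "good f" "odd_fun \<tau>"
  shows "xeval \<tau> \<zeta> \<xi> (foldr act_t u f) = xeval (\<tau> \<circ> word_product u) \<zeta> (neg_values \<tau> (word_product u) @ \<xi>) f"
  unfolding foldr_act_t_nat_letters word_product_nat_letters by (rule xeval_nat_word[OF assms])

section \<open>Localization of double Schubert polynomials\<close>

text \<open>The recursions are brought into multiplied form, with descents expressed by inversions;
  a left descent of \<open>w\<close> is a right descent of \<open>inv w\<close>.\<close>

lemma double_schubertD:
  assumes "double_schubert ty S" "w \<in> weyl ty"
  shows "S w \<in> Rring ty" "good (S w)"
    "i \<in> nodes ty \<Longrightarrow> act_z i (S w) = S w - omega (simple_root i) * (if root_pair i \<in> inversions ty w then S (w \<circ> simple_refl i) else 0)"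
    "i \<in> nodes ty \<Longrightarrow> act_t i (S w) = S w - simple_root i * (if root_pair i \<in> inversions ty (inv w) then S (simple_refl i \<circ> w) else 0)"
    "S id = 1" "w \<noteq> id \<Longrightarrow> const_term (S w) = 0"
proof -
  show R: "S w \<in> Rring ty" using assms unfolding double_schubert_def by blast
  show "good (S w)" by (rule good_Rring[OF R])
  show "S id = 1" "w \<noteq> id \<Longrightarrow> const_term (S w) = 0" using assms unfolding double_schubert_def by blast+
  assume i: "i \<in> nodes ty"
  have z: "diff_z i (S w) = (if root_pair i \<in> inversions ty w then S (w \<circ> simple_refl i) else 0)"
    using assms i unfolding double_schubert_def coxeter_length_refl(1)[OF assms(2) i, symmetric] by blast
  have sw: "simple_refl i \<circ> w \<in> weyl ty" by (rule weyl_refl_left[OF assms(2) i])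
  have "coxeter_length ty (simple_refl i \<circ> w) = coxeter_length ty (inv w \<circ> simple_refl i)"
    using coxeter_length_inv[OF sw] unfolding inv_comp_refl(2)[OF weyl_W[OF assms(2)]] by (rule sym)
  hence c: "coxeter_length ty (simple_refl i \<circ> w) < coxeter_length ty w \<longleftrightarrow> root_pair i \<in> inversions ty (inv w)"
    using coxeter_length_refl(1)[OF weyl_inv[OF assms(2)] i] coxeter_length_inv[OF assms(2)] by simp
  have t: "diff_t i (S w) = (if root_pair i \<in> inversions ty (inv w) then S (simple_refl i \<circ> w) else 0)"
    using assms i unfolding double_schubert_def c[symmetric] by blast
  show "act_z i (S w) = S w - omega (simple_root i) * (if root_pair i \<in> inversions ty w then S (w \<circ> simple_refl i) else 0)"
    unfolding z[symmetric] diff_z_mult[OF R i] by (simp only: diff_diff_eq2 add_diff_cancel_left')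
  show "act_t i (S w) = S w - simple_root i * (if root_pair i \<in> inversions ty (inv w) then S (simple_refl i \<circ> w) else 0)"
    unfolding t[symmetric] diff_t_mult[OF R i] by (simp only: diff_diff_eq2 add_diff_cancel_left')
qed

lemma xeval_simple_root:
  assumes "odd_fun \<tau>"
  shows "xeval \<tau> \<zeta> \<xi> (simple_root i) = \<tau> (snd (root_pair i)) - \<tau> (fst (root_pair i))"
    "xeval \<zeta> \<tau> \<xi> (omega (simple_root i)) = \<tau> (fst (root_pair i)) - \<tau> (snd (root_pair i))"
proof -
  have odd: "\<tau> (- 1) = - \<tau> 1" by (rule odd_fun_uminus[OF assms])
  show "xeval \<tau> \<zeta> \<xi> (simple_root i) = \<tau> (snd (root_pair i)) - \<tau> (fst (root_pair i))"
    unfolding simple_root_conv xeval_def using odd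
    by (cases i) (auto simp: root_factor_def point_def algebra_simps)
  show "xeval \<zeta> \<tau> \<xi> (omega (simple_root i)) = \<tau> (fst (root_pair i)) - \<tau> (snd (root_pair i))"
    unfolding omega_simple_root_conv xeval_def using odd
    by (cases i) (auto simp: root_factor_def point_def algebra_simps)
qed

lemma xeval_if_0: "xeval \<tau> \<zeta> \<xi> (if b then f else 0) = (if b then xeval \<tau> \<zeta> \<xi> f else 0)"
  by simp

lemma inversions_id: "inversions ty id = {}"
  by (auto simp: inversions_def pos_roots_def)

lemma root_pair_inversions_refl: "i \<in> nodes ty \<Longrightarrow> root_pair i \<in> inversions ty (simple_refl i)"
  using inversions_refl(2)[OF W_id, of i ty] by (simp only: inversions_id id_comp empty_iff simp_thms)

text \<open>At \<open>z = t\<close>, \<open>x = 0\<close> the value is a polynomial in t. Symmetry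
  in infinitely many t makes it constant, and the constant is read off at the origin.\<close>

lemma symmetric_diagonal_const:
  assumes f: "good f"
    and sym: "\<And>i. i \<ge> 1 \<Longrightarrow> xeval (gen_T \<circ> simple_refl (Nd i)) (gen_T \<circ> simple_refl (Nd i)) [] f = xeval gen_T gen_T [] f"
  shows "xeval gen_T gen_T [] f = of_int (const_term f)"
proof -
  let ?p = "xeval gen_T gen_T [] f"
  have fv: "finite_vars f" using f by (rule good_finite_vars)
  obtain K where K: "involves_only (allowed K 0) (f 0)" using fv by (auto simp: finite_vars_def)
  have inv: "involves_only (T ` {1..K}) ?p"
    unfolding xeval_def list.size
    by (rule involves_only_eval[OF K]) (auto simp: allowed_def point_def)
  have "rename_T (transpose i (Suc i)) ?p = ?p" if i: "i \<ge> 1" for i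
  proof -
    let ?h = "eval_mpoly (\<lambda>v. case v of T k \<Rightarrow> Var (T (transpose i (Suc i) k)) | _ \<Rightarrow> Var v)"
    have h: "?h (gen_T k) = (gen_T \<circ> simple_refl (Nd i)) k" if k: "k > 0" for k
    proof -
      obtain m where m: "k = int m" "m \<ge> 1" using k by (metis int_one_le_iff_zero_less nat_0_le not_le of_nat_1 of_nat_le_iff less_imp_le)
      have "transpose i (Suc i) m \<ge> 1" using m(2) i by (auto simp: transpose_def)
      thus ?thesis using m i by (simp add: simple_refl_nat_int)
    qed
    have "rename_T (transpose i (Suc i)) ?p = xeval (\<lambda>k. ?h (gen_T k)) (\<lambda>k. ?h (gen_T k)) [] f"
      unfolding rename_T_def xeval_hom[OF ring_hom_eval] list.map ..
    also have "\<dots> = xeval (gen_T \<circ> simple_refl (Nd i)) (gen_T \<circ> simple_refl (Nd i)) [] f"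
      by (rule xeval_cong[OF fv h h])
    finally show ?thesis using sym[OF i] by (rule trans)
  qed
  hence "involves_only (T ` {1..K} - range T) ?p"
    by (rule symmetric_imp_T_free[OF _ inv]) auto
  hence "eval_mpoly Var ?p = eval_mpoly (\<lambda>_. 0) ?p" by (rule eval_cong_involves) auto
  hence "?p = eval_mpoly (\<lambda>_. 0) ?p" unfolding eval_id .
  also have "\<dots> = eval_mpoly (\<lambda>_. 0) (f 0)"
    unfolding xeval_def eval_eval list.size
    by (rule eval_cong_involves[OF K]) (auto simp: allowed_def point_def gen_T_def)
  also have "\<dots> = of_int (const_term f)" unfolding const_term_def by (rule eval_at_0)
  finally show ?thesis .
qed

text \<open>Induction on the length. Comparing the z-recursion with the t-recsursion at the
  reflected point shows that the diagonal value is invariant under all reflections, because the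
  contributions of shorter elements agree. It is therefore constant, and the normalization makes the
  constant 0.\<close>

lemma double_schubert_diagonal:
  assumes S: "double_schubert ty S" and w: "w \<in> weyl ty" "w \<noteq> id"
  shows "xeval \<tau> \<tau> [] (S w) = 0"
proof -
  have "w \<in> weyl ty \<Longrightarrow> w \<noteq> id \<Longrightarrow> xeval gen_T gen_T [] (S w) = 0"
  proof (induction "coxeter_length ty w" arbitrary: w rule: less_induct)
    case less
    note w = \<open>w \<in> weyl ty\<close> and ne = \<open>w \<noteq> id\<close>
    have g: "good (S w)" by (rule double_schubertD(2)[OF S w])
    have one: "xeval \<tau> \<tau> [] (S v) = (if v = id then 1 else 0)"
      if v: "v \<in> weyl ty" "coxeter_length ty v < coxeter_length ty w" for v and \<tau> :: "int \<Rightarrow> mpoly"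
    proof (cases "v = id")
      case True
      thus ?thesis using double_schubertD(5)[OF S w] by (simp only: xeval_ring if_True simp_thms)
    next
      case False
      have "xeval gen_T gen_T [] (S v) = 0" by (rule less.hyps[OF v(2,1) False])
      from xeval_eq_0_transfer[OF good_finite_vars[OF double_schubertD(2)[OF S v(1)]] this]
      show ?thesis using False by (simp only: if_False)
    qed
    have "xeval (gen_T \<circ> simple_refl i) (gen_T \<circ> simple_refl i) [] (S w) = xeval gen_T gen_T [] (S w)"
      if i: "i \<in> nodes ty" for i
    proof -
      let ?s = "simple_refl i" and ?a = "gen_T (snd (root_pair i)) - gen_T (fst (root_pair i))"
      let ?\<tau> = "gen_T \<circ> ?s"
      have odd: "odd_fun ?\<tau>" by (rule odd_fun_comp[OF odd_fun_gen(1)])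
      have len: "coxeter_length ty (?s \<circ> w) = coxeter_length ty (inv w \<circ> ?s)"
        using coxeter_length_inv[OF weyl_refl_left[OF w i]] unfolding inv_comp_refl(2)[OF weyl_W[OF w]] by (rule sym)
      have lz: "(if root_pair i \<in> inversions ty w then xeval gen_T gen_T [] (S (w \<circ> ?s)) else 0)
          = (if w = ?s then 1 else 0)"
      proof (cases "root_pair i \<in> inversions ty w")
        case True
        hence "coxeter_length ty (w \<circ> ?s) < coxeter_length ty w" by (simp only: coxeter_length_refl(1)[OF w i])
        from one[OF weyl_refl_right[OF w i] this, of gen_T]
        have "xeval gen_T gen_T [] (S (w \<circ> ?s)) = (if w \<circ> ?s = id then 1 else 0)" .
        moreover have "w \<circ> ?s = id \<longleftrightarrow> w = ?s"
        proof
          assume "w \<circ> ?s = id"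
          hence "w \<circ> ?s \<circ> ?s = ?s" by simp
          thus "w = ?s" by (simp add: fun_eq_iff simple_refl_involutory)
        next
          assume "w = ?s"
          thus "w \<circ> ?s = id" by (simp add: fun_eq_iff simple_refl_involutory)
        qed
        ultimately show ?thesis using True by (simp only: if_True)
      next
        case False
        have "w \<noteq> ?s" using False root_pair_inversions_refl[OF i] by blast
        thus ?thesis using False by (simp only: if_False)
      qed
      have lt: "(if root_pair i \<in> inversions ty (inv w) then xeval ?\<tau> ?\<tau> [] (S (?s \<circ> w)) else 0)
          = (if w = ?s then 1 else 0)"
      proof (cases "root_pair i \<in> inversions ty (inv w)")
        case True
        hence "coxeter_length ty (?s \<circ> w) < coxeter_length ty w"
          unfolding len coxeter_length_inv[OF w, symmetric] by (simp only: coxeter_length_refl(1)[OF weyl_inv[OF w] i])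
        from one[OF weyl_refl_left[OF w i] this, of ?\<tau>]
        have "xeval ?\<tau> ?\<tau> [] (S (?s \<circ> w)) = (if ?s \<circ> w = id then 1 else 0)" .
        moreover have "?s \<circ> w = id \<longleftrightarrow> w = ?s"
        proof
          assume "?s \<circ> w = id"
          hence "?s \<circ> (?s \<circ> w) = ?s" by simp
          thus "w = ?s" by (simp add: fun_eq_iff simple_refl_involutory)
        next
          assume "w = ?s"
          thus "?s \<circ> w = id" by (simp add: fun_eq_iff simple_refl_involutory)
        qed
        ultimately show ?thesis using True by (simp only: if_True)
      next
        case False
        have "w \<noteq> ?s" using False root_pair_inversions_refl[OF i] inv_simple_refl[of i] by force
        thus ?thesis using False by (simp only: if_False)
      qed
      \<comment> \<open>The two recursions evaluate their roots with equal signs: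
        \<open>omega\<close> contributes one sign and the reflected point the other. The shorter
        terms are nonzero only for \<open>w = s_i\<close>, so the corrections agree.\<close>
      have ta: "?\<tau> (snd (root_pair i)) - ?\<tau> (fst (root_pair i)) = - ?a"
        using root_pair_swap[of i] by simp
      have "xeval gen_T gen_T [] (act_z i (S w)) = xeval gen_T gen_T [] (S w) - - ?a * (if w = ?s then 1 else 0)"
        unfolding double_schubertD(3)[OF S w i] xeval_ring xeval_simple_root(2)[OF odd_fun_gen(1)] xeval_if_0 lz by simp
      moreover have "xeval ?\<tau> ?\<tau> [] (act_t i (S w)) = xeval ?\<tau> ?\<tau> [] (S w) - - ?a * (if w = ?s then 1 else 0)"
        unfolding double_schubertD(4)[OF S w i] xeval_ring xeval_simple_root(1)[OF odd] xeval_if_0 lt ta ..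
      ultimately show ?thesis using xeval_diagonal_act[OF g odd_fun_gen(1), of i] by (simp only: diff_eq_eq diff_add_cancel)
    qed
    note inv = this
    have node: "Nd i \<in> nodes ty" if "i \<ge> 1" for i using that by (cases ty) auto
    have "xeval gen_T gen_T [] (S w) = of_int (const_term (S w))"
      by (rule symmetric_diagonal_const[OF g inv[OF node]])
    thus ?case using double_schubertD(6)[OF S w ne] by (simp only: of_int_0)
  qed
  from this[OF w] xeval_eq_0_transfer[OF good_finite_vars[OF double_schubertD(2)[OF S w(1)]]]
  show ?thesis by blast
qed

section \<open>Localizations along words\<close>

text \<open>The localization of \<open>S w\<close> at \<open>inv w\<close>. A factor is the negative
  of the root \<open>t_b - t_a\<close>; the sign comes from \<open>omega\<close>.\<close>

definition root_prod :: "lie_type \<Rightarrow> (int \<Rightarrow> 'a::comm_ring_1) \<Rightarrow> (int \<Rightarrow> int) \<Rightarrow> 'a" where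
  "root_prod ty \<tau> w = (\<Prod>(a, b)\<in>inversions ty w. \<tau> a - \<tau> b)"

text \<open>The remaining inversions are reflected. Changing the representative of a root leaves its
  factor unchanged because \<open>\<tau>\<close> is odd.\<close>

lemma root_prod_refl:
  assumes w: "w \<in> W_infinity" and i: "i \<in> nodes ty" and \<tau>: "odd_fun \<tau>" and d: "root_pair i \<in> inversions ty w"
  shows "root_prod ty \<tau> w = (\<tau> (fst (root_pair i)) - \<tau> (snd (root_pair i)))
    * root_prod ty (\<tau> \<circ> simple_refl i) (w \<circ> simple_refl i)"
proof -
  let ?s = "simple_refl i" and ?r = "root_pair i" and ?h = "\<lambda>\<tau> (a, b). \<tau> a - \<tau> b :: 'a"
  have "?r \<notin> inversions ty (w \<circ> ?s)" using inversions_refl(2)[OF w i] d by blast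
  hence "inversions ty (w \<circ> ?s) = inversions ty (w \<circ> ?s) - {?r}" by simp
  hence inv: "inversions ty (w \<circ> ?s) = refl_pair ty i ` (inversions ty w - {?r})"
    unfolding inversions_refl(1)[OF w i] .
  have h: "?h (\<tau> \<circ> ?s) (refl_pair ty i p) = ?h \<tau> p" for p
  proof -
    obtain a b where p: "p = (a, b)" by (cases p)
    have neg: "\<tau> (?s (- ?s k)) = - \<tau> k" for k
      by (simp only: simple_refl_uminus simple_refl_involutory odd_fun_uminus[OF \<tau>])
    from refl_pair_cases[of ty i a b] show ?thesis
      unfolding p by (elim disjE) (simp_all add: neg simple_refl_involutory)
  qed
  have "root_prod ty \<tau> w = ?h \<tau> ?r * (\<Prod>p\<in>inversions ty w - {?r}. ?h \<tau> p)"
    unfolding root_prod_def by (rule prod.remove[OF finite_inversions[OF w] d])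
  also have "(\<Prod>p\<in>inversions ty w - {?r}. ?h \<tau> p) = root_prod ty (\<tau> \<circ> ?s) (w \<circ> ?s)"
    unfolding root_prod_def inv prod.reindex[OF inj_on_refl_pair[OF i]] comp_apply[of "\<lambda>(a, b). (\<tau> \<circ> ?s) a - (\<tau> \<circ> ?s) b"] h ..
  finally show ?thesis by (simp only: case_prod_beta)
qed

lemma foldr_act_t_if_0: "foldr act_t u (if b then f else 0) = (if b then foldr act_t u f else 0)"
proof -
  have "foldr act_t u 0 = 0" by (induction u) (simp_all only: foldr.simps comp_apply id_apply act_t_ring)
  thus ?thesis by simp
qed

lemma foldr_act_t_omega_root: "foldr act_t u (omega (simple_root i)) = omega (simple_root i)"
proof -
  have f: "(\<lambda>N. root_factor i * root_z i) = (if i = Nd 0 then 2 else 1) * (\<lambda>N. root_z i)"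
    by (auto simp: root_factor_def fun_eq_iff)
  have "act_t j (omega (simple_root i)) = omega (simple_root i)" for j
    unfolding omega_simple_root_conv f by (simp only: act_t_ring act_t_root_z act_t_2 if_distrib[of "act_t j"])
  thus ?thesis by (induction u) (simp_all only: foldr.simps comp_apply id_apply)
qed

text \<open>On the diagonal the first letter becomes a reflection in z, which the recursion resolves
  into \<open>S w\<close> and \<open>S (w \<circ> s_i)\<close>, both localized at the shorter word
  \<open>u\<close>. The first term vanishes because \<open>u\<close> is too short to represent
  \<open>inv w\<close>; the second is the induction hypothesis and contributes one more
  root.\<close>

lemma double_schubert_short_word:
  assumes S: "double_schubert ty S"
  shows "odd_fun \<tau> \<Longrightarrow> w \<in> weyl ty \<Longrightarrow> set u \<subseteq> nodes ty \<Longrightarrow> length u \<le> coxeter_length ty w \<Longrightarrow>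
    xeval \<tau> \<tau> [] (foldr act_t u (S w)) = (if word_product u = inv w then root_prod ty \<tau> w else 0)"
proof (induction u arbitrary: \<tau> w)
  case Nil
  show ?case
  proof (cases "w = id")
    case True
    show ?thesis
      unfolding True double_schubertD(5)[OF S Nil.prems(2)] root_prod_def inversions_id inv_id
      by (simp only: foldr.simps id_apply xeval_ring prod.empty word_product_simps if_True simp_thms)
  next
    case False
    have "inv w \<noteq> id"
    proof
      assume "inv w = id"
      hence "inv (inv w) = id" by (simp only: inv_id)
      thus False using False inv_inv_eq[OF W_bij[OF weyl_W[OF Nil.prems(2)]]] by simp
    qed
    thus ?thesis using double_schubert_diagonal[OF S Nil.prems(2) False, of \<tau>] by (auto simp: id_def)
  qed
next
  case (Cons i u)
  let ?s = "simple_refl i" and ?F = "foldr act_t u (S w)"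
  let ?\<tau> = "\<tau> \<circ> ?s"
  have i: "i \<in> nodes ty" and u: "set u \<subseteq> nodes ty" using Cons.prems(3) by auto
  have len: "length u < coxeter_length ty w" using Cons.prems(4) by simp
  note w = Cons.prems(2)
  have odd: "odd_fun ?\<tau>" by (rule odd_fun_comp[OF Cons.prems(1)])
  have g: "good (S w)" by (rule double_schubertD(2)[OF S w])
  have ss: "?\<tau> \<circ> ?s = \<tau>" by (simp add: fun_eq_iff simple_refl_involutory)
  have z: "xeval ?\<tau> ?\<tau> [] ?F = 0"
  proof -
    have "word_product u \<noteq> inv w"
    proof
      assume "word_product u = inv w"
      hence "coxeter_length ty w \<le> length u"
        using coxeter_length_le[OF u] coxeter_length_inv[OF w] by simp
      thus False using len by simp
    qed
    thus ?thesis using Cons.IH[OF odd w u less_imp_le[OF len]] by (simp only: if_False)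
  qed
  have root: "?\<tau> (fst (root_pair i)) - ?\<tau> (snd (root_pair i)) = \<tau> (snd (root_pair i)) - \<tau> (fst (root_pair i))"
    unfolding comp_apply root_pair_swap ..
  have "xeval \<tau> \<tau> [] (foldr act_t (i # u) (S w)) = xeval (?\<tau> \<circ> ?s) (?\<tau> \<circ> ?s) [] (act_t i ?F)"
    unfolding ss by simp
  also have "\<dots> = xeval ?\<tau> ?\<tau> [] (act_z i ?F)"
    by (rule xeval_diagonal_act[OF good_foldr_act_t[OF g] odd, symmetric])
  also have "act_z i ?F = ?F - omega (simple_root i) * (if root_pair i \<in> inversions ty w then foldr act_t u (S (w \<circ> ?s)) else 0)"
    unfolding act_z_foldr_act_t[OF g] double_schubertD(3)[OF S w i] foldr_act_t_diff foldr_act_t_mult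
      foldr_act_t_if_0 foldr_act_t_omega_root ..
  also have "xeval ?\<tau> ?\<tau> [] \<dots> = (\<tau> (fst (root_pair i)) - \<tau> (snd (root_pair i)))
      * (if root_pair i \<in> inversions ty w then xeval ?\<tau> ?\<tau> [] (foldr act_t u (S (w \<circ> ?s))) else 0)"
    unfolding xeval_ring z xeval_simple_root(2)[OF odd] xeval_if_0 root by (simp only: diff_0 minus_mult_left minus_diff_eq)
  also have "\<dots> = (if word_product (i # u) = inv w then root_prod ty \<tau> w else 0)"
  proof -
    have wp: "word_product (i # u) = inv w \<longleftrightarrow> word_product u = inv (w \<circ> ?s)"
      unfolding inv_comp_refl(1)[OF weyl_W[OF w]] word_product_simps(2)
    proof
      assume "?s \<circ> word_product u = inv w"
      hence "?s \<circ> (?s \<circ> word_product u) = ?s \<circ> inv w" by simp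
      thus "word_product u = ?s \<circ> inv w" by (simp add: fun_eq_iff simple_refl_involutory)
    next
      assume "word_product u = ?s \<circ> inv w"
      thus "?s \<circ> word_product u = inv w" by (simp add: fun_eq_iff simple_refl_involutory)
    qed
    have ws: "w \<circ> ?s \<in> weyl ty" by (rule weyl_refl_right[OF w i])
    show ?thesis
    proof (cases "root_pair i \<in> inversions ty w")
      case True
      have "length u \<le> coxeter_length ty (w \<circ> ?s)"
        using coxeter_length_refl(2)[OF w i] Cons.prems(4) by simp
      from Cons.IH[OF odd ws u this] show ?thesis
        unfolding wp root_prod_refl[OF weyl_W[OF w] i Cons.prems(1) True] using True
        by (simp only: if_True if_distrib[of "(*) _"] mult_zero_right)
    next
      case False
      have "word_product u \<noteq> inv (w \<circ> ?s)"
      proof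
        assume "word_product u = inv (w \<circ> ?s)"
        hence "coxeter_length ty (w \<circ> ?s) \<le> length u"
          using coxeter_length_le[OF u] coxeter_length_inv[OF ws] by simp
        hence "coxeter_length ty (w \<circ> ?s) < coxeter_length ty w" using len by simp
        thus False using False by (simp only: coxeter_length_refl(1)[OF w i])
      qed
      thus ?thesis unfolding wp using False by simp
    qed
  qed
  finally show ?case .
qed

text \<open>The word is replaced by a reduced one, which is short enough because
  \<open>w_max\<close> is longest.\<close>

lemma double_schubert_w_max_word:
  assumes S: "double_schubert ty S" and u: "set u \<subseteq> finite_nodes ty n"
  shows "xeval gen_T gen_T [] (foldr act_t u (S (w_max ty n)))
    = (if word_product u = w_max ty n then root_prod ty gen_T (w_max ty n) else 0)"
proof -
  let ?w = "w_max ty n" and ?v = "word_product u"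
  have v: "?v \<in> weyl ty" "fixes_above n ?v"
    using u unfolding atomize_conj by (metis (mono_tags, lifting) finite_weyl_def finite_weyl_eq mem_Collect_eq)
  have len: "coxeter_length ty ?v \<le> coxeter_length ty ?w"
    using coxeter_length_less_w_max[OF v] by (cases "?v = ?w") auto
  obtain u' where u': "set u' \<subseteq> nodes ty" "length u' = coxeter_length ty ?v" "word_product u' = ?v"
    using reduced_word[OF v(1)] .
  have g: "good (S ?w)" by (rule double_schubertD(2)[OF S w_max_weyl])
  have inv: "inv ?w = ?w" by (rule inv_equality) (simp_all add: w_max_involutory)
  have "xeval gen_T gen_T [] (foldr act_t u (S ?w)) = xeval gen_T gen_T [] (foldr act_t u' (S ?w))"
    unfolding xeval_word[OF g odd_fun_gen(1)] u'(3) ..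
  also have "\<dots> = (if word_product u' = inv ?w then root_prod ty gen_T ?w else 0)"
    by (rule double_schubert_short_word[OF S odd_fun_gen(1) w_max_weyl u'(1)]) (use len u'(2) in simp)
  finally show ?thesis unfolding inv u'(3) .
qed

section \<open>Localization of staircase functions\<close>

lemma prod_pos_roots:
  fixes h :: "int \<times> int \<Rightarrow> 'a::comm_monoid_mult"
  shows "(\<Prod>p\<in>{p \<in> pos_roots ty. snd p \<le> int n}. h p) = (\<Prod>k\<in>{1..n}. (if ty = TypeC then h (- int k, int k) else 1)
    * (\<Prod>j\<in>{1..<k}. h (int j, int k) * h (- int j, int k)))"
proof (induction n)
  case 0
  have empty: "{p \<in> pos_roots ty. snd p \<le> int 0} = {}" by (auto simp: pos_roots_def)
  show ?case unfolding empty by simp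
next
  case (Suc n)
  let ?k = "Suc n"
  let ?A = "(\<lambda>j. (int j, int ?k)) ` {1..<?k}" and ?B = "(\<lambda>j. (- int j, int ?k)) ` {1..<?k}"
    and ?C = "if ty = TypeC then {(- int ?k, int ?k)} else {}"
  have mem: "p \<in> {p \<in> pos_roots ty. snd p \<le> int ?k} \<longleftrightarrow> p \<in> {p \<in> pos_roots ty. snd p \<le> int n} \<union> (?C \<union> (?A \<union> ?B))" for p
  proof (cases p)
    case (Pair a b)
    show ?thesis
    proof (cases "b = int ?k")
      case True
      have "a \<noteq> 0 \<and> \<bar>a\<bar> < int ?k \<longleftrightarrow> (\<exists>j\<in>{1..<?k}. a = int j \<or> a = - int j)"
      proof
        assume a: "a \<noteq> 0 \<and> \<bar>a\<bar> < int ?k"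
        show "\<exists>j\<in>{1..<?k}. a = int j \<or> a = - int j"
          by (rule bexI[of _ "nat \<bar>a\<bar>"]) (use a in auto)
      qed auto
      thus ?thesis unfolding Pair using True by (auto simp: pos_roots_def)
    next
      case False
      thus ?thesis unfolding Pair by (auto simp: pos_roots_def)
    qed
  qed
  hence set: "{p \<in> pos_roots ty. snd p \<le> int ?k} = {p \<in> pos_roots ty. snd p \<le> int n} \<union> (?C \<union> (?A \<union> ?B))" by blast
  have injA: "inj_on (\<lambda>j. (int j, int ?k)) {1..<?k}" and injB: "inj_on (\<lambda>j. (- int j, int ?k)) {1..<?k}"
    by (auto simp: inj_on_def)
  have "(\<Prod>p\<in>?A \<union> ?B. h p) = (\<Prod>p\<in>?A. h p) * (\<Prod>p\<in>?B. h p)"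
    by (rule prod.union_disjoint) auto
  also have "\<dots> = (\<Prod>j\<in>{1..<?k}. h (int j, int ?k) * h (- int j, int ?k))"
    unfolding prod.reindex[OF injA] prod.reindex[OF injB] comp_apply prod.distrib ..
  finally have AB: "(\<Prod>p\<in>?A \<union> ?B. h p) = (\<Prod>j\<in>{1..<?k}. h (int j, int ?k) * h (- int j, int ?k))" .
  have "(\<Prod>p\<in>?C \<union> (?A \<union> ?B). h p) = (\<Prod>p\<in>?C. h p) * (\<Prod>p\<in>?A \<union> ?B. h p)"
    by (rule prod.union_disjoint) auto
  hence CAB: "(\<Prod>p\<in>?C \<union> (?A \<union> ?B). h p) = (if ty = TypeC then h (- int ?k, int ?k) else 1)
      * (\<Prod>j\<in>{1..<?k}. h (int j, int ?k) * h (- int j, int ?k))"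
    unfolding AB by simp
  have "(\<Prod>p\<in>{p \<in> pos_roots ty. snd p \<le> int ?k}. h p)
      = (\<Prod>p\<in>{p \<in> pos_roots ty. snd p \<le> int n}. h p) * (\<Prod>p\<in>?C \<union> (?A \<union> ?B). h p)"
    unfolding set by (rule prod.union_disjoint) (auto simp: finite_pos_roots_le)
  moreover have "{1..?k} = insert ?k {1..n}" by auto
  ultimately show ?case unfolding CAB Suc by (simp add: mult.commute del: atLeastLessThan_iff)
qed

section \<open>Signed permutations with nonzero localization\<close>

text \<open>The indices \<open>k\<close> such that \<open>- t_k\<close> is among the x-values of the
  localization at \<open>v\<close>.\<close>

definition hit :: "nat \<Rightarrow> (int \<Rightarrow> int) \<Rightarrow> nat set" where
  "hit n v = {k \<in> {1..n}. \<exists>i>0. v i = - int k}"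

lemma neg_values_set:
  assumes v: "v \<in> W_infinity" "fixes_above n v" and \<tau>: "odd_fun \<tau>"
  shows "set (neg_values \<tau> v) = (\<lambda>k. - \<tau> (int k)) ` hit n v" "card (hit n v) = card (negs v)"
    "negs v \<subseteq> int ` {1..n}"
proof -
  have fin: "finite (negs v)" by (rule finite_negs[OF v(1)])
  have bound: "\<exists>k\<in>{1..n}. v i = - int k" if i: "i \<in> negs v" for i
  proof (cases "\<bar>i\<bar> \<le> int n")
    case True
    hence "\<bar>v i\<bar> \<le> int n" by (rule W_preserves_interval[OF v])
    thus ?thesis using i by (intro bexI[of _ "nat (- v i)"]) (auto simp: negs_def)
  next
    case False
    hence "v i = i" using v(2) by (simp add: fixes_above_def)
    thus ?thesis using i by (auto simp: negs_def)
  qed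
  have im: "v ` negs v = (\<lambda>k. - int k) ` hit n v"
  proof
    show "v ` negs v \<subseteq> (\<lambda>k. - int k) ` hit n v"
    proof
      fix x assume "x \<in> v ` negs v"
      then obtain i where i: "x = v i" "i \<in> negs v" by blast
      obtain k where k: "k \<in> {1..n}" "v i = - int k" using bound[OF i(2)] by blast
      have "i > 0" using i(2) by (simp add: negs_def)
      hence "k \<in> hit n v" using k by (auto simp: hit_def)
      thus "x \<in> (\<lambda>k. - int k) ` hit n v" using i(1) k(2) by blast
    qed
    show "(\<lambda>k. - int k) ` hit n v \<subseteq> v ` negs v"
    proof
      fix x assume "x \<in> (\<lambda>k. - int k) ` hit n v"
      then obtain k i where k: "x = - int k" "k \<in> {1..n}" "i > 0" "v i = - int k" by (auto simp: hit_def)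
      hence "i \<in> negs v" by (simp add: negs_def)
      thus "x \<in> v ` negs v" using k(1,4) by (metis imageI)
    qed
  qed
  have "set (neg_values \<tau> v) = \<tau> ` v ` negs v"
    using fin by (simp add: neg_values_def image_image)
  also have "\<dots> = (\<lambda>k. - \<tau> (int k)) ` hit n v" unfolding im image_image odd_fun_uminus[OF \<tau>] ..
  finally show "set (neg_values \<tau> v) = (\<lambda>k. - \<tau> (int k)) ` hit n v" .
  have "inj_on v (negs v)" using W_bij[OF v(1)] by (meson bij_is_inj inj_on_subset subset_UNIV)
  hence "card (v ` negs v) = card (negs v)" by (rule card_image)
  moreover have "card ((\<lambda>k. - int k) ` hit n v) = card (hit n v)" by (rule card_image) (simp add: inj_on_def)
  ultimately show "card (hit n v) = card (negs v)" unfolding im by simp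
  show "negs v \<subseteq> int ` {1..n}"
  proof
    fix i assume i: "i \<in> negs v"
    have "\<bar>i\<bar> \<le> int n"
    proof (rule ccontr)
      assume "\<not> \<bar>i\<bar> \<le> int n"
      hence "v i = i" using v(2) by (simp add: fixes_above_def)
      thus False using i by (auto simp: negs_def)
    qed
    thus "i \<in> int ` {1..n}" using i by (intro image_eqI[of _ _ "nat i"]) (auto simp: negs_def)
  qed
qed

lemma hit_even: "v \<in> weyl TypeD \<Longrightarrow> fixes_above n v \<Longrightarrow> even (card (hit n v))"
  using neg_values_set(2)[OF weyl_W _ odd_fun_gen(1)] by (simp add: weyl_def')

text \<open>All indices but 1 being barred, the even number of sign changes decides about 1.\<close>

lemma hit_TypeD:
  assumes "v \<in> weyl TypeD" "fixes_above n v" "{2..n} \<subseteq> hit n v" "n \<ge> 1"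
  shows "1 \<in> hit n v \<longleftrightarrow> even n"
proof -
  have sub: "hit n v \<subseteq> {1..n}" by (auto simp: hit_def)
  have ins: "{1..n} = insert 1 {2..n}" using assms(4) by auto
  have "hit n v = (if 1 \<in> hit n v then {1..n} else {2..n})"
  proof (cases "1 \<in> hit n v")
    case True
    have "hit n v = {1..n}" using sub assms(3) True unfolding ins by blast
    thus ?thesis using True by simp
  next
    case False
    have "hit n v = {2..n}" using sub assms(3) False unfolding ins by blast
    thus ?thesis using False by simp
  qed
  hence "card (hit n v) = (if 1 \<in> hit n v then n else n - 1)"
    by (metis card_atLeastAtMost diff_Suc_1 diff_Suc_Suc numeral_2_eq_2 One_nat_def)
  thus ?thesis using hit_even[OF assms(1,2)] assms(4) by (auto split: if_splits)
qed

text \<open>By \<open>late\<close> the value \<open>- k\<close> cannot occur before position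
  \<open>k\<close>. Going down from \<open>n\<close>, the later positions are already occupied, so
  it occurs exactly there. In type D for odd \<open>n\<close> the entry 1 is what is left
  over.\<close>

lemma eq_w_max:
  assumes v: "v \<in> weyl ty" "fixes_above n v" and n: "n \<ge> 1"
    and hit: "{Suc (low_row ty)..n} \<subseteq> hit n v"
    and late: "\<And>j k. 1 \<le> j \<Longrightarrow> j < k \<Longrightarrow> k \<le> n \<Longrightarrow> v (int j) \<noteq> - int k"
  shows "v = w_max ty n"
proof -
  note W = weyl_W[OF v(1)]
  have big: "v (int k) = - int k" if k: "k \<in> hit n v" "\<And>l. k < l \<Longrightarrow> l \<le> n \<Longrightarrow> v (int l) = - int l" for k
  proof -
    obtain i where i: "i > 0" "v i = - int k" "1 \<le> k" "k \<le> n" using k(1) by (auto simp: hit_def)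
    hence "i \<in> negs v" by (simp add: negs_def)
    then obtain l where l: "i = int l" "1 \<le> l" "l \<le> n" using neg_values_set(3)[OF W v(2) odd_fun_gen(1)] by auto
    have "\<not> l < k" using late[of l k] i l by auto
    moreover have "\<not> k < l" using k(2)[of l] i l by auto
    ultimately show ?thesis using i l by simp
  qed
  have neg: "v (int k) = - int k" if "k \<in> hit n v" for k
    using that
  proof (induction "n - k" arbitrary: k rule: less_induct)
    case less
    show ?case
    proof (rule big[OF less.prems])
      fix l assume l: "k < l" "l \<le> n"
      have "k \<ge> 1" using less.prems by (simp add: hit_def)
      hence "l \<in> {Suc (low_row ty)..n}" using l by (auto simp: low_row_def)
      hence "l \<in> hit n v" using hit by blast
      thus "v (int l) = - int l" by (rule less.hyps[rotated]) (use l in simp)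
    qed
  qed
  have pos: "v (int k) = w_max ty n (int k)" if k: "1 \<le> k" "k \<le> n" for k
  proof (cases "ty = TypeD \<and> k = 1")
    case False
    hence "k \<in> {Suc (low_row ty)..n}" using k by (cases ty) auto
    hence "v (int k) = - int k" using hit neg by blast
    thus ?thesis using False k by (auto simp: w_max_def)
  next
    case True
    have "{2..n} \<subseteq> hit n v" using hit True by (simp add: low_row_def numeral_2_eq_2)
    hence e: "1 \<in> hit n v \<longleftrightarrow> even n" using hit_TypeD v n True by blast
    show ?thesis
    proof (cases "even n")
      case True': True
      thus ?thesis using neg[of 1] e True k by (simp add: w_max_def)
    next
      case False
      have "\<bar>v 1\<bar> \<le> int n" by (rule W_preserves_interval[OF W v(2)]) (use n in simp)
      moreover have "v 1 \<noteq> 0" using W_eq_0_iff[OF W] by simp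
      \<comment> \<open>The values of absolute value 2 to \<open>n\<close> belong to the later
        positions and their negatives, which leaves \<open>1\<close> and \<open>- 1\<close>.\<close>
      moreover have "\<bar>v 1\<bar> \<noteq> int l" if l: "2 \<le> l" "l \<le> n" for l
      proof
        assume a: "\<bar>v 1\<bar> = int l"
        have vl: "v (int l) = - int l" using neg[of l] \<open>{2..n} \<subseteq> hit n v\<close> l by auto
        hence "v 1 = v (int l) \<or> v 1 = v (- int l)" using a W_odd[OF W, of "int l"] by auto
        thus False unfolding W_inj[OF W] using l by auto
      qed
      ultimately have "\<bar>v 1\<bar> = 1" by (cases "nat \<bar>v 1\<bar> \<ge> 2") (metis abs_ge_zero nat_0_le nat_le_iff, auto)
      moreover have "v 1 \<noteq> - 1"
      proof
        assume "v 1 = - 1"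
        hence "\<exists>i>0. v i = - int 1" by (intro exI[of _ 1]) simp
        hence "1 \<in> hit n v" using n by (simp add: hit_def)
        thus False using e False by simp
      qed
      ultimately have "v 1 = 1" by auto
      thus ?thesis using True False k by (simp add: w_max_def)
    qed
  qed
  show ?thesis
  proof
    fix i :: int
    have W': "w_max ty n \<in> W_infinity" by (rule weyl_W[OF w_max_weyl])
    show "v i = w_max ty n i"
    proof (cases "\<bar>i\<bar> \<le> int n")
      case True
      consider "i = 0" | "i > 0" | "i < 0" by linarith
      thus ?thesis
      proof cases
        case 1
        thus ?thesis using W_0[OF W] W_0[OF W'] by simp
      next
        case 2
        thus ?thesis using pos[of "nat i"] True by simp
      next
        case 3
        hence "v (- i) = w_max ty n (- i)" using pos[of "nat (- i)"] True by simp
        thus ?thesis unfolding W_odd[OF W] W_odd[OF W'] by simp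
      qed
    next
      case False
      thus ?thesis using v(2) fixes_above_w_max[of n ty] by (simp add: fixes_above_def)
    qed
  qed
qed

text \<open>The factor between Q and P for a partition with \<open>n\<close> parts.\<close>

definition stair_factor :: "lie_type \<Rightarrow> nat \<Rightarrow> 'a::comm_ring_1" where
  "stair_factor ty n = (if ty = TypeC then 2 ^ n else 1)"

text \<open>At \<open>z = t\<close> the x-values \<open>?y k = - t_k\<close> are the second
  parameters, so the triangular formula applies. Its factor \<open>?y k - ?p j\<close> vanishes if
  \<open>v\<close> sends \<open>j < k\<close> to \<open>- k\<close>; what survives is
  \<open>w_max\<close> by \<open>eq_w_max\<close>, and there the factors pair up to the positive
  roots.\<close>

lemma stair_localize:
  assumes v: "v \<in> weyl ty" "fixes_above n v" and n: "n \<ge> 1"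
  shows "stair_factor ty n * stair ty (\<lambda>j. to_fract (gen_T (v (int j)))) (\<lambda>j. - to_fract (gen_T (int j))) n
      ((\<lambda>k. - to_fract (gen_T (int k))) ` hit n v)
    = (if v = w_max ty n then to_fract (root_prod ty gen_T v) else 0)"
proof -
  let ?y = "\<lambda>k. - to_fract (gen_T (int k))" and ?p = "\<lambda>j. to_fract (gen_T (v (int j)))"
  let ?J = "hit n v"
  note W = weyl_W[OF v(1)]
  have J: "?J \<subseteq> {1..n}" by (auto simp: hit_def)
  have inj: "inj_on ?y {1..n}" by (rule inj_onI) (simp add: neg_equal_iff_equal)
  have p_eq: "?p j = ?y k" if "v (int j) = - int k" for j k
    unfolding that by (simp add: odd_fun_uminus[OF odd_fun_gen(1)])
  let ?t = "\<lambda>k j. (?y k - ?p j) * (if j \<in> ?J then ?y k + ?y j else ?y k - ?y j)"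
  have late0: "(\<Prod>j\<in>{1..<k}. ?t k j) = 0" if "1 \<le> j" "j < k" "v (int j) = - int k" for j k
  proof (rule prod_zero)
    have "?y k - ?p j = 0" unfolding p_eq[OF that(3)] by (rule diff_self)
    hence "?t k j = 0" by (simp only: mult_zero_left)
    thus "\<exists>j\<in>{1..<k}. ?t k j = 0" using that(1,2) by (intro bexI[of _ j]) simp_all
  qed simp
  have full: "stair ty ?p ?y n (?y ` ?J) = (if {Suc (low_row ty)..n} \<subseteq> ?J then
      \<Prod>k\<in>{Suc (low_row ty)..n}. (if ty = TypeC then ?y k else 1) * (\<Prod>j\<in>{1..<k}. ?t k j) else 0)"
  proof (cases ty)
    case TypeC
    have e: "?J = {1..n} \<longleftrightarrow> {1..n} \<subseteq> ?J" using J by blast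
    show ?thesis
    proof (cases "{1..n} \<subseteq> ?J")
      case True
      have "(\<Prod>j\<in>{1..<k}. (?y k - ?p j) * (?y k + ?y j)) = (\<Prod>j\<in>{1..<k}. ?t k j)" if "k \<in> {1..n}" for k
      proof (rule prod.cong[OF refl])
        fix j assume "j \<in> {1..<k}"
        hence "j \<in> {1..n}" using that by auto
        hence "j \<in> ?J" using True by blast
        thus "(?y k - ?p j) * (?y k + ?y j) = ?t k j" by (simp only: if_True)
      qed
      thus ?thesis
        unfolding TypeC stair_C_localize[OF inj J] e low_row_simps One_nat_def[symmetric]
        using True by (simp only: if_True simp_thms cong: prod.cong)
    next
      case False
      thus ?thesis unfolding TypeC stair_C_localize[OF inj J] e low_row_simps One_nat_def[symmetric]
        by (simp only: if_False)
    qed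
  next
    case TypeD
    have two: "{Suc (low_row TypeD)..n} = {2..n}" by (simp add: numeral_2_eq_2)
    show ?thesis
      unfolding TypeD two stair_D_localize[OF inj J n] by (simp only: lie_type.distinct if_False mult_1_left)
  qed
  show ?thesis
  proof (cases "v = w_max ty n")
    case False
    have "stair ty ?p ?y n (?y ` ?J) = 0"
    proof (cases "{Suc (low_row ty)..n} \<subseteq> ?J")
      case True
      have "\<exists>j k. 1 \<le> j \<and> j < k \<and> k \<le> n \<and> v (int j) = - int k"
        using eq_w_max[OF v n True] False by blast
      then obtain j k where jk: "1 \<le> j" "j < k" "k \<le> n" "v (int j) = - int k" by blast
      have "(\<Prod>k\<in>{Suc (low_row ty)..n}. (if ty = TypeC then ?y k else 1) * (\<Prod>j\<in>{1..<k}. ?t k j)) = 0"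
      proof (rule prod_zero)
        show "\<exists>k\<in>{Suc (low_row ty)..n}. (if ty = TypeC then ?y k else 1) * (\<Prod>j\<in>{1..<k}. ?t k j) = 0"
        proof (rule bexI[of _ k])
          show "(if ty = TypeC then ?y k else 1) * (\<Prod>j\<in>{1..<k}. ?t k j) = 0"
            unfolding late0[OF jk(1,2,4)] by (rule mult_zero_right)
          show "k \<in> {Suc (low_row ty)..n}" using jk by (auto simp: low_row_def)
        qed
      qed simp
      thus ?thesis unfolding full by simp
    next
      case F: False
      thus ?thesis unfolding full by (simp only: if_False)
    qed
    thus ?thesis using False by (simp only: if_False mult_zero_right)
  next
    case True
    have mem: "k \<in> ?J \<longleftrightarrow> \<not> (ty = TypeD \<and> odd n \<and> k = 1)" if k: "k \<in> {1..n}" for k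
    proof
      assume "\<not> (ty = TypeD \<and> odd n \<and> k = 1)"
      hence "v (int k) = - int k" unfolding True using k by (auto simp: w_max_def)
      thus "k \<in> ?J" using k unfolding hit_def by (auto intro!: exI[of _ "int k"])
    next
      assume "k \<in> ?J"
      then obtain i where i: "i > 0" "w_max ty n i = - int k" unfolding hit_def True by auto
      thus "\<not> (ty = TypeD \<and> odd n \<and> k = 1)" by (auto simp: w_max_def split: if_splits)
    qed
    have hitm: "{Suc (low_row ty)..n} \<subseteq> ?J"
    proof
      fix k assume "k \<in> {Suc (low_row ty)..n}"
      thus "k \<in> ?J" using mem[of k] by (cases ty) auto
    qed
    \<comment> \<open>Whether \<open>j\<close> is barred or not only decides which of the two
      factors comes from the parameter and which from the ratio.\<close>
    have t: "?t k j = (?y k - ?y j) * (?y k + ?y j)" if j: "j \<in> {1..n}" for k j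
    proof (cases "j \<in> ?J")
      case T: True
      hence "v (int j) = - int j" using mem[OF j] j unfolding True by (auto simp: w_max_def)
      from p_eq[OF this] show ?thesis using T by simp
    next
      case F: False
      hence "v (int j) = int j" using mem[OF j] j unfolding True by (auto simp: w_max_def)
      thus ?thesis using F by (simp add: mult.commute)
    qed
    have "to_fract (root_prod ty gen_T v) = (\<Prod>k\<in>{1..n}. (if ty = TypeC then 2 * ?y k else 1)
        * (\<Prod>j\<in>{1..<k}. (?y k - ?y j) * (?y k + ?y j)))"
      unfolding root_prod_def True inversions_w_max prod_pos_roots to_fract_prod to_fract_mult
    proof (rule prod.cong[OF refl])
      fix k assume "k \<in> {1..n}"
      have "to_fract (if ty = TypeC then case (- int k, int k) of (a, b) \<Rightarrow> gen_T a - gen_T b else 1) = (if ty = TypeC then 2 * ?y k else 1)"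
        using to_fract_add[of "1 :: mpoly" 1] by (simp add: odd_fun_uminus[OF odd_fun_gen(1)])
      moreover have "(\<Prod>j\<in>{1..<k}. to_fract (case (int j, int k) of (a, b) \<Rightarrow> gen_T a - gen_T b)
          * to_fract (case (- int j, int k) of (a, b) \<Rightarrow> gen_T a - gen_T b))
        = (\<Prod>j\<in>{1..<k}. (?y k - ?y j) * (?y k + ?y j))"
        by (rule prod.cong[OF refl]) (simp add: odd_fun_uminus[OF odd_fun_gen(1)])
      ultimately show "to_fract (if ty = TypeC then case (- int k, int k) of (a, b) \<Rightarrow> gen_T a - gen_T b else 1)
          * (\<Prod>j\<in>{1..<k}. to_fract (case (int j, int k) of (a, b) \<Rightarrow> gen_T a - gen_T b)
            * to_fract (case (- int j, int k) of (a, b) \<Rightarrow> gen_T a - gen_T b))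
        = (if ty = TypeC then 2 * ?y k else 1) * (\<Prod>j\<in>{1..<k}. (?y k - ?y j) * (?y k + ?y j))"
        by (simp only:)
    qed
    also have "\<dots> = stair_factor ty n * (\<Prod>k\<in>{1..n}. (if ty = TypeC then ?y k else 1)
        * (\<Prod>j\<in>{1..<k}. (?y k - ?y j) * (?y k + ?y j)))"
    proof -
      let ?P = "\<lambda>k. \<Prod>j\<in>{1..<k}. (?y k - ?y j) * (?y k + ?y j)"
      have "(if ty = TypeC then 2 * ?y k else 1) * ?P k
          = (if ty = TypeC then 2 else 1) * ((if ty = TypeC then ?y k else 1) * ?P k)" for k
        by (cases ty) (simp_all only: lie_type.distinct if_True if_False simp_thms mult.assoc mult_1_left)
      moreover have "(\<Prod>k\<in>{1..n}. if ty = TypeC then 2 else 1 :: mpoly fract) = stair_factor ty n"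
        by (cases ty) (simp_all add: stair_factor_def)
      ultimately show ?thesis by (simp only: prod.distrib)
    qed
    also have "(\<Prod>k\<in>{1..n}. (if ty = TypeC then ?y k else 1) * (\<Prod>j\<in>{1..<k}. (?y k - ?y j) * (?y k + ?y j)))
      = (\<Prod>k\<in>{Suc (low_row ty)..n}. (if ty = TypeC then ?y k else 1) * (\<Prod>j\<in>{1..<k}. ?t k j))"
    proof (rule prod.mono_neutral_cong_right)
      show "{Suc (low_row ty)..n} \<subseteq> {1..n}" by auto
      show "\<forall>k\<in>{1..n} - {Suc (low_row ty)..n}. (if ty = TypeC then ?y k else 1) * (\<Prod>j\<in>{1..<k}. (?y k - ?y j) * (?y k + ?y j)) = 1"
      proof
        fix k assume "k \<in> {1..n} - {Suc (low_row ty)..n}"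
        hence "ty = TypeD" "k = 1" by (auto simp: low_row_def split: if_splits) (cases ty; simp)+
        thus "(if ty = TypeC then ?y k else 1) * (\<Prod>j\<in>{1..<k}. (?y k - ?y j) * (?y k + ?y j)) = 1" by simp
      qed
      fix k assume k: "k \<in> {Suc (low_row ty)..n}"
      have "(\<Prod>j\<in>{1..<k}. (?y k - ?y j) * (?y k + ?y j)) = (\<Prod>j\<in>{1..<k}. ?t k j)"
      proof (rule prod.cong[OF refl])
        fix j assume "j \<in> {1..<k}"
        hence "j \<in> {1..n}" using k by auto
        from t[OF this, of k] show "(?y k - ?y j) * (?y k + ?y j) = ?t k j" by (rule sym)
      qed
      thus "(if ty = TypeC then ?y k else 1) * (\<Prod>j\<in>{1..<k}. (?y k - ?y j) * (?y k + ?y j))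
        = (if ty = TypeC then ?y k else 1) * (\<Prod>j\<in>{1..<k}. ?t k j)" by (simp only:)
    qed simp
    also have "\<dots> = stair ty ?p ?y n (?y ` ?J)" unfolding full using hitm by (simp only: if_True)
    finally have E: "to_fract (root_prod ty gen_T v) = stair_factor ty n * stair ty ?p ?y n (?y ` ?J)" .
    show ?thesis unfolding if_P[OF True] by (rule E[symmetric])
  qed
qed

section \<open>Symmetry of staircase functions\<close>

text \<open>With \<open>refl_insert\<close> and \<open>refl_root\<close> this mirrors composition
  with a reflection, \<open>inserted\<close> and the roots. With \<open>p j = t_j\<close> or
  \<open>q j = - z_j\<close> the same formulas serve for t and for z.\<close>

fun refl_params :: "node \<Rightarrow> (nat \<Rightarrow> 'a::field) \<Rightarrow> nat \<Rightarrow> 'a" where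
  "refl_params (Nd m) p = (if m = 0 then p(1 := - p 1) else p \<circ> transpose m (Suc m))"
| "refl_params Hat1 p = p(1 := - p 2, 2 := - p 1)"

fun refl_insert :: "node \<Rightarrow> (nat \<Rightarrow> 'a::field) \<Rightarrow> 'a set \<Rightarrow> 'a set" where
  "refl_insert (Nd m) p Y = (if m = 0 then insert (- p 1) Y else Y)"
| "refl_insert Hat1 p Y = insert (- p 1) (insert (- p 2) Y)"

fun refl_root :: "node \<Rightarrow> (nat \<Rightarrow> 'a::field) \<Rightarrow> 'a" where
  "refl_root (Nd m) p = (if m = 0 then p 1 else p (Suc m) - p m)"
| "refl_root Hat1 p = p 1 + p 2"

definition stair_change :: "lie_type \<Rightarrow> nat \<Rightarrow> node \<Rightarrow> (nat \<Rightarrow> 'a::field) \<Rightarrow> (nat \<Rightarrow> 'a) \<Rightarrow> 'a set \<Rightarrow> 'a" where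
  "stair_change ty n i p q Y = stair ty p q n Y - stair ty (refl_params i p) q n (refl_insert i p Y)"

text \<open>In each case the change is the root times an explicit sum, and these sums coincide for
  \<open>p\<close> at \<open>i\<close> and \<open>q\<close> at \<open>conj_node ty n i\<close>. The
  nodes fall into those with a row below theirs, \<open>Nd 0\<close> in type C, and the pair
  \<open>Nd 1\<close>, \<open>Hat1\<close> in type D, which odd \<open>n\<close> exchanges.\<close>

lemma stair_change_symmetric:
  assumes i: "i \<in> finite_nodes ty n" and two: "(2 :: 'a::field) \<noteq> 0" and Y: "finite Y" "even (card Y)"
    and p: "- p 1 \<notin> Y" "- p 2 \<notin> Y" "p 1 \<noteq> p 2" and q: "- q 1 \<notin> Y" "- q 2 \<notin> Y" "q 1 \<noteq> (q 2 :: 'a)"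
  shows "refl_root (conj_node ty n i) q * stair_change ty n i p q Y
    = refl_root i p * stair_change ty n (conj_node ty n i) q p Y"
proof -
  have comm: "a * (b * c) = b * (a * c)" for a b c :: 'a by (simp only: mult.left_commute)
  show ?thesis
  proof (cases "\<exists>m. i = Nd m \<and> low_row ty < m")
    case True
    then obtain m where m: "i = Nd m" "low_row ty < m" by blast
    have "m < n" using i m by (cases ty) (auto split: if_splits)
    have m0: "m \<noteq> 0" using m(2) by simp
    have c: "conj_node ty n i = Nd m" using m by (cases ty) (auto simp: conj_node_def)
    obtain G where G: "stair ty p q n Y - stair ty (p \<circ> transpose m (Suc m)) q n Y = (p (Suc m) - p m) * G"
      "stair ty p q n Y - stair ty p (q \<circ> transpose m (Suc m)) n Y = (q (Suc m) - q m) * G"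
      using stair_swap_symmetric[OF m(2) \<open>m < n\<close> Y(1) two, of p q] .
    have "stair_change ty n i p q Y = (p (Suc m) - p m) * G"
      using G(1) m by (simp only: stair_change_def refl_params.simps refl_insert.simps if_not_P[OF m0])
    moreover have "stair_change ty n (Nd m) q p Y = (q (Suc m) - q m) * G"
      using G(2) m by (simp only: stair_change_def refl_params.simps refl_insert.simps if_not_P[OF m0]
          stair_commute[of ty q p] stair_commute[of ty "q \<circ> transpose m (Suc m)" p])
    moreover have "refl_root (Nd m) p = p (Suc m) - p m" "refl_root (Nd m) q = q (Suc m) - q m" using m by simp_all
    ultimately show ?thesis unfolding c unfolding m(1) by (simp only: comm)
  next
    case False
    show ?thesis
    proof (cases ty)
      case TypeC
      obtain m where m: "i = Nd m" "m < n" using i unfolding TypeC finite_nodes.simps by auto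
      have "\<not> low_row ty < m" using False m(1) by blast
      hence "m = 0" by (simp add: TypeC)
      hence i0: "i = Nd 0" and n: "1 \<le> n" using m by simp_all
      have c: "conj_node ty n i = Nd 0" using i0 TypeC by (simp add: conj_node_def)
      let ?R = "sym_sum (map (stair_row TypeC p q) (rev [1..<n])) (\<lambda>_. 1) Y"
      have "stair_change ty n i p q Y = p 1 * ?R"
        using stair_C_insert[of n Y p q, OF n Y(1) p(1)]
        unfolding stair_change_def TypeC i0 refl_params.simps refl_insert.simps if_P[OF refl] .
      moreover have "stair_change ty n (Nd 0) q p Y = q 1 * ?R"
        using stair_C_insert[of n Y q p, OF n Y(1) q(1)]
        unfolding stair_change_def TypeC refl_params.simps refl_insert.simps if_P[OF refl]
          stair_row_commute[of TypeC q p] .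
      moreover have "refl_root (Nd 0) p = p 1" "refl_root (Nd 0) q = q 1" by simp_all
      ultimately show ?thesis unfolding c unfolding i0 by (simp only: comm)
    next
      case TypeD
      have i1: "i = Nd 1 \<or> i = Hat1"
      proof (cases i)
        case (Nd m)
        have "\<not> low_row ty < m" using False Nd by blast
        moreover have "m \<ge> 1" using i unfolding Nd TypeD by (auto split: if_splits)
        ultimately show ?thesis using Nd by (simp add: TypeD)
      qed simp
      have n: "2 \<le> n" using i1 i unfolding TypeD by (auto split: if_splits)
      let ?R = "\<lambda>c. sym_sum (map (stair_row TypeD p q) (rev [2..<n])) (\<lambda>B. \<Sum>B - c) Y"
      let ?e = "if odd n then 1 else 0 :: 'a" and ?e' = "if odd n then 0 else 1 :: 'a"
      have rq: "stair_row TypeD q p = stair_row TypeD p q" by (rule stair_row_commute)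
      have t12: "transpose (1::nat) (Suc 1) = transpose 1 2" by (simp add: numeral_2_eq_2)
      have s1: "stair_change TypeD n (Nd 1) p q Y = (p 2 - p 1) * ?R (q 1 * ?e)"
        "stair_change TypeD n (Nd 1) q p Y = (q 2 - q 1) * ?R (p 1 * ?e)"
        by (simp_all only: stair_change_def refl_params.simps refl_insert.simps one_neq_zero if_False t12 rq
            stair_D_swap_1[of n Y p q, OF n Y] stair_D_swap_1[of n Y q p, OF n Y])
      have s2: "stair_change TypeD n Hat1 p q Y = (p 1 + p 2) * ?R (p 1 + q 1 * ?e')"
        "stair_change TypeD n Hat1 q p Y = (q 1 + q 2) * ?R (q 1 + p 1 * ?e')"
        by (simp_all only: stair_change_def refl_params.simps refl_insert.simps rq diff_diff_eq
            stair_D_insert[of n Y p q, OF n Y p] stair_D_insert[of n Y q p, OF n Y q])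
      have roots: "refl_root (Nd 1) p = p 2 - p 1" "refl_root (Nd 1) q = q 2 - q 1"
        by (simp_all add: numeral_2_eq_2)
      show ?thesis
      proof (cases "odd n")
        case odd: True
        have e: "?e = 1" "?e' = 0" using odd by simp_all
        have c: "conj_node TypeD n (Nd 1) = Hat1" "conj_node TypeD n Hat1 = Nd 1"
          using odd by (simp_all add: conj_node_def)
        show ?thesis
          unfolding TypeD
        proof (rule disjE[OF i1])
          assume i: "i = Nd 1"
          show "refl_root (conj_node TypeD n i) q * stair_change TypeD n i p q Y
            = refl_root i p * stair_change TypeD n (conj_node TypeD n i) q p Y"
            unfolding i c s1 s2 roots refl_root.simps(2) e mult_1_right mult_zero_right add_0_right by (rule comm)
        next
          assume i: "i = Hat1"
          show "refl_root (conj_node TypeD n i) q * stair_change TypeD n i p q Y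
            = refl_root i p * stair_change TypeD n (conj_node TypeD n i) q p Y"
            unfolding i c s1 s2 roots refl_root.simps(2) e mult_1_right mult_zero_right add_0_right by (rule comm)
        qed
      next
        case ev: False
        have e: "?e = 0" "?e' = 1" using ev by simp_all
        have c: "conj_node TypeD n (Nd 1) = Nd 1" "conj_node TypeD n Hat1 = Hat1"
          using ev by (simp_all add: conj_node_def)
        show ?thesis
          unfolding TypeD
        proof (rule disjE[OF i1])
          assume i: "i = Nd 1"
          show "refl_root (conj_node TypeD n i) q * stair_change TypeD n i p q Y
            = refl_root i p * stair_change TypeD n (conj_node TypeD n i) q p Y"
            unfolding i c s1 roots e mult_zero_right by (rule comm)
        next
          assume i: "i = Hat1"
          show "refl_root (conj_node TypeD n i) q * stair_change TypeD n i p q Y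
            = refl_root i p * stair_change TypeD n (conj_node TypeD n i) q p Y"
            unfolding i c s2 refl_root.simps(2) e mult_1_right add.commute[of "q 1" "p 1"] by (rule comm)
        qed
      qed
    qed
  qed
qed

section \<open>Transfer of the symmetry to the inverse limit\<close>

text \<open>An odd number of variables is reached from the next even one by setting the last
  variable to 0. This suffices for type D, where the formulas require evenness.\<close>

lemma good_ext_even:
  assumes "good f" "good g"
    and eq: "\<And>N. even N \<Longrightarrow> xeval gen_T gen_Z (gen_X N) f = xeval gen_T gen_Z (gen_X N) g"
  shows "f = g"
proof (rule xfun_ext)
  show "finite_vars f" "finite_vars g" using assms(1,2) by (simp_all only: good_finite_vars)
  fix N
  show "xeval gen_T gen_Z (gen_X N) f = xeval gen_T gen_Z (gen_X N) g"
  proof (cases "even N")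
    case False
    let ?h = "eval_mpoly (Var(X (Suc N) := 0))"
    have map: "map ?h (gen_X (Suc N)) = gen_X N @ [0]"
      by (simp add: gen_X_def)
    have red: "xeval gen_T gen_Z (gen_X N) e = ?h (xeval gen_T gen_Z (gen_X (Suc N)) e)" if e: "good e" for e
    proof -
      have "?h (xeval gen_T gen_Z (gen_X (Suc N)) e) = xeval gen_T gen_Z (gen_X N @ [0]) e"
        unfolding map[symmetric]
        by (rule xeval_specialize[OF good_finite_vars[OF e] _ _ ring_hom_eval]) simp_all
      also have "\<dots> = xeval gen_T gen_Z (0 # gen_X N) e" by (rule xeval_mset[OF e]) simp
      also have "\<dots> = xeval gen_T gen_Z (gen_X N) e" by (rule xeval_zero[OF e])
      finally show ?thesis by (rule sym)
    qed
    have "even (Suc N)" using False by simp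
    from eq[OF this] show ?thesis unfolding red[OF assms(1)] red[OF assms(2)] by (rule arg_cong)
  qed (rule eq)
qed

lemma refl_params_eq:
  assumes "odd_fun \<tau>"
  shows "(\<lambda>j. \<tau> (simple_refl i (int j))) = refl_params i (\<lambda>j. \<tau> (int j))"
proof
  fix j
  have odd: "\<tau> (- 1) = - \<tau> 1" "\<tau> (- 2) = - \<tau> 2" using assms by (simp_all add: odd_fun_uminus)
  show "\<tau> (simple_refl i (int j)) = refl_params i (\<lambda>j. \<tau> (int j)) j"
  proof (cases i)
    case (Nd m)
    show ?thesis
    proof (cases "m = 0")
      case True
      have "simple_refl i (int j) = (if j = 1 then - 1 else int j)"
        unfolding Nd True simple_refl.simps simple_refl_nat_zero by auto
      thus ?thesis unfolding Nd True using odd by simp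
    next
      case False
      hence "simple_refl i (int j) = int (transpose m (Suc m) j)" unfolding Nd simple_refl.simps by (intro simple_refl_nat_int) simp
      thus ?thesis unfolding Nd using False by simp
    qed
  next
    case Hat1
    have "simple_refl i (int j) = (if j = 1 then - 2 else if j = 2 then - 1 else int j)"
      unfolding Hat1 simple_refl_Hat1 by auto
    thus ?thesis unfolding Hat1 using odd by simp
  qed
qed

lemma neg_Var_neq: "- Var v \<noteq> Var w" "Var w \<noteq> - Var v"
  using Var_add_neq_0[of v w] by (metis add.right_inverse)+

lemma set_gen_X: "set (gen_X N) = (\<lambda>k. Var (X (Suc k))) ` {0..<N}"
  by (simp add: gen_X_def)

lemma distinct_gen_X: "distinct (gen_X N)"
  by (simp add: gen_X_def distinct_map inj_on_def)

lemma stair_change_xfun: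
  assumes N: "even N" and i: "i \<in> nodes ty"
  defines "p \<equiv> \<lambda>j. to_fract (gen_T (int j))" and "q \<equiv> \<lambda>j. - to_fract (gen_Z (int j))"
    and "Y \<equiv> to_fract ` set (gen_X N)"
  shows "to_fract (xeval gen_T gen_Z (gen_X N) (stair_xfun ty n - act_t i (stair_xfun ty n))) = stair_change ty n i p q Y"
    "to_fract (xeval gen_T gen_Z (gen_X N) (stair_xfun ty n - act_z i (stair_xfun ty n))) = stair_change ty n i q p Y"
proof -
  let ?F = "stair_xfun ty n" and ?\<xi> = "gen_X N"
  let ?t = "inserted i (\<lambda>k. - gen_T k) @ ?\<xi>" and ?z = "inserted i gen_Z @ ?\<xi>"
  have oddT: "odd_fun (\<lambda>k. to_fract (gen_T k))" and oddZ: "odd_fun (\<lambda>k. - to_fract (gen_Z k))"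
    unfolding odd_fun_def by (simp_all add: odd_fun_uminus[OF odd_fun_gen(1)] odd_fun_uminus[OF odd_fun_gen(2)])
  have par: "(\<lambda>j. to_fract ((gen_T \<circ> simple_refl i) (int j))) = refl_params i p"
    "(\<lambda>j. - to_fract ((gen_Z \<circ> simple_refl i) (int j))) = refl_params i q"
    unfolding p_def q_def comp_apply by (rule refl_params_eq[OF oddT], rule refl_params_eq[OF oddZ])
  have ins: "to_fract ` set ?t = refl_insert i p Y" "to_fract ` set ?z = refl_insert i q Y"
    unfolding p_def q_def Y_def by (cases i; simp add: insert_commute)+
  have dist: "distinct ?t" "distinct ?z"
    using distinct_gen_X by (cases i; auto simp: set_gen_X neg_Var_neq)+
  \<comment> \<open>The single value inserted by \<open>Nd 0\<close> makes the length odd; this node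
    occurs in type C only, where that is admissible.\<close>
  have par_len: "even (length ?t) \<or> ty = TypeC \<and> 0 \<notin> set ?t" "even (length ?z) \<or> ty = TypeC \<and> 0 \<notin> set ?z"
    using N i by (cases i; cases ty; auto simp: set_gen_X split: if_splits)+
  have base: "to_fract (xeval gen_T gen_Z ?\<xi> ?F) = stair ty p q n Y"
    unfolding p_def q_def Y_def by (rule xeval_stair_xfun_eq[OF distinct_gen_X]) (simp add: N)
  have t: "to_fract (xeval gen_T gen_Z ?\<xi> (act_t i ?F)) = stair ty (refl_params i p) q n (refl_insert i p Y)"
    unfolding xeval_act_t[OF odd_fun_gen(1)] xeval_stair_xfun_eq[OF dist(1) par_len(1)] par ins q_def ..
  have z: "to_fract (xeval gen_T gen_Z ?\<xi> (act_z i ?F)) = stair ty p (refl_params i q) n (refl_insert i q Y)"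
    unfolding xeval_act_z[OF odd_fun_gen(2)] xeval_stair_xfun_eq[OF dist(2) par_len(2)] par ins p_def ..
  show "to_fract (xeval gen_T gen_Z ?\<xi> (?F - act_t i ?F)) = stair_change ty n i p q Y"
    unfolding xeval_ring to_fract_diff base t stair_change_def ..
  show "to_fract (xeval gen_T gen_Z ?\<xi> (?F - act_z i ?F)) = stair_change ty n i q p Y"
    unfolding xeval_ring to_fract_diff base z stair_change_def stair_commute[of ty q] stair_commute[of ty "refl_params i q"] ..
qed

lemma good_root: "good (\<lambda>N. root_t i)" "good (\<lambda>N. root_z i)"
  using involves_only_root good_const by blast+

lemma xeval_root:
  "to_fract (xeval gen_T gen_Z \<xi> (\<lambda>N. root_t i)) = refl_root i (\<lambda>j. to_fract (gen_T (int j)))"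
  "to_fract (xeval gen_T gen_Z \<xi> (\<lambda>N. root_z i)) = refl_root i (\<lambda>j. - to_fract (gen_Z (int j)))"
  unfolding xeval_def by (cases i; simp add: point_def)+

lemma stair_xfun_symmetric:
  assumes i: "i \<in> finite_nodes ty n"
  shows "(\<lambda>N. root_z (conj_node ty n i)) * (stair_xfun ty n - act_t i (stair_xfun ty n))
    = (\<lambda>N. root_t i) * (stair_xfun ty n - act_z (conj_node ty n i) (stair_xfun ty n))"
proof (rule good_ext_even)
  let ?j = "conj_node ty n i" and ?F = "stair_xfun ty n"
  show "good ((\<lambda>N. root_z ?j) * (?F - act_t i ?F))" "good ((\<lambda>N. root_t i) * (?F - act_z ?j ?F))"
    by (rule good_mult good_root good_diff good_act_t good_act_z good_stair_xfun)+
  fix N :: nat assume N: "even N"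
  let ?p = "\<lambda>j. to_fract (gen_T (int j))" and ?q = "\<lambda>j. - to_fract (gen_Z (int j))" and ?Y = "to_fract ` set (gen_X N)"
  have nodes: "i \<in> nodes ty" "?j \<in> nodes ty"
    using i conj_node_finite[OF i] finite_nodes_subset by blast+
  have two: "(2 :: mpoly fract) \<noteq> 0"
  proof -
    have "(1 :: mpoly) + 1 \<noteq> 0" by (simp only: mpoly_double_eq_0_iff one_neq_zero not_False_eq_True)
    hence "(2 :: mpoly) \<noteq> 0" by (simp only: one_add_one not_False_eq_True)
    hence "to_fract (2 :: mpoly) \<noteq> 0" by (simp only: to_fract_eq_0_iff not_False_eq_True)
    moreover have "to_fract (2 :: mpoly) = 2" using to_fract_add[of "1 :: mpoly" 1] by simp
    ultimately show ?thesis by (simp only: not_False_eq_True)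
  qed
  have inj: "inj_on to_fract (set (gen_X N))" by (rule inj_onI) simp
  have card: "card ?Y = N"
    unfolding card_image[OF inj] using distinct_card[OF distinct_gen_X] by simp
  have notin: "- ?p k \<notin> ?Y" "- ?q k \<notin> ?Y" if "k \<ge> 1" for k
  proof -
    have "- gen_T (int k) \<notin> set (gen_X N)" "gen_Z (int k) \<notin> set (gen_X N)"
      using that by (auto simp: set_gen_X neg_Var_neq)
    moreover have "- ?p k = to_fract (- gen_T (int k))" "- ?q k = to_fract (gen_Z (int k))" by simp_all
    ultimately show "- ?p k \<notin> ?Y" "- ?q k \<notin> ?Y" by (metis (no_types, lifting) imageE to_fract_eq_iff)+
  qed
  have ne: "?p 1 \<noteq> ?p 2" "?q 1 \<noteq> ?q 2" by simp_all
  have fin: "finite ?Y" "even (card ?Y)" unfolding card using N by simp_all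
  have "refl_root ?j ?q * stair_change ty n i ?p ?q ?Y = refl_root i ?p * stair_change ty n ?j ?q ?p ?Y"
    by (rule stair_change_symmetric[OF i two fin _ _ ne(1) _ _ ne(2)]) (rule notin, simp)+
  hence "to_fract (xeval gen_T gen_Z (gen_X N) ((\<lambda>N. root_z ?j) * (?F - act_t i ?F)))
      = to_fract (xeval gen_T gen_Z (gen_X N) ((\<lambda>N. root_t i) * (?F - act_z ?j ?F)))"
    unfolding xeval_ring(3) to_fract_mult xeval_root stair_change_xfun[OF N nodes(1)] stair_change_xfun[OF N nodes(2)] .
  thus "xeval gen_T gen_Z (gen_X N) ((\<lambda>N. root_z ?j) * (?F - act_t i ?F))
      = xeval gen_T gen_Z (gen_X N) ((\<lambda>N. root_t i) * (?F - act_z ?j ?F))"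
    by (simp only: to_fract_eq_iff)
qed

text \<open>The t that occur are \<open>t_1, ..., t_(n-1)\<close>, which a transposition of
  \<open>t_m\<close> and \<open>t_(m+1)\<close> with \<open>m \<ge> n\<close> does not touch.
  \<open>Hat1\<close> is left out of the finite nodes of type D only for \<open>n = 1\<close>, where
  the function is 1.\<close>

lemma stair_xfun_fixed:
  assumes i: "i \<in> nodes ty - finite_nodes ty n" and n: "n \<ge> 1"
  shows "act_t i (stair_xfun ty n) = stair_xfun ty n"
proof (cases "i = Hat1")
  case True
  hence D: "ty = TypeD" "n = 1" using i n by (cases ty; auto split: if_splits)+
  have "to_fract (stair_poly TypeD 1 N) = to_fract 1" for N
    unfolding stair_poly_props(1) by (simp add: stair_fract_def)
  hence "stair_poly TypeD 1 N = 1" for N by (simp only: to_fract_eq_iff)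
  hence "stair_xfun ty n = 1"
    by (simp add: D stair_xfun_def restrict_x_def subst_eq_eval fun_eq_iff)
  thus ?thesis by (simp only: act_t_ring)
next
  case False
  then obtain m where m: "i = Nd m" by (cases i) auto
  hence mn: "m \<ge> n" using i n by (cases ty) (auto split: if_splits)
  have inv: "involves_only (allowed (n - 1) N) (stair_xfun ty n N)" for N
    unfolding stair_xfun_def restrict_x_def subst_eq_eval
    by (rule involves_only_eval[OF involves_only_stair_poly]) (auto simp: allowed_def)
  show ?thesis
  proof
    fix N
    have "act_t i (stair_xfun ty n) N
        = eval_mpoly (\<lambda>v. case v of T k \<Rightarrow> Var (T (transpose m (Suc m) k)) | _ \<Rightarrow> Var v) (stair_xfun ty n N)"
      using mn n by (simp add: m act_t_nat_def subst_eq_eval)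
    also have "\<dots> = eval_mpoly Var (stair_xfun ty n N)"
      by (rule eval_cong_involves[OF inv]) (use mn n in \<open>auto simp: allowed_def transpose_def\<close>)
    finally show "act_t i (stair_xfun ty n) N = stair_xfun ty n N" unfolding eval_id .
  qed
qed

lemma stair_xfun_word:
  assumes u: "set u \<subseteq> finite_nodes ty n" and n: "n \<ge> 1"
  shows "stair_factor ty n * xeval gen_T gen_T [] (foldr act_t u (stair_xfun ty n))
    = (if word_product u = w_max ty n then root_prod ty gen_T (w_max ty n) else 0)"
proof -
  let ?v = "word_product u" and ?F = "stair_xfun ty n"
  have v: "?v \<in> weyl ty" "fixes_above n ?v"
    using u unfolding atomize_conj by (metis (mono_tags, lifting) finite_weyl_def finite_weyl_eq mem_Collect_eq)
  note W = weyl_W[OF v(1)]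
  let ?\<xi> = "neg_values gen_T ?v"
  have set: "set ?\<xi> = (\<lambda>k. - gen_T (int k)) ` hit n ?v"
    by (rule neg_values_set(1)[OF W v(2) odd_fun_gen(1)])
  have len: "length ?\<xi> = card (negs ?v)" by (simp add: neg_values_def)
  have "inj_on (\<lambda>k. - gen_T (int k)) (hit n ?v)"
    by (rule inj_onI) (auto simp: hit_def)
  hence "card (set ?\<xi>) = length ?\<xi>"
    unfolding set len using card_image neg_values_set(2)[OF W v(2) odd_fun_gen(1)] by metis
  hence dist: "distinct ?\<xi>" by (rule card_distinct)
  have par: "even (length ?\<xi>) \<or> ty = TypeC \<and> 0 \<notin> set ?\<xi>"
  proof (cases ty)
    case TypeC
    have "0 \<notin> set ?\<xi>" unfolding set by (auto simp: hit_def)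
    thus ?thesis using TypeC by simp
  next
    case TypeD
    thus ?thesis using v(1) by (simp add: weyl_def' len)
  qed
  have img: "to_fract ` set ?\<xi> = (\<lambda>k. - to_fract (gen_T (int k))) ` hit n ?v"
    unfolding set image_image to_fract_uminus ..
  have c: "to_fract (stair_factor ty n) = (stair_factor ty n :: mpoly fract)"
  proof -
    have "to_fract (2 :: mpoly) = 2" using to_fract_add[of "1 :: mpoly" 1] by simp
    hence "to_fract (2 ^ n :: mpoly) = 2 ^ n" by (induction n) simp_all
    thus ?thesis by (simp add: stair_factor_def)
  qed
  have "to_fract (stair_factor ty n * xeval gen_T gen_T [] (foldr act_t u ?F))
      = (if ?v = w_max ty n then to_fract (root_prod ty gen_T ?v) else 0)"
    unfolding to_fract_mult c xeval_word[OF good_stair_xfun odd_fun_gen(1)] append_Nil2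
      xeval_stair_xfun_eq[OF dist par] img comp_apply
    by (rule stair_localize[OF v n])
  also have "\<dots> = to_fract (if ?v = w_max ty n then root_prod ty gen_T (w_max ty n) else 0)" by simp
  finally show ?thesis by (simp only: to_fract_eq_iff)
qed

section \<open>The top double Schubert polynomials\<close>

lemma double_schubert_longest:
  assumes S: "double_schubert ty S" and n: "n \<ge> 1"
  shows "S (longest ty n) = (\<lambda>N. stair_factor ty n) * stair_xfun ty n"
proof -
  let ?w = "w_max ty n" and ?F = "stair_xfun ty n"
  let ?c = "\<lambda>N :: nat. stair_factor ty n :: mpoly"
  let ?S = "S ?w"
  have inv: "inv ?w = ?w" by (rule inv_equality) (simp_all add: w_max_involutory)
  have c_good: "good ?c"
    by (rule good_const[of 0]) (simp add: involves_only_def stair_factor_def)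
  have c_t: "act_t i ?c = ?c" for i
    by (cases i) (auto simp: act_t_nat_def subst_eq_eval stair_factor_def fun_eq_iff)
  have c_z: "act_z i ?c = ?c" for i
    by (cases i) (auto simp: act_z_nat_def subst_eq_eval stair_factor_def fun_eq_iff)
  have c_word: "foldr act_t u ?c = ?c" for u
    by (induction u) (simp_all only: foldr.simps comp_apply id_apply c_t)
  have c_eval: "xeval gen_T gen_T [] ?c = stair_factor ty n"
    by (simp add: xeval_def stair_factor_def)
  have S_good: "good ?S" by (rule double_schubertD(2)[OF S w_max_weyl])
  have "?c * ?F - ?S = 0"
  proof (rule vanishing_criterion[OF _ finite_nodes_subset])
    show "good (?c * ?F - ?S)" by (rule good_diff good_mult c_good good_stair_xfun S_good)+
  next
    fix i assume i: "i \<in> nodes ty - finite_nodes ty n"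
    hence "i \<in> nodes ty" by (rule DiffD1)
    hence "act_t i ?S = ?S"
      unfolding double_schubertD(4)[OF S w_max_weyl \<open>i \<in> nodes ty\<close>] inv if_not_P[OF root_pair_not_finite_nodes[OF i n]]
      by (simp only: mult_zero_right diff_zero)
    thus "act_t i (?c * ?F - ?S) = ?c * ?F - ?S"
      unfolding act_t_ring c_t stair_xfun_fixed[OF i n] by (rule arg_cong)
  next
    fix i assume i: "i \<in> finite_nodes ty n"
    let ?j = "conj_node ty n i"
    have j: "?j \<in> finite_nodes ty n" by (rule conj_node_finite[OF i])
    have nodes: "i \<in> nodes ty" "?j \<in> nodes ty" using i j finite_nodes_subset by blast+
    \<comment> \<open>As \<open>s_i w_0 = w_0 s_j\<close>, the differences of \<open>?S\<close> in t
      at \<open>i\<close> and in z at \<open>?j\<close> are multiples of the same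
      polynomial.\<close>
    let ?G = "S (simple_refl i \<circ> ?w)"
    \<comment> \<open>\<open>conj_node\<close> moves at most \<open>Nd 1\<close> and
      \<open>Hat1\<close>, so the factor 2 occurs at both nodes or at neither.\<close>
    have rf: "root_factor ?j = root_factor i"
      by (auto simp: conj_node_def root_factor_def)
    have "?S - act_t i ?S = simple_root i * ?G"
      unfolding double_schubertD(4)[OF S w_max_weyl nodes(1)] inv if_P[OF root_pair_finite_nodes[OF i]] by (simp only: diff_diff_eq2 add_diff_cancel_left')
    moreover have "?S - act_z ?j ?S = omega (simple_root ?j) * ?G"
      unfolding double_schubertD(3)[OF S w_max_weyl nodes(2)] if_P[OF root_pair_finite_nodes[OF j]]
        refl_w_max[OF i] by (simp only: diff_diff_eq2 add_diff_cancel_left')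
    moreover have "(\<lambda>N. root_z ?j) * (simple_root i * ?G) = (\<lambda>N. root_t i) * (omega (simple_root ?j) * ?G)"
      unfolding omega_simple_root_conv unfolding simple_root_conv rf
      by (rule ext) (simp only: times_fun_apply mult_ac)
    ultimately have symS: "(\<lambda>N. root_z ?j) * (?S - act_t i ?S) = (\<lambda>N. root_t i) * (?S - act_z ?j ?S)"
      by (simp only:)
    note symF = stair_xfun_symmetric[OF i]
    have alg: "(x - s) - (y - t) = (x - y) - (s - t)" for x s y t :: xfun by (simp only: algebra_simps)
    have t: "?c * ?F - ?S - act_t i (?c * ?F - ?S) = ?c * (?F - act_t i ?F) - (?S - act_t i ?S)"
      unfolding act_t_ring c_t right_diff_distrib by (rule alg)
    have z: "?c * ?F - ?S - act_z ?j (?c * ?F - ?S) = ?c * (?F - act_z ?j ?F) - (?S - act_z ?j ?S)"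
      unfolding act_z_ring c_z right_diff_distrib by (rule alg)
    have "(\<lambda>N. root_z ?j) * (?c * ?F - ?S - act_t i (?c * ?F - ?S))
        = ?c * ((\<lambda>N. root_z ?j) * (?F - act_t i ?F)) - (\<lambda>N. root_z ?j) * (?S - act_t i ?S)"
      unfolding t right_diff_distrib[of "\<lambda>N. root_z ?j" "?c * (?F - act_t i ?F)"] by (simp only: mult.left_commute[of ?c])
    also have "\<dots> = (\<lambda>N. root_t i) * (?c * ?F - ?S - act_z ?j (?c * ?F - ?S))"
      unfolding symS symF z right_diff_distrib[of "\<lambda>N. root_t i" "?c * (?F - act_z ?j ?F)"] by (simp only: mult.left_commute[of ?c])
    finally show "\<exists>j\<in>finite_nodes ty n. (\<lambda>N. root_z j) * (?c * ?F - ?S - act_t i (?c * ?F - ?S))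
        = (\<lambda>N. root_t i) * (?c * ?F - ?S - act_z j (?c * ?F - ?S))"
      using j by (rule bexI)
  next
    fix u assume u: "set u \<subseteq> finite_nodes ty n"
    show "xeval gen_T gen_T [] (foldr act_t u (?c * ?F - ?S)) = 0"
      unfolding foldr_act_t_diff foldr_act_t_mult xeval_ring c_word c_eval stair_xfun_word[OF u n]
        double_schubert_w_max_word[OF S u] by (rule diff_self)
  qed
  hence "?S = ?c * ?F" by (simp only: right_minus_eq)
  thus ?thesis unfolding longest_eq .
qed

theorem theorem1p2:
  fixes n :: nat and CC DD :: "(int \<Rightarrow> int) \<Rightarrow> xfun"
  assumes "n \<ge> 1"
  shows "(double_schubert TypeC CC \<longrightarrow>
        CC (longest TypeC n) = factorial_Q (rho_C n) (tz_params n))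
    \<and> (double_schubert TypeD DD \<longrightarrow>
        DD (longest TypeD n) = factorial_P (rho_D n) (tz_params n))"
proof (intro conjI impI)
  assume C: "double_schubert TypeC CC"
  have P: "factorial_P (rho_C n) (case_nat 0 (tz_params n)) = stair_xfun TypeC n"
    using factorial_P_eq[OF assms, of TypeC] by (simp add: lie_rho_def lie_params_def)
  have len: "length (rho_C n) = n"
    using assms by (simp add: rho_C_def length_rho)
  have pow: "(2 :: xfun) ^ k = (\<lambda>N. 2 ^ k)" for k
    by (induction k) (auto simp: fun_eq_iff)
  show "CC (longest TypeC n) = factorial_Q (rho_C n) (tz_params n)"
    unfolding double_schubert_longest[OF C assms] factorial_Q_def P len pow by (simp add: stair_factor_def)
next
  assume D: "double_schubert TypeD DD"
  have P: "factorial_P (rho_D n) (tz_params n) = stair_xfun TypeD n"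
    using factorial_P_eq[OF assms, of TypeD] by (simp add: lie_rho_def lie_params_def)
  have one: "(\<lambda>N. stair_factor TypeD n) = (1 :: xfun)"
    by (simp add: stair_factor_def one_fun_def)
  show "DD (longest TypeD n) = factorial_P (rho_D n) (tz_params n)"
    unfolding double_schubert_longest[OF D assms] P one by (rule mult_1_left)
qed

end
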